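(* Let $\Gamma$ be an irreducible lattice of $G=\mathrm{PSL}(2,\mathbb{R})\times\mathrm{PSL}(2,\mathbb{R})$. Let $g=(g_1,g_2)\in G$ and let $x=\Gamma g$ be the class of $g$ in $\Gamma\backslash G$. Then the semi-orbit $xA^+=\{xa : a\in A^+\}$ is dense in $\Gamma\backslash G$ if one of the following conditions holds: 1) a mixed element of $\Gamma$ fixes one of the points $g_1(\infty)$ (in the first factor $\partial\mathbb{H}$) and $g_2(\infty)$ (in the second factor $\partial\mathbb{H}$); 2) a hyperbolic hyper-regular element of $\Gamma$ fixes exactly one of the points $g_1(\infty)$ (in the first factor) and $g_2(\infty)$ (in the second factor).
   Context: A lattice in $G=\mathrm{PSL}(2,\mathbb{R})\times\mathrm{PSL}(2,\mathbb{R})$ is a discrete subgroup of finite covolume. It is reducible if, up to finite index, it is a product of two lattices of $\mathrm{PSL}(2,\mathbb{R})$ (one in each factor), and irreducible otherwise. $A^+=\left\{\left(\pm\begin{pmatrix}\lambda_1&0\\0&\lambda_1^{-1}\end{pmatrix},\pm\begin{pmatrix}\lambda_2&0\\0&\lambda_2^{-1}\end{pmatrix}\right):\lambda_1,\lambda_2\ge 1\right\}$, acting on $\Gamma\backslash G$ by right translation. $\partial\mathbb{H}=\mathbb{R}\cup\{\infty\}$ is the boundary of the upper half-plane $\mathbb{H}$, on which $\mathrm{PSL}(2,\mathbb{R})$ acts by Möbius transformations. The group $G$ acts on $\partial\mathbb{H}\times\partial\mathbb{H}$ componentwise, and on each factor $\partial\mathbb{H}$ through the corresponding component: an element $\gamma=(\gamma_1,\gamma_2)$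 fixes a point $\xi_i$ of the $i$-th factor if $\gamma_i(\xi_i)=\xi_i$. A non-identity element of $\mathrm{PSL}(2,\mathbb{R})$ is hyperbolic, parabolic or elliptic according to whether its absolute trace is $>2$, $=2$ or $<2$; the identity is neither hyperbolic, nor parabolic, nor elliptic. An element of $G$ is hyperbolic (resp. parabolic, elliptic) if both its components are hyperbolic (resp. parabolic, elliptic). A non-trivial element of $G$ is mixed if its two components are not of the same kind. A hyperbolic element $\gamma=(\gamma_1,\gamma_2)$ is hyper-regular if the dominant (positive) eigenvalues of $\gamma_1$ and $\gamma_2$ (the eigenvalues $>1$ of their representatives with positive trace) are distinct. *)

theory Defs
  imports "HOL-Analysis.Analysis" "HOL-Algebra.Coset"
begin

section \<open>Coset spaces and lattices\<close>

text \<open>A topological group is given by a group \<open>G\<close> together with a topology \<open>T\<close> on its carrier.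
  The quotient topology on \<open>H\G\<close>, the space of cosets \<open>H #> g\<close>:\<close>

definition coset_topology ::
    "('a, 'b) monoid_scheme \<Rightarrow> 'a topology \<Rightarrow> 'a set \<Rightarrow> 'a set topology" where
  "coset_topology G T H =
     topology (\<lambda>U. U \<subseteq> rcosets\<^bsub>G\<^esub> H \<and> openin T {g \<in> topspace T. H #>\<^bsub>G\<^esub> g \<in> U})"

lemma openin_coset_topology:
  "openin (coset_topology G T H) U \<longleftrightarrow>
     U \<subseteq> rcosets\<^bsub>G\<^esub> H \<and> openin T {g \<in> topspace T. H #>\<^bsub>G\<^esub> g \<in> U}"
proof -
  let ?P = "\<lambda>U. U \<subseteq> rcosets\<^bsub>G\<^esub> H \<and> openin T {g \<in> topspace T. H #>\<^bsub>G\<^esub> g \<in> U}"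
  have "istopology ?P"
    unfolding istopology_def
  proof (intro conjI allI impI)
    fix U V assume "?P U" and "?P V"
    moreover have "{g \<in> topspace T. H #>\<^bsub>G\<^esub> g \<in> U \<inter> V} =
        {g \<in> topspace T. H #>\<^bsub>G\<^esub> g \<in> U} \<inter> {g \<in> topspace T. H #>\<^bsub>G\<^esub> g \<in> V}"
      by blast
    ultimately show "U \<inter> V \<subseteq> rcosets\<^bsub>G\<^esub> H" "openin T {g \<in> topspace T. H #>\<^bsub>G\<^esub> g \<in> U \<inter> V}"
      by auto
  next
    fix K assume K: "\<forall>U\<in>K. ?P U"
    have "{g \<in> topspace T. H #>\<^bsub>G\<^esub> g \<in> \<Union>K} = (\<Union>U\<in>K. {g \<in> topspace T. H #>\<^bsub>G\<^esub> g \<in> U})"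
      by blast
    then show "\<Union>K \<subseteq> rcosets\<^bsub>G\<^esub> H" "openin T {g \<in> topspace T. H #>\<^bsub>G\<^esub> g \<in> \<Union>K}"
      using K by auto
  qed
  then show ?thesis
    by (simp add: coset_topology_def topology_inverse')
qed

lemma topspace_coset_topology:
  assumes "topspace T = carrier G"
  shows "topspace (coset_topology G T H) = rcosets\<^bsub>G\<^esub> H"
proof -
  have "{g \<in> topspace T. H #>\<^bsub>G\<^esub> g \<in> rcosets\<^bsub>G\<^esub> H} = topspace T"
    using assms by (auto simp: RCOSETS_def)
  then have "openin (coset_topology G T H) (rcosets\<^bsub>G\<^esub> H)"
    by (simp add: openin_coset_topology)
  then show ?thesis
    by (meson openin_coset_topology openin_subset openin_topspace subset_antisym)
qed

lemma quotient_map_coset_topology: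
  assumes "topspace T = carrier G"
  shows "quotient_map T (coset_topology G T H) (\<lambda>g. H #>\<^bsub>G\<^esub> g)"
  using assms
  by (auto simp: quotient_map_def openin_coset_topology topspace_coset_topology RCOSETS_def)

definition discrete_subgroup ::
    "('a, 'b) monoid_scheme \<Rightarrow> 'a topology \<Rightarrow> 'a set \<Rightarrow> bool" where
  "discrete_subgroup G T H \<longleftrightarrow> subgroup H G \<and> subtopology T H = discrete_topology H"

text \<open>Finite covolume: \<open>H\G\<close> carries a nonzero finite Borel measure that is invariant under
  right translation by \<open>G\<close>.\<close>

definition finite_covolume ::
    "('a, 'b) monoid_scheme \<Rightarrow> 'a topology \<Rightarrow> 'a set \<Rightarrow> bool" where
  "finite_covolume G T H \<longleftrightarrow>
     (\<exists>M :: 'a set measure.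
        sets M = sets (sigma (rcosets\<^bsub>G\<^esub> H) {U. openin (coset_topology G T H) U}) \<and>
        emeasure M (space M) \<noteq> 0 \<and> emeasure M (space M) \<noteq> \<infinity> \<and>
        (\<forall>g \<in> carrier G. \<forall>B \<in> sets M. emeasure M ((\<lambda>x. x #>\<^bsub>G\<^esub> g) ` B) = emeasure M B))"

definition lattice_subgroup ::
    "('a, 'b) monoid_scheme \<Rightarrow> 'a topology \<Rightarrow> 'a set \<Rightarrow> bool" where
  "lattice_subgroup G T H \<longleftrightarrow> discrete_subgroup G T H \<and> finite_covolume G T H"


section \<open>\<open>PSL(2,\<real>)\<close> and \<open>G = PSL(2,\<real>) \<times> PSL(2,\<real>)\<close>\<close>

definition SL2R :: "(real^2^2) monoid" where
  "SL2R = \<lparr>carrier = {A. det A = 1}, mult = (**), one = mat 1\<rparr>"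

text \<open>Elements of \<open>PSL(2,\<real>)\<close> are the sets \<open>{A, -A}\<close>.\<close>

definition PSL2R :: "(real^2^2) set monoid" where
  "PSL2R = SL2R Mod {mat 1, - mat 1}"

definition psl :: "real^2^2 \<Rightarrow> (real^2^2) set" where
  "psl A = {mat 1, - mat 1} #>\<^bsub>SL2R\<^esub> A"

definition PSL2R_top :: "(real^2^2) set topology" where
  "PSL2R_top = coset_topology SL2R (top_of_set (carrier SL2R)) {mat 1, - mat 1}"

definition G2 :: "((real^2^2) set \<times> (real^2^2) set) monoid" where
  "G2 = PSL2R \<times>\<times> PSL2R"

definition G2_top :: "((real^2^2) set \<times> (real^2^2) set) topology" where
  "G2_top = prod_topology PSL2R_top PSL2R_top"

lemma psl_eq: "psl A = {A, - A}"
proof -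
  have "(- mat 1) ** A = - A"
    by (simp add: matrix_matrix_mult_def mat_def vec_eq_iff if_distrib if_distribR sum_negf
        cong: if_cong)
  then show ?thesis
    by (auto simp: psl_def r_coset_def SL2R_def)
qed

lemma det_uminus_2: "det (- A) = det (A :: real^2^2)"
  by (simp add: det_2)

lemma carrier_PSL2R: "carrier PSL2R = psl ` {A. det A = 1}"
  by (simp add: PSL2R_def carrier_FactGroup psl_def SL2R_def)

lemma group_SL2R: "group SL2R"
proof (rule groupI)
  fix A assume "A \<in> carrier SL2R"
  then have "det A = 1" by (simp add: SL2R_def)
  then have "invertible A" by (simp add: invertible_det_nz)
  then obtain B where B: "A ** B = mat 1" "B ** A = mat 1"
    by (auto simp: invertible_def)
  then have "det B = 1"
    using \<open>det A = 1\<close> by (metis det_I det_mul mult_1)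
  then show "\<exists>B\<in>carrier SL2R. B \<otimes>\<^bsub>SL2R\<^esub> A = \<one>\<^bsub>SL2R\<^esub>"
    using B by (auto simp: SL2R_def)
qed (auto simp: SL2R_def det_mul matrix_mul_assoc)

lemma normal_pm1_SL2R: "{mat 1, - mat 1} \<lhd> SL2R"
proof -
  interpret group SL2R by (rule group_SL2R)
  have neg: "(- A) ** B = - (A ** B)" "B ** (- A) = - (B ** A)" for A B :: "real^2^2"
    by (simp_all add: matrix_matrix_mult_def vec_eq_iff sum_negf)
  have "subgroup {mat 1, - mat 1} SL2R"
  proof (rule subgroupI)
    fix A assume "A \<in> {mat 1, - mat 1 :: real^2^2}"
    then have "A \<in> carrier SL2R" "A \<otimes>\<^bsub>SL2R\<^esub> A = \<one>\<^bsub>SL2R\<^esub>"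
      by (auto simp: SL2R_def det_uminus_2 neg)
    then have "inv\<^bsub>SL2R\<^esub> A = A"
      by (simp add: inv_equality)
    then show "inv\<^bsub>SL2R\<^esub> A \<in> {mat 1, - mat 1}"
      using \<open>A \<in> {mat 1, - mat 1}\<close> by simp
  qed (auto simp: SL2R_def det_uminus_2 neg)
  then show ?thesis
    by (rule normalI) (auto simp: SL2R_def r_coset_def l_coset_def neg)
qed

lemma group_PSL2R: "group PSL2R"
  unfolding PSL2R_def by (rule normal.factorgroup_is_group[OF normal_pm1_SL2R])

lemma group_G2: "group G2"
  unfolding G2_def by (intro DirProd_group group_PSL2R)

lemma topspace_PSL2R_top: "topspace PSL2R_top = carrier PSL2R"
  by (simp add: PSL2R_top_def topspace_coset_topology PSL2R_def FactGroup_def)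

lemma topspace_G2_top: "topspace G2_top = carrier G2"
  by (simp add: G2_top_def G2_def topspace_PSL2R_top)


section \<open>Irreducible lattices and the semigroup \<open>A\<^sup>+\<close>\<close>

definition reducible_lattice :: "((real^2^2) set \<times> (real^2^2) set) set \<Rightarrow> bool" where
  "reducible_lattice \<Gamma> \<longleftrightarrow> lattice_subgroup G2 G2_top \<Gamma> \<and>
     (\<exists>\<Gamma>1 \<Gamma>2. lattice_subgroup PSL2R PSL2R_top \<Gamma>1 \<and> lattice_subgroup PSL2R PSL2R_top \<Gamma>2 \<and>
        \<Gamma>1 \<times> \<Gamma>2 \<subseteq> \<Gamma> \<and> finite (rcosets\<^bsub>G2\<lparr>carrier := \<Gamma>\<rparr>\<^esub> (\<Gamma>1 \<times> \<Gamma>2)))"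

definition irreducible_lattice :: "((real^2^2) set \<times> (real^2^2) set) set \<Rightarrow> bool" where
  "irreducible_lattice \<Gamma> \<longleftrightarrow> lattice_subgroup G2 G2_top \<Gamma> \<and> \<not> reducible_lattice \<Gamma>"

definition diag_SL2 :: "real \<Rightarrow> real^2^2" where
  "diag_SL2 l = vector [vector [l, 0], vector [0, inverse l]]"

definition A_plus :: "((real^2^2) set \<times> (real^2^2) set) set" where
  "A_plus = {(psl (diag_SL2 l1), psl (diag_SL2 l2)) | l1 l2. l1 \<ge> 1 \<and> l2 \<ge> 1}"

definition semi_orbit ::
    "((real^2^2) set \<times> (real^2^2) set) set \<Rightarrow> ((real^2^2) set \<times> (real^2^2) set) set set" where
  "semi_orbit x = {x #>\<^bsub>G2\<^esub> a | a. a \<in> A_plus}"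

lemma A_plus_subset: "A_plus \<subseteq> carrier G2"
  by (auto simp: A_plus_def G2_def carrier_PSL2R diag_SL2_def det_2 intro!: imageI)


section \<open>The action on the boundary\<close>

datatype boundary = Finite real | Infinity

fun boundary_map :: "real^2^2 \<Rightarrow> boundary \<Rightarrow> boundary" where
  "boundary_map A (Finite x) =
     (if A$2$1 * x + A$2$2 = 0 then Infinity
      else Finite ((A$1$1 * x + A$1$2) / (A$2$1 * x + A$2$2)))"
| "boundary_map A Infinity = (if A$2$1 = 0 then Infinity else Finite (A$1$1 / A$2$1))"

definition psl_act :: "(real^2^2) set \<Rightarrow> boundary \<Rightarrow> boundary" where
  "psl_act p \<xi> = the_elem ((\<lambda>A. boundary_map A \<xi>) ` p)"

lemma psl_act_psl: "psl_act (psl A) \<xi> = boundary_map A \<xi>"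
proof -
  have "boundary_map (- A) \<xi> = boundary_map A \<xi>"
  proof (cases \<xi>)
    case (Finite x)
    have *: "- (A$2$1 * x) - A$2$2 = - (A$2$1 * x + A$2$2)"
            "- (A$1$1 * x) - A$1$2 = - (A$1$1 * x + A$1$2)"
      by simp_all
    show ?thesis
      unfolding Finite by (simp add: * del: minus_add_distrib)
  qed simp
  then show ?thesis
    by (simp add: psl_act_def psl_eq)
qed


section \<open>Kinds of elements\<close>

definition abs_trace :: "(real^2^2) set \<Rightarrow> real" where
  "abs_trace p = the_elem ((\<lambda>A. \<bar>trace A\<bar>) ` p)"

lemma trace_uminus: "trace (- A) = - trace (A :: real^2^2)"
  by (simp add: trace_def sum_negf)

lemma abs_trace_psl: "abs_trace (psl A) = \<bar>trace A\<bar>"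
  by (simp add: abs_trace_def psl_eq trace_uminus)

definition hyperbolic :: "(real^2^2) set \<Rightarrow> bool" where
  "hyperbolic p \<longleftrightarrow> p \<in> carrier PSL2R \<and> p \<noteq> \<one>\<^bsub>PSL2R\<^esub> \<and> abs_trace p > 2"

definition parabolic :: "(real^2^2) set \<Rightarrow> bool" where
  "parabolic p \<longleftrightarrow> p \<in> carrier PSL2R \<and> p \<noteq> \<one>\<^bsub>PSL2R\<^esub> \<and> abs_trace p = 2"

definition elliptic :: "(real^2^2) set \<Rightarrow> bool" where
  "elliptic p \<longleftrightarrow> p \<in> carrier PSL2R \<and> p \<noteq> \<one>\<^bsub>PSL2R\<^esub> \<and> abs_trace p < 2"

definition hyperbolic_G2 :: "(real^2^2) set \<times> (real^2^2) set \<Rightarrow> bool" where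
  "hyperbolic_G2 \<gamma> \<longleftrightarrow> hyperbolic (fst \<gamma>) \<and> hyperbolic (snd \<gamma>)"

definition parabolic_G2 :: "(real^2^2) set \<times> (real^2^2) set \<Rightarrow> bool" where
  "parabolic_G2 \<gamma> \<longleftrightarrow> parabolic (fst \<gamma>) \<and> parabolic (snd \<gamma>)"

definition elliptic_G2 :: "(real^2^2) set \<times> (real^2^2) set \<Rightarrow> bool" where
  "elliptic_G2 \<gamma> \<longleftrightarrow> elliptic (fst \<gamma>) \<and> elliptic (snd \<gamma>)"

text \<open>The identity of \<open>PSL(2,\<real>)\<close> is of none of the three kinds, so \<open>\<gamma> \<noteq> 1\<close> with exactly one
  trivial component is mixed.\<close>

definition mixed :: "(real^2^2) set \<times> (real^2^2) set \<Rightarrow> bool" where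
  "mixed \<gamma> \<longleftrightarrow> \<gamma> \<in> carrier G2 \<and> \<gamma> \<noteq> \<one>\<^bsub>G2\<^esub> \<and>
     \<not> hyperbolic_G2 \<gamma> \<and> \<not> parabolic_G2 \<gamma> \<and> \<not> elliptic_G2 \<gamma>"

definition dominant_eigenvalue :: "(real^2^2) set \<Rightarrow> real" where
  "dominant_eigenvalue p =
     (THE l. l > 1 \<and> (\<exists>A\<in>p. trace A > 0 \<and> (\<exists>v. v \<noteq> 0 \<and> A *v v = l *s v)))"

text \<open>For hyperbolic elements, and only for these, the description determines a number:\<close>

lemma dominant_eigenvalue_psl:
  assumes "det A = 1" "trace A > 2"
  shows "dominant_eigenvalue (psl A) = (trace A + sqrt ((trace A)\<^sup>2 - 4)) / 2"
proof -
  define t where "t = trace A"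
  define s where "s = sqrt (t\<^sup>2 - 4)"
  have t: "t > 2" using assms by (simp add: t_def)
  have "t\<^sup>2 > 2\<^sup>2" using t by (intro power_strict_mono) auto
  then have s: "s > 0" "s\<^sup>2 = t\<^sup>2 - 4" by (simp_all add: s_def)
  have ev: "(\<exists>v. v \<noteq> 0 \<and> A *v v = l *s v) \<longleftrightarrow> l\<^sup>2 - t * l + 1 = 0" for l
  proof -
    have "(\<exists>v. v \<noteq> 0 \<and> A *v v = l *s v) \<longleftrightarrow> (\<exists>v. v \<noteq> 0 \<and> (A - mat l) *v v = 0)"
      by (simp add: matrix_vector_mult_diff_rdistrib mat_def matrix_vector_mult_def vec_eq_iff
          sum_2 forall_2 UNIV_2 algebra_simps)
    also have "\<dots> \<longleftrightarrow> det (A - mat l) = 0"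
      using matrix_left_invertible_ker[of "A - mat l"] invertible_left_inverse[of "A - mat l"]
        invertible_det_nz[of "A - mat l"] by blast
    also have "det (A - mat l) = l\<^sup>2 - t * l + 1"
      using assms(1) by (simp add: det_2 mat_def t_def trace_def sum_2 power2_eq_square algebra_simps)
    finally show ?thesis .
  qed
  have fac: "l\<^sup>2 - t * l + 1 = (l - (t + s) / 2) * (l - (t - s) / 2)" for l
    using s(2) by (simp add: field_simps power2_eq_square)
  have "(t - s) * (t + s) = 4"
    using s(2) by (simp add: power2_eq_square algebra_simps)
  moreover have "t + s > 2" using t s by simp
  moreover have "2 * (t + s) \<le> (t - s) * (t + s)" if "t - s \<ge> 2"
    using that t s by (intro mult_right_mono) auto
  ultimately have small: "(t - s) / 2 < 1"
    by fastforce
  show ?thesis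
    unfolding dominant_eigenvalue_def psl_eq
  proof (rule the_equality)
    show "(trace A + sqrt ((trace A)\<^sup>2 - 4)) / 2 > 1 \<and> (\<exists>B\<in>{A, - A}. trace B > 0 \<and>
        (\<exists>v. v \<noteq> 0 \<and> B *v v = ((trace A + sqrt ((trace A)\<^sup>2 - 4)) / 2) *s v))"
      using t s ev fac by (simp flip: t_def s_def)
  next
    fix l assume l: "l > 1 \<and> (\<exists>B\<in>{A, - A}. trace B > 0 \<and> (\<exists>v. v \<noteq> 0 \<and> B *v v = l *s v))"
    then have "\<exists>v. v \<noteq> 0 \<and> A *v v = l *s v"
      using t by (auto simp: trace_uminus simp flip: t_def)
    then have "(l - (t + s) / 2) * (l - (t - s) / 2) = 0"
      using ev fac by simp
    then show "l = (trace A + sqrt ((trace A)\<^sup>2 - 4)) / 2"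
      using l small by (auto simp flip: t_def s_def)
  qed
qed

definition hyper_regular :: "(real^2^2) set \<times> (real^2^2) set \<Rightarrow> bool" where
  "hyper_regular \<gamma> \<longleftrightarrow> hyperbolic_G2 \<gamma> \<and>
     dominant_eigenvalue (fst \<gamma>) \<noteq> dominant_eigenvalue (snd \<gamma>)"

end

theory Submission
  imports Defs "HOL-Real_Asymp.Real_Asymp" "HOL-Analysis.Kronecker_Approximation_Theorem"
begin

text \<open>Let \<open>L\<close> be the preimage of \<open>\<Gamma>\<close> in \<open>SL(2,\<real>) \<times> SL(2,\<real>)\<close>. If one projection of \<open>L\<close> to a factor is
  discrete, then so is the other, both kernels are lattices, and their product has finite index in \<open>\<Gamma>\<close>.
  Hence for irreducible \<open>\<Gamma>\<close> both projections are dense, no nontrivial element has a trivial component, and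
  the flow of \<open>(1, a\<^sub>t)\<close> is topologically transitive. An element with exactly one parabolic component would
  give conjugates of \<open>L\<close> without small elements in which the parabolic component is scaled down
  arbitrarily, which finite covolume excludes. So a mixed element fixing \<open>g\<^sub>1(\<infinity>)\<close> is hyperbolic in the
  first factor and elliptic of infinite order in the second. Its powers absorb the first factor of \<open>A\<^sup>+\<close>
  while rotating the second one, so the closure of the semi-orbit contains the images of a whole circle
  under \<open>(1, a\<^sub>t)\<close>, \<open>t \<ge> 0\<close>; circle and contracted directions together fill an open set, and transitivity
  applies. In the hyper-regular case the elements of \<open>L\<close> commuting with the given one contain pairs
  \<open>(diag(x, 1/x), diag(y, 1/y))\<close> with \<open>x\<close> arbitrarily small and \<open>y\<close> close to any given positive number;
  they move \<open>g\<^sub>2\<close> along an expanded horocycle, to which transitivity applies in the same way.\<close>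


section \<open>Discrete subgroups of \<open>SL(2,\<real>) \<times> SL(2,\<real>)\<close>\<close>

text \<open>The packing property of finite covolume stands in for a description of the cusps. To
  exclude a single parabolic component, and to find many elements commuting with a given one, base
  points are constructed at which the lattice has no small elements; two of them must then nearly
  agree modulo \<open>L\<close>, and this produces an element of \<open>L\<close>. In both cases
  small elements are controlled in the same way: a small element commutes with its bounded
  conjugates. In the hyper-regular case this leaves, besides diagonal elements, pairs of unipotent
  ones. Such pairs would form a discrete subgroup of the plane, scaled by the given element with
  factors \<open>d1\<close> and \<open>d2\<close> squared or inverse squared. A discrete planar
  lattice forces such a map to preserve area, and hyper-regularity says that it does not, whichever
  eigenvalue of each component stands first. This is where the regularity condition comes from. The
  computations take place in SL(2), where matrices can be added and measured; the price is the
  signs, which \<open>L\<close> contains in each component.\<close>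

type_synonym mat2 = "real^2^2"
type_synonym mat22 = "mat2 \<times> mat2"

section \<open>Real 2x2 matrices: norm, adjugate, traceless part\<close>

lemma mat2_eq_iff: "(A::mat2) = B \<longleftrightarrow> A$1$1 = B$1$1 \<and> A$1$2 = B$1$2 \<and> A$2$1 = B$2$1 \<and> A$2$2 = B$2$2"
  by (auto simp: vec_eq_iff forall_2)

definition mk2 :: "real \<Rightarrow> real \<Rightarrow> real \<Rightarrow> real \<Rightarrow> mat2" where
  "mk2 a b c d = vector [vector [a, b], vector [c, d]]"

lemma mk2_nth [simp]: "mk2 a b c d $1$1 = a" "mk2 a b c d $1$2 = b" "mk2 a b c d $2$1 = c" "mk2 a b c d $2$2 = d"
  by (auto simp: mk2_def)

lemma mult2_nth [simp]:
  "((A::mat2) ** B)$1$1 = A$1$1 * B$1$1 + A$1$2 * B$2$1"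
  "(A ** B)$1$2 = A$1$1 * B$1$2 + A$1$2 * B$2$2"
  "(A ** B)$2$1 = A$2$1 * B$1$1 + A$2$2 * B$2$1"
  "(A ** B)$2$2 = A$2$1 * B$1$2 + A$2$2 * B$2$2"
  by (auto simp: matrix_matrix_mult_def sum_2)

lemma mat1_nth [simp]: "(mat k::mat2)$1$1 = k" "(mat k::mat2)$1$2 = 0" "(mat k::mat2)$2$1 = 0" "(mat k::mat2)$2$2 = k"
  by (auto simp: mat_def)

lemma norm_mat2_sq: "(norm (A::mat2))\<^sup>2 = (A$1$1)\<^sup>2 + (A$1$2)\<^sup>2 + (A$2$1)\<^sup>2 + (A$2$2)\<^sup>2"
  by (simp add: norm_vec_def L2_set_def sum_2 real_sqrt_pow2)

lemma norm_mult2: "norm ((A::mat2) ** (B::mat2)) \<le> norm A * norm B"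
proof -
  \<comment> \<open>Lagrange's identity: the two sides differ by the square of
    \<open>a*g-b*e\<close>.\<close>
  have cs: "(a*e+b*g)\<^sup>2 \<le> (a\<^sup>2+b\<^sup>2)*(e\<^sup>2+g\<^sup>2)" for a b e g :: real
    using zero_le_power2[of "a*g-b*e"] by (simp add: power2_eq_square algebra_simps)
  have "(norm (A ** B))\<^sup>2 \<le> (norm A)\<^sup>2 * (norm B)\<^sup>2"
    unfolding norm_mat2_sq mult2_nth
    using cs[of "A$1$1" "B$1$1" "A$1$2" "B$2$1"] cs[of "A$1$1" "B$1$2" "A$1$2" "B$2$2"]
      cs[of "A$2$1" "B$1$1" "A$2$2" "B$2$1"] cs[of "A$2$1" "B$1$2" "A$2$2" "B$2$2"]
    by (simp add: algebra_simps)
  then show ?thesis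
    by (metis norm_ge_zero mult_nonneg_nonneg power_mult_distrib power2_le_imp_le)
qed

text \<open>The adjugate serves as inverse on determinant 1. Being linear and total, it passes
  through limits and preserves the norm.\<close>

definition adj :: "mat2 \<Rightarrow> mat2" where
  "adj A = mk2 (A$2$2) (- A$1$2) (- A$2$1) (A$1$1)"

lemma adj_nth [simp]: "adj A$1$1 = A$2$2" "adj A$1$2 = - A$1$2" "adj A$2$1 = - A$2$1" "adj A$2$2 = A$1$1"
  by (auto simp: adj_def)

lemma adj_mult: "adj (A ** B) = adj B ** adj A"
  by (simp add: mat2_eq_iff algebra_simps)

lemma adj_adj [simp]: "adj (adj A) = A" by (simp add: mat2_eq_iff)

lemma adj_right: "det A = 1 \<Longrightarrow> A ** adj A = mat 1"
  and adj_left: "det A = 1 \<Longrightarrow> adj A ** A = mat 1"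
  by (simp_all add: mat2_eq_iff det_2 algebra_simps)

lemma norm_adj [simp]: "norm (adj A) = norm A"
proof -
  have "(norm (adj A))\<^sup>2 = (norm A)\<^sup>2" by (simp add: norm_mat2_sq)
  then show ?thesis by simp
qed

lemma det_adj [simp]: "det (adj A) = det A" by (simp add: det_2)

text \<open>Twice the traceless part. For \<open>det A = 1\<close> its determinant is \<open>4 - (trace A)\<^sup>2\<close>, so that its sign tells
  the kind of \<open>A\<close>, and two non-scalar matrices commute iff their traceless parts are proportional.\<close>

definition tl2 :: "mat2 \<Rightarrow> mat2" where "tl2 A = A - adj A"

lemma tl2_nth [simp]: "tl2 A$1$1 = A$1$1 - A$2$2" "tl2 A$1$2 = 2 * A$1$2" "tl2 A$2$1 = 2 * A$2$1" "tl2 A$2$2 = A$2$2 - A$1$1"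
  by (auto simp: tl2_def)

lemma tl2_eq0_iff: "det A = 1 \<Longrightarrow> tl2 A = 0 \<longleftrightarrow> A = mat 1 \<or> A = - mat 1"
proof
  assume "det A = 1" "tl2 A = 0"
  have "tl2 A$1$1 = 0" "tl2 A$1$2 = 0" "tl2 A$2$1 = 0" unfolding \<open>tl2 A = 0\<close> by simp_all
  then have e: "A$2$2 = A$1$1" "A$1$2 = 0" "A$2$1 = 0" by simp_all
  then have "A$1$1 * A$1$1 = 1" using \<open>det A = 1\<close> by (simp add: det_2)
  then have "A$1$1 = 1 \<or> A$1$1 = -1" by (simp add: square_eq_1_iff)
  then show "A = mat 1 \<or> A = - mat 1" using e unfolding mat2_eq_iff by simp
qed (auto simp: mat2_eq_iff)

lemma det_tl2: "det (tl2 A) = 4 * det A - (trace A)\<^sup>2"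
  by (simp add: det_2 trace_def sum_2 power2_eq_square algebra_simps)

lemma tl2_conj: "det h = 1 \<Longrightarrow> tl2 (adj h ** A ** h) = adj h ** tl2 A ** h"
proof -
  have "adj h ** tl2 A ** h - tl2 (adj h ** A ** h) = 0"
    by (simp add: mat2_eq_iff algebra_simps)
  then show ?thesis by simp
qed

text \<open>On the three-dimensional space of traceless matrices the commutator behaves like a cross
  product, which vanishes only for parallel vectors. The factor is read off at a nonzero entry of
  \<open>tl2 X\<close>.\<close>

lemma commute_proportional:
  assumes "(X::mat2) ** A = A ** X" "tl2 X \<noteq> 0"
  shows "\<exists>q. tl2 A = q *\<^sub>R tl2 X"
proof -
  have e: "X$1$2 * A$2$1 = A$1$2 * X$2$1" 
    "X$1$1 * A$1$2 + X$1$2 * A$2$2 = A$1$1 * X$1$2 + A$1$2 * X$2$2"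
    "X$2$1 * A$1$1 + X$2$2 * A$2$1 = A$2$1 * X$1$1 + A$2$2 * X$2$1"
    using assms(1) by (auto simp: mat2_eq_iff)
  consider "X$1$2 \<noteq> 0" | "X$2$1 \<noteq> 0" | "X$1$2 = 0" "X$2$1 = 0" "X$1$1 \<noteq> X$2$2"
    using assms(2) by (auto simp: mat2_eq_iff)
  then show ?thesis
  proof cases
    case 1
    show ?thesis by (rule exI[of _ "A$1$2 / X$1$2"]) (use e 1 in \<open>simp add: mat2_eq_iff field_simps; algebra\<close>)
  next
    case 2
    show ?thesis by (rule exI[of _ "A$2$1 / X$2$1"]) (use e 2 in \<open>simp add: mat2_eq_iff field_simps; algebra\<close>)
  next
    case 3
    then have "A$1$2 * (X$1$1 - X$2$2) = 0" "A$2$1 * (X$1$1 - X$2$2) = 0" using e by (auto simp: algebra_simps)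
    then have "A$1$2 = 0" "A$2$1 = 0" using 3 by auto
    then show ?thesis using 3 by (intro exI[of _ "(A$1$1 - A$2$2) / (X$1$1 - X$2$2)"]) (simp add: mat2_eq_iff field_simps)
  qed
qed

text \<open>\<open>A\<close> is then a combination of the identity and \<open>X\<close>.\<close>

lemma proportional_commute:
  assumes "tl2 A = q *\<^sub>R tl2 X"
  shows "X ** A = A ** X"
proof -
  have "tl2 A$1$1 = (q *\<^sub>R tl2 X)$1$1" "tl2 A$1$2 = (q *\<^sub>R tl2 X)$1$2" "tl2 A$2$1 = (q *\<^sub>R tl2 X)$2$1"
    using assms by simp_all
  then have e: "A$1$1 = A$2$2 + q * (X$1$1 - X$2$2)" "A$1$2 = q * X$1$2" "A$2$1 = q * X$2$1"
    by simp_all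
  show ?thesis unfolding mat2_eq_iff mult2_nth e by (simp add: algebra_simps)
qed

section \<open>Pairs of matrices\<close>

definition pmul :: "mat22 \<Rightarrow> mat22 \<Rightarrow> mat22" (infixl "\<star>" 70) where
  "x \<star> y = (fst x ** fst y, snd x ** snd y)"

text \<open>\<open>\<star>\<close> and \<open>pinv\<close> act on all pairs, so that they are a
  bilinear and a linear map of a normed space, with the estimates and limits this gives;
  \<open>SS\<close> is the group inside.\<close>

definition pinv :: "mat22 \<Rightarrow> mat22" where "pinv x = (adj (fst x), adj (snd x))"

definition pone :: mat22 where "pone = (mat 1, mat 1)"

definition SS :: "mat22 set" where "SS = {x. det (fst x) = 1 \<and> det (snd x) = 1}"

lemma fst_pmul [simp]: "fst (x \<star> y) = fst x ** fst y" and snd_pmul [simp]: "snd (x \<star> y) = snd x ** snd y"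
  and fst_pinv [simp]: "fst (pinv x) = adj (fst x)" and snd_pinv [simp]: "snd (pinv x) = adj (snd x)"
  and fst_pone [simp]: "fst pone = mat 1" and snd_pone [simp]: "snd pone = mat 1"
  by (auto simp: pmul_def pinv_def pone_def)

lemma pmul_assoc: "x \<star> y \<star> z = x \<star> (y \<star> z)" by (simp add: pmul_def matrix_mul_assoc)
lemma pone_left [simp]: "pone \<star> x = x" and pone_right [simp]: "x \<star> pone = x" by (simp_all add: pmul_def)
lemma pinv_mul: "pinv (x \<star> y) = pinv y \<star> pinv x" by (simp add: pmul_def pinv_def adj_mult)
lemma pinv_pinv [simp]: "pinv (pinv x) = x" by (simp add: pinv_def)
lemma adj_mat1 [simp]: "adj (mat 1) = mat 1" by (simp add: mat2_eq_iff)
lemma pinv_pone [simp]: "pinv pone = pone" by (simp add: pinv_def pone_def)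
lemma SS_pone [simp]: "pone \<in> SS" by (simp add: SS_def)
lemma SS_pmul [simp]: "x \<in> SS \<Longrightarrow> y \<in> SS \<Longrightarrow> x \<star> y \<in> SS" by (simp add: SS_def det_mul)
lemma SS_pinv [simp]: "x \<in> SS \<Longrightarrow> pinv x \<in> SS" by (simp add: SS_def)
lemma pinv_right [simp]: "x \<in> SS \<Longrightarrow> x \<star> pinv x = pone" and pinv_left [simp]: "x \<in> SS \<Longrightarrow> pinv x \<star> x = pone"
  by (simp_all add: SS_def pmul_def pinv_def pone_def adj_right adj_left)
lemma pinv_left' [simp]: "x \<in> SS \<Longrightarrow> pinv x \<star> (x \<star> y) = y" and pinv_right' [simp]: "x \<in> SS \<Longrightarrow> x \<star> (pinv x \<star> y) = y"
  by (simp_all flip: pmul_assoc)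

lemma norm_pinv [simp]: "norm (pinv x) = norm x" by (simp add: norm_prod_def)

lemma norm_pmul: "norm (x \<star> y) \<le> norm x * norm y"
proof -
  define a b c d where "a = norm (fst x)" "b = norm (snd x)" "c = norm (fst y)" "d = norm (snd y)"
  have nn: "a \<ge> 0" "b \<ge> 0" "c \<ge> 0" "d \<ge> 0" by (auto simp: a_b_c_d_def)
  have "norm (x \<star> y) \<le> sqrt ((a*c)\<^sup>2 + (b*d)\<^sup>2)"
    unfolding norm_prod_def a_b_c_d_def
    by (intro real_sqrt_le_mono add_mono power_mono) (auto intro: norm_mult2)
  also have "\<dots> \<le> sqrt ((a\<^sup>2+b\<^sup>2)*(c\<^sup>2+d\<^sup>2))"
    by (intro real_sqrt_le_mono) (simp add: algebra_simps power_mult_distrib)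
  also have "\<dots> = norm x * norm y" by (simp add: norm_prod_def a_b_c_d_def real_sqrt_mult)
  finally show ?thesis .
qed

interpretation mult2: bounded_bilinear "(**) :: mat2 \<Rightarrow> mat2 \<Rightarrow> mat2"
proof
  show "\<exists>K. \<forall>a b. norm (a ** b) \<le> norm (a::mat2) * norm (b::mat2) * K"
    by (intro exI[of _ 1]) (simp add: norm_mult2)
qed (simp_all add: mat2_eq_iff algebra_simps)

interpretation pmul: bounded_bilinear "(\<star>)"
proof
  show "\<exists>K. \<forall>a b. norm (a \<star> b) \<le> norm a * norm b * K"
    by (intro exI[of _ 1]) (simp add: norm_pmul)
qed (simp_all add: prod_eq_iff mult2.add_left mult2.add_right mult2.scaleR_left mult2.scaleR_right)

lemma bounded_linear_pinv: "bounded_linear pinv"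
  by (rule bounded_linear_intro[where K=1]) (auto simp: pinv_def prod_eq_iff mat2_eq_iff simp flip: pinv_def)

lemma bounded_linear_adj: "bounded_linear adj"
  by (rule bounded_linear_intro[where K=1]) (auto simp: mat2_eq_iff)

lemmas pinv_diff = linear_diff[OF bounded_linear.linear[OF bounded_linear_pinv]]

lemma norm_pone [simp]: "norm pone = 2"
proof -
  have "(norm (mat 1::mat2))\<^sup>2 = 2" by (simp add: norm_mat2_sq)
  then show ?thesis by (simp add: norm_prod_def)
qed

lemma norm_fst_diff: "norm (fst x - fst y) \<le> norm (x - y)" and norm_snd_diff: "norm (snd x - snd y) \<le> norm (x - y)" for x y :: mat22
  by (metis fst_diff norm_fst_le prod.collapse) (metis snd_diff norm_snd_le prod.collapse)

lemma norm_pinv_minus_one: "norm (pinv x - pone) = norm (x - pone)"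
  by (metis norm_pinv pinv_diff pinv_pone)

lemmas [tendsto_intros] = pmul.tendsto mult2.tendsto
  bounded_linear.tendsto[OF bounded_linear_pinv] bounded_linear.tendsto[OF bounded_linear_adj]
lemmas [continuous_intros] = pmul.continuous_on mult2.continuous_on
  bounded_linear.continuous_on[OF bounded_linear_pinv] bounded_linear.continuous_on[OF bounded_linear_adj]

lemma closed_SS: "closed SS"
proof -
  have "SS = {x. det (fst x) = 1} \<inter> {x. det (snd x) = 1}" by (auto simp: SS_def)
  moreover have "closed {x. det (fst x :: mat2) = 1}" "closed {x. det (snd x :: mat2) = 1}" for x :: mat22
    unfolding det_2 by (intro closed_Collect_eq continuous_intros)+
  ultimately show ?thesis by (metis closed_Int)
qed

definition conj_set :: "mat22 \<Rightarrow> mat22 set \<Rightarrow> mat22 set" where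
  "conj_set h L = (\<lambda>x. pinv h \<star> x \<star> h) ` L"

locale discrete_SS =
  fixes L :: "mat22 set"
  assumes sub: "L \<subseteq> SS" and one_in: "pone \<in> L"
    and mul_in: "x \<in> L \<Longrightarrow> y \<in> L \<Longrightarrow> x \<star> y \<in> L" and inv_in: "x \<in> L \<Longrightarrow> pinv x \<in> L"
    and discrete: "\<exists>e>0. \<forall>x\<in>L. norm (x - pone) < e \<longrightarrow> x = pone"
begin

lemma in_SS [simp]: "x \<in> L \<Longrightarrow> x \<in> SS" using sub by auto

text \<open>At an accumulation point two distinct elements \<open>x\<close>, \<open>y\<close> would
  come so close that \<open>pinv x \<star> y\<close> is near \<open>pone\<close> without being equal
  to it.\<close>

lemma finite_bounded: 
  assumes "bounded B" shows "finite (L \<inter> B)"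
proof (rule ccontr)
  assume inf: "infinite (L \<inter> B)"
  obtain e where e: "e > 0" "\<And>x. x \<in> L \<Longrightarrow> norm (x - pone) < e \<Longrightarrow> x = pone" using discrete by auto
  obtain K where K: "K > 0" "\<And>x. x \<in> B \<Longrightarrow> norm x \<le> K" using assms bounded_pos by metis
  obtain l where l: "l islimpt (L \<inter> B)" 
    using bounded_infinite_imp_islimpt[of "L \<inter> B" "L \<inter> B"] inf assms by (metis bounded_Int order_refl)
  \<comment> \<open>Two points of a ball of radius \<open>d\<close> differ by less than
    \<open>2 * d\<close>, and multiplication by \<open>pinv x\<close> costs the factor
    \<open>K\<close>.\<close>
  define d where "d = e / (2 * K)"
  have "d > 0" using e K by (simp add: d_def)
  have "infinite ((L \<inter> B) \<inter> ball l d)"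
    using l \<open>d > 0\<close> by (simp add: islimpt_eq_infinite_ball)
  then obtain x where x: "x \<in> L" "x \<in> B" "x \<in> ball l d" using infinite_imp_nonempty by blast
  have "infinite (((L \<inter> B) \<inter> ball l d) - {x})" using \<open>infinite ((L \<inter> B) \<inter> ball l d)\<close> by simp
  then obtain y where y: "y \<in> L" "y \<in> B" "y \<in> ball l d" "y \<noteq> x" using infinite_imp_nonempty by blast
  have "norm (y - x) < 2 * d" using x(3) y(3) dist_triangle_less_add[of y l d x d] by (simp add: dist_norm norm_minus_commute)
  have "pinv x \<star> y - pone = pinv x \<star> (y - x)" using x by (simp add: pmul.diff_right)
  then have "norm (pinv x \<star> y - pone) \<le> norm x * norm (y - x)" using norm_pmul[of "pinv x" "y - x"] by simp
  also have "\<dots> \<le> K * norm (y - x)" using K x by (intro mult_right_mono) auto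
  also have "\<dots> < K * (2 * d)" using K \<open>norm (y - x) < 2 * d\<close> by simp
  also have "\<dots> = e" using K by (simp add: d_def)
  finally have "pinv x \<star> y = pone" using e x y mul_in inv_in by blast
  then have "x \<star> (pinv x \<star> y) = x" by simp
  then show False using y x by simp
qed

text \<open>Conjugation is a change of base point: how close \<open>conj_set h L\<close> comes to
  \<open>pone\<close> measures the injectivity radius of the quotient at \<open>h\<close>.\<close>

lemma conj: assumes h: "h \<in> SS" shows "discrete_SS (conj_set h L)"
proof
  obtain e where e: "e > 0" "\<And>x. x \<in> L \<Longrightarrow> norm (x - pone) < e \<Longrightarrow> x = pone" using discrete by auto
  have hn: "norm h > 0" using h by (auto simp: SS_def det_2)
  show "\<exists>e>0. \<forall>x\<in>conj_set h L. norm (x - pone) < e \<longrightarrow> x = pone"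
  proof (intro exI[of _ "e / (norm h * norm h)"] conjI ballI impI)
    show "e / (norm h * norm h) > 0" using e hn by simp
    fix x assume "x \<in> conj_set h L" and n: "norm (x - pone) < e / (norm h * norm h)"
    then obtain y where y: "y \<in> L" "x = pinv h \<star> y \<star> h" by (auto simp: conj_set_def)
    have "y - pone = h \<star> (x - pone) \<star> pinv h" using y h by (simp add: pmul.diff_left pmul.diff_right pmul_assoc)
    then have "norm (y - pone) \<le> norm h * norm (x - pone) * norm h"
      using order_trans[OF norm_pmul mult_right_mono[OF norm_pmul norm_ge_zero], of h "x - pone" "pinv h"] by simp
    also have "\<dots> < e" using n hn by (simp add: field_simps)
    finally have "y = pone" using e y by auto
    then show "x = pone" using y h by (simp add: pmul_assoc)
  qed
  show "conj_set h L \<subseteq> SS" using h by (auto simp: conj_set_def)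
  show "pone \<in> conj_set h L" using h one_in by (auto simp: conj_set_def image_iff pmul_assoc intro!: bexI[of _ pone])
  fix x assume "x \<in> conj_set h L" then obtain a where a: "a \<in> L" "x = pinv h \<star> a \<star> h" by (auto simp: conj_set_def)
  show "pinv x \<in> conj_set h L" using a inv_in by (auto simp: conj_set_def pinv_mul pmul_assoc)
  fix y assume "y \<in> conj_set h L" then obtain b where b: "b \<in> L" "y = pinv h \<star> b \<star> h" by (auto simp: conj_set_def)
  have "x \<star> y = pinv h \<star> (a \<star> b) \<star> h" using a b h by (simp add: pmul_assoc)
  then show "x \<star> y \<in> conj_set h L" using a b mul_in unfolding conj_set_def by blast
qed

text \<open>A minimal non-commuting pair of small elements would commute with its commutator; since
  centralizers of non-scalar \<open>2\<times>2\<close> matrices are commutative, this is impossible.\<close>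

lemma small_commute:
  assumes "x \<in> L" "y \<in> L" "norm (x - pone) < 1/32" "norm (y - pone) < 1/32"
  shows "x \<star> y = y \<star> x"
proof (rule ccontr)
  assume nc: "x \<star> y \<noteq> y \<star> x"
  define S where "S = L \<inter> ball pone (1/32)"
  define P where "P = {(x,y). x \<in> S \<and> y \<in> S \<and> x \<star> y \<noteq> y \<star> x}"
  define f where "f = (\<lambda>(x,y). norm (x - pone) + norm (y - pone))"
  have mS: "x \<in> S \<longleftrightarrow> x \<in> L \<and> norm (x - pone) < 1/32" for x by (auto simp: S_def dist_norm norm_minus_commute)
  have "finite S" unfolding S_def by (rule finite_bounded) simp
  then have "finite P" unfolding P_def by (rule_tac finite_subset[of _ "S \<times> S"]) auto
  moreover have "(x,y) \<in> P" using nc assms by (simp add: P_def mS)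
  then have "P \<noteq> {}" by blast
  ultimately obtain p where p: "p \<in> P" "\<And>q. q \<in> P \<Longrightarrow> f p \<le> f q"
    using arg_min_least[of P _ f] arg_min_if_finite(1)[of P f] by blast
  obtain a b where ab: "p = (a,b)" by (cases p)
  have aS: "a \<in> S" and bS: "b \<in> S" and nc: "a \<star> b \<noteq> b \<star> a" using p(1) ab by (auto simp: P_def)
  have aL: "a \<in> L" "b \<in> L" and an: "norm (a - pone) < 1/32" "norm (b - pone) < 1/32" using aS bS mS by auto
  have SSa: "a \<in> SS" "b \<in> SS" using aL by auto
  define w where "w = a \<star> b \<star> pinv a \<star> pinv b"
  have wL: "w \<in> L" using aL by (auto simp: w_def mul_in inv_in)
  have na: "norm a \<le> 3" "norm b \<le> 3" using an norm_triangle_sub[of a pone] norm_triangle_sub[of b pone] by auto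
  have wab: "w \<star> (b \<star> a) = a \<star> b" using SSa by (simp add: w_def pmul_assoc)
  \<comment> \<open>A commutator is quadratic in the distances to \<open>pone\<close>. The constant
    is 2 times 9, the norms of \<open>a\<close> and \<open>b\<close> being at most 3; as 18/32 < 1,
    the bound 1/32 puts \<open>w\<close> closer to \<open>pone\<close> than both \<open>a\<close>
    and \<open>b\<close>.\<close>
  have "w - pone = ((a - pone) \<star> (b - pone) - (b - pone) \<star> (a - pone)) \<star> (pinv a \<star> pinv b)"
    using SSa by (simp add: w_def pmul.diff_left pmul.diff_right pmul_assoc)
  then have "norm (w - pone) \<le> norm ((a - pone) \<star> (b - pone) - (b - pone) \<star> (a - pone)) * norm (pinv a \<star> pinv b)"
    using norm_pmul by metis
  also have "\<dots> \<le> (2 * norm (a - pone) * norm (b - pone)) * 9"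
  proof (intro mult_mono)
    show "norm ((a - pone) \<star> (b - pone) - (b - pone) \<star> (a - pone)) \<le> 2 * norm (a - pone) * norm (b - pone)"
      using norm_triangle_ineq4[of "(a - pone) \<star> (b - pone)" "(b - pone) \<star> (a - pone)"]
        norm_pmul[of "a - pone" "b - pone"] norm_pmul[of "b - pone" "a - pone"] by (simp add: mult.commute mult.left_commute)
    have "norm (pinv a \<star> pinv b) \<le> norm a * norm b" using norm_pmul[of "pinv a" "pinv b"] by simp
    also have "\<dots> \<le> 3 * 3" using na by (intro mult_mono) auto
    finally show "norm (pinv a \<star> pinv b) \<le> 9" by simp
  qed auto
  finally have wn: "norm (w - pone) \<le> 18 * norm (a - pone) * norm (b - pone)" by simp
  have pos: "norm (a - pone) > 0" "norm (b - pone) > 0" using nc by auto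
  have "18 * norm (a - pone) * norm (b - pone) < norm (b - pone)" 
    using an pos by (intro mult_strict_right_mono[of "18 * norm (a - pone)" 1, simplified]) auto
  with wn have wb: "norm (w - pone) < norm (b - pone)" by simp
  have "norm (a - pone) * (18 * norm (b - pone)) < norm (a - pone) * 1" 
    using an pos by (intro mult_strict_left_mono) auto
  with wn have wa: "norm (w - pone) < norm (a - pone)" by (simp add: algebra_simps)
  have wS: "w \<in> S" using wL wa an by (simp add: mS)
  have c1: "a \<star> w = w \<star> a"
  proof (rule ccontr)
    assume "a \<star> w \<noteq> w \<star> a" then have "(a,w) \<in> P" using aS wS by (simp add: P_def)
    then show False using p(2)[of "(a,w)"] wb by (simp add: f_def ab)
  qed
  have c2: "w \<star> b = b \<star> w"
  proof (rule ccontr)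
    assume "w \<star> b \<noteq> b \<star> w" then have "(w,b) \<in> P" using bS wS by (simp add: P_def)
    then show False using p(2)[of "(w,b)"] wa by (simp add: f_def ab)
  qed
  \<comment> \<open>\<open>W\<close> is the commutator of \<open>A\<close> and \<open>B\<close> and
    commutes with both. If it is not scalar, they lie in its commutative centralizer; if it is
    scalar it is 1, since -1 is too far from 1.\<close>
  have comp: "A ** B = B ** A" if cm: "W ** (B ** A) = A ** B" "A ** W = W ** A" "W ** B = B ** W" "det W = 1" 
    "norm (W - mat 1) < 1" for A B W :: mat2
  proof (cases "tl2 W = 0")
    case True
    then have "W = mat 1 \<or> W = - mat 1" using that tl2_eq0_iff by simp
    moreover have "norm (- mat 1 - mat 1 :: mat2) \<ge> 1"
    proof (rule power2_le_imp_le)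
      show "1\<^sup>2 \<le> (norm (- mat 1 - mat 1 :: mat2))\<^sup>2" unfolding norm_mat2_sq vector_minus_component uminus_vec_def by simp
    qed simp
    ultimately have "W = mat 1" using that(5) by auto
    then show ?thesis using that(1) by simp
  next
    case False
    then obtain q r where q: "tl2 A = q *\<^sub>R tl2 W" "tl2 B = r *\<^sub>R tl2 W"
      using commute_proportional[of W A] commute_proportional[of W B] cm(2)[symmetric] cm(3) by blast
    show ?thesis
    proof (cases "q = 0")
      case True
      then show ?thesis using q(1) proportional_commute[of A 0 B] by simp
    next
      case False
      then have "tl2 B = (r / q) *\<^sub>R tl2 A" using q by simp
      then show ?thesis by (rule proportional_commute)
    qed
  qed
  have wn1: "norm (fst w - mat 1) < 1" "norm (snd w - mat 1) < 1"
    using wa an norm_fst_diff[of w pone] norm_snd_diff[of w pone] by auto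
  have "a \<star> b = b \<star> a"
    using comp[of "fst w" "fst b" "fst a"] comp[of "snd w" "snd b" "snd a"] wab c1 c2 wn1 in_SS[OF wL]
    unfolding prod_eq_iff SS_def fst_pmul snd_pmul by blast
  then show False using nc by simp
qed

end

section \<open>Unipotent and diagonal matrices\<close>

definition nn :: "real \<Rightarrow> mat2" where "nn t = mk2 1 t 0 1"
definition nm :: "real \<Rightarrow> mat2" where "nm t = mk2 1 0 t 1"
text \<open>Orientation used throughout: for \<open>l > 1\<close>, the conjugation
  \<open>adj (dg l) ** A ** dg l\<close> contracts \<open>nn\<close> and expands \<open>nm\<close>,
  both by the square of \<open>l\<close>.\<close>

definition dg :: "real \<Rightarrow> mat2" where "dg l = mk2 l 0 0 (inverse l)"

lemma nn_nth [simp]: "nn t$1$1 = 1" "nn t$1$2 = t" "nn t$2$1 = 0" "nn t$2$2 = 1" by (auto simp: nn_def)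
lemma nm_nth [simp]: "nm t$1$1 = 1" "nm t$1$2 = 0" "nm t$2$1 = t" "nm t$2$2 = 1" by (auto simp: nm_def)
lemma dg_nth [simp]: "dg t$1$1 = t" "dg t$1$2 = 0" "dg t$2$1 = 0" "dg t$2$2 = inverse t" by (auto simp: dg_def)
lemma det_nn [simp]: "det (nn t) = 1" and det_nm [simp]: "det (nm t) = 1" and det_dg [simp]: "t \<noteq> 0 \<Longrightarrow> det (dg t) = 1"
  by (auto simp: det_2)

lemma dg_mult: "dg (s * t) = dg s ** dg t" by (simp add: mat2_eq_iff)

lemma dg_1: "dg 1 = mat 1" by (simp add: mat2_eq_iff)

lemma adj_cancel: "det A = 1 \<Longrightarrow> A ** (adj A ** B) = B" "det A = 1 \<Longrightarrow> adj A ** (A ** B) = B" for A B :: mat2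
  by (simp_all add: matrix_mul_assoc adj_left adj_right)

lemma mat2_tendsto_iff:
  "((f::_ \<Rightarrow> mat2) \<longlongrightarrow> A) F \<longleftrightarrow> ((\<lambda>x. f x$1$1) \<longlongrightarrow> A$1$1) F \<and> ((\<lambda>x. f x$1$2) \<longlongrightarrow> A$1$2) F \<and>
     ((\<lambda>x. f x$2$1) \<longlongrightarrow> A$2$1) F \<and> ((\<lambda>x. f x$2$2) \<longlongrightarrow> A$2$2) F" (is "?l \<longleftrightarrow> ?r")
proof
  assume ?l then show ?r by (auto intro!: tendsto_intros)
next
  assume r: ?r
  have "((\<lambda>x. f x$i$j) \<longlongrightarrow> A$i$j) F" for i j
    using r exhaust_2[of i] exhaust_2[of j] by auto
  then show ?l by (intro vec_tendstoI)
qed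

text \<open>If the lower left entry is nonzero, row and column operations give three shears; a
  factor \<open>nm 1\<close> makes that entry nonzero otherwise.\<close>

lemma SL2_generated:
  assumes "det (B::mat2) = 1" shows "\<exists>x y z t. B = nn x ** nm y ** nn z ** nm t"
proof -
  have *: "\<exists>x y z. B = nn x ** nm y ** nn z" if "det B = 1" "B$2$1 \<noteq> 0" for B :: mat2
  proof -
    have "B$1$2 = (B$1$1 * B$2$2 - 1) / B$2$1" using that by (simp add: det_2 field_simps)
    then have "B = nn ((B$1$1 - 1)/B$2$1) ** nm (B$2$1) ** nn ((B$2$2 - 1)/B$2$1)"
      using that by (simp add: mat2_eq_iff det_2 divide_simps) (simp add: algebra_simps)
    then show ?thesis by blast
  qed
  show ?thesis
  proof (cases "B$2$1 = 0")
    case False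
    then obtain x y z where "B = nn x ** nm y ** nn z" using * assms by blast
    then have "B = nn x ** nm y ** nn z ** nm 0" by (simp add: mat2_eq_iff)
    then show ?thesis by blast
  next
    case True
    then have "B$2$2 \<noteq> 0" using assms by (auto simp: det_2)
    then have "(B ** nm 1)$2$1 \<noteq> 0" "det (B ** nm 1) = 1" using assms True by (auto simp: det_mul)
    then obtain x y z where e: "B ** nm 1 = nn x ** nm y ** nn z" using * by blast
    have "B = B ** nm 1 ** nm (-1)" by (simp add: mat2_eq_iff)
    then show ?thesis unfolding e by blast
  qed
qed

text \<open>What finite covolume is used for: recurrence of the translation by a one-parameter group, and
  the impossibility of infinitely many disjoint balls of equal size at points \<open>h\<^sub>n\<close> where the injectivity
  radius stays away from \<open>0\<close>.\<close>

locale lat22 = discrete_SS +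
  assumes signs: "(- mat 1, mat 1) \<in> L" "(mat 1, - mat 1) \<in> L"
    and nonwandering: "open U \<Longrightarrow> U \<inter> SS \<noteq> {} \<Longrightarrow> (\<And>n. g n \<in> SS) \<Longrightarrow> (\<And>i j::nat. g (i + j) = g i \<star> g j) \<Longrightarrow>
      \<exists>n\<ge>N. \<exists>\<gamma>\<in>L. \<exists>u\<in>U \<inter> SS. \<exists>u'\<in>U \<inter> SS. \<gamma> \<star> u \<star> g n = u'"
    and packing: "r > 0 \<Longrightarrow> (\<And>n. h n \<in> SS) \<Longrightarrow>
      (\<And>n::nat. \<And>\<gamma>. \<gamma> \<in> L \<Longrightarrow> norm (pinv (h n) \<star> \<gamma> \<star> h n - pone) < r \<Longrightarrow> \<gamma> = pone) \<Longrightarrow> r' > 0 \<Longrightarrow>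
      \<exists>i j. i < j \<and> (\<exists>\<gamma>\<in>L. norm (pinv (h j) \<star> \<gamma> \<star> h i - pone) < r')"
begin

lemma neg_in: "x \<in> L \<Longrightarrow> (- fst x, snd x) \<in> L" "x \<in> L \<Longrightarrow> (fst x, - snd x) \<in> L"
  using mul_in[OF signs(1), of x] mul_in[OF signs(2), of x]
  by (simp_all add: pmul_def mult2.minus_left)

end

text \<open>Density of both projections is the form in which irreducibility is used;
  \<open>irr22_L\<close> derives it.\<close>

locale irr22 = lat22 +
  assumes dense1: "det A = 1 \<Longrightarrow> e > 0 \<Longrightarrow> \<exists>x\<in>L. norm (fst x - A) < e"
    and dense2: "det A = 1 \<Longrightarrow> e > 0 \<Longrightarrow> \<exists>x\<in>L. norm (snd x - A) < e"
begin

text \<open>The commutator of \<open>(mat 1, B)\<close> with an element of \<open>L\<close> whose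
  second component is near 1 is a small element of \<open>L\<close>, hence trivial. The second
  components are dense, so \<open>B\<close> commutes with a neighbourhood of 1, in particular with
  short upper and lower shears, and is scalar.\<close>

lemma trivial_fst_1:
  assumes "(mat 1, B) \<in> L" shows "B = mat 1 \<or> B = - mat 1"
proof -
  have dB: "det B = 1" using in_SS[OF assms] by (simp add: SS_def)
  obtain e where e: "e > 0" "\<And>x. x \<in> L \<Longrightarrow> norm (x - pone) < e \<Longrightarrow> x = pone" using discrete by auto
  have "continuous_on UNIV (\<lambda>C. C ** B ** adj C ** adj B)" by (intro continuous_intros)
  then obtain d where d: "d > 0" "\<And>C. dist C (mat 1) < d \<Longrightarrow> dist (C ** B ** adj C ** adj B) (mat 1) < e"
    using e(1) adj_right[OF dB] unfolding continuous_on_iff by (metis UNIV_I adj_mat1 matrix_mul_lid matrix_mul_rid)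
  have c1: "snd x ** B = B ** snd x" if "x \<in> L" "dist (snd x) (mat 1) < d" for x
  proof -
    let ?y = "x \<star> (mat 1, B) \<star> pinv x \<star> pinv (mat 1, B)"
    have "?y \<in> L" using that assms by (intro mul_in inv_in)
    moreover have y: "?y = (mat 1, snd x ** B ** adj (snd x) ** adj B)"
      using in_SS[OF that(1)] by (simp add: prod_eq_iff SS_def adj_right)
    moreover have "norm (?y - pone) < e" using d(2)[OF that(2)] unfolding y by (simp add: pone_def dist_norm)
    ultimately have "snd x ** B ** adj (snd x) ** adj B = mat 1" using e by (metis snd_conv snd_pone)
    moreover have "snd x ** B = snd x ** B ** (adj (snd x) ** ((adj B ** B) ** snd x))"
      using dB in_SS[OF that(1)] by (simp add: SS_def adj_left)
    then have "snd x ** B = snd x ** B ** adj (snd x) ** adj B ** (B ** snd x)" by (simp only: matrix_mul_assoc)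
    ultimately show ?thesis by simp
  qed
  have c2: "C ** B = B ** C" if C: "det C = 1" "dist C (mat 1) < d" for C
  proof -
    have "closed {C. C ** B = B ** C}" by (intro closed_Collect_eq continuous_intros)
    moreover have "C \<in> closure {C. C ** B = B ** C}"
      unfolding closure_approachable
    proof (intro allI impI)
      fix r :: real assume "r > 0"
      then have "min r (d - dist C (mat 1)) > 0" using C by simp
      then obtain x where x: "x \<in> L" "norm (snd x - C) < min r (d - dist C (mat 1))" using dense2 C by meson
      then have "dist (snd x) (mat 1) < d" using dist_triangle[of "snd x" "mat 1" C] by (simp add: dist_norm)
      then have "snd x ** B = B ** snd x" using c1 x(1) by blast
      moreover have "dist (snd x) C < r" using x(2) by (simp add: dist_norm)
      ultimately show "\<exists>y\<in>{C. C ** B = B ** C}. dist y C < r" by blast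
    qed
    ultimately show ?thesis by (simp add: closure_closed)
  qed
  define t where "t = d / 2"
  have t: "t > 0" "t < d" using d by (auto simp: t_def)
  have "norm (nn t - mat 1) = t" "norm (nm t - mat 1) = t"
    using norm_mat2_sq[of "nn t - mat 1"] norm_mat2_sq[of "nm t - mat 1"] t
    by (auto simp: power2_eq_iff_nonneg)
  then have "nn t ** B = B ** nn t" "nm t ** B = B ** nm t" using c2 t by (auto simp: dist_norm)
  then have "t * B$2$1 = 0" "t * B$2$2 = t * B$1$1" "t * B$1$2 = 0" by (auto simp: mat2_eq_iff)
  then have "tl2 B = 0" using t by (auto simp: mat2_eq_iff)
  then show ?thesis using tl2_eq0_iff dB by blast
qed

end

text \<open>With the symmetry of the two factors, every one-sided statement is proved for one factor
  only.\<close>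

lemma lat22_swap: 
  assumes "lat22 L" shows "lat22 (prod.swap ` L)"
proof -
  interpret lat22 L by fact
  have sw: "prod.swap (x \<star> y) = prod.swap x \<star> prod.swap y" "prod.swap (pinv x) = pinv (prod.swap x)" "prod.swap pone = pone"
    "prod.swap x \<in> SS \<longleftrightarrow> x \<in> SS" for x y
    by (auto simp: pmul_def pinv_def pone_def SS_def)
  have nsw: "norm (prod.swap x) = norm x" for x :: mat22 by (cases x) (simp add: norm_prod_def add.commute)
  have nsw1: "norm (prod.swap x - pone) = norm (x - pone)" for x :: mat22
    using nsw[of "x - pone"] by (cases x) (simp add: pone_def)
  have iL: "x \<in> prod.swap ` L \<longleftrightarrow> prod.swap x \<in> L" for x :: mat22
    by (auto intro: image_eqI[of x prod.swap "prod.swap x"])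
  show ?thesis
  proof
    show "prod.swap ` L \<subseteq> SS" "pone \<in> prod.swap ` L" using sub one_in by (auto simp: iL sw image_subset_iff)
    show "x \<star> y \<in> prod.swap ` L" if "x \<in> prod.swap ` L" "y \<in> prod.swap ` L" for x y using that mul_in by (auto simp: iL sw)
    show "pinv x \<in> prod.swap ` L" if "x \<in> prod.swap ` L" for x using that inv_in by (auto simp: iL sw)
    show "\<exists>e>0. \<forall>x\<in>prod.swap ` L. norm (x - pone) < e \<longrightarrow> x = pone"
    proof -
      obtain e where e: "e > 0" "\<And>x. x \<in> L \<Longrightarrow> norm (x - pone) < e \<Longrightarrow> x = pone" using discrete by auto
      have "x = pone" if "x \<in> prod.swap ` L" "norm (x - pone) < e" for x
        using e(2)[of "prod.swap x"] that nsw1[of x] sw(3) by (auto simp: iL)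
      then show ?thesis using e(1) by blast
    qed
    show "(- mat 1, mat 1) \<in> prod.swap ` L" "(mat 1, - mat 1) \<in> prod.swap ` L" using signs by (auto simp: iL)
  next
    fix U :: "mat22 set" and g :: "nat \<Rightarrow> mat22" and N :: nat
    assume "open U" "U \<inter> SS \<noteq> {}" and g: "\<And>n. g n \<in> SS" "\<And>i j. g (i + j) = g i \<star> g j"
    have "open (prod.swap -` U)" using \<open>open U\<close> by (intro open_vimage continuous_on_swap) auto
    moreover have "prod.swap -` U \<inter> SS \<noteq> {}" 
    proof -
      obtain u where "u \<in> U" "u \<in> SS" using \<open>U \<inter> SS \<noteq> {}\<close> by blast
      then have "prod.swap u \<in> prod.swap -` U \<inter> SS" by (simp add: sw)
      then show ?thesis by blast
    qed
    ultimately have "\<exists>n\<ge>N. \<exists>\<gamma>\<in>L. \<exists>u\<in>prod.swap -` U \<inter> SS. \<exists>u'\<in>prod.swap -` U \<inter> SS. \<gamma> \<star> u \<star> prod.swap (g n) = u'"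
      by (rule nonwandering) (simp_all add: g sw)
    then obtain n \<gamma> u u' where *: "n \<ge> N" "\<gamma> \<in> L" "u \<in> prod.swap -` U \<inter> SS" "u' \<in> prod.swap -` U \<inter> SS" 
        "\<gamma> \<star> u \<star> prod.swap (g n) = u'" by blast
    then have "prod.swap \<gamma> \<star> prod.swap u \<star> g n = prod.swap u'" by (auto simp: sw)
    moreover have "prod.swap \<gamma> \<in> prod.swap ` L" "prod.swap u \<in> U \<inter> SS" "prod.swap u' \<in> U \<inter> SS"
      using * by (simp_all add: sw)
    ultimately show "\<exists>n\<ge>N. \<exists>\<gamma>\<in>prod.swap ` L. \<exists>u\<in>U \<inter> SS. \<exists>u'\<in>U \<inter> SS. \<gamma> \<star> u \<star> g n = u'"
      using *(1) by blast
  next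
    fix r r' :: real and h :: "nat \<Rightarrow> mat22" assume r: "r > 0" "r' > 0" and h: "\<And>n. h n \<in> SS"
      and s: "\<And>n \<gamma>. \<gamma> \<in> prod.swap ` L \<Longrightarrow> norm (pinv (h n) \<star> \<gamma> \<star> h n - pone) < r \<Longrightarrow> \<gamma> = pone"
    have *: "norm (pinv (prod.swap x) \<star> y \<star> prod.swap z - pone) = norm (pinv x \<star> prod.swap y \<star> z - pone)" for x y z
      using nsw1[of "pinv x \<star> prod.swap y \<star> z"] by (simp add: sw)
    have "\<exists>i j. i < j \<and> (\<exists>\<gamma>\<in>L. norm (pinv (prod.swap (h j)) \<star> \<gamma> \<star> prod.swap (h i) - pone) < r')"
    proof (rule packing[OF r(1) _ _ r(2)])
      show "prod.swap (h n) \<in> SS" for n using h sw by simp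
      fix n \<gamma> assume "\<gamma> \<in> L" "norm (pinv (prod.swap (h n)) \<star> \<gamma> \<star> prod.swap (h n) - pone) < r"
      then have "prod.swap \<gamma> = pone" using s[of "prod.swap \<gamma>" n] by (simp add: *)
      then have "prod.swap (prod.swap \<gamma>) = prod.swap pone" by simp
      then show "\<gamma> = pone" by (simp add: sw)
    qed
    then show "\<exists>i j. i < j \<and> (\<exists>\<gamma>\<in>prod.swap ` L. norm (pinv (h j) \<star> \<gamma> \<star> h i - pone) < r')"
      by (auto simp: *)
  qed
qed

lemma irr22_swap: 
  assumes "irr22 L" shows "irr22 (prod.swap ` L)"
proof -
  interpret irr22 L by fact
  interpret s: lat22 "prod.swap ` L" by (rule lat22_swap) unfold_locales
  show ?thesis by unfold_locales (use dense1 dense2 in auto)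
qed

context irr22 begin

lemma trivial_snd_1: "(B, mat 1) \<in> L \<Longrightarrow> B = mat 1 \<or> B = - mat 1"
  using irr22.trivial_fst_1[OF irr22_swap, of L B] irr22_axioms by force

lemma trivial_fst: "(A, B) \<in> L \<Longrightarrow> tl2 A = 0 \<Longrightarrow> tl2 B = 0"
  using trivial_fst_1[of B] neg_in(1)[of "(A,B)"] in_SS[of "(A,B)"] tl2_eq0_iff[of A] tl2_eq0_iff[of B]
  by (auto simp: SS_def)

lemma trivial_snd: "(A, B) \<in> L \<Longrightarrow> tl2 B = 0 \<Longrightarrow> tl2 A = 0"
  using trivial_snd_1[of A] neg_in(2)[of "(A,B)"] in_SS[of "(A,B)"] tl2_eq0_iff[of A] tl2_eq0_iff[of B]
  by (auto simp: SS_def)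

section \<open>The diagonal flow in the second factor\<close>

definition "asnd t = (mat 1 :: mat2, dg (exp t))"

lemma asnd_add: "asnd (s + t) = asnd s \<star> asnd t"
  by (simp add: asnd_def pmul_def exp_add dg_mult)

lemma asnd_SS [simp]: "asnd t \<in> SS" by (simp add: asnd_def SS_def)

lemma asnd_0: "asnd 0 = pone" by (simp add: asnd_def pone_def dg_1)

text \<open>The closure of an open set invariant under the flow \<open>(1, a\<^sub>t)\<close> is invariant under the horocyclic
  directions contracted by the flow in either time direction: a nearby orbit returns, by which time
  the horocyclic displacement has become negligible.\<close>

lemma transitive:
  assumes U: "open U" "U \<inter> SS \<noteq> {}" and V: "open V" "V \<inter> SS \<noteq> {}"
  shows "\<exists>s\<ge>S. \<exists>u\<in>U \<inter> SS. \<exists>v\<in>V \<inter> SS. \<exists>\<gamma>\<in>L. \<gamma> \<star> u \<star> asnd s = v"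
proof -
  define W where "W = {w. \<exists>\<gamma>\<in>L. \<exists>t. \<gamma> \<star> w \<star> asnd t \<in> U}"
  have "W = (\<Union>\<gamma>\<in>L. \<Union>t. (\<lambda>w. \<gamma> \<star> w \<star> asnd t) -` U)" unfolding W_def by blast
  then have oW: "open W" using U by (auto intro!: open_UN open_vimage continuous_intros)
  have WL: "\<gamma> \<star> w \<in> W" if "w \<in> W" "\<gamma> \<in> L" for \<gamma> w
  proof -
    obtain \<delta> t where *: "\<delta> \<in> L" "\<delta> \<star> w \<star> asnd t \<in> U" using \<open>w \<in> W\<close> unfolding W_def by blast
    have "(\<delta> \<star> pinv \<gamma>) \<star> (\<gamma> \<star> w) \<star> asnd t \<in> U" using * that by (simp add: pmul_assoc)
    then show ?thesis using * that mul_in inv_in unfolding W_def by blast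
  qed
  have Wa: "w \<star> asnd t \<in> W" if "w \<in> W" for t w
  proof -
    obtain \<delta> s where *: "\<delta> \<in> L" "\<delta> \<star> w \<star> asnd s \<in> U" using \<open>w \<in> W\<close> unfolding W_def by blast
    have "\<delta> \<star> (w \<star> asnd t) \<star> asnd (s - t) \<in> U" using * asnd_add[of t "s - t"] by (simp add: pmul_assoc)
    then show ?thesis using * unfolding W_def by blast
  qed
  have WL': "w \<in> W" if "\<gamma> \<star> w \<in> W" "\<gamma> \<in> L" for \<gamma> w
    using WL[OF that(1) inv_in[OF that(2)]] that(2) by simp
  have Wa': "w \<in> W" if "w \<star> asnd t \<in> W" for t w
    using Wa[OF that, of "-t"] asnd_add[of t "-t"] by (simp add: pmul_assoc asnd_0)
  define C where "C = closure (W \<inter> SS)"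
  have CS: "C \<subseteq> SS" unfolding C_def by (rule closure_minimal) (auto simp: closed_SS)
  \<comment> \<open>For a return \<open>\<gamma> \<star> q \<star> g k = q'\<close> near
    \<open>w\<close>, the point \<open>q \<star> n\<close> is carried to
    \<open>q' \<star> (pinv (g k) \<star> n \<star> g k)\<close>, which is close to
    \<open>q'\<close> and so in the open set \<open>W\<close>; invariance brings
    \<open>q \<star> n\<close> itself into \<open>W\<close>.\<close>
  have step1: "w \<star> n \<in> C" if w: "w \<in> W \<inter> SS" and n: "n \<in> SS" 
    and g: "\<And>k. g k \<in> range asnd" "\<And>i j::nat. g (i + j) = g i \<star> g j" and lim: "(\<lambda>k. pinv (g k) \<star> n \<star> g k) \<longlonglongrightarrow> pone" for w n g
    unfolding C_def closure_approachable
  proof (intro allI impI)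
    fix e :: real assume "e > 0"
    have gS: "g k \<in> SS" for k using g(1)[of k] by auto
    have "open {p. fst p \<star> snd p \<in> W}" using oW by (auto intro!: open_vimage[of W "\<lambda>p. fst p \<star> snd p", unfolded vimage_def] continuous_intros)
    moreover have "(w, pone) \<in> {p. fst p \<star> snd p \<in> W}" using w by simp
    ultimately obtain O1 O2 where O: "open O1" "open O2" "w \<in> O1" "pone \<in> O2" "O1 \<times> O2 \<subseteq> {p. fst p \<star> snd p \<in> W}"
      by (rule open_prod_elim) auto
    define Q where "Q = O1 \<inter> (\<lambda>q. q \<star> n) -` ball (w \<star> n) e"
    have "open Q" unfolding Q_def using O by (auto intro!: open_Int open_vimage continuous_intros)
    moreover have "w \<in> Q \<inter> SS" using O w \<open>e > 0\<close> by (auto simp: Q_def)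
    moreover obtain N where N: "\<And>k. k \<ge> N \<Longrightarrow> pinv (g k) \<star> n \<star> g k \<in> O2"
      using topological_tendstoD[OF lim O(2) O(4)] by (auto simp: eventually_sequentially)
    ultimately obtain k \<gamma> q q' where *: "k \<ge> N" "\<gamma> \<in> L" "q \<in> Q \<inter> SS" "q' \<in> Q \<inter> SS" "\<gamma> \<star> q \<star> g k = q'"
      using nonwandering[of Q g N] gS g(2) by blast
    have "\<gamma> \<star> (q \<star> n) \<star> g k = q' \<star> (pinv (g k) \<star> n \<star> g k)" using *(5) gS by (auto simp: pmul_assoc)
    moreover have "q' \<star> (pinv (g k) \<star> n \<star> g k) \<in> W" using N[OF *(1)] *(4) O(5) by (auto simp: Q_def)
    ultimately have "\<gamma> \<star> (q \<star> n) \<star> g k \<in> W" by simp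
    then have "q \<star> n \<in> W" using WL' Wa' *(2) g(1)[of k] by (metis imageE)
    then show "\<exists>y\<in>W \<inter> SS. dist y (w \<star> n) < e" using * n by (auto simp: Q_def dist_commute intro!: bexI[of _ "q \<star> n"])
  qed
  have step2: "x \<star> n \<in> C" if "x \<in> C" "\<And>w. w \<in> W \<inter> SS \<Longrightarrow> w \<star> n \<in> C" for x n
  proof -
    have "(\<lambda>w. w \<star> n) ` closure (W \<inter> SS) \<subseteq> C"
      using that(2) by (intro image_closure_subset) (auto simp: C_def intro!: continuous_intros)
    then show ?thesis using that unfolding C_def by blast
  qed
  have cn: "x \<star> (mat 1, nn r) \<in> C" if "x \<in> C" for x r
  proof (rule step2[OF that], rule step1[where g="\<lambda>k. asnd (real k)"])
    have "pinv (asnd (real k)) \<star> (mat 1, nn r) \<star> asnd (real k) = (mat 1, nn (r * exp (- (2 * real k))))" for k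
      by (simp add: prod_eq_iff asnd_def mat2_eq_iff exp_minus field_simps flip: exp_add)
    moreover have "(\<lambda>k. (mat 1, nn (r * exp (- (2 * real k))))) \<longlonglongrightarrow> pone"
      unfolding pone_def by (intro tendsto_intros) (auto simp: mat2_tendsto_iff; real_asymp)
    ultimately show "(\<lambda>k. pinv (asnd (real k)) \<star> (mat 1, nn r) \<star> asnd (real k)) \<longlonglongrightarrow> pone" by simp
  qed (auto simp: SS_def simp flip: asnd_add)
  have cm: "x \<star> (mat 1, nm r) \<in> C" if "x \<in> C" for x r
  proof (rule step2[OF that], rule step1[where g="\<lambda>k. asnd (- real k)"])
    have "pinv (asnd (- real k)) \<star> (mat 1, nm r) \<star> asnd (- real k) = (mat 1, nm (r * exp (- (2 * real k))))" for k
      by (simp add: prod_eq_iff asnd_def mat2_eq_iff exp_minus field_simps flip: exp_add)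
    moreover have "(\<lambda>k. (mat 1, nm (r * exp (- (2 * real k))))) \<longlonglongrightarrow> pone"
      unfolding pone_def by (intro tendsto_intros) (auto simp: mat2_tendsto_iff; real_asymp)
    ultimately show "(\<lambda>k. pinv (asnd (- real k)) \<star> (mat 1, nm r) \<star> asnd (- real k)) \<longlonglongrightarrow> pone" by simp
  qed (auto simp: SS_def simp flip: asnd_add)
  \<comment> \<open>The two horocyclic groups generate the second factor, so \<open>C\<close> is
    invariant under all of it. What remains is the first factor, where the projection of
    \<open>L\<close> is dense.\<close>
  have cS: "x \<star> (mat 1, B) \<in> C" if x: "x \<in> C" and B: "det B = 1" for x B
  proof -
    obtain p y z t where e: "B = nn p ** nm y ** nn z ** nm t" using SL2_generated B by blast
    have "x \<star> (mat 1, B) = x \<star> (mat 1, nn p) \<star> (mat 1, nm y) \<star> (mat 1, nn z) \<star> (mat 1, nm t)"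
      by (simp add: e prod_eq_iff matrix_mul_assoc)
    then show ?thesis using cn cm x by simp
  qed
  have CL: "\<gamma> \<star> x \<in> C" if "x \<in> C" "\<gamma> \<in> L" for \<gamma> x
  proof -
    have "\<gamma> \<star> w \<in> C" if "w \<in> W \<inter> SS" for w
    proof -
      have "\<gamma> \<star> w \<in> W" using that WL \<open>\<gamma> \<in> L\<close> by blast
      moreover have "\<gamma> \<star> w \<in> SS" using that \<open>\<gamma> \<in> L\<close> by simp
      ultimately show ?thesis unfolding C_def using closure_subset[of "W \<inter> SS"] by blast
    qed
    then have "(\<lambda>w. \<gamma> \<star> w) ` closure (W \<inter> SS) \<subseteq> C"
      by (intro image_closure_subset continuous_intros) (simp_all add: C_def image_subset_iff)
    then show ?thesis using that unfolding C_def by blast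
  qed
  obtain u0 where u0: "u0 \<in> U" "u0 \<in> SS" using U by auto
  have "pone \<star> u0 \<star> asnd 0 \<in> U" using u0 by (simp add: asnd_0)
  then have "u0 \<in> W" using one_in unfolding W_def by blast
  then have "u0 \<in> W \<inter> SS" using u0 by simp
  then have u0C: "u0 \<in> C" unfolding C_def using closure_subset[of "W \<inter> SS"] by blast
  obtain v0 where v0: "v0 \<in> V" "v0 \<in> SS" using V by auto
  have "v0 \<in> closure C" unfolding closure_approachable
  proof (intro allI impI)
    fix e :: real assume "e > 0"
    define K where "K = norm (fst u0) + 1"
    have K: "K > 0" by (simp add: K_def add_nonneg_pos)
    obtain x where x: "x \<in> L" "norm (fst x - fst v0 ** adj (fst u0)) < e / K"
      using dense1[of "fst v0 ** adj (fst u0)" "e / K"] \<open>e > 0\<close> K u0 v0 by (auto simp: SS_def det_mul)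
    \<comment> \<open>The second component of \<open>v0\<close> is reached exactly by means of
      \<open>cS\<close>; only the first one is approximated.\<close>
    let ?y = "x \<star> (u0 \<star> (mat 1, adj (snd u0) ** adj (snd x) ** snd v0))"
    have "?y \<in> C" using x in_SS[OF x(1)] u0 v0 by (intro CL cS u0C) (auto simp: SS_def det_mul)
    moreover have y2: "snd ?y = snd v0" using in_SS[OF x(1)] u0
      by (simp add: SS_def adj_cancel flip: matrix_mul_assoc)
    moreover have "fst ?y - fst v0 = (fst x - fst v0 ** adj (fst u0)) ** fst u0"
      using u0 by (simp add: mult2.diff_left SS_def adj_left flip: matrix_mul_assoc)
    then have "norm (fst ?y - fst v0) < e"
    proof -
      have "norm (fst ?y - fst v0) \<le> norm (fst x - fst v0 ** adj (fst u0)) * norm (fst u0)"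
        using \<open>fst ?y - fst v0 = _\<close> norm_mult2 by metis
      also have "\<dots> \<le> norm (fst x - fst v0 ** adj (fst u0)) * K" by (intro mult_left_mono) (auto simp: K_def)
      also have "\<dots> < e" using x K by (simp add: field_simps)
      finally show ?thesis .
    qed
    then have "dist ?y v0 < e" using y2 by (simp add: dist_prod_def dist_norm)
    ultimately show "\<exists>y\<in>C. dist y v0 < e" by blast
  qed
  then have "v0 \<in> closure (W \<inter> SS)" by (simp add: C_def)
  then obtain w where w: "w \<in> V" "w \<in> W" "w \<in> SS"
    using v0 V open_Int_closure_eq_empty[of V "W \<inter> SS"] by blast
  then obtain \<gamma> t where \<gamma>: "\<gamma> \<in> L" "\<gamma> \<star> w \<star> asnd t \<in> U" unfolding W_def by blast
  \<comment> \<open>The time \<open>t\<close> joining \<open>V\<close> to \<open>U\<close> has no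
    prescribed size or sign. A return of \<open>Q\<close> to itself at a late time \<open>m\<close>,
    combined with going back from \<open>U\<close> by \<open>t\<close>, leads from \<open>U\<close>
    to \<open>V\<close> in the time \<open>m - t\<close>, which is at least
    \<open>S\<close>.\<close>
  define Q where "Q = V \<inter> (\<lambda>q. \<gamma> \<star> q \<star> asnd t) -` U"
  have "open Q" unfolding Q_def using U V by (auto intro!: open_Int open_vimage continuous_intros)
  moreover have "Q \<inter> SS \<noteq> {}" using w \<gamma> by (auto simp: Q_def)
  ultimately have "\<exists>m\<ge>nat \<lceil>S + t\<rceil>. \<exists>\<delta>\<in>L. \<exists>q\<in>Q \<inter> SS. \<exists>q'\<in>Q \<inter> SS. \<delta> \<star> q \<star> asnd (real m) = q'"
    by (rule nonwandering) (simp_all add: asnd_add)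
  then obtain m \<delta> q q' where *: "m \<ge> nat \<lceil>S + t\<rceil>" "\<delta> \<in> L" "q \<in> Q \<inter> SS" "q' \<in> Q \<inter> SS" "\<delta> \<star> q \<star> asnd (real m) = q'"
    by blast
  show ?thesis
  proof (intro exI[of _ "real m - t"] conjI bexI)
    show "S \<le> real m - t" using *(1) by linarith
    show "\<gamma> \<star> q \<star> asnd t \<in> U \<inter> SS" using * \<gamma> by (auto simp: Q_def)
    show "q' \<in> V \<inter> SS" using * by (auto simp: Q_def)
    show "\<delta> \<star> pinv \<gamma> \<in> L" using * \<gamma> mul_in inv_in by blast
    show "\<delta> \<star> pinv \<gamma> \<star> (\<gamma> \<star> q \<star> asnd t) \<star> asnd (real m - t) = q'"
      using *(5) \<gamma> asnd_add[of t "real m - t"] by (simp add: pmul_assoc)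
  qed
qed

end

section \<open>Elements with one parabolic component\<close>

definition cj :: "mat22 \<Rightarrow> mat22 \<Rightarrow> mat22" where "cj h x = pinv h \<star> x \<star> h"

lemma cj_pmul: "h \<in> SS \<Longrightarrow> cj h (x \<star> y) = cj h x \<star> cj h y" by (simp add: cj_def pmul_assoc)
lemma cj_pinv: "cj h (pinv x) = pinv (cj h x)" by (simp add: cj_def pinv_mul pmul_assoc)
lemma cj_SS [simp]: "h \<in> SS \<Longrightarrow> x \<in> SS \<Longrightarrow> cj h x \<in> SS" by (simp add: cj_def)
lemma cj_inj: "h \<in> SS \<Longrightarrow> cj h x = cj h y \<Longrightarrow> x = y"
proof -
  assume h: "h \<in> SS" and "cj h x = cj h y"
  then have "h \<star> cj h x \<star> pinv h = h \<star> cj h y \<star> pinv h" by simp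
  then show "x = y" using h by (simp add: cj_def pmul_assoc)
qed
lemma fst_cj: "fst (cj h x) = adj (fst h) ** fst x ** fst h" and snd_cj: "snd (cj h x) = adj (snd h) ** snd x ** snd h"
  by (simp_all add: cj_def)

lemma SS_D: "x \<in> SS \<Longrightarrow> det (fst x) = 1" "x \<in> SS \<Longrightarrow> det (snd x) = 1" by (simp_all add: SS_def)

lemma norm_conj_minus_one:
  assumes "l \<in> SS" "norm l \<le> K" 
  shows "norm (l \<star> x \<star> pinv l - pone) \<le> K * K * norm (x - pone)"
proof -
  have "l \<star> x \<star> pinv l - pone = l \<star> (x - pone) \<star> pinv l" using assms by (simp add: pmul.diff_left pmul.diff_right)
  then have "norm (l \<star> x \<star> pinv l - pone) \<le> norm l * norm (x - pone) * norm l"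
    using order_trans[OF norm_pmul mult_right_mono[OF norm_pmul norm_ge_zero], of l "x - pone" "pinv l"] by simp
  also have "\<dots> \<le> K * norm (x - pone) * K"
    by (intro mult_mono mult_right_mono mult_nonneg_nonneg;
        use assms(2) norm_ge_zero[of l] norm_ge_zero[of "x - pone"] in linarith)
  finally show ?thesis by (simp add: mult_ac)
qed

section \<open>Traceless parts: size and behaviour under conjugation\<close>

lemma norm_ge_entry: "\<bar>(A::mat2)$i$j\<bar> \<le> norm A"
  by (meson Finite_Cartesian_Product.norm_nth_le order_trans real_norm_def component_le_norm_cart)

lemma norm_tl2: "norm (tl2 A) \<le> 2 * norm (A - mat 1)"
proof -
  have "tl2 A = (A - mat 1) - adj (A - mat 1)" by (simp add: mat2_eq_iff)
  then show ?thesis using norm_triangle_ineq4[of "A - mat 1" "adj (A - mat 1)"] by simp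
qed

lemma tl2_mat1: "tl2 (mat 1) = 0" by (simp add: mat2_eq_iff)

lemma norm_neg1: "norm (- mat 1 - mat 1 :: mat2) \<ge> 1"
proof (rule power2_le_imp_le)
  show "1\<^sup>2 \<le> (norm (- mat 1 - mat 1 :: mat2))\<^sup>2" unfolding norm_mat2_sq vector_minus_component uminus_vec_def by simp
qed simp

text \<open>For determinant 1 the trace is controlled by the traceless part, because its square is
  \<open>4 - det (tl2 A)\<close>; trace and traceless part together make up
  \<open>A\<close>.\<close>

lemma norm_le_tl2:
  assumes "det A = 1" shows "norm A \<le> 2 + 2 * norm (tl2 A)"
proof -
  let ?T = "tl2 A" let ?s = "trace A"
  have "- det ?T \<le> (norm ?T)\<^sup>2"
    unfolding norm_mat2_sq det_2 tl2_nth unfolding power2_eq_square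
    using zero_le_square[of "A$1$2 - A$2$1"] zero_le_square[of "A$1$1 - A$2$2"] zero_le_square[of "A$1$2"] zero_le_square[of "A$2$1"]
    by (simp only: algebra_simps)
  then have "?s\<^sup>2 \<le> 4 + (norm ?T)\<^sup>2" using det_tl2[of A] assms by simp
  also have "\<dots> \<le> (2 + norm ?T)\<^sup>2" by (simp add: power2_eq_square algebra_simps)
  finally have s: "\<bar>?s\<bar> \<le> 2 + norm ?T" by (metis abs_le_square_iff abs_of_nonneg add_nonneg_nonneg norm_ge_zero zero_le_numeral)
  have "A = (?s/2) *\<^sub>R mat 1 + (1/2) *\<^sub>R ?T" by (simp add: mat2_eq_iff trace_def sum_2 field_simps)
  then have "norm A \<le> \<bar>?s/2\<bar> * norm (mat 1 :: mat2) + norm ?T / 2"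
    using norm_triangle_ineq[of "(?s/2) *\<^sub>R mat 1" "(1/2) *\<^sub>R ?T"] by simp
  also have "norm (mat 1 :: mat2) \<le> 2" using norm_fst_le[of "mat 1 :: mat2" "mat 1 :: mat2"] norm_pone by (simp add: pone_def)
  finally have "norm A \<le> \<bar>?s/2\<bar> * 2 + norm ?T / 2" by (simp add: mult_left_mono)
  then show ?thesis using s norm_ge_zero[of ?T] by linarith
qed

text \<open>A diagonal conjugation stretches a nonzero off-diagonal entry to absolute value
  \<open>R\<close>, while the other entries do not grow and contribute at most the square of
  \<open>R\<close> again. If both off-diagonal entries vanish, a shear first creates one.\<close>

lemma conj_large:
  assumes "(X::mat2)$2$2 = - X$1$1" "X \<noteq> 0" "R \<ge> norm X"
  shows "\<exists>g. det g = 1 \<and> R \<le> norm (adj g ** X ** g) \<and> norm (adj g ** X ** g) \<le> 2 * R"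
proof -
  have nX: "norm X > 0" using assms by simp
  then have R: "R > 0" using assms(3) by linarith
  have R2: "(norm X)\<^sup>2 \<le> R\<^sup>2" using assms by (simp add: power_mono)
  have four: "(2*R)\<^sup>2 = 4 * R\<^sup>2" by (simp add: power_mult_distrib)
  have key: ?thesis if "det g = 1" "R\<^sup>2 \<le> (norm (adj g ** X ** g))\<^sup>2" "(norm (adj g ** X ** g))\<^sup>2 \<le> (2*R)\<^sup>2" for g
    using that R by (metis less_eq_real_def mult_nonneg_nonneg norm_ge_zero power2_le_imp_le zero_le_numeral)
  consider "X$2$1 \<noteq> 0" | "X$1$2 \<noteq> 0" | "X$2$1 = 0" "X$1$2 = 0" "X$1$1 \<noteq> 0"
    using assms by (auto simp: mat2_eq_iff)
  then show ?thesis
  proof cases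
    case 1
    \<comment> \<open>Conjugation by \<open>dg l\<close> multiplies the lower left entry by the
      square of \<open>l\<close>, hence the square root.\<close>
    define m where "m = R / \<bar>X$2$1\<bar>" define l where "l = sqrt m"
    have m: "m \<ge> 1" using 1 assms(3) norm_ge_entry[of X 2 1] by (simp add: m_def field_simps)
    have l: "l > 0" "l * l = m" using m by (auto simp: l_def)
    have e: "adj (dg l) ** X ** dg l = mk2 (X$1$1) (X$1$2 / m) (X$2$1 * m) (- X$1$1)"
      using l(1) assms(1) unfolding l(2)[symmetric] by (simp add: mat2_eq_iff field_simps)
    have a: "(X$2$1 * m)\<^sup>2 = R\<^sup>2" using 1 by (simp add: m_def power_mult_distrib power_divide)
    have ab: "(X$1$2 / m)\<^sup>2 \<le> (X$1$2)\<^sup>2" using m by (simp add: power_divide divide_le_eq mult_le_cancel_left1 self_le_power one_le_power)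
    have n: "(norm (adj (dg l) ** X ** dg l))\<^sup>2 = (X$1$1)\<^sup>2 + (X$1$2 / m)\<^sup>2 + (X$2$1 * m)\<^sup>2 + (X$1$1)\<^sup>2"
      unfolding e norm_mat2_sq by simp
    have R2': "(X$1$1)\<^sup>2 + (X$1$2)\<^sup>2 + (X$2$1)\<^sup>2 + (X$1$1)\<^sup>2 \<le> R\<^sup>2" using R2 unfolding norm_mat2_sq assms(1) by simp
    show ?thesis
    proof (rule key[of "dg l"])
      show "det (dg l) = 1" using l(1) by simp
      show "R\<^sup>2 \<le> (norm (adj (dg l) ** X ** dg l))\<^sup>2"
        unfolding n using a zero_le_power2[of "X$1$2 / m"] zero_le_power2[of "X$1$1"] by linarith
      show "(norm (adj (dg l) ** X ** dg l))\<^sup>2 \<le> (2*R)\<^sup>2"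
        unfolding n four using a ab R2' zero_le_power2[of R] zero_le_power2[of "X$1$2"] zero_le_power2[of "X$2$1"] by linarith
    qed
  next
    case 2
    define m where "m = R / \<bar>X$1$2\<bar>" define l where "l = sqrt m"
    have m: "m \<ge> 1" using 2 assms(3) norm_ge_entry[of X 1 2] by (simp add: m_def field_simps)
    have l: "l > 0" "l * l = m" using m by (auto simp: l_def)
    have e: "adj (dg (inverse l)) ** X ** dg (inverse l) = mk2 (X$1$1) (X$1$2 * m) (X$2$1 / m) (- X$1$1)"
      using l(1) assms(1) unfolding l(2)[symmetric] by (simp add: mat2_eq_iff field_simps)
    have a: "(X$1$2 * m)\<^sup>2 = R\<^sup>2" using 2 by (simp add: m_def power_mult_distrib power_divide)
    have ab: "(X$2$1 / m)\<^sup>2 \<le> (X$2$1)\<^sup>2" using m by (simp add: power_divide divide_le_eq mult_le_cancel_left1 self_le_power one_le_power)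
    have n: "(norm (adj (dg (inverse l)) ** X ** dg (inverse l)))\<^sup>2 = (X$1$1)\<^sup>2 + (X$1$2 * m)\<^sup>2 + (X$2$1 / m)\<^sup>2 + (X$1$1)\<^sup>2"
      unfolding e norm_mat2_sq by simp
    have R2': "(X$1$1)\<^sup>2 + (X$1$2)\<^sup>2 + (X$2$1)\<^sup>2 + (X$1$1)\<^sup>2 \<le> R\<^sup>2" using R2 unfolding norm_mat2_sq assms(1) by simp
    show ?thesis
    proof (rule key[of "dg (inverse l)"])
      show "det (dg (inverse l)) = 1" using l(1) by simp
      show "R\<^sup>2 \<le> (norm (adj (dg (inverse l)) ** X ** dg (inverse l)))\<^sup>2"
        unfolding n using a zero_le_power2[of "X$2$1 / m"] zero_le_power2[of "X$1$1"] by linarith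
      show "(norm (adj (dg (inverse l)) ** X ** dg (inverse l)))\<^sup>2 \<le> (2*R)\<^sup>2"
        unfolding n four using a ab R2' zero_le_power2[of R] zero_le_power2[of "X$1$2"] zero_le_power2[of "X$2$1"] by linarith
    qed
  next
    case 3
    \<comment> \<open>The shear turns the upper right entry into \<open>2 * r * X$1$1\<close>, which
      is \<open>R\<close>.\<close>
    define r where "r = R / (2 * X$1$1)"
    have e: "adj (nn r) ** X ** nn r = mk2 (X$1$1) R 0 (- X$1$1)"
      using 3 assms(1) by (simp add: mat2_eq_iff r_def)
    have n: "(norm (adj (nn r) ** X ** nn r))\<^sup>2 = (X$1$1)\<^sup>2 + R\<^sup>2 + (X$1$1)\<^sup>2" unfolding e norm_mat2_sq by simp
    have "(X$1$1)\<^sup>2 + (X$1$1)\<^sup>2 \<le> R\<^sup>2" using R2 3 unfolding norm_mat2_sq assms(1) by simp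
    then show ?thesis using zero_le_power2[of "X$1$1"] zero_le_power2[of R] by (intro key[of "nn r"]) (simp, unfold n four, linarith+)
  qed
qed

text \<open>A nilpotent matrix is conjugate to one with a single off-diagonal entry, which diagonal
  conjugation scales at will. For a nonzero determinant this would fail: the determinant bounds the
  norm from below.\<close>

lemma conj_nilpotent:
  assumes "(X::mat2)$2$2 = - X$1$1" "X \<noteq> 0" "det X = 0" "\<delta> > 0"
  shows "\<exists>g. det g = 1 \<and> norm (adj g ** X ** g) = \<delta>"
proof -
  have key: ?thesis if "det g = 1" "(norm (adj g ** X ** g))\<^sup>2 = \<delta>\<^sup>2" for g
    using that assms(4) by (metis less_eq_real_def norm_ge_zero power2_eq_iff_nonneg)
  have d: "X$1$1 * X$1$1 + X$1$2 * X$2$1 = 0" using assms(1,3) by (simp add: det_2)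
  show ?thesis
  proof (cases "X$2$1 = 0")
    case False
    define m where "m = \<delta> / \<bar>X$2$1\<bar>" define l where "l = sqrt m"
    have l: "l > 0" "l * l = m" using False assms(4) by (auto simp: l_def m_def)
    have x12: "X$1$2 = - (X$1$1 * X$1$1) / X$2$1" 
    proof -
      have "X$1$2 * X$2$1 = - (X$1$1 * X$1$1)" using d by linarith
      then show ?thesis using False by (simp only: nonzero_eq_divide_eq[OF False])
    qed
    have "adj (nn (X$1$1 / X$2$1)) ** X ** nn (X$1$1 / X$2$1) = mk2 0 0 (X$2$1) 0"
      using False by (simp add: mat2_eq_iff x12 assms(1))
    moreover have "adj (dg l) ** mk2 0 0 (X$2$1) 0 ** dg l = mk2 0 0 (X$2$1 * m) 0"
      unfolding l(2)[symmetric] by (simp add: mat2_eq_iff)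
    ultimately have "adj (dg l) ** (adj (nn (X$1$1 / X$2$1)) ** X ** nn (X$1$1 / X$2$1)) ** dg l = mk2 0 0 (X$2$1 * m) 0"
      by (simp only:)
    then have "adj (nn (X$1$1 / X$2$1) ** dg l) ** X ** (nn (X$1$1 / X$2$1) ** dg l) = mk2 0 0 (X$2$1 * m) 0"
      by (simp only: adj_mult matrix_mul_assoc)
    moreover have "(X$2$1 * m)\<^sup>2 = \<delta>\<^sup>2" using False by (simp add: m_def power_mult_distrib power_divide)
    ultimately show ?thesis using l(1) by (intro key[of "nn (X$1$1 / X$2$1) ** dg l"]) (simp_all add: det_mul norm_mat2_sq)
  next
    case True
    then have z: "X$1$1 = 0" "X$2$2 = 0" using d assms(1) by auto
    then have b: "X$1$2 \<noteq> 0" using True assms(2) by (auto simp: mat2_eq_iff)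
    define m where "m = \<delta> / \<bar>X$1$2\<bar>" define l where "l = sqrt m"
    have l: "l > 0" "l * l = m" using b assms(4) by (auto simp: l_def m_def)
    have "adj (dg (inverse l)) ** X ** dg (inverse l) = mk2 0 (X$1$2 * m) 0 0"
      using l z True by (simp add: mat2_eq_iff)
    moreover have "(X$1$2 * m)\<^sup>2 = \<delta>\<^sup>2" using b by (simp add: m_def power_mult_distrib power_divide)
    ultimately show ?thesis using l(1) by (intro key[of "dg (inverse l)"]) (simp_all add: norm_mat2_sq)
  qed
qed

text \<open>The conjugation by a parabolic element is unipotent, hence has no eigenvalue other than \<open>1\<close>.\<close>

lemma parabolic_commute:
  assumes t: "det t = 1" "det (tl2 t) = 0" and x: "det x = 1"
    and c: "x ** (t ** x ** adj t) = (t ** x ** adj t) ** x"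
  shows "x ** t = t ** x"
proof (cases "tl2 x = 0")
  case True
  then show ?thesis using proportional_commute[of x 0 t] by simp
next
  case False
  \<comment> \<open>Conjugation by \<open>t\<close> maps the line of \<open>tl2 x\<close> to itself;
    \<open>\<beta>\<close> is its eigenvalue there.\<close>
  obtain \<beta> where "tl2 (t ** x ** adj t) = \<beta> *\<^sub>R tl2 x" using commute_proportional[OF c False] by blast
  moreover have "tl2 (t ** x ** adj t) = t ** tl2 x ** adj t" using tl2_conj[of "adj t" x] t by simp
  ultimately have "t ** tl2 x ** adj t ** t = (\<beta> *\<^sub>R tl2 x) ** t" by simp
  then have eq: "t ** tl2 x = (\<beta> *\<^sub>R tl2 x) ** t" using t by (simp add: adj_left flip: matrix_mul_assoc)
  define e f g where "e = tl2 x$1$1" "f = tl2 x$1$2" "g = tl2 x$2$1"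
  define X Y Z s where "X = tl2 t$1$1" "Y = tl2 t$1$2" "Z = tl2 t$2$1" "s = trace t"
  have nz: "e \<noteq> 0 \<or> f \<noteq> 0 \<or> g \<noteq> 0" using False by (auto simp: mat2_eq_iff e_f_g_def)
  have tt: "t$1$1 = (s + X)/2" "t$1$2 = Y/2" "t$2$1 = Z/2" "t$2$2 = (s - X)/2"
    by (auto simp: X_Y_Z_s_def trace_def sum_2 field_simps)
  have xx: "tl2 x$1$1 = e" "tl2 x$1$2 = f" "tl2 x$2$1 = g" "tl2 x$2$2 = - e" by (auto simp: e_f_g_def)
  have n0: "X*X + Y*Z = 0" using t(2) by (simp add: det_2 X_Y_Z_s_def algebra_simps)
  have s: "s * s = 4" using det_tl2[of t] t by (simp add: X_Y_Z_s_def power2_eq_square)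
  have "(t ** tl2 x)$i$j = ((\<beta> *\<^sub>R tl2 x) ** t)$i$j" for i j using eq by simp
  from this[of 1 1] this[of 1 2] this[of 2 1] this[of 2 2]
  have q: "s*e + X*e + Y*g = \<beta> * (s*e + e*X + f*Z)" "s*f + X*f - Y*e = \<beta> * (s*f + e*Y - f*X)"
    "s*g + Z*e - X*g = \<beta> * (s*g + g*X - e*Z)" "- s*e + Z*f + X*e = \<beta> * (- s*e + g*Y + e*X)"
    unfolding mult2_nth vector_scaleR_component tt xx by (simp_all add: field_simps)
  have "\<beta> = 1"
  proof (rule ccontr)
    assume b1: "\<beta> \<noteq> 1"
    have "(1 - \<beta>) * (2*X*e + Y*g + Z*f) = 0" using q(1,4) by algebra
    then have qq: "2*X*e + Y*g + Z*f = 0" using b1 by simp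
    \<comment> \<open>In vector form: \<open>2 * u\<close> times the traceless matrix
      \<open>(e,f,g)\<close> is \<open>w\<close> times its bracket with the nilpotent matrix
      \<open>(X,Y,Z)\<close>. By \<open>qq\<close> the two are orthogonal for the trace form, and
      then the bracket applied twice is zero.\<close>
    define u w where "u = s * (1 - \<beta>)" "w = - (1 + \<beta>)"
    have 1: "2*u*e = w * (Y*g - Z*f)" using q(1,4) unfolding u_w_def by algebra
    have 2: "u*f = w * (X*f - Y*e)" "u*g = w * (Z*e - X*g)" using q(2,3) unfolding u_w_def by algebra+
    have "u * u * e = 0" using 1 2 qq n0 by algebra
    moreover have "u * u * f = 0" using 1 2 qq n0 by algebra
    moreover have "u * u * g = 0" using 1 2 qq n0 by algebra
    ultimately have "u = 0" using nz by auto
    then show False using b1 s by (auto simp: u_w_def)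
  qed
  then have "t ** tl2 x = tl2 x ** t" using eq by simp
  then have "Y*g = f*Z" "X*f = Y*e" "Z*e = g*X" using q \<open>\<beta> = 1\<close> by (simp_all add: algebra_simps)
  then have "t$1$2 * x$2$1 = x$1$2 * t$2$1" "(t$1$1 - t$2$2) * x$1$2 = t$1$2 * (x$1$1 - x$2$2)" 
    "t$2$1 * (x$1$1 - x$2$2) = x$2$1 * (t$1$1 - t$2$2)"
    by (simp_all add: e_f_g_def X_Y_Z_s_def)
  then show ?thesis by (simp add: mat2_eq_iff algebra_simps)
qed

text \<open>The determinant of the traceless part gives the square of the trace. So trace and
  traceless part are each known up to sign, and the four sign choices are those listed.\<close>

lemma tl2_sign_cases:
  assumes "det A = 1" "det B = 1" "tl2 A = s *\<^sub>R tl2 B" "s\<^sup>2 = 1"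
  shows "A = B \<or> A = - B \<or> A = adj B \<or> A = - adj B"
proof -
  have "det (tl2 A) = s\<^sup>2 * det (tl2 B)" using assms(3) by (simp add: det_2 power2_eq_square algebra_simps del: tl2_nth)
  then have "(trace A)\<^sup>2 = (trace B)\<^sup>2" using assms det_tl2[of A] det_tl2[of B] by simp
  then have tr: "trace A = trace B \<or> trace A = - trace B" by (simp add: power2_eq_iff)
  have e: "tl2 A$1$1 = s * tl2 B$1$1" "tl2 A$1$2 = s * tl2 B$1$2" "tl2 A$2$1 = s * tl2 B$2$1" using assms(3) by (simp_all del: tl2_nth)
  have s: "s = 1 \<or> s = -1" using assms(4) by (simp add: power2_eq_1_iff)
  have t: "trace A = A$1$1 + A$2$2" "trace B = B$1$1 + B$2$2" by (simp_all add: trace_def sum_2)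
  from s tr consider "s = 1" "trace A = trace B" | "s = 1" "trace A = - trace B" | "s = -1" "trace A = trace B" | "s = -1" "trace A = - trace B"
    by blast
  then show ?thesis
  proof cases
    case 1 then have "A = B" using e t unfolding mat2_eq_iff tl2_nth by (intro conjI; simp)
    then show ?thesis by simp
  next
    case 2 then have "A = - adj B" using e t unfolding mat2_eq_iff tl2_nth by (intro conjI; simp)
    then show ?thesis by simp
  next
    case 3 then have "A = adj B" using e t unfolding mat2_eq_iff tl2_nth by (intro conjI; simp)
    then show ?thesis by simp
  next
    case 4 then have "A = - B" using e t unfolding mat2_eq_iff tl2_nth by (intro conjI; simp)
    then show ?thesis by simp
  qed
qed

lemma trace_conj: "det h = 1 \<Longrightarrow> trace (adj h ** A ** h) = trace (A :: mat2)"
proof -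
  assume h: "det h = 1"
  have "trace (adj h ** A ** h) = trace A * det h" by (simp add: trace_def sum_2 det_2 algebra_simps)
  then show ?thesis using h by simp
qed

section \<open>Commutation inside the lattice and exclusion of single parabolic components\<close>

context discrete_SS begin

lemma small_commute_cj:
  assumes "h \<in> SS" "x \<in> L" "y \<in> L" "norm (cj h x - pone) < 1/32" "norm (cj h y - pone) < 1/32"
  shows "x \<star> y = y \<star> x"
proof -
  interpret c: discrete_SS "conj_set h L" by (rule conj[OF assms(1)])
  have "cj h x \<in> conj_set h L" "cj h y \<in> conj_set h L" using assms by (auto simp: conj_set_def cj_def)
  then have "cj h x \<star> cj h y = cj h y \<star> cj h x" using c.small_commute assms by blast
  then show ?thesis using cj_inj[OF assms(1)] cj_pmul[OF assms(1)] by metis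
qed

end

context irr22 begin

text \<open>The commutator has second component 1, hence first component 1 or -1. The value -1 would
  make \<open>fst x\<close> conjugate to its negative, which a nonzero trace forbids.\<close>

lemma commute_fst_of_snd:
  assumes "x \<in> L" "y \<in> L" "snd x ** snd y = snd y ** snd x" "trace (fst x) > 0"
  shows "fst x ** fst y = fst y ** fst x"
proof -
  let ?c = "y \<star> x \<star> pinv y \<star> pinv x"
  have S: "det (fst x) = 1" "det (snd x) = 1" "det (fst y) = 1" "det (snd y) = 1" using assms(1,2)[THEN in_SS] by (auto simp: SS_def)
  have cL: "?c \<in> L" using assms by (intro mul_in inv_in)
  have "snd ?c = snd x ** (snd y ** adj (snd y)) ** adj (snd x)" using assms(3) by (simp add: matrix_mul_assoc)
  then have "snd ?c = mat 1" using S by (simp add: adj_right)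
  then have "tl2 (snd ?c) = 0" by (simp only: tl2_mat1)
  then have "tl2 (fst ?c) = 0" using trivial_snd[of "fst ?c" "snd ?c"] cL unfolding prod.collapse by blast
  then have c: "fst ?c = mat 1 \<or> fst ?c = - mat 1" using tl2_eq0_iff in_SS[OF cL] SS_D by blast
  have e: "fst ?c ** fst x = fst y ** fst x ** adj (fst y)" using S by (simp add: adj_left flip: matrix_mul_assoc)
  have "fst ?c \<noteq> - mat 1"
  proof
    assume "fst ?c = - mat 1"
    then have "- fst x = fst y ** fst x ** adj (fst y)" using e by (simp add: mult2.minus_left)
    then have "trace (- fst x) = trace (fst x)" using trace_conj[of "adj (fst y)" "fst x"] S by simp
    then show False using assms(4) trace_uminus[of "fst x"] by simp
  qed
  then have "fst x = fst y ** fst x ** adj (fst y)" using c e by simp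
  then have "fst x ** fst y = fst y ** fst x ** (adj (fst y) ** fst y)" by (metis matrix_mul_assoc)
  then show ?thesis using S by (simp add: adj_left)
qed

end

lemma norm_Pair_le_add: "norm (x::mat22) \<le> norm (fst x) + norm (snd x)"
  using norm_Pair_le[of "fst x" "snd x"] by simp

lemma tl2_uminus: "tl2 (- A) = - tl2 A" and tl2_adj: "tl2 (adj A) = - tl2 A"
  by (simp_all add: mat2_eq_iff)

lemma tl2_conj': "det h = 1 \<Longrightarrow> tl2 (h ** A ** adj h) = h ** tl2 A ** adj h"
  using tl2_conj[of "adj h" A] by simp

context irr22 begin

text \<open>Suppose \<open>(C, U) \<in> L\<close> with \<open>U\<close> parabolic and \<open>C\<close> hyperbolic or elliptic. The elements of \<open>L\<close> whose
  components lie in the one-parameter groups of \<open>C\<close> and \<open>U\<close> can be conjugated into a compact set by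
  suitable \<open>h\<^sub>j\<close> such that the conjugate of \<open>L\<close> by \<open>h\<^sub>j\<close> has no small elements, while the conjugators scale
  \<open>U\<close> by \<open>16\<^sup>-\<^sup>j\<close>. Then finite covolume makes two of these conjugates coincide up to a bounded
  conjugation, which contradicts the scaling.\<close>

lemma renormalize:
  assumes CU: "(C, U) \<in> L" "det (tl2 C) \<noteq> 0" "tl2 U \<noteq> 0" "det (tl2 U) = 0" and \<delta>: "0 < \<delta>" "\<delta> \<le> 1"
    and K: "K = 6 + 4 * norm (tl2 C)" and r: "0 < r" "r * (K * K) < 1/32" "r < 1/32" "4 * r < norm (tl2 C)"
  shows "\<exists>l h q y. l \<in> L \<and> h \<in> SS \<and> tl2 (fst l) = q *\<^sub>R tl2 C \<and> tl2 (snd l) = y *\<^sub>R tl2 U \<and> q \<noteq> 0 \<and> y \<noteq> 0 \<and>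
    norm (cj h l) \<le> K \<and> norm (adj (snd h) ** tl2 U ** snd h) = \<delta> \<and> (\<forall>m\<in>L. norm (cj h m - pone) < r \<longrightarrow> m = pone)"
proof -
  define X E where "X = tl2 C" "E = tl2 U"
  have X0: "X \<noteq> 0" using CU(2) by (auto simp: X_E_def det_2 simp del: tl2_nth)
  have E0: "E \<noteq> 0" using CU(3) by (simp add: X_E_def)
  have nX: "norm X > 0" and nE: "norm E > 0" using X0 E0 by auto
  define Lam where "Lam = {l \<in> L. \<exists>q y. tl2 (fst l) = q *\<^sub>R X \<and> tl2 (snd l) = y *\<^sub>R E}"
  \<comment> \<open>The second bound is what the later scaling of \<open>E\<close> to norm
    \<open>\<delta>\<close> turns into 1; it admits \<open>(C, U)\<close> because
    \<open>\<delta>\<close> is at most 1. The set is finite, so an \<open>l\<close> with shortest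
    first part exists.\<close>
  define F where "F = {l \<in> Lam. tl2 (fst l) \<noteq> 0 \<and> norm (tl2 (fst l)) \<le> norm X \<and> norm (tl2 (snd l)) \<le> norm E / \<delta>}"
  have "F \<subseteq> L \<inter> cball 0 (4 + 2 * norm X + 2 * (norm E / \<delta>))"
  proof
    fix l assume l: "l \<in> F"
    then have lL: "l \<in> L" by (simp add: F_def Lam_def)
    have "norm l \<le> norm (fst l) + norm (snd l)" by (rule norm_Pair_le_add)
    also have "\<dots> \<le> (2 + 2 * norm (tl2 (fst l))) + (2 + 2 * norm (tl2 (snd l)))"
      using lL by (intro add_mono norm_le_tl2 SS_D) auto
    also have "\<dots> \<le> 4 + 2 * norm X + 2 * (norm E / \<delta>)" using l unfolding F_def by auto
    finally show "l \<in> L \<inter> cball 0 (4 + 2 * norm X + 2 * (norm E / \<delta>))" using lL by (simp add: dist_norm)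
  qed
  then have finF: "finite F" using finite_bounded[OF bounded_cball] finite_subset by blast
  have "(C, U) \<in> Lam" unfolding Lam_def X_E_def using CU(1) by (auto intro: exI[of _ 1])
  moreover have "norm E \<le> norm E / \<delta>" using \<delta> nE by (simp add: pos_le_divide_eq mult_left_le)
  ultimately have "(C, U) \<in> F" using X0 by (simp add: F_def X_E_def)
  then have neF: "F \<noteq> {}" by blast
  obtain l where l: "l \<in> F" "\<And>m. m \<in> F \<Longrightarrow> norm (tl2 (fst l)) \<le> norm (tl2 (fst m))"
    using arg_min_if_finite(1)[OF finF neF, of "\<lambda>l. norm (tl2 (fst l))"]
      arg_min_least[OF finF neF, of _ "\<lambda>l. norm (tl2 (fst l))"] by blast
  have lL: "l \<in> L" and lS: "l \<in> SS" using l(1) by (auto simp: F_def Lam_def)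
  obtain q y where qy: "tl2 (fst l) = q *\<^sub>R X" "tl2 (snd l) = y *\<^sub>R E" using l(1) unfolding F_def Lam_def by blast
  have q0: "q \<noteq> 0" using l(1) qy by (auto simp: F_def)
  have y0: "y \<noteq> 0" using trivial_snd[of "fst l" "snd l"] lL qy q0 X0 by auto
  have "\<bar>q\<bar> * norm X \<le> 1 * norm X" using l(1) unfolding F_def by (simp add: qy)
  then have q1: "\<bar>q\<bar> \<le> 1" using nX by (rule mult_right_le_imp_le)
  have "\<bar>y\<bar> * norm E \<le> (1 / \<delta>) * norm E" using l(1) unfolding F_def by (simp add: qy)
  then have y1: "\<bar>y\<bar> \<le> 1 / \<delta>" using nE by (rule mult_right_le_imp_le)
  \<comment> \<open>The first part of \<open>l\<close> is \<open>q\<close> times \<open>X\<close>;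
    scaling \<open>X\<close> to norm between \<open>R\<close> and \<open>2 * R\<close> brings that
    part to norm between \<open>norm X\<close> and \<open>2 * norm X\<close>.\<close>
  define R where "R = norm X / \<bar>q\<bar>"
  have "R \<ge> norm X" using q1 q0 nX by (simp add: R_def pos_le_divide_eq mult_left_le)
  moreover have "X$2$2 = - X$1$1" "E$2$2 = - E$1$1" by (simp_all add: X_E_def)
  moreover have "det E = 0" using CU(4) by (simp add: X_E_def)
  ultimately obtain g1 g2 where g1: "det g1 = 1" "R \<le> norm (adj g1 ** X ** g1)" "norm (adj g1 ** X ** g1) \<le> 2 * R"
    and g2: "det g2 = 1" "norm (adj g2 ** E ** g2) = \<delta>"
    using conj_large[of X R] conj_nilpotent[of E \<delta>] X0 E0 \<delta> by blast
  define h where "h = (g1, g2)"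
  have hS: "h \<in> SS" using g1 g2 by (simp add: h_def SS_def)
  have t1: "tl2 (fst (cj h m)) = adj g1 ** tl2 (fst m) ** g1" and t2: "tl2 (snd (cj h m)) = adj g2 ** tl2 (snd m) ** g2" for m
    using g1 g2 by (simp_all add: fst_cj snd_cj h_def tl2_conj)
  have n1: "norm (tl2 (fst (cj h l))) = \<bar>q\<bar> * norm (adj g1 ** X ** g1)"
    unfolding t1 qy by (simp add: mult2.scaleR_left mult2.scaleR_right)
  have n2: "norm (tl2 (snd (cj h l))) = \<bar>y\<bar> * \<delta>"
    unfolding t2 qy by (simp add: mult2.scaleR_left mult2.scaleR_right g2)
  have n1l: "norm X \<le> norm (tl2 (fst (cj h l)))" and n1u: "norm (tl2 (fst (cj h l))) \<le> 2 * norm X"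
    using g1(2,3) q0 unfolding n1 by (simp_all add: R_def field_simps)
  have n2u: "norm (tl2 (snd (cj h l))) \<le> 1" using y1 \<delta> unfolding n2 by (simp add: field_simps)
  have cS: "cj h l \<in> SS" using hS lS by simp
  \<comment> \<open>By \<open>norm_le_tl2\<close> the two components have norm at most
    \<open>2 + 4 * norm X\<close> and \<open>2 + 2\<close>, which is the origin of
    \<open>K\<close>.\<close>
  have nK: "norm (cj h l) \<le> K"
    using norm_Pair_le_add[of "cj h l"] norm_le_tl2[OF SS_D(1)[OF cS]] norm_le_tl2[OF SS_D(2)[OF cS]] n1u n2u
    unfolding K X_E_def by linarith
  \<comment> \<open>The conjugated \<open>l\<close> has norm at most \<open>K\<close>, so a small
    \<open>m\<close> commutes with its conjugate by \<open>l\<close>. By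
    \<open>parabolic_commute\<close> the second components of \<open>m\<close> and \<open>l\<close>
    commute, hence the first ones do, and \<open>m\<close> lies in \<open>Lam\<close>. There its
    first part is shorter than the minimal one, so \<open>m\<close> is trivial.\<close>
  have small: "m = pone" if m: "m \<in> L" "norm (cj h m - pone) < r" for m
  proof -
    let ?m' = "l \<star> m \<star> pinv l"
    have mS: "m \<in> SS" using m by simp
    have m'L: "?m' \<in> L" using lL m by (intro mul_in inv_in)
    have "cj h ?m' = cj h l \<star> cj h m \<star> pinv (cj h l)" using hS by (simp add: cj_pmul cj_pinv)
    then have "norm (cj h ?m' - pone) \<le> K * K * norm (cj h m - pone)" using norm_conj_minus_one[OF cS nK] by simp
    also have "\<dots> \<le> K * K * r" using m(2) by (intro mult_left_mono) auto
    finally have "norm (cj h ?m' - pone) < 1/32" using r(2) by (simp add: mult_ac)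
    then have comm: "m \<star> ?m' = ?m' \<star> m"
      using small_commute_cj[OF hS m(1) m'L] m(2) r(3) by linarith
    then have "snd m ** (snd l ** snd m ** adj (snd l)) = (snd l ** snd m ** adj (snd l)) ** snd m"
      by (metis snd_pmul snd_pinv)
    moreover have "det (tl2 (snd l)) = 0" using CU(4) qy(2) by (simp add: X_E_def det_2 algebra_simps)
    ultimately have c2: "snd m ** snd l = snd l ** snd m"
      using parabolic_commute[of "snd l" "snd m"] SS_D lS mS by blast
    have e1: "norm (fst (cj h m) - mat 1) < r" "norm (snd (cj h m) - mat 1) < r"
      using m(2) norm_fst_diff[of "cj h m" pone] norm_snd_diff[of "cj h m" pone] by auto
    have "trace (fst m) = trace (fst (cj h m))" using g1 by (simp add: fst_cj h_def trace_conj)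
    moreover have "\<bar>(fst (cj h m) - mat 1)$1$1\<bar> < r" "\<bar>(fst (cj h m) - mat 1)$2$2\<bar> < r"
      using norm_ge_entry e1(1) le_less_trans by blast+
    ultimately have "trace (fst m) > 0" using r(3) by (simp add: trace_def sum_2)
    then have c1: "fst m ** fst l = fst l ** fst m" using commute_fst_of_snd[OF m(1) lL c2] by simp
    have l0: "tl2 (fst l) \<noteq> 0" "tl2 (snd l) \<noteq> 0" using qy q0 y0 X0 E0 by auto
    obtain s where s: "tl2 (fst m) = s *\<^sub>R tl2 (fst l)" using commute_proportional[OF c1[symmetric] l0(1)] by blast
    obtain s' where s': "tl2 (snd m) = s' *\<^sub>R tl2 (snd l)" using commute_proportional[OF c2[symmetric] l0(2)] by blast
    have "\<exists>q y. tl2 (fst m) = q *\<^sub>R X \<and> tl2 (snd m) = y *\<^sub>R E" using s s' qy by (metis scaleR_scaleR)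
    then have mLam: "m \<in> Lam" using m(1) by (simp add: Lam_def)
    have "\<bar>s\<bar> * norm (tl2 (fst (cj h l))) = norm (tl2 (fst (cj h m)))"
      unfolding t1 s by (simp add: mult2.scaleR_left mult2.scaleR_right)
    also have "\<dots> \<le> 2 * r" using norm_tl2[of "fst (cj h m)"] e1 by simp
    finally have "\<bar>s\<bar> * norm X \<le> 2 * r" using mult_left_mono[OF n1l, of "\<bar>s\<bar>"] by simp
    also have "\<dots> < 1 * norm X" using r by (simp add: X_E_def)
    finally have s1: "\<bar>s\<bar> < 1" using nX by (simp add: mult_less_cancel_right)
    have nl: "norm (tl2 (fst l)) > 0" using l0 by simp
    have lt: "norm (tl2 (fst m)) < norm (tl2 (fst l))" unfolding s using s1 nl by simp
    have "\<bar>s' * y\<bar> * \<delta> = norm (tl2 (snd (cj h m)))"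
      unfolding t2 s' qy by (simp add: mult2.scaleR_left mult2.scaleR_right g2 abs_mult)
    also have "\<dots> \<le> 1" using norm_tl2[of "snd (cj h m)"] e1 r by simp
    finally have "\<bar>s' * y\<bar> \<le> 1 / \<delta>" using \<delta> by (simp add: field_simps)
    then have "norm (tl2 (snd m)) \<le> norm E / \<delta>" unfolding s' qy using nE mult_right_mono[of "\<bar>s' * y\<bar>" "1 / \<delta>" "norm E"] by (simp add: abs_mult mult_ac)
    then have "tl2 (fst m) = 0" using l(2)[of m] lt l(1) mLam unfolding F_def by force
    then have z: "tl2 (fst m) = 0" "tl2 (snd m) = 0" using trivial_fst[of "fst m" "snd m"] m(1) by auto
    then have "fst m = mat 1 \<or> fst m = - mat 1" "snd m = mat 1 \<or> snd m = - mat 1"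
      using tl2_eq0_iff SS_D mS by blast+
    moreover have "fst m \<noteq> - mat 1"
    proof
      assume "fst m = - mat 1"
      then have "fst (cj h m) = - mat 1" using g1 by (simp add: fst_cj h_def mult2.minus_left mult2.minus_right adj_left)
      then show False using e1 r norm_neg1 by simp
    qed
    moreover have "snd m \<noteq> - mat 1"
    proof
      assume "snd m = - mat 1"
      then have "snd (cj h m) = - mat 1" using g2 by (simp add: snd_cj h_def mult2.minus_left mult2.minus_right adj_left)
      then show False using e1 r norm_neg1 by simp
    qed
    ultimately show ?thesis by (simp add: pone_def prod_eq_iff)
  qed
  have nh: "norm (adj (snd h) ** tl2 U ** snd h) = \<delta>" using g2(2) by (simp add: h_def X_E_def)
  show ?thesis
    using lL hS qy q0 y0 nK nh small unfolding X_E_def by blast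
qed

text \<open>For \<open>\<delta>\<close> running through the powers of 1/16 the conjugated elements
  of \<open>renormalize\<close> stay bounded, and a subsequence converges. Packing gives some
  \<open>\<gamma>\<close> in \<open>L\<close> that nearly matches two of the conjugated lattices and
  therefore conjugates \<open>l I\<close> exactly to \<open>l J\<close>. The first components then
  determine the parameter \<open>y\<close> up to sign, whereas the scales of \<open>U\<close> differ
  by at least the factor 16.\<close>

lemma no_parabolic_mixed:
  assumes CU: "(C, U) \<in> L" "det (tl2 C) \<noteq> 0" "tl2 U \<noteq> 0" "det (tl2 U) = 0"
  shows False
proof -
  define X E where "X = tl2 C" "E = tl2 U"
  have nX: "norm X > 0" using CU(2) by (auto simp: X_E_def det_2 simp del: tl2_nth)
  define K where "K = 6 + 4 * norm (tl2 C)"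
  have Kpos: "K \<ge> 6" by (simp add: K_def)
  have "\<exists>r>0. r * (K * K) < 1/32 \<and> r < 1/32 \<and> 4 * r < norm X"
  proof -
    let ?r = "min (1 / (64 * (K * K))) (min (1/64) (norm X / 8))"
    have "?r > 0" using nX Kpos by simp
    moreover have "?r * (K * K) \<le> 1 / (64 * (K * K)) * (K * K)" using Kpos by (intro mult_right_mono) auto
    then have "?r * (K * K) < 1/32" using Kpos by simp
    ultimately show ?thesis using nX by (intro exI[of _ ?r]) linarith
  qed
  then obtain r where r: "0 < r" "r * (K * K) < 1/32" "r < 1/32" "4 * r < norm (tl2 C)" unfolding X_E_def by blast
  define P where "P = (\<lambda>(j::nat) l h q y. l \<in> L \<and> h \<in> SS \<and> tl2 (fst l) = q *\<^sub>R X \<and> tl2 (snd l) = y *\<^sub>R E \<and> q \<noteq> 0 \<and> y \<noteq> 0 \<and>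
    norm (cj h l) \<le> K \<and> norm (adj (snd h) ** E ** snd h) = (1/16)^j \<and> (\<forall>m\<in>L. norm (cj h m - pone) < r \<longrightarrow> m = pone))"
  have "\<forall>j. \<exists>l h q y. P j l h q y"
    unfolding P_def X_E_def using renormalize[OF CU _ _ K_def r] by (simp add: power_le_one)
  then obtain l h q y where P: "\<And>j. P j (l j) (h j) (q j) (y j)" by metis
  have lL: "l j \<in> L" and hS: "h j \<in> SS" and tl: "tl2 (fst (l j)) = q j *\<^sub>R X" "tl2 (snd (l j)) = y j *\<^sub>R E" and
    q0: "q j \<noteq> 0" and y0: "y j \<noteq> 0" and nK: "norm (cj (h j) (l j)) \<le> K" and nE: "norm (adj (snd (h j)) ** E ** snd (h j)) = (1/16)^j"
    and sm: "\<And>m. m \<in> L \<Longrightarrow> norm (cj (h j) m - pone) < r \<Longrightarrow> m = pone" for j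
    using P[of j] unfolding P_def by blast+
  define x where "x j = cj (h j) (l j)" for j
  have "bounded (range x)" unfolding bounded_iff x_def using nK by auto
  \<comment> \<open>Only two nearby members of the sequence can be compared; packing is applied to
    the tail where all members are within \<open>e\<close>.\<close>
  then obtain \<sigma> a where \<sigma>: "strict_mono \<sigma>" "(x \<circ> \<sigma>) \<longlonglongrightarrow> a" using bounded_imp_convergent_subsequence by blast
  define e where "e = r / (4 * K)"
  have e: "e > 0" using r Kpos by (simp add: e_def)
  have "Cauchy (x \<circ> \<sigma>)" using \<sigma>(2) LIMSEQ_imp_Cauchy by blast
  then obtain N where N: "\<And>i j. i \<ge> N \<Longrightarrow> j \<ge> N \<Longrightarrow> norm (x (\<sigma> i) - x (\<sigma> j)) < e"
    using CauchyD[of "x \<circ> \<sigma>" e] e unfolding comp_apply by blast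
  define r' where "r' = min 1 (r / (16 * K * K))"
  have r': "r' > 0" "r' \<le> 1" "r' * (16 * K * K) \<le> r" using r Kpos by (auto simp: r'_def min_def field_simps)
  have "\<exists>i j. i < j \<and> (\<exists>\<gamma>\<in>L. norm (pinv (h (\<sigma> (N + j))) \<star> \<gamma> \<star> h (\<sigma> (N + i)) - pone) < r')"
    using packing[OF r(1), of "\<lambda>n. h (\<sigma> (N + n))"] hS sm r'(1) unfolding cj_def by blast
  then obtain i j \<gamma> where ij: "i < j" "\<gamma> \<in> L" "norm (pinv (h (\<sigma> (N + j))) \<star> \<gamma> \<star> h (\<sigma> (N + i)) - pone) < r'" by blast
  define I J where "I = \<sigma> (N + i)" "J = \<sigma> (N + j)"
  define w where "w = pinv (h J) \<star> \<gamma> \<star> h I"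
  have IJ: "I < J" using ij(1) \<sigma>(1) by (simp add: I_J_def strict_monoD)
  have gS: "\<gamma> \<in> SS" using ij(2) by simp
  have wS: "w \<in> SS" using gS hS by (simp add: w_def)
  have wn: "norm (w - pone) < r'" using ij(3) by (simp add: w_def I_J_def)
  have wn3: "norm w \<le> 3" using norm_triangle_sub[of w pone] wn r' by simp
  have xS: "x n \<in> SS" for n using hS lL by (simp add: x_def)
  have xd: "norm (x I - x J) < e" using N[of "N+i" "N+j"] by (simp add: I_J_def)
  have conjw: "cj (h J) (\<gamma> \<star> m \<star> pinv \<gamma>) = w \<star> cj (h I) m \<star> pinv w" for m
    using hS by (simp add: cj_def w_def pmul_assoc pinv_mul)
  \<comment> \<open>Conjugated by \<open>h J\<close> this element of \<open>L\<close> is small,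
    since \<open>x I\<close> is close to \<open>x J\<close> and \<open>w\<close> close to
    \<open>pone\<close>; there are no small elements, so \<open>\<gamma>\<close> conjugates
    \<open>l I\<close> to \<open>l J\<close>.\<close>
  let ?c = "\<gamma> \<star> l I \<star> pinv \<gamma> \<star> pinv (l J)"
  have "cj (h J) ?c = w \<star> x I \<star> pinv w \<star> pinv (x J)"
    unfolding cj_pmul[OF hS, of J "\<gamma> \<star> l I \<star> pinv \<gamma>" "pinv (l J)"] cj_pinv conjw x_def by (rule refl)
  moreover have "w \<star> x I \<star> pinv w \<star> pinv (x J) - pone = (((w - pone) \<star> x I - x I \<star> (w - pone)) \<star> pinv w + (x I - x J)) \<star> pinv (x J)"
    using wS xS by (simp add: pmul.diff_left pmul.diff_right pmul.add_left pmul_assoc)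
  moreover have "norm \<dots> \<le> (norm (((w - pone) \<star> x I - x I \<star> (w - pone)) \<star> pinv w) + norm (x I - x J)) * norm (x J)"
    using order_trans[OF norm_pmul mult_right_mono[OF norm_triangle_ineq norm_ge_zero]] norm_pinv by metis
  moreover have "\<dots> \<le> (6 * K * r' + e) * K"
  proof (intro mult_mono add_mono)
    have "norm (((w - pone) \<star> x I - x I \<star> (w - pone)) \<star> pinv w) \<le> norm ((w - pone) \<star> x I - x I \<star> (w - pone)) * norm w"
      using norm_pmul[of _ "pinv w"] by simp
    also have "\<dots> \<le> (2 * K * r') * 3"
    proof (intro mult_mono wn3)
      have "norm (w - pone) * norm (x I) \<le> r' * K" using wn nK[of I] r' by (intro mult_mono) (auto simp: x_def)
      then show "norm ((w - pone) \<star> x I - x I \<star> (w - pone)) \<le> 2 * K * r'"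
        using norm_triangle_ineq4[of "(w - pone) \<star> x I" "x I \<star> (w - pone)"] norm_pmul[of "w - pone" "x I"]
          norm_pmul[of "x I" "w - pone"] by (simp add: mult.commute mult.left_commute)
    qed (use r' Kpos in auto)
    finally show "norm (((w - pone) \<star> x I - x I \<star> (w - pone)) \<star> pinv w) \<le> 6 * K * r'" by simp
    show "norm (x I - x J) \<le> e" using xd by simp
    show "norm (x J) \<le> K" using nK by (simp add: x_def)
  qed (use r' e Kpos in auto)
  moreover have "(6 * K * r' + e) * K < r"
  proof -
    have "e * K = r / 4" using Kpos by (simp add: e_def)
    moreover have "6 * K * r' * K \<le> r * (6 / 16)" using r'(3) by (simp add: mult_ac)
    ultimately show ?thesis unfolding distrib_right using r(1) by linarith
  qed
  ultimately have "norm (cj (h J) ?c - pone) < r" by simp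
  moreover have "?c \<in> L" using ij(2) lL by (intro mul_in inv_in)
  ultimately have "?c = pone" using sm by blast
  then have "?c \<star> l J = l J" by simp
  then have cc: "\<gamma> \<star> l I \<star> pinv \<gamma> = l J" using lL by (simp add: pmul_assoc)
  \<comment> \<open>Both first parts are multiples of \<open>X\<close> and have the same nonzero
    determinant, so \<open>fst (l J)\<close> is \<open>fst (l I)\<close> or its inverse up to sign.
    The corresponding quotient or product of \<open>l J\<close> and \<open>l I\<close> has trivial
    first component, hence trivial second one.\<close>
  have "tl2 (fst (l J)) = fst \<gamma> ** tl2 (fst (l I)) ** adj (fst \<gamma>)"
    using cc tl2_conj'[of "fst \<gamma>" "fst (l I)"] SS_D[OF gS] by (metis fst_pmul fst_pinv)
  then have "det (tl2 (fst (l J))) = det (tl2 (fst (l I)))" using SS_D[OF gS] by (simp only: det_mul det_adj mult_1_right mult_1_left)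
  then have "(q J)\<^sup>2 * det X = (q I)\<^sup>2 * det X" unfolding tl by (simp add: det_2 power2_eq_square algebra_simps)
  then have qq: "(q J)\<^sup>2 = (q I)\<^sup>2" using CU(2) by (simp add: X_E_def)
  have "tl2 (fst (l J)) = (q J / q I) *\<^sub>R tl2 (fst (l I))" using q0 by (simp add: tl)
  moreover have "(q J / q I)\<^sup>2 = 1" using qq q0 by (simp add: power_divide)
  ultimately have cases: "fst (l J) = fst (l I) \<or> fst (l J) = - fst (l I) \<or> fst (l J) = adj (fst (l I)) \<or> fst (l J) = - adj (fst (l I))"
    using tl2_sign_cases SS_D lL in_SS by blast
  have triv: "tl2 (snd a) = 0" if "a \<in> L" "fst a = mat 1 \<or> fst a = - mat 1" for a
  proof -
    have "tl2 (fst a) = 0" using that(2) tl2_mat1 tl2_uminus[of "mat 1"] by auto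
    then show ?thesis using trivial_fst[of "fst a" "snd a"] that(1) by simp
  qed
  have dI: "det (fst (l I)) = 1" "det (snd (l I)) = 1" "det (snd (l J)) = 1" using SS_D lL in_SS by blast+
  have sg: "B = B' \<or> B = - B'" if "tl2 (B ** adj B') = 0" "det B = 1" "det B' = 1" for B B' :: mat2
  proof -
    have "B ** adj B' = mat 1 \<or> B ** adj B' = - mat 1" using that tl2_eq0_iff[of "B ** adj B'"] by (simp add: det_mul)
    then have "B ** adj B' ** B' = B' \<or> B ** adj B' ** B' = - B'" by (auto simp: mult2.minus_left)
    then show ?thesis using that(3) by (simp add: adj_left flip: matrix_mul_assoc)
  qed
  have "\<bar>y J\<bar> = \<bar>y I\<bar>"
  proof -
    have "tl2 (snd (l J)) = tl2 (snd (l I)) \<or> tl2 (snd (l J)) = - tl2 (snd (l I))"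
    proof (cases "fst (l J) = fst (l I) \<or> fst (l J) = - fst (l I)")
      case True
      then have "fst (l J \<star> pinv (l I)) = mat 1 \<or> fst (l J \<star> pinv (l I)) = - mat 1"
        using dI by (auto simp: adj_right mult2.minus_left)
      then have "tl2 (snd (l J) ** adj (snd (l I))) = 0" using triv[of "l J \<star> pinv (l I)"] lL mul_in inv_in by simp
      then show ?thesis using sg[of "snd (l J)" "snd (l I)"] dI tl2_uminus by metis
    next
      case False
      then have "fst (l J \<star> l I) = mat 1 \<or> fst (l J \<star> l I) = - mat 1"
        using cases dI by (auto simp: adj_left mult2.minus_left)
      then have "tl2 (snd (l J) ** adj (adj (snd (l I)))) = 0" using triv[of "l J \<star> l I"] lL mul_in by simp
      then show ?thesis using sg[of "snd (l J)" "adj (snd (l I))"] dI tl2_uminus tl2_adj by (metis det_adj minus_minus)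
    qed
    then have "y J *\<^sub>R E = y I *\<^sub>R E \<or> y J *\<^sub>R E = (- y I) *\<^sub>R E" unfolding tl by simp
    moreover have "E \<noteq> 0" using CU(3) by (simp add: X_E_def)
    ultimately have "y J = y I \<or> y J = - y I" by (metis scaleR_cancel_right)
    then show ?thesis by auto
  qed
  have "tl2 (snd (cj (h J) (l J))) = snd w ** tl2 (snd (cj (h I) (l I))) ** adj (snd w)"
    using conjw[of "l I"] cc tl2_conj'[of "snd w" "snd (cj (h I) (l I))"] SS_D[OF wS] by (metis snd_pmul snd_pinv)
  then have "y J *\<^sub>R (adj (snd (h J)) ** E ** snd (h J)) = snd w ** (y I *\<^sub>R (adj (snd (h I)) ** E ** snd (h I))) ** adj (snd w)"
    using SS_D[OF hS] by (simp add: snd_cj tl2_conj tl mult2.scaleR_left mult2.scaleR_right)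
  then have "adj (snd w) ** (y J *\<^sub>R (adj (snd (h J)) ** E ** snd (h J))) ** snd w = y I *\<^sub>R (adj (snd (h I)) ** E ** snd (h I))"
    using SS_D[OF wS] by (simp add: adj_left adj_cancel flip: matrix_mul_assoc)
  then have "\<bar>y I\<bar> * (1/16)^I = norm (adj (snd w) ** (y J *\<^sub>R (adj (snd (h J)) ** E ** snd (h J))) ** snd w)"
    using nE[of I] by simp
  also have "\<dots> \<le> norm (snd w) * (\<bar>y J\<bar> * (1/16)^J) * norm (snd w)"
    using order_trans[OF norm_mult2 mult_right_mono[OF norm_mult2 norm_ge_zero], of "adj (snd w)" "y J *\<^sub>R (adj (snd (h J)) ** E ** snd (h J))" "snd w"]
      nE[of J] by simp
  also have "\<dots> \<le> 3 * (\<bar>y J\<bar> * (1/16)^J) * 3"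
    using wn3 norm_snd_le[of "snd w" "fst w"] by (intro mult_mono) auto
  \<comment> \<open>Conjugation by \<open>snd w\<close>, of norm at most 3, distorts norms by at
    most 9; the ratio 16 of consecutive scales was chosen to exceed this.\<close>
  finally have "(1/16)^I \<le> 9 * (1/16::real)^J" using y0[of I] \<open>\<bar>y J\<bar> = \<bar>y I\<bar>\<close> by (simp add: mult_ac)
  also have "(1/16::real)^J \<le> (1/16)^(Suc I)" using IJ by (intro power_decreasing) auto
  finally show False by simp
qed

end

section \<open>Elements with two hyperbolic components\<close>

text \<open>Needed to bring a given element of \<open>L\<close> to normal form: left translation by
  \<open>pinv z\<close> turns every condition on \<open>L\<close> into the one on its conjugate,
  with distances changed by a bounded factor.\<close>

lemma irr22_conj:
  assumes "irr22 L" and z: "z \<in> SS" shows "irr22 (conj_set z L)"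
proof -
  interpret irr22 L by fact
  interpret c: discrete_SS "conj_set z L" by (rule conj[OF z])
  have mem: "x \<in> conj_set z L \<longleftrightarrow> z \<star> x \<star> pinv z \<in> L" for x
  proof
    assume "x \<in> conj_set z L" then obtain y where "y \<in> L" "x = pinv z \<star> y \<star> z" by (auto simp: conj_set_def)
    then show "z \<star> x \<star> pinv z \<in> L" using z by (simp add: pmul_assoc)
  next
    assume "z \<star> x \<star> pinv z \<in> L"
    moreover have "x = pinv z \<star> (z \<star> x \<star> pinv z) \<star> z" using z by (simp add: pmul_assoc)
    ultimately show "x \<in> conj_set z L" unfolding conj_set_def by blast
  qed
  have dz: "det (fst z) = 1" "det (snd z) = 1" using z by (simp_all add: SS_def)
  show ?thesis
  proof
    have "z \<star> (- mat 1, mat 1) \<star> pinv z = (- mat 1, mat 1)" "z \<star> (mat 1, - mat 1) \<star> pinv z = (mat 1, - mat 1)"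
      using dz by (simp_all add: prod_eq_iff mult2.minus_left mult2.minus_right adj_right)
    then show "(- mat 1, mat 1) \<in> conj_set z L" "(mat 1, - mat 1) \<in> conj_set z L" using signs by (simp_all add: mem)
  next
    fix U :: "mat22 set" and g :: "nat \<Rightarrow> mat22" and N :: nat
    assume U: "open U" "U \<inter> SS \<noteq> {}" and g: "\<And>n. g n \<in> SS" "\<And>i j. g (i + j) = g i \<star> g j"
    have "open ((\<lambda>w. pinv z \<star> w) -` U)" using U by (intro open_vimage continuous_intros)
    moreover obtain u0 where "u0 \<in> U" "u0 \<in> SS" using U by blast
    then have "z \<star> u0 \<in> (\<lambda>w. pinv z \<star> w) -` U \<inter> SS" using z by simp
    ultimately have "\<exists>n\<ge>N. \<exists>\<gamma>\<in>L. \<exists>u\<in>(\<lambda>w. pinv z \<star> w) -` U \<inter> SS. \<exists>u'\<in>(\<lambda>w. pinv z \<star> w) -` U \<inter> SS. \<gamma> \<star> u \<star> g n = u'"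
      by (intro nonwandering g) auto
    then obtain n \<gamma> u u' where *: "n \<ge> N" "\<gamma> \<in> L" "pinv z \<star> u \<in> U" "u \<in> SS" "pinv z \<star> u' \<in> U" "u' \<in> SS" "\<gamma> \<star> u \<star> g n = u'"
      by blast
    have "(pinv z \<star> \<gamma> \<star> z) \<star> (pinv z \<star> u) \<star> g n = pinv z \<star> u'" using z *(7) by (simp add: pmul_assoc)
    moreover have "pinv z \<star> \<gamma> \<star> z \<in> conj_set z L" using * by (auto simp: conj_set_def)
    moreover have "pinv z \<star> u \<in> U \<inter> SS" "pinv z \<star> u' \<in> U \<inter> SS" using * z by simp_all
    ultimately show "\<exists>n\<ge>N. \<exists>\<gamma>\<in>conj_set z L. \<exists>u\<in>U \<inter> SS. \<exists>u'\<in>U \<inter> SS. \<gamma> \<star> u \<star> g n = u'"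
      using *(1) by blast
  next
    fix r r' :: real and h :: "nat \<Rightarrow> mat22" assume r: "r > 0" "r' > 0" and h: "\<And>n. h n \<in> SS"
      and s: "\<And>n \<gamma>. \<gamma> \<in> conj_set z L \<Longrightarrow> norm (pinv (h n) \<star> \<gamma> \<star> h n - pone) < r \<Longrightarrow> \<gamma> = pone"
    have "\<exists>i j. i < j \<and> (\<exists>\<gamma>\<in>L. norm (pinv (z \<star> h j) \<star> \<gamma> \<star> (z \<star> h i) - pone) < r')"
    proof (rule packing[OF r(1) _ _ r(2)])
      show "z \<star> h n \<in> SS" for n using h z by simp
      fix n \<gamma> assume g: "\<gamma> \<in> L" "norm (pinv (z \<star> h n) \<star> \<gamma> \<star> (z \<star> h n) - pone) < r"
      have "pinv z \<star> \<gamma> \<star> z = pone"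
      proof (rule s)
        show "pinv z \<star> \<gamma> \<star> z \<in> conj_set z L" using g by (auto simp: conj_set_def)
        show "norm (pinv (h n) \<star> (pinv z \<star> \<gamma> \<star> z) \<star> h n - pone) < r" using g(2) by (simp add: pinv_mul pmul_assoc)
      qed
      then show "\<gamma> = pone" using cj_inj[OF z, of \<gamma> pone] z by (simp add: cj_def)
    qed
    then obtain i j \<gamma> where "i < j" "\<gamma> \<in> L" "norm (pinv (z \<star> h j) \<star> \<gamma> \<star> (z \<star> h i) - pone) < r'" by blast
    moreover then have "norm (pinv (h j) \<star> (pinv z \<star> \<gamma> \<star> z) \<star> h i - pone) < r'" by (simp add: pinv_mul pmul_assoc)
    ultimately show "\<exists>i j. i < j \<and> (\<exists>\<gamma>\<in>conj_set z L. norm (pinv (h j) \<star> \<gamma> \<star> h i - pone) < r')"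
      unfolding conj_set_def by blast
  next
    fix A :: mat2 and e :: real assume A: "det A = 1" "e > 0"
    let ?n = "norm (fst z)"
    have n: "?n > 0" using dz by (auto simp: det_2)
    have "det (fst z ** A ** adj (fst z)) = 1" using A dz by (simp add: det_mul)
    then obtain x where x: "x \<in> L" "norm (fst x - fst z ** A ** adj (fst z)) < e / (?n * ?n)" using dense1 A n by (meson divide_pos_pos mult_pos_pos)
    have "adj (fst z) ** fst x ** fst z - A = adj (fst z) ** (fst x - fst z ** A ** adj (fst z)) ** fst z"
      using dz by (simp add: mult2.diff_left mult2.diff_right adj_left adj_cancel flip: matrix_mul_assoc)
    then have "norm (adj (fst z) ** fst x ** fst z - A) \<le> ?n * norm (fst x - fst z ** A ** adj (fst z)) * ?n"
      using order_trans[OF norm_mult2 mult_right_mono[OF norm_mult2 norm_ge_zero], of "adj (fst z)" _ "fst z"] by simp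
    also have "\<dots> < e" using x(2) n by (simp add: field_simps)
    finally have "norm (fst (cj z x) - A) < e" by (simp add: fst_cj)
    then show "\<exists>x\<in>conj_set z L. norm (fst x - A) < e" using x(1) by (auto simp: conj_set_def cj_def)
  next
    fix A :: mat2 and e :: real assume A: "det A = 1" "e > 0"
    let ?n = "norm (snd z)"
    have n: "?n > 0" using dz by (auto simp: det_2)
    have "det (snd z ** A ** adj (snd z)) = 1" using A dz by (simp add: det_mul)
    then obtain x where x: "x \<in> L" "norm (snd x - snd z ** A ** adj (snd z)) < e / (?n * ?n)" using dense2 A n by (meson divide_pos_pos mult_pos_pos)
    have "adj (snd z) ** snd x ** snd z - A = adj (snd z) ** (snd x - snd z ** A ** adj (snd z)) ** snd z"
      using dz by (simp add: mult2.diff_left mult2.diff_right adj_left adj_cancel flip: matrix_mul_assoc)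
    then have "norm (adj (snd z) ** snd x ** snd z - A) \<le> ?n * norm (snd x - snd z ** A ** adj (snd z)) * ?n"
      using order_trans[OF norm_mult2 mult_right_mono[OF norm_mult2 norm_ge_zero], of "adj (snd z)" _ "snd z"] by simp
    also have "\<dots> < e" using x(2) n by (simp add: field_simps)
    finally have "norm (snd (cj z x) - A) < e" by (simp add: snd_cj)
    then show "\<exists>x\<in>conj_set z L. norm (snd x - A) < e" using x(1) by (auto simp: conj_set_def cj_def)
  qed
qed

text \<open>A planar lattice invariant under a hyperbolic diagonal map has determinant-one dynamics: by
  Dirichlet's theorem it contains vectors in long thin boxes of bounded area, and an area-contracting
  power of the map would make them arbitrarily short.\<close>

lemma no_contracting_lattice_aux:
  fixes P :: "real \<Rightarrow> real \<Rightarrow> bool"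
  assumes add: "\<And>a b c d. P a b \<Longrightarrow> P c d \<Longrightarrow> P (a + c) (b + d)" and neg: "\<And>a b. P a b \<Longrightarrow> P (- a) (- b)"
    and D: "\<And>a b. P a b \<Longrightarrow> P (p * a) (q * b)" and \<eta>: "\<eta> > 0" "\<And>a b. P a b \<Longrightarrow> \<bar>a\<bar> < \<eta> \<Longrightarrow> \<bar>b\<bar> < \<eta> \<Longrightarrow> a = 0 \<and> b = 0"
    and v: "P b c" "b \<noteq> 0" "c \<noteq> 0" and pq: "p > 1" "0 < q" "q < 1" "p * q < 1"
  shows False
proof -
  have nat: "P (of_nat n * a) (of_nat n * d)" if "P a d" for a d n
  proof (induction n)
    case 0 show ?case using add[OF that neg[OF that]] by simp
  next
    case (Suc n) then show ?case using add[OF that Suc] by (simp add: algebra_simps)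
  qed
  have int: "P (of_int k * a) (of_int k * d)" if "P a d" for a d k
    using nat[OF that, of "nat k"] neg[OF nat[OF that, of "nat (- k)"]] by (cases "k \<ge> 0") (auto simp: of_nat_nat)
  have Dm: "P (p ^ m * a) (q ^ m * d)" if "P a d" for a d m
    using D that by (induction m) (auto simp: mult.assoc)
  \<comment> \<open>\<open>C * p ^ m\<close> will bound the second coordinate of the Dirichlet
    vector: its second factor comes from estimating \<open>t\<close>, the first from the size of
    \<open>N\<close> relative to \<open>p ^ m\<close>.\<close>
  define C where "C = (\<bar>b\<bar> / \<eta> + 1) * ((p + q + 1) * \<bar>c\<bar>)"
  have "(\<lambda>m. C * (p * q) ^ m) \<longlonglongrightarrow> C * 0" using pq by (intro tendsto_intros LIMSEQ_power_zero) (simp add: abs_mult)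
  then have "\<forall>\<^sub>F m in sequentially. C * (p * q) ^ m < \<eta>" using \<eta>(1) by (intro order_tendstoD) auto
  then obtain m where m: "C * (p * q) ^ m < \<eta>" by (metis eventually_at_top_linorder order_refl)
  \<comment> \<open>The least convenient \<open>N\<close> for which a first coordinate of size
    \<open>\<bar>b\<bar> / N\<close> stays below \<open>\<eta>\<close> after \<open>m\<close>
    expansions by \<open>p\<close>.\<close>
  define N where "N = nat \<lfloor>p ^ m * \<bar>b\<bar> / \<eta>\<rfloor> + 1"
  have fl: "p ^ m * \<bar>b\<bar> / \<eta> \<ge> 0" using pq \<eta> by simp
  have N: "N > 0" "p ^ m * \<bar>b\<bar> / \<eta> < N" by (auto simp: N_def) (use fl in linarith)
  have Nu: "N \<le> p ^ m * (\<bar>b\<bar> / \<eta> + 1)"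
  proof -
    have "real N \<le> p ^ m * \<bar>b\<bar> / \<eta> + 1" unfolding N_def using fl by simp
    also have "\<dots> \<le> p ^ m * \<bar>b\<bar> / \<eta> + p ^ m" using pq by (simp add: one_le_power)
    finally show ?thesis by (simp add: algebra_simps)
  qed
  obtain h k where hk: "0 < k" "k \<le> int N" "\<bar>of_int k * p - of_int h\<bar> < 1 / N" using Dirichlet_approx[OF N(1)] by blast
  \<comment> \<open>This is \<open>k\<close> times the image of \<open>(b, c)\<close> minus
    \<open>h\<close> times \<open>(b, c)\<close>, a vector of the lattice. Dirichlet's theorem makes
    its first coordinate small; the second one is of order \<open>N\<close>.\<close>
  define s t where "s = (of_int k * p - of_int h) * b" "t = (of_int k * q - of_int h) * c"
  have "P (of_int k * (p * b)) (of_int k * (q * c))" using int[OF D[OF v(1)]] .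
  moreover have "P (of_int (- h) * b) (of_int (- h) * c)" using int[OF v(1)] .
  ultimately have "P s t" using add unfolding s_t_def by (fastforce simp: algebra_simps)
  then have Pm: "P (p ^ m * s) (q ^ m * t)" by (rule Dm)
  have "\<bar>s\<bar> \<le> 1 / N * \<bar>b\<bar>" unfolding s_t_def abs_mult using hk(3) by (intro mult_right_mono) auto
  then have "\<bar>p ^ m * s\<bar> \<le> p ^ m * (1 / N * \<bar>b\<bar>)" using pq unfolding abs_mult by (intro mult_mono) auto
  also have "\<dots> < \<eta>" using N \<eta>(1) by (simp add: field_simps)
  finally have 1: "\<bar>p ^ m * s\<bar> < \<eta>" .
  have "\<bar>real_of_int h\<bar> \<le> real_of_int k * p + 1" 
  proof -
    have "1 / real N \<le> 1" using N(1) by simp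
    moreover have "0 < real_of_int k * p" using hk(1) pq by simp
    ultimately show ?thesis using hk(3) by linarith
  qed
  also have "\<dots> \<le> N * p + 1" using hk(2) pq by (simp add: mult_right_mono)
  finally have h: "\<bar>real_of_int h\<bar> \<le> N * p + 1" .
  have "\<bar>of_int k * q - of_int h\<bar> \<le> \<bar>of_int k * q\<bar> + \<bar>real_of_int h\<bar>" by (rule abs_triangle_ineq4)
  also have "\<bar>of_int k * q\<bar> \<le> N * q" using hk(1,2) pq by (simp add: abs_mult mult_right_mono)
  finally have "\<bar>of_int k * q - of_int h\<bar> \<le> N * q + (N * p + 1)" using h by linarith
  also have "\<dots> \<le> N * (p + q + 1)" using N(1) by (simp add: algebra_simps)
  finally have "\<bar>t\<bar> \<le> N * (p + q + 1) * \<bar>c\<bar>" unfolding s_t_def by (simp add: abs_mult mult_right_mono)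
  also have "\<dots> \<le> p ^ m * (\<bar>b\<bar> / \<eta> + 1) * (p + q + 1) * \<bar>c\<bar>" using Nu pq by (intro mult_right_mono) auto
  finally have "\<bar>t\<bar> \<le> C * p ^ m" by (simp add: C_def mult_ac)
  then have "\<bar>q ^ m * t\<bar> \<le> q ^ m * (C * p ^ m)" using pq by (simp add: abs_mult mult_left_mono)
  also have "\<dots> < \<eta>" using m by (simp add: power_mult_distrib mult_ac)
  finally have 2: "\<bar>q ^ m * t\<bar> < \<eta>" .
  \<comment> \<open>Vanishing of both coordinates gives \<open>k * p = h = k * q\<close> with
    positive \<open>k\<close>, impossible as \<open>q < 1 < p\<close>.\<close>
  have "s = 0" "t = 0" using \<eta>(2)[OF Pm 1 2] pq by auto
  then have "of_int k * p = of_int k * q" using v by (simp add: s_t_def)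
  then show False using hk(1) pq by simp
qed

text \<open>If both factors lie on the same side of 1, powers of the map or of its inverse shrink
  the given vector to nothing. Otherwise inverting the map or exchanging the coordinates leads to an
  expanding first factor and an area-contracting map.\<close>

lemma no_contracting_lattice:
  fixes P :: "real \<Rightarrow> real \<Rightarrow> bool"
  assumes add: "\<And>a b c d. P a b \<Longrightarrow> P c d \<Longrightarrow> P (a + c) (b + d)" and neg: "\<And>a b. P a b \<Longrightarrow> P (- a) (- b)"
    and D: "\<And>a b. P a b \<Longrightarrow> P (p * a) (q * b)" and D': "\<And>a b. P a b \<Longrightarrow> P (inverse p * a) (inverse q * b)" 
    and \<eta>: "\<eta> > 0" "\<And>a b. P a b \<Longrightarrow> \<bar>a\<bar> < \<eta> \<Longrightarrow> \<bar>b\<bar> < \<eta> \<Longrightarrow> a = 0 \<and> b = 0"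
    and v: "P b c" "b \<noteq> 0" "c \<noteq> 0" and pq: "0 < p" "0 < q" "p \<noteq> 1" "q \<noteq> 1" "p * q \<noteq> 1"
  shows False
proof -
  have contr: False if "0 < p" "p < 1" "0 < q" "q < 1" and D: "\<And>a b. P a b \<Longrightarrow> P (p * a) (q * b)" for p q
  proof -
    have Dm: "P (p ^ m * b) (q ^ m * c)" for m using D v(1) by (induction m) (auto simp: mult.assoc)
    have "(\<lambda>m. \<bar>p ^ m * b\<bar>) \<longlonglongrightarrow> \<bar>0 * b\<bar>" "(\<lambda>m. \<bar>q ^ m * c\<bar>) \<longlonglongrightarrow> \<bar>0 * c\<bar>" using that by (intro tendsto_intros LIMSEQ_power_zero; simp)+
    then have "\<forall>\<^sub>F m in sequentially. \<bar>p ^ m * b\<bar> < \<eta>" "\<forall>\<^sub>F m in sequentially. \<bar>q ^ m * c\<bar> < \<eta>" using \<eta>(1) by (intro order_tendstoD; simp)+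
    then have "\<forall>\<^sub>F m in sequentially. \<bar>p ^ m * b\<bar> < \<eta> \<and> \<bar>q ^ m * c\<bar> < \<eta>" by (rule eventually_conj)
    then obtain m where "\<bar>p ^ m * b\<bar> < \<eta>" "\<bar>q ^ m * c\<bar> < \<eta>" using eventually_happens'[OF sequentially_bot] by blast
    then show False using \<eta>(2)[OF Dm[of m]] v that by simp
  qed
  have main: False if "p > 1" "0 < q" "q < 1" "p * q < 1" and D: "\<And>a b. P a b \<Longrightarrow> P (p * a) (q * b)" for p q
  proof (rule no_contracting_lattice_aux[of P p q \<eta> b c])
    show "P (a + c) (b + d)" if "P a b" "P c d" for a b c d using add that .
  qed (fact neg D \<eta> v that)+
  have main': False if "p > 1" "0 < q" "q < 1" "p * q < 1" and D: "\<And>a b. P a b \<Longrightarrow> P (q * a) (p * b)" for p q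
  proof (rule no_contracting_lattice_aux[of "\<lambda>a b. P b a" p q \<eta> c b])
    show "P (b + d) (a + c)" if "P b a" "P d c" for a b c d using add that .
    show "a = 0 \<and> b = 0" if "P b a" "\<bar>a\<bar> < \<eta>" "\<bar>b\<bar> < \<eta>" for a b using \<eta>(2)[OF that(1,3,2)] by simp
  qed (fact neg D \<eta> v that)+
  have ip: "inverse p > 0" "inverse q > 0" "inverse p * inverse q = inverse (p * q)" using pq by simp_all
  have ipq: "inverse p * inverse q < 1" if "p * q > 1" unfolding ip(3) inverse_less_1_iff using that by simp
  have "p < 1 \<or> p > 1" "q < 1 \<or> q > 1" "p * q < 1 \<or> p * q > 1" using pq by auto
  then consider "p < 1" "q < 1" | "p > 1" "q > 1" | "p > 1" "q < 1" "p * q < 1" | "p > 1" "q < 1" "p * q > 1"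
    | "p < 1" "q > 1" "p * q < 1" | "p < 1" "q > 1" "p * q > 1" by blast
  then show False
  proof cases
    case 1 then show ?thesis using contr[OF pq(1) _ pq(2) _ D] by simp
  next
    case 2 then have "inverse p < 1" "inverse q < 1" by (simp_all add: inverse_less_1_iff)
    then show ?thesis using contr[OF ip(1) _ ip(2) _ D'] by simp
  next
    case 3 then show ?thesis using main[OF _ pq(2) _ _ D] by simp
  next
    case 4 then have "inverse q > 1" "inverse p < 1" using pq
      by (simp_all add: one_less_inverse_iff inverse_less_1_iff)
    moreover have "inverse q * inverse p < 1" using ipq 4 by (simp only: mult.commute)
    ultimately have "inverse q > 1" "inverse p < 1" "inverse q * inverse p < 1" by blast+
    then show ?thesis using main'[OF _ ip(1) _ _ D'] by simp
  next
    case 5 then show ?thesis using main'[OF _ pq(1) _ _ D] by (simp add: mult.commute)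
  next
    case 6 then have "inverse p > 1" "inverse q < 1" using pq
      by (simp_all add: one_less_inverse_iff inverse_less_1_iff)
    then show ?thesis using main[OF _ ip(2) _ ipq[OF 6(3)] D'] by simp
  qed
qed

text \<open>Conjugation by \<open>dg d\<close> scales the off-diagonal entries by \<open>D\<close>
  and \<open>1 / D\<close>. Comparing entries of the two products annihilates the product of the
  off-diagonal entries and their products with the difference of the diagonal ones.\<close>

lemma diag_conj_commute:
  fixes m :: mat2
  assumes c: "m ** (dg d ** m ** adj (dg d)) = (dg d ** m ** adj (dg d)) ** m" and d: "d > 0" "d \<noteq> 1"
  shows "m$1$2 = 0 \<and> m$2$1 = 0 \<or> (m$1$1 = m$2$2 \<and> (m$1$2 = 0 \<or> m$2$1 = 0))"
proof -
  define D where "D = d * d"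
  have D: "D > 0" "D \<noteq> 1" using d by (auto simp: D_def square_eq_1_iff)
  have "inverse d * (m$2$1) * inverse d = m$2$1 / D" "d * m$1$2 * d = D * m$1$2" by (simp_all add: D_def field_simps)
  then have e: "dg d ** m ** adj (dg d) = mk2 (m$1$1) (D * m$1$2) (m$2$1 / D) (m$2$2)" using d by (simp add: mat2_eq_iff)
  have "(m ** mk2 (m$1$1) (D * m$1$2) (m$2$1 / D) (m$2$2))$i$j = (mk2 (m$1$1) (D * m$1$2) (m$2$1 / D) (m$2$2) ** m)$i$j" for i j
    using c e by simp
  from this[of 1 1] this[of 1 2] this[of 2 1]
  have "m$1$2 * (m$2$1 / D) = D * m$1$2 * m$2$1" "m$1$1 * (D * m$1$2) + m$1$2 * m$2$2 = m$1$1 * m$1$2 + D * m$1$2 * m$2$2"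
    "m$2$1 * m$1$1 + m$2$2 * (m$2$1 / D) = m$2$1 / D * m$1$1 + m$2$2 * m$2$1" by simp_all
  then have q: "m$1$2 * m$2$1 = (D * D) * (m$1$2 * m$2$1)" "(D - 1) * (m$1$2 * (m$1$1 - m$2$2)) = 0" "(D - 1) * (m$2$1 * (m$1$1 - m$2$2)) = 0"
    using D(1) by (simp_all add: field_simps)
  have "D * D \<noteq> 1" using D by (simp add: square_eq_1_iff)
  then have "m$1$2 * m$2$1 = 0" using q(1) by (metis mult_cancel_right1)
  then show ?thesis using q D by auto
qed

context irr22 begin

text \<open>The pairs \<open>(s, t)\<close> with \<open>(f1 s, f2 t)\<close> in \<open>L\<close>
  form a discrete subgroup of the plane, invariant under conjugation by the given element. If both
  components are upper or both lower, the determinant differs from 1 because \<open>d1 * d2\<close>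
  does; if they are opposite, because \<open>d1\<close> and \<open>d2\<close> differ.\<close>

lemma no_unipotent:
  assumes \<gamma>: "(dg d1, dg d2) \<in> L" and d: "0 < d1" "0 < d2" "d1 \<noteq> 1" "d2 \<noteq> 1" "d1 \<noteq> d2" "d1 * d2 \<noteq> 1"
    and f: "f1 \<in> {nn, nm}" "f2 \<in> {nn, nm}" and m: "(f1 b, f2 c) \<in> L" "b \<noteq> 0" "c \<noteq> 0"
  shows False
proof -
  \<comment> \<open>The factor by which conjugation by \<open>dg d\<close> scales the parameter of
    \<open>nn\<close> or \<open>nm\<close>.\<close>
  define e :: "(real \<Rightarrow> mat2) \<Rightarrow> real \<Rightarrow> real" where "e = (\<lambda>f d. if f = nn then d * d else inverse (d * d))"
  have ne: "nn \<noteq> nm"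
  proof
    assume "nn = nm" then have "nn 1$1$2 = nm 1$1$2" by simp then show False by simp
  qed
  have fadd: "f (s + t) = f s ** f t" if "f \<in> {nn, nm}" for f s t using that by (auto simp: mat2_eq_iff)
  have fneg: "f (- t) = adj (f t)" if "f \<in> {nn, nm}" for f t using that by (auto simp: mat2_eq_iff)
  have fcj: "f (e f d * t) = dg d ** f t ** adj (dg d)" if "f \<in> {nn, nm}" "d > 0" for f t d 
    using that ne by (auto simp: mat2_eq_iff e_def)
  have fn: "norm (f t - mat 1) = \<bar>t\<bar>" if "f \<in> {nn, nm}" for f t
  proof -
    have "(norm (f t - mat 1))\<^sup>2 = \<bar>t\<bar>\<^sup>2" using that unfolding norm_mat2_sq by auto
    then show ?thesis by (metis abs_ge_zero norm_ge_zero power2_eq_iff_nonneg)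
  qed
  have ei: "e f (inverse d) = inverse (e f d)" for f d by (auto simp: e_def)
  obtain r where r: "r > 0" "\<And>x. x \<in> L \<Longrightarrow> norm (x - pone) < r \<Longrightarrow> x = pone" using discrete by blast
  have dgi: "adj (dg t) = dg (inverse t)" for t by (simp add: mat2_eq_iff)
  show False
  proof (rule no_contracting_lattice[of "\<lambda>s t. (f1 s, f2 t) \<in> L" "e f1 d1" "e f2 d2" "r / 2" b c])
    show "(f1 (a + c), f2 (b + d)) \<in> L" if "(f1 a, f2 b) \<in> L" "(f1 c, f2 d) \<in> L" for a b c d
      using mul_in[OF that] f by (simp add: fadd pmul_def)
    show "(f1 (- a), f2 (- b)) \<in> L" if "(f1 a, f2 b) \<in> L" for a b
      using inv_in[OF that] f by (simp add: fneg pinv_def)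
    show "(f1 (e f1 d1 * a), f2 (e f2 d2 * b)) \<in> L" if "(f1 a, f2 b) \<in> L" for a b
      using mul_in[OF mul_in[OF \<gamma> that] inv_in[OF \<gamma>]] f d by (simp add: fcj pmul_def pinv_def)
    show "(f1 (inverse (e f1 d1) * a), f2 (inverse (e f2 d2) * b)) \<in> L" if "(f1 a, f2 b) \<in> L" for a b
    proof -
      have "(f1 (e f1 (inverse d1) * a), f2 (e f2 (inverse d2) * b)) \<in> L"
        using mul_in[OF mul_in[OF inv_in[OF \<gamma>] that] \<gamma>] f d fcj[of f1 "inverse d1" a] fcj[of f2 "inverse d2" b]
        by (simp add: pmul_def pinv_def dgi)
      then show ?thesis by (simp add: ei)
    qed
    show "a = 0 \<and> b = 0" if "(f1 a, f2 b) \<in> L" "\<bar>a\<bar> < r / 2" "\<bar>b\<bar> < r / 2" for a b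
    proof -
      have "norm ((f1 a, f2 b) - pone) \<le> norm (f1 a - mat 1) + norm (f2 b - mat 1)"
        using norm_Pair_le_add[of "(f1 a, f2 b) - pone"] by simp
      then have "norm ((f1 a, f2 b) - pone) < r" using that fn f by simp
      then have "(f1 a, f2 b) = pone" using r(2) that(1) by blast
      then have "norm (f1 a - mat 1) = 0" "norm (f2 b - mat 1) = 0" by (simp_all add: pone_def)
      then show ?thesis using fn[OF f(1), of a] fn[OF f(2), of b] by simp
    qed
    have s1: "d1 * d1 \<noteq> 1" "d2 * d2 \<noteq> 1" using d by (auto simp: square_eq_1_iff)
    show "e f1 d1 \<noteq> 1" "e f2 d2 \<noteq> 1" "0 < e f1 d1" "0 < e f2 d2" using d s1
      by (auto simp: e_def simp del: inverse_mult_distrib)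
    have "(d1 * d1) * (d2 * d2) \<noteq> 1"
    proof
      assume "(d1 * d1) * (d2 * d2) = 1"
      then have "(d1 * d2) * (d1 * d2) = 1" by (simp add: mult_ac)
      then show False using d by (auto simp: square_eq_1_iff) (smt (verit) mult_pos_pos)
    qed
    moreover have "d1 * d1 \<noteq> d2 * d2" using d by (metis less_le_not_le mult_strict_mono' not_less_iff_gr_or_eq)
    ultimately show "e f1 d1 * e f2 d2 \<noteq> 1"
      using d by (auto simp: e_def field_simps)
  qed (use r m in auto)
qed

text \<open>The base points \<open>h n\<close> commute with \<open>g\<close>. A small element of a
  conjugate by \<open>h n\<close> commutes with its conjugate by \<open>g\<close>, so its components
  are diagonal or unipotent; pairs of nontrivial unipotents are excluded, and diagonal elements are
  unchanged by \<open>h n\<close>, hence trivial when small. So packing applies, and the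
  \<open>t\<close> obtained nearly commutes with \<open>g\<close>. Its commutator with
  \<open>g\<close> is small, thus trivial, and \<open>t\<close> is diagonal and close to
  \<open>h j\<close> times the inverse of \<open>h i\<close>.\<close>

lemma torus_small:
  assumes \<gamma>: "(dg d1, dg d2) \<in> L" and d: "0 < d1" "0 < d2" "d1 \<noteq> 1" "d2 \<noteq> 1" "d1 \<noteq> d2" "d1 * d2 \<noteq> 1"
    and M: "M > 0" and \<epsilon>: "\<epsilon> > 0"
  shows "\<exists>x y. (dg x, dg y) \<in> L \<and> 0 < x \<and> x * M \<le> 1 \<and> 0 < y \<and> \<bar>ln y\<bar> < \<epsilon>"
proof -
  define g where "g = (dg d1, dg d2)"
  have gL: "g \<in> L" and gS: "g \<in> SS" using \<gamma> by (simp_all add: g_def)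
  define K where "K = norm g + 1"
  have K: "K \<ge> 1" "norm g \<le> K" by (auto simp: K_def)
  obtain r0 where r0: "r0 > 0" "\<And>x. x \<in> L \<Longrightarrow> norm (x - pone) < r0 \<Longrightarrow> x = pone" using discrete by blast
  define r where "r = min (r0) (1 / (64 * (K * K)))"
  have r: "r > 0" "r \<le> r0" "r \<le> 1/64" "r * (K * K) < 1/32"
  proof -
    show "r > 0" "r \<le> r0" using r0 K by (auto simp: r_def)
    have "r \<le> 1 / (64 * (K * K))" by (simp add: r_def)
    also have "\<dots> \<le> 1/64" using K by (simp add: mult_ge1_I)
    finally show "r \<le> 1/64" .
    have "r * (K * K) \<le> 1 / (64 * (K * K)) * (K * K)" using K by (intro mult_right_mono) (auto simp: r_def)
    then show "r * (K * K) < 1/32" using K by simp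
  qed
  \<comment> \<open>The factor 2 is spent on the first entry of \<open>w\<close>, known only to be
    at least 1/2.\<close>
  define B where "B = 2 * max 1 M"
  have B: "B \<ge> 2" "B \<ge> 2 * M" by (auto simp: B_def)
  define h where "h n = (dg (B ^ n), mat 1 :: mat2)" for n :: nat
  have hS: "h n \<in> SS" for n using B by (simp add: h_def SS_def)
  have dgc: "dg s ** dg t = dg t ** dg s" for s t by (simp add: mult.commute flip: dg_mult)
  have hg: "h n \<star> g = g \<star> h n" for n by (simp add: h_def g_def pmul_def dgc)
  have hg': "pinv (h n) \<star> g = g \<star> pinv (h n)" for n
  proof -
    have "pinv (h n) \<star> (h n \<star> g) \<star> pinv (h n) = pinv (h n) \<star> (g \<star> h n) \<star> pinv (h n)" by (simp add: hg)
    then show ?thesis using hS[of n] by (simp add: pmul_assoc)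
  qed
  have cg: "cj (h n) g = g" for n using hS[of n] hg[of n] by (simp add: cj_def pmul_assoc flip: hg)
  have small: "m = pone" if m: "m \<in> L" "norm (cj (h n) m - pone) < r" for m n
  proof -
    let ?m' = "g \<star> m \<star> pinv g"
    have mS: "m \<in> SS" using m by simp
    have m'L: "?m' \<in> L" using gL m by (intro mul_in inv_in)
    have "cj (h n) ?m' = g \<star> cj (h n) m \<star> pinv g" using hS[of n] by (simp add: cj_pmul cj_pinv cg)
    then have "norm (cj (h n) ?m' - pone) \<le> K * K * norm (cj (h n) m - pone)" using norm_conj_minus_one[OF gS K(2)] by simp
    also have "\<dots> \<le> K * K * r" using m(2) by (intro mult_left_mono) auto
    finally have "norm (cj (h n) ?m' - pone) < 1/32" using r(4) by (simp add: mult_ac)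
    then have comm: "m \<star> ?m' = ?m' \<star> m" using small_commute_cj[OF hS m(1) m'L, of n] m(2) r(3) by linarith
    have "fst m ** (dg d1 ** fst m ** adj (dg d1)) = (dg d1 ** fst m ** adj (dg d1)) ** fst m"
      "snd m ** (dg d2 ** snd m ** adj (dg d2)) = (dg d2 ** snd m ** adj (dg d2)) ** snd m"
      using comm by (simp_all add: pmul_def pinv_def g_def)
    from this[THEN diag_conj_commute] 
    have s1: "fst m$1$2 = 0 \<and> fst m$2$1 = 0 \<or> (fst m$1$1 = fst m$2$2 \<and> (fst m$1$2 = 0 \<or> fst m$2$1 = 0))"
      and s2: "snd m$1$2 = 0 \<and> snd m$2$1 = 0 \<or> (snd m$1$1 = snd m$2$2 \<and> (snd m$1$2 = 0 \<or> snd m$2$1 = 0))"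
      using d by blast+
    have e1: "norm (fst (cj (h n) m) - mat 1) < r" "norm (snd (cj (h n) m) - mat 1) < r"
      using m(2) norm_fst_diff[of "cj (h n) m" pone] norm_snd_diff[of "cj (h n) m" pone] by auto
    have B0: "B ^ n \<noteq> 0" using B by simp
    have c1: "fst (cj (h n) m)$1$1 = fst m$1$1" "fst (cj (h n) m)$2$2 = fst m$2$2" "snd (cj (h n) m) = snd m"
      using B0 by (simp_all add: fst_cj snd_cj h_def)
    have "\<bar>(fst (cj (h n) m) - mat 1)$1$1\<bar> < r" "\<bar>(fst (cj (h n) m) - mat 1)$2$2\<bar> < r"
      "\<bar>(snd (cj (h n) m) - mat 1)$1$1\<bar> < r" "\<bar>(snd (cj (h n) m) - mat 1)$2$2\<bar> < r"
      using norm_ge_entry e1 le_less_trans by blast+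
    then have en: "\<bar>fst m$1$1 - 1\<bar> < r" "\<bar>fst m$2$2 - 1\<bar> < r" "\<bar>snd m$1$1 - 1\<bar> < r" "\<bar>snd m$2$2 - 1\<bar> < r" by (simp_all add: c1)
    have det: "det (fst m) = 1" "det (snd m) = 1" using SS_D mS by blast+
    have tr: "trace (fst m) > 0" "trace (snd m) > 0" using en r(3) by (auto simp: trace_def sum_2)
    have cdiag: "A ** dg t = dg t ** A \<longleftrightarrow> A$1$2 = 0 \<and> A$2$1 = 0" if "t > 0" "t \<noteq> 1" for A :: mat2 and t
    proof -
      have "t \<noteq> inverse t" using that by (metis inverse_eq_1_iff less_imp_neq not_less_iff_gr_or_eq one_less_inverse_iff inverse_less_1_iff)
      then show ?thesis by (auto simp: mat2_eq_iff)
    qed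
    \<comment> \<open>Being diagonal means commuting with \<open>g\<close>, and this passes from one
      component to the other. So no element is diagonal in one component and unipotent in the other,
      unless trivially.\<close>
    have sw: "fst m$1$2 = 0 \<and> fst m$2$1 = 0 \<longleftrightarrow> snd m$1$2 = 0 \<and> snd m$2$1 = 0"
    proof
      assume "snd m$1$2 = 0 \<and> snd m$2$1 = 0"
      then have "snd m ** snd g = snd g ** snd m" using cdiag d by (simp add: g_def)
      then have "fst m ** fst g = fst g ** fst m" using commute_fst_of_snd[OF m(1) gL _ tr(1)] by blast
      then show "fst m$1$2 = 0 \<and> fst m$2$1 = 0" using cdiag d by (simp add: g_def)
    next
      interpret s: irr22 "prod.swap ` L" by (rule irr22_swap) unfold_locales
      assume "fst m$1$2 = 0 \<and> fst m$2$1 = 0"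
      then have "fst m ** fst g = fst g ** fst m" using cdiag d by (simp add: g_def)
      then have "snd m ** snd g = snd g ** snd m" 
        using s.commute_fst_of_snd[of "prod.swap m" "prod.swap g"] m(1) gL tr(2) by simp
      then show "snd m$1$2 = 0 \<and> snd m$2$1 = 0" using cdiag d by (simp add: g_def)
    qed
    show ?thesis
    proof (cases "fst m$1$2 = 0 \<and> fst m$2$1 = 0")
      case True
      then have "fst (cj (h n) m) = fst m" using c1 by (simp add: mat2_eq_iff fst_cj h_def)
      then have "cj (h n) m = m" using c1 by (simp add: prod_eq_iff)
      then show ?thesis using m r r0(2)[of m] by simp
    next
      case False
      have uni: "\<exists>f\<in>{nn, nm}. \<exists>b. b \<noteq> 0 \<and> A = f b" 
        if "det A = 1" "\<bar>A$1$1 - 1\<bar> < r" "A$1$1 = A$2$2" "A$1$2 = 0 \<or> A$2$1 = 0" "\<not> (A$1$2 = 0 \<and> A$2$1 = 0)" for A :: mat2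
      proof -
        have "A$1$1 * A$1$1 = 1" using that by (auto simp: det_2)
        then have "A$1$1 = 1" using that(2) r(3) by (auto simp: square_eq_1_iff)
        then show ?thesis using that
          by (cases "A$1$2 = 0") (auto simp: mat2_eq_iff)
      qed
      obtain f1 b where f1: "f1 \<in> {nn, nm}" "b \<noteq> 0" "fst m = f1 b" using uni[OF det(1) en(1)] s1 False by blast
      obtain f2 c where f2: "f2 \<in> {nn, nm}" "c \<noteq> 0" "snd m = f2 c" using uni[OF det(2) en(3)] s2 False sw by blast
      have "(f1 b, f2 c) \<in> L" using m(1) f1(3) f2(3) by (metis prod.collapse)
      then show ?thesis using no_unipotent[OF \<gamma> d f1(1) f2(1) _ f1(2) f2(2)] by blast
    qed
  qed
  \<comment> \<open>The three bounds serve, in this order, to keep the first entry of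
    \<open>w\<close> above 1/2, to make the commutator with \<open>g\<close> smaller than
    \<open>r\<close>, and to keep the logarithm of the second factor below
    \<open>\<epsilon>\<close>.\<close>
  define r' where "r' = min (1/4) (min (r / (64 * K * K)) ((1 - exp (- \<epsilon> / 2)) / 2))"
  have eps: "exp (- \<epsilon> / 2) < 1" using \<epsilon> by simp
  have r'p: "r' > 0" "r' \<le> 1/4" "r' * (64 * K * K) \<le> r" "2 * r' \<le> 1 - exp (- \<epsilon> / 2)"
  proof -
    show "r' > 0" using r K eps by (auto simp: r'_def)
    have "r' \<le> (1 - exp (- \<epsilon> / 2)) / 2" unfolding r'_def by (meson min.cobounded2 order_trans)
    then show "2 * r' \<le> 1 - exp (- \<epsilon> / 2)" by simp
    show "r' \<le> 1/4" by (simp add: r'_def)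
    have "r' \<le> r / (64 * K * K)" by (simp add: r'_def)
    then show "r' * (64 * K * K) \<le> r" using K by (simp add: field_simps)
  qed
  have "\<exists>i j. i < j \<and> (\<exists>\<gamma>\<in>L. norm (pinv (h j) \<star> \<gamma> \<star> h i - pone) < r')"
    using packing[OF r(1), of h] hS small r'p(1) unfolding cj_def by blast
  then obtain i j t where ij: "i < j" "t \<in> L" "norm (pinv (h j) \<star> t \<star> h i - pone) < r'" by blast
  define w where "w = pinv (h j) \<star> t \<star> h i"
  have tS: "t \<in> SS" using ij(2) by simp
  have wS: "w \<in> SS" using tS hS by (simp add: w_def)
  have wn: "norm (w - pone) < r'" using ij(3) by (simp add: w_def)
  have tw: "t = h j \<star> w \<star> pinv (h i)" using hS[of i] hS[of j] by (simp add: w_def pmul_assoc)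
  let ?c = "t \<star> g \<star> pinv t \<star> pinv g"
  have cw: "cj (h j) ?c = w \<star> g \<star> pinv w \<star> pinv g"
  proof -
    have "pinv (h j) \<star> t = w \<star> pinv (h i)" using hS[of i] by (simp add: w_def pmul_assoc)
    moreover have "pinv t = h i \<star> pinv w \<star> pinv (h j)" by (simp add: tw pinv_mul pmul_assoc)
    ultimately have "cj (h j) ?c = w \<star> (pinv (h i) \<star> g \<star> h i) \<star> pinv w \<star> (pinv (h j) \<star> pinv g \<star> h j)"
      by (simp add: cj_def pmul_assoc flip: pmul_assoc[of "pinv (h j)" t])
    moreover have "pinv (h j) \<star> pinv g \<star> h j = pinv g" using cg[of j] cj_pinv[of "h j" g] by (simp add: cj_def)
    moreover have "pinv (h i) \<star> g \<star> h i = g" using cg[of i] by (simp add: cj_def)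
    ultimately show ?thesis by simp
  qed
  have "w \<star> g \<star> pinv w \<star> pinv g - pone = ((w - pone) \<star> g - g \<star> (w - pone)) \<star> (pinv w \<star> pinv g)"
    using wS gS by (simp add: pmul.diff_left pmul.diff_right pmul_assoc)
  then have "norm (w \<star> g \<star> pinv w \<star> pinv g - pone) \<le> norm ((w - pone) \<star> g - g \<star> (w - pone)) * norm (pinv w \<star> pinv g)"
    using norm_pmul by simp
  also have "\<dots> \<le> (2 * K * r') * (3 * K)"
  proof (intro mult_mono)
    have "norm (w - pone) * norm g \<le> r' * K" using wn K r'p by (intro mult_mono) auto
    then show "norm ((w - pone) \<star> g - g \<star> (w - pone)) \<le> 2 * K * r'"
      using norm_triangle_ineq4[of "(w - pone) \<star> g" "g \<star> (w - pone)"] norm_pmul[of "w - pone" g]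
        norm_pmul[of g "w - pone"] by (simp add: mult.commute mult.left_commute)
    have "norm (pinv w \<star> pinv g) \<le> norm w * norm g" using norm_pmul[of "pinv w" "pinv g"] by simp
    also have "\<dots> \<le> 3 * K" using norm_triangle_sub[of w pone] wn r'p K by (intro mult_mono) auto
    finally show "norm (pinv w \<star> pinv g) \<le> 3 * K" .
  qed (use r'p K in auto)
  also have "\<dots> < r"
  proof -
    have "(2 * K * r') * (3 * K) = 6 / 64 * (r' * (64 * K * K))" by simp
    also have "\<dots> \<le> 6 / 64 * r" using r'p(3) by (intro mult_left_mono) auto
    finally show ?thesis using r(1) by linarith
  qed
  finally have "norm (cj (h j) ?c - pone) < r" by (simp add: cw)
  moreover have "?c \<in> L" using ij(2) gL by (intro mul_in inv_in)
  ultimately have "?c = pone" using small by blast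
  then have "?c \<star> g \<star> t = g \<star> t" by simp
  then have comm: "t \<star> g = g \<star> t" using gS tS by (simp add: pmul_assoc)
  have cdiag: "A$1$2 = 0 \<and> A$2$1 = 0" if "A ** dg t = dg t ** A" "t > 0" "t \<noteq> 1" for A :: mat2 and t
  proof -
    have "t \<noteq> inverse t" using that(2,3) by (metis inverse_eq_1_iff less_imp_neq not_less_iff_gr_or_eq one_less_inverse_iff inverse_less_1_iff)
    then show ?thesis using that(1) by (auto simp: mat2_eq_iff)
  qed
  have "fst t ** dg d1 = dg d1 ** fst t" "snd t ** dg d2 = dg d2 ** snd t" using comm by (simp_all add: pmul_def g_def)
  then have z: "fst t$1$2 = 0 \<and> fst t$2$1 = 0" "snd t$1$2 = 0 \<and> snd t$2$1 = 0" using cdiag d by blast+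
  define a e where "a = fst t$1$1" "e = snd t$1$1"
  have det: "det (fst t) = 1" "det (snd t) = 1" using SS_D tS by blast+
  then have "a * fst t$2$2 = 1" "e * snd t$2$2 = 1" using z by (simp_all add: det_2 a_e_def)
  then have ae: "fst t$2$2 = inverse a" "snd t$2$2 = inverse e" "a \<noteq> 0" "e \<noteq> 0"
    using inverse_unique by force+
  have tdg: "t = (dg a, dg e)" using z ae by (simp add: prod_eq_iff mat2_eq_iff a_e_def)
  have "norm (fst w - mat 1) < r'" "norm (snd w - mat 1) < r'"
    using wn norm_fst_diff[of w pone] norm_snd_diff[of w pone] by auto
  then have "\<bar>(fst w - mat 1)$1$1\<bar> < r'" "\<bar>(snd w - mat 1)$1$1\<bar> < r'" using norm_ge_entry le_less_trans by blast+
  then have w1: "\<bar>fst w$1$1 - 1\<bar> < r'" "\<bar>snd w$1$1 - 1\<bar> < r'" by simp_all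
  have Bp: "B ^ i > 0" "B ^ j > 0" using B by simp_all
  have "fst w$1$1 = inverse (B ^ j) * a * B ^ i" using tdg by (simp add: w_def h_def)
  then have a1: "a = B ^ j / B ^ i * fst w$1$1" using Bp B by (simp add: field_simps)
  have e1: "e = snd w$1$1" using tdg by (simp add: w_def h_def)
  have "B ^ j / B ^ i = B ^ (j - i)" using ij(1) B by (simp add: power_diff)
  moreover have "B ^ (j - i) \<ge> B" using ij(1) B self_le_power[of B "j - i"] by simp
  ultimately have ab: "B ^ j / B ^ i \<ge> B" by simp
  have wp: "fst w$1$1 \<ge> 1/2" "snd w$1$1 > 0" using w1 r'p by linarith+
  have "a \<ge> B * (1/2)" unfolding a1 using ab wp B by (intro mult_mono) auto
  then have aM: "a \<ge> M" "a > 0" using B by auto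
  have "\<bar>ln e\<bar> < \<epsilon>"
  proof -
    have "1 - 2 * r' > 0 \<and> exp (- \<epsilon>/2) \<le> 1 - 2 * r'" using r'p by (smt (verit) exp_gt_zero)
    then have lo: "e > exp (- \<epsilon> / 2)" using w1 r'p unfolding e1 by linarith
    have "e < 1 + r'" using w1 unfolding e1 by linarith
    also have "\<dots> \<le> inverse (1 - 2 * r')" using r'p by (simp add: field_simps)
    also have "\<dots> \<le> inverse (exp (- \<epsilon> / 2))" using r'p by (intro le_imp_inverse_le) auto
    finally have up: "e < exp (\<epsilon> / 2)" by (simp add: exp_minus)
    have "- \<epsilon> / 2 < ln e" using lo wp unfolding e1 by (metis exp_gt_zero ln_exp ln_less_cancel_iff)
    moreover have "ln e < \<epsilon> / 2" using up wp unfolding e1 by (metis exp_gt_zero ln_exp ln_less_cancel_iff)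
    ultimately show ?thesis using \<epsilon> by auto
  qed
  \<comment> \<open>Since \<open>i < j\<close>, the entry \<open>a\<close> is large; the required
    small \<open>x\<close> belongs to the inverse.\<close>
  moreover have "pinv t = (dg (inverse a), dg (inverse e))" unfolding tdg pinv_def by (simp add: mat2_eq_iff)
  then have "(dg (inverse a), dg (inverse e)) \<in> L" using inv_in[OF ij(2)] by simp
  moreover have "inverse a * M \<le> 1" using aM by (simp add: field_simps)
  moreover have "e > 0" using wp e1 by simp
  ultimately show ?thesis using aM by (intro exI[of _ "inverse a"] exI[of _ "inverse e"]) (auto simp: ln_inverse)
qed

text \<open>An element with \<open>ln y\<close> small but nonzero has powers that pass the real line
  in short steps, so one of them brings \<open>y\<close> near \<open>Y\<close>; a further element
  with tiny \<open>x\<close> and \<open>y\<close> near 1 corrects the first component.\<close>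

lemma torus_dense:
  assumes \<gamma>: "(dg d1, dg d2) \<in> L" and d: "0 < d1" "0 < d2" "d1 \<noteq> 1" "d2 \<noteq> 1" "d1 \<noteq> d2" "d1 * d2 \<noteq> 1"
    and Y: "Y > 0" "\<epsilon> > 0"
  shows "\<exists>x y. (dg x, dg y) \<in> L \<and> 0 < x \<and> x * T \<le> 1 \<and> 0 < y \<and> \<bar>y - Y\<bar> < \<epsilon>"
proof -
  have "isCont exp (ln Y)" by simp
  then obtain \<delta> where \<delta>: "\<delta> > 0" "\<And>t. \<bar>t - ln Y\<bar> < \<delta> \<Longrightarrow> \<bar>exp t - Y\<bar> < \<epsilon>"
    using Y unfolding continuous_at_eps_delta dist_real_def by (metis exp_ln)
  have h2: "(0::real) < 2" "\<delta> / 2 > 0" using \<delta> by auto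
  obtain x0 y0 where 0: "(dg x0, dg y0) \<in> L" "0 < x0" "x0 * 2 \<le> 1" "0 < y0" "\<bar>ln y0\<bar> < \<delta> / 2"
    using torus_small[OF \<gamma> d h2] by blast
  define \<tau> where "\<tau> = ln y0"
  \<comment> \<open>Otherwise \<open>(dg x0, mat 1)\<close> would be a nontrivial element with a
    trivial component; \<open>x0 * 2 \<le> 1\<close> ensures that \<open>x0\<close> is not
    1.\<close>
  have "\<tau> \<noteq> 0"
  proof
    assume "\<tau> = 0" then have "y0 = 1" using 0 by (simp add: \<tau>_def)
    then have "tl2 (dg x0) = 0" using trivial_snd[OF 0(1)] by (simp add: dg_1 tl2_mat1)
    then have "tl2 (dg x0)$1$1 = 0" by (simp del: tl2_nth)
    then have "x0 = inverse x0" by simp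
    moreover have "inverse x0 > 1" using 0 by (simp add: one_less_inverse_iff)
    ultimately show False using 0 by simp
  qed
  define k where "k = \<lfloor>ln Y / \<tau>\<rfloor>"
  have pw: "(dg (exp (of_int k * ln x0)), dg (exp (of_int k * \<tau>))) \<in> L" for k
  proof -
    have n: "(dg (x ^ n), dg (y ^ n)) \<in> L" if "(dg x, dg y) \<in> L" for x y n
    proof (induction n)
      case 0 show ?case using one_in by (simp add: dg_1 pone_def)
    next
      case (Suc n) show ?case using mul_in[OF that Suc] by (simp add: pmul_def dg_mult)
    qed
    have e: "exp (real n * ln x) = x ^ n" if "x > 0" for x n using that by (simp add: exp_of_nat_mult)
    show ?thesis
    proof (cases "k \<ge> 0")
      case True then show ?thesis using n[OF 0(1), of "nat k"] e[OF 0(2), of "nat k"] e[OF 0(4), of "nat k"] by (simp add: \<tau>_def)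
    next
      case False
      have i: "(dg (inverse x0), dg (inverse y0)) \<in> L" using inv_in[OF 0(1)] unfolding pinv_def by (simp add: adj_def dg_def)
      show ?thesis using n[OF i, of "nat (- k)"] e[of "inverse x0" "nat (- k)"] e[of "inverse y0" "nat (- k)"] 0 False by (simp add: \<tau>_def ln_inverse)
    qed
  qed
  have "of_int k \<le> ln Y / \<tau>" "ln Y / \<tau> < of_int k + 1" unfolding k_def by linarith+
  then have "\<bar>of_int k - ln Y / \<tau>\<bar> \<le> 1" by linarith
  then have "\<bar>of_int k - ln Y / \<tau>\<bar> * \<bar>\<tau>\<bar> \<le> 1 * \<bar>\<tau>\<bar>" by (intro mult_right_mono) auto
  then have kt: "\<bar>of_int k * \<tau> - ln Y\<bar> \<le> \<bar>\<tau>\<bar>" using \<open>\<tau> \<noteq> 0\<close> unfolding abs_mult[symmetric] by (simp add: left_diff_distrib)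
  define X where "X = exp (of_int k * ln x0)"
  \<comment> \<open>The power fixes \<open>y\<close> but leaves an uncontrolled first component
    \<open>X\<close>, for which \<open>x1\<close> has to compensate. The maximum with 1 provides the
    positive bound that \<open>torus_small\<close> requires.\<close>
  have "X * max T 1 > 0" by (simp add: X_def)
  then obtain x1 y1 where 1: "(dg x1, dg y1) \<in> L" "0 < x1" "x1 * (X * max T 1) \<le> 1" "0 < y1" "\<bar>ln y1\<bar> < \<delta> / 2"
    using torus_small[OF \<gamma> d _ h2(2)] by blast
  have "(dg (X * x1), dg (exp (of_int k * \<tau>) * y1)) \<in> L" using mul_in[OF pw[of k] 1(1)] by (simp add: pmul_def dg_mult X_def)
  moreover have "exp (of_int k * \<tau>) * y1 = exp (of_int k * \<tau> + ln y1)" using 1 by (simp add: exp_add)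
  moreover have "\<bar>of_int k * \<tau> + ln y1 - ln Y\<bar> < \<delta>" using kt 1(5) 0(5) unfolding \<tau>_def by linarith
  moreover have "X * x1 * T \<le> 1"
  proof -
    have "X * x1 * T \<le> X * x1 * max T 1" using 1 by (intro mult_left_mono) (auto simp: X_def)
    then show ?thesis using 1(3) by (simp add: mult_ac)
  qed
  ultimately show ?thesis using \<delta>(2) 1 by (intro exI[of _ "X * x1"] exI[of _ "exp (of_int k * \<tau>) * y1"]) (auto simp: X_def)
qed

end

section \<open>Dense semi-orbits\<close>

definition rot :: "real \<Rightarrow> mat2" where "rot t = mk2 (cos t) (- sin t) (sin t) (cos t)"

lemma rot_nth [simp]: "rot t$1$1 = cos t" "rot t$1$2 = - sin t" "rot t$2$1 = sin t" "rot t$2$2 = cos t"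
  by (auto simp: rot_def)

lemma rot_add: "rot (s + t) = rot s ** rot t" by (simp add: mat2_eq_iff cos_add sin_add)
lemma det_rot [simp]: "det (rot t) = 1" by (simp add: det_2 flip: power2_eq_square)
lemma rot_0: "rot 0 = mat 1" by (simp add: mat2_eq_iff)
lemma adj_rot: "adj (rot t) = rot (- t)" by (simp add: mat2_eq_iff)
lemma rot_periodic: "rot (t + 2 * pi * of_int k) = rot t"
  by (simp add: mat2_eq_iff cos_add sin_add)

text \<open>The affine maps act transitively on the upper half-plane, so an upper triangular
  \<open>q\<close> takes i to the fixed point of \<open>k\<close>. Triangularity matters:
  conjugation by \<open>q\<close> then preserves the upper triangular group, in which the flow only
  contracts.\<close>

lemma elliptic_normal_form:
  assumes "det k = 1" "det (tl2 k) > 0"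
  shows "\<exists>q t. det q = 1 \<and> q$2$1 = 0 \<and> k = q ** rot t ** adj q"
proof -
  define a b c e where "a = k$1$1" "b = k$1$2" "c = k$2$1" "e = k$2$2"
  define C where "C = (a + e) / 2"
  have det: "a * e - b * c = 1" using assms(1) by (simp add: det_2 a_b_c_e_def)
  have tr: "C * C < 1" using assms det_tl2[of k] by (simp add: trace_def sum_2 C_def a_b_c_e_def power2_eq_square field_simps)
  have c0: "c \<noteq> 0"
  proof
    assume "c = 0" then have "a * e = 1" using det by simp
    moreover have "4 * (C * C) = (a - e) * (a - e) + 4 * (a * e)" by (simp add: C_def field_simps)
    ultimately show False using tr zero_le_square[of "a - e"] by linarith
  qed
  \<comment> \<open>The sign of the sine must be that of the lower left entry \<open>c\<close>,
    since \<open>S / c\<close> becomes the square of the diagonal entry \<open>p\<close>.\<close>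
  define S where "S = sgn c * sqrt (1 - C * C)"
  have S2: "S * S = 1 - C * C" using tr c0 by (simp add: S_def sgn_if)
  have S0: "S \<noteq> 0" using S2 tr by auto
  have Sc: "S / c > 0" using tr c0 by (simp add: S_def sgn_if divide_pos_pos zero_less_divide_iff)
  define p where "p = sqrt (S / c)"
  have p: "p > 0" "p * p = S / c" using Sc unfolding p_def by (simp, simp only: real_sqrt_mult_self abs_of_pos)
  define s where "s = p * (a - e) / (2 * S)"
  have "C\<^sup>2 + S\<^sup>2 = 1" using S2 by (simp add: power2_eq_square)
  then obtain t where t: "cos t = C" "sin t = S" using sincos_total_2pi by metis
  define q where "q = mk2 p s 0 (inverse p)"
  have cp: "c * (p * p) = S" using p c0 by simp
  have sS: "2 * S * s = p * (a - e)" using S0 by (simp add: s_def)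
  have "q ** rot t ** adj q = mk2 (C + S * s / p) (- S * (s * s + p * p)) (S / (p * p)) (C - S * s / p)"
    using p(1) by (simp add: mat2_eq_iff q_def t field_simps)
  moreover have "C + S * s / p = a" "C - S * s / p = e" 
    using sS p(1) by (simp_all add: C_def field_simps)
  moreover have "S / (p * p) = c" using cp p(1) by (simp add: field_simps)
  moreover have "- S * (s * s + p * p) = b"
  proof -
    have "4 * S * S * (s * s) = p * p * ((a - e) * (a - e))" using sS by algebra
    then have "4 * S * S * c * (S * (s * s)) = S * S * ((a - e) * (a - e))" using cp by algebra
    then have "4 * c * (S * (s * s)) = (a - e) * (a - e)" using S0 by (simp add: mult_ac)
    moreover have "4 * c * (S * (p * p)) = 4 * S * (c * (p * p))" by (simp add: mult_ac)
    then have "4 * c * (S * (p * p)) = 4 * (S * S)" by (simp only: cp mult.assoc)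
    moreover have "4 * c * (S * (s * s + p * p)) = 4 * c * (S * (s * s)) + 4 * c * (S * (p * p))" by (simp add: distrib_left)
    moreover have "4 * (S * S) = 4 - (a + e) * (a + e)" using S2 by (simp add: C_def field_simps)
    ultimately have "4 * c * (S * (s * s + p * p)) = (a - e) * (a - e) + 4 - (a + e) * (a + e)" by simp
    also have "\<dots> = 4 * c * (- b)" using det by (simp add: algebra_simps)
    finally have "(4 * c) * (S * (s * s + p * p)) = (4 * c) * (- b)" .
    then have "S * (s * s + p * p) = - b" using c0 by (simp only: mult_cancel_left) simp
    then show ?thesis by simp
  qed
  ultimately have "k = q ** rot t ** adj q" by (simp add: mat2_eq_iff a_b_c_e_def)
  moreover have "det q = 1" "q$2$1 = 0" using p(1) by (simp_all add: q_def det_2)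
  ultimately show ?thesis by blast
qed

text \<open>Only the upper right entry is affected, and it shrinks: upper triangular errors do not
  grow under the flow.\<close>

lemma upper_contract:
  assumes "b$2$1 = 0" "s \<ge> 0"
  shows "norm (adj (dg (exp s)) ** b ** dg (exp s) - mat 1) \<le> norm (b - mat 1)"
proof (rule power2_le_imp_le)
  have e: "adj (dg (exp s)) ** b ** dg (exp s) = mk2 (b$1$1) (b$1$2 * exp (- (2 * s))) 0 (b$2$2)"
    using assms(1) by (simp add: mat2_eq_iff exp_minus field_simps flip: exp_add)
  have "\<bar>b$1$2 * exp (- (2 * s))\<bar> \<le> \<bar>b$1$2\<bar> * 1" unfolding abs_mult using assms(2) by (intro mult_left_mono) auto
  then have "(b$1$2 * exp (- (2 * s)))\<^sup>2 \<le> (b$1$2)\<^sup>2" by (simp add: abs_le_square_iff)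
  then show "(norm (adj (dg (exp s)) ** b ** dg (exp s) - mat 1))\<^sup>2 \<le> (norm (b - mat 1))\<^sup>2"
    unfolding e norm_mat2_sq using assms(1) by simp
qed simp

text \<open>Arbitrarily large parameters are demanded, so that \<open>dense_transfer\<close> can
  shrink bounded horocyclic displacements and absorb a diagonal factor.\<close>

definition dense_from :: "mat22 set \<Rightarrow> mat22 \<Rightarrow> bool" where
  "dense_from L c \<longleftrightarrow> (\<forall>V T. open V \<longrightarrow> V \<inter> SS \<noteq> {} \<longrightarrow>
     (\<exists>\<gamma>\<in>L. \<exists>x\<ge>T. \<exists>l\<ge>T. \<gamma> \<star> c \<star> (dg x, dg l) \<in> V))"

lemma open_pmul_nhd:
  assumes "open V" "z \<star> v \<in> V"
  obtains O1 \<rho> where "open O1" "v \<in> O1" "\<rho> > 0" "\<And>w n. w \<in> O1 \<Longrightarrow> norm (n - pone) < \<rho> \<Longrightarrow> z \<star> w \<star> n \<in> V"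
proof -
  have "open {p. z \<star> fst p \<star> snd p \<in> V}"
    using assms(1) by (auto intro!: open_vimage[of V "\<lambda>p. z \<star> fst p \<star> snd p", unfolded vimage_def] continuous_intros)
  moreover have "(v, pone) \<in> {p. z \<star> fst p \<star> snd p \<in> V}" using assms(2) by simp
  ultimately obtain O1 O2 where O: "open O1" "open O2" "(v, pone) \<in> O1 \<times> O2" "O1 \<times> O2 \<subseteq> {p. z \<star> fst p \<star> snd p \<in> V}"
    by (rule open_prod_elim)
  obtain \<rho> where \<rho>: "\<rho> > 0" "ball pone \<rho> \<subseteq> O2" using O(2,3) open_contains_ball by blast
  have "z \<star> w \<star> n \<in> V" if "w \<in> O1" "norm (n - pone) < \<rho>" for w n
  proof -
    have "n \<in> O2" using that(2) \<rho>(2) by (auto simp: dist_norm norm_minus_commute)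
    then have "(w, n) \<in> O1 \<times> O2" using that(1) by simp
    then show ?thesis using O(4) by fastforce
  qed
  then show ?thesis using that[of O1 \<rho>] O(1,3) \<rho>(1) by simp
qed

text \<open>Points on the same leaf of the foliation contracted by the semigroup have the same limit points.\<close>

lemma dense_transfer:
  assumes z: "z \<in> SS" and D: "dense_from (conj_set z L) c" and g: "g = z \<star> c \<star> (nn b, dg \<alpha> ** nn e)" and \<alpha>: "\<alpha> > 0"
    and V: "open V" "V \<inter> SS \<noteq> {}"
  shows "\<exists>\<gamma>\<in>L. \<exists>l1\<ge>1. \<exists>l2\<ge>1. \<gamma> \<star> g \<star> (dg l1, dg l2) \<in> V"
proof -
  obtain v0 where v0: "v0 \<in> V" "v0 \<in> SS" using V by blast
  then have "z \<star> (pinv z \<star> v0) \<in> V" using z by simp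
  then obtain O1 \<rho> where O: "open O1" "pinv z \<star> v0 \<in> O1" "\<rho> > 0" 
    "\<And>w n. w \<in> O1 \<Longrightarrow> norm (n - pone) < \<rho> \<Longrightarrow> z \<star> w \<star> n \<in> V"
    by (rule open_pmul_nhd[OF V(1)]) (rule that)
  have ne: "O1 \<inter> SS \<noteq> {}" using O(2) v0 z by (metis Int_iff SS_pinv SS_pmul empty_iff)
  \<comment> \<open>Diagonal parameters of size at least \<open>T\<close> divide the displacements
    \<open>b\<close> and \<open>e\<close> by at least \<open>T\<close>, and
    \<open>(\<bar>b\<bar> + \<bar>e\<bar>) / T\<close> is below \<open>\<rho>\<close>.\<close>
  define T where "T = 2 * (\<bar>b\<bar> + \<bar>e\<bar>) / \<rho> + 1"
  have T: "T \<ge> 1" using O(3) by (simp add: T_def)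
  \<comment> \<open>The factor \<open>1 + \<alpha>\<close> leaves both \<open>x\<close> and
    \<open>l / \<alpha>\<close> at least \<open>T\<close>.\<close>
  obtain \<gamma> x l where *: "\<gamma> \<in> conj_set z L" "x \<ge> T * (1 + \<alpha>)" "l \<ge> T * (1 + \<alpha>)" "\<gamma> \<star> c \<star> (dg x, dg l) \<in> O1"
    using D O(1) ne unfolding dense_from_def by blast
  define l2 where "l2 = l / \<alpha>"
  have xT: "x \<ge> T" using *(2) T \<alpha> by (smt (verit) mult_le_cancel_left1)
  have "T * \<alpha> \<le> l" using *(3) T by (simp add: distrib_left)
  then have lT: "l2 \<ge> T" using \<alpha> by (simp add: l2_def pos_le_divide_eq)
  have l2: "\<alpha> * l2 = l" using \<alpha> by (simp add: l2_def)
  obtain \<delta> where \<delta>: "\<delta> \<in> L" "\<gamma> = pinv z \<star> \<delta> \<star> z" using *(1) by (auto simp: conj_set_def)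
  define n where "n = (nn (b / (x * x)), nn (e / (l2 * l2)))"
  have "(nn b, dg \<alpha> ** nn e) \<star> (dg x, dg l2) = (dg x, dg l) \<star> n"
    using xT lT T \<alpha> unfolding l2[symmetric] by (simp add: n_def prod_eq_iff mat2_eq_iff field_simps)
  then have "\<delta> \<star> g \<star> (dg x, dg l2) = z \<star> (\<gamma> \<star> c \<star> (dg x, dg l)) \<star> n"
    using z by (simp add: g \<delta> pmul_assoc)
  moreover have "norm (n - pone) < \<rho>"
  proof -
    have nn: "norm (nn t - mat 1) = \<bar>t\<bar>" for t
    proof -
      have "(norm (nn t - mat 1))\<^sup>2 = \<bar>t\<bar>\<^sup>2" unfolding norm_mat2_sq by simp
      then show ?thesis by (metis abs_ge_zero norm_ge_zero power2_eq_iff_nonneg)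
    qed
    have q: "\<bar>t / (y * y)\<bar> \<le> \<bar>t\<bar> / T" if "y \<ge> T" for t y
    proof -
      have "T * 1 \<le> y * y" using that T by (intro mult_mono) auto
      then show ?thesis using T by (simp add: abs_mult frac_le)
    qed
    have "norm (n - pone) \<le> norm (nn (b / (x * x)) - mat 1) + norm (nn (e / (l2 * l2)) - mat 1)"
      using norm_Pair_le_add[of "n - pone"] by (simp add: n_def)
    also have "\<dots> \<le> \<bar>b\<bar> / T + \<bar>e\<bar> / T" unfolding nn using q xT lT by (intro add_mono) auto
    also have "\<dots> = (\<bar>b\<bar> + \<bar>e\<bar>) / T" by (simp add: add_divide_distrib)
    also have "\<dots> < \<rho>"
    proof -
      have "\<rho> * T = 2 * (\<bar>b\<bar> + \<bar>e\<bar>) + \<rho>" using O(3) by (simp add: T_def field_simps)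
      moreover have "0 \<le> \<bar>b\<bar> + \<bar>e\<bar>" by simp
      ultimately have "\<bar>b\<bar> + \<bar>e\<bar> < \<rho> * T" using O(3) by simp
      then show ?thesis using T by (simp add: divide_less_eq)
    qed
    finally show ?thesis .
  qed
  ultimately have "\<delta> \<star> g \<star> (dg x, dg l2) \<in> V" using O(4) *(4) by simp
  then show ?thesis using \<delta> xT lT T by (meson order_trans)
qed

context irr22 begin

text \<open>The orbit of \<open>K \<times> small upper triangular\<close> under the expanding flow meets every open set, and
  the upper triangular part only contributes a small error.\<close>

lemma dense_from_elliptic:
  assumes \<gamma>: "(dg d, k) \<in> L" "d > 1" and k: "k = q ** rot \<theta> ** adj q" "det q = 1" "q$2$1 = 0"
  shows "dense_from L pone"
  unfolding dense_from_def
proof (intro allI impI)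
  fix V :: "mat22 set" and T :: real assume V: "open V" "V \<inter> SS \<noteq> {}"
  have pw: "(dg (d ^ m), q ** rot (m * \<theta>) ** adj q) \<in> L" for m
  proof (induction m)
    case 0 show ?case using one_in k(2) by (simp add: dg_1 rot_0 pone_def adj_right)
  next
    case (Suc m) 
    have "(q ** rot \<theta> ** adj q) ** (q ** rot (m * \<theta>) ** adj q) = q ** rot (Suc m * \<theta>) ** adj q"
      using k(2) by (simp add: distrib_right rot_add adj_cancel flip: matrix_mul_assoc)
    then show ?case using mul_in[OF \<gamma>(1) Suc] by (simp add: pmul_def dg_mult k(1) del: of_nat_Suc)
  qed
  define \<alpha> where "\<alpha> = \<theta> / (2 * pi)"
  \<comment> \<open>A rational angle would give a power with second component 1 and first component
    \<open>dg (d ^ n)\<close>, which is not scalar.\<close>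
  have irr: "\<alpha> \<notin> \<rat>"
  proof
    assume "\<alpha> \<in> \<rat>"
    then obtain i n where n: "n \<noteq> 0" "\<alpha> = of_int i / of_nat n" by (auto simp: Rats_eq_int_div_nat)
    then have "n * \<theta> = 0 + 2 * pi * of_int i" by (simp add: \<alpha>_def field_simps)
    then have "rot (n * \<theta>) = mat 1" by (metis rot_0 rot_periodic)
    then have "(dg (d ^ n), mat 1) \<in> L" using pw[of n] k(2) by (simp add: adj_right)
    then have "tl2 (dg (d ^ n)) = 0" using trivial_snd tl2_mat1 by blast
    then have "tl2 (dg (d ^ n))$1$1 = 0" by (simp del: tl2_nth)
    then have "d ^ n = inverse (d ^ n)" by simp
    moreover have "d ^ n > 1" using \<gamma>(2) n(1) by (simp add: one_less_power)
    then have "inverse (d ^ n) < 1" by (simp only: inverse_less_1_iff) simp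
    ultimately show False using \<open>d ^ n > 1\<close> by linarith
  qed
  obtain v0 where v0: "v0 \<in> V" "v0 \<in> SS" using V by blast
  then have "pone \<star> v0 \<in> V" by simp
  then obtain O1 \<rho> where O: "open O1" "v0 \<in> O1" "\<rho> > 0" 
    "\<And>w n. w \<in> O1 \<Longrightarrow> norm (n - pone) < \<rho> \<Longrightarrow> pone \<star> w \<star> n \<in> V"
    by (rule open_pmul_nhd[OF V(1)]) (rule that)
  \<comment> \<open>Gram-Schmidt: \<open>r w\<close> is the rotation with the normalized first
    column of \<open>w\<close>, so \<open>adj (r w) ** w\<close> is upper triangular.
    \<open>F u\<close> is the corresponding triangular factor of \<open>u\<close> for the rotation
    group conjugated by \<open>q\<close>; it is continuous at 1.\<close>
  define r where "r w = (1 / sqrt ((w$1$1)\<^sup>2 + (w$2$1)\<^sup>2)) *\<^sub>R mk2 (w$1$1) (- w$2$1) (w$2$1) (w$1$1)" for w :: mat2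
  define F where "F u = q ** adj (r (adj q ** u ** q)) ** adj q ** u" for u
  have q1: "adj q ** mat 1 ** q = mat 1" using k(2) by (simp add: adj_left)
  have r1: "r (mat 1) = mat 1" by (simp add: r_def mat2_eq_iff)
  have F1: "F (mat 1) = mat 1" unfolding F_def q1 r1 using k(2) by (simp add: adj_right)
  have "F \<midarrow>mat 1\<rightarrow> F (mat 1)"
  proof -
    have "((\<lambda>u. adj q ** u ** q) \<longlongrightarrow> adj q ** mat 1 ** q) (at (mat 1))" by (intro tendsto_intros)
    then have w: "((\<lambda>u. adj q ** u ** q) \<longlongrightarrow> mat 1) (at (mat 1))" by (simp only: q1)
    then have c: "((\<lambda>u. (adj q ** u ** q)$1$1) \<longlongrightarrow> 1) (at (mat 1))" "((\<lambda>u. (adj q ** u ** q)$2$1) \<longlongrightarrow> 0) (at (mat 1))"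
      unfolding mat2_tendsto_iff by simp_all
    have "((\<lambda>u. 1 / sqrt (((adj q ** u ** q)$1$1)\<^sup>2 + ((adj q ** u ** q)$2$1)\<^sup>2)) \<longlongrightarrow> 1 / sqrt (1\<^sup>2 + 0\<^sup>2)) (at (mat 1))"
      by (intro tendsto_intros c) simp
    then have s: "((\<lambda>u. 1 / sqrt (((adj q ** u ** q)$1$1)\<^sup>2 + ((adj q ** u ** q)$2$1)\<^sup>2)) \<longlongrightarrow> 1) (at (mat 1))" by simp
    have "((\<lambda>u. r (adj q ** u ** q)) \<longlongrightarrow> 1 *\<^sub>R mat 1) (at (mat 1))"
      unfolding r_def
    proof (intro tendsto_scaleR s)
      show "((\<lambda>u. mk2 ((adj q ** u ** q)$1$1) (- (adj q ** u ** q)$2$1) ((adj q ** u ** q)$2$1) ((adj q ** u ** q)$1$1)) \<longlongrightarrow> mat 1) (at (mat 1))"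
        unfolding mat2_tendsto_iff mk2_nth mat1_nth using c tendsto_minus[OF c(2)] by (intro conjI) (simp_all del: mult2_nth)
    qed
    then have "((\<lambda>u. r (adj q ** u ** q)) \<longlongrightarrow> mat 1) (at (mat 1))" by simp
    then have "(F \<longlongrightarrow> q ** adj (mat 1) ** adj q ** mat 1) (at (mat 1))" unfolding F_def by (intro tendsto_intros)
    then show ?thesis unfolding F1 using k(2) by (simp add: adj_right)
  qed
  moreover have "\<rho> / 4 > 0" using O(3) by simp
  ultimately obtain \<eta>0 where \<eta>0: "\<eta>0 > 0" "\<And>u. u \<noteq> mat 1 \<Longrightarrow> norm (u - mat 1) < \<eta>0 \<Longrightarrow> norm (F u - F (mat 1)) < \<rho> / 4"
    unfolding LIM_def dist_norm by blast
  define \<eta> where "\<eta> = min \<eta>0 (\<rho> / 4)"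
  define S where "S = max 0 (ln (max T 1))"
  have "open (ball pone \<eta>)" "pone \<in> ball pone \<eta> \<inter> SS" using \<eta>0(1) O(3) by (auto simp: \<eta>_def)
  then obtain s :: real and u v \<delta> where *: "s \<ge> S" "u \<in> ball pone \<eta>" "u \<in> SS" "v \<in> O1" "v \<in> SS" "\<delta> \<in> L" "\<delta> \<star> u \<star> asnd s = v"
    using transitive[of "ball pone \<eta>" O1 S] O(1,2) v0(2) by blast
  have nu: "norm (fst u - mat 1) < \<eta>" "norm (snd u - mat 1) < \<eta>"
    using *(2) norm_fst_diff[of u pone] norm_snd_diff[of u pone] by (auto simp: dist_norm norm_minus_commute)
  define w where "w = adj q ** snd u ** q"
  define R where "R = r w"
  define b where "b = F (snd u)"
  have du: "det (fst u) = 1" "det (snd u) = 1" using *(3) by (simp_all add: SS_def)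
  have dw: "det w = 1" using du k(2) by (simp add: w_def det_mul)
  define n where "n = sqrt ((w$1$1)\<^sup>2 + (w$2$1)\<^sup>2)"
  have "w$1$1 \<noteq> 0 \<or> w$2$1 \<noteq> 0" using dw by (auto simp: det_2)
  then have n: "n > 0" "n * n = (w$1$1)\<^sup>2 + (w$2$1)\<^sup>2" by (auto simp: n_def sum_power2_gt_zero_iff)
  have "(w$1$1 / n)\<^sup>2 + (w$2$1 / n)\<^sup>2 = ((w$1$1)\<^sup>2 + (w$2$1)\<^sup>2) / (n * n)"
    by (simp add: power_divide power2_eq_square add_divide_distrib)
  also have "\<dots> = 1" using n(1) unfolding n(2)[symmetric] by simp
  finally obtain \<phi> where \<phi>: "cos \<phi> = w$1$1 / n" "sin \<phi> = w$2$1 / n" using sincos_total_2pi by metis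
  have R: "R = rot \<phi>" by (simp add: R_def r_def mat2_eq_iff \<phi> n_def)
  have bF: "b = q ** adj R ** adj q ** snd u" by (simp add: b_def F_def R_def w_def)
  have su: "snd u = (q ** R ** adj q) ** b" using k(2) by (simp add: bF R adj_cancel flip: matrix_mul_assoc)
  have b21: "b$2$1 = 0"
  proof -
    have "b = q ** (adj R ** w) ** adj q" using k(2) by (simp add: bF w_def adj_right flip: matrix_mul_assoc)
    moreover have "(adj R ** w)$2$1 = 0" by (simp add: R \<phi>)
    ultimately show ?thesis using k(3) by simp
  qed
  have nb: "norm (b - mat 1) < \<rho> / 4"
    using \<eta>0(2)[of "snd u"] nu(2) F1 O(3) unfolding b_def by (cases "snd u = mat 1") (auto simp: \<eta>_def)
  have db: "det b = 1" unfolding bF R using du k(2) by (simp add: det_mul)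
  define b' where "b' = adj (dg (exp s)) ** b ** dg (exp s)"
  have s0: "s \<ge> 0" using *(1) unfolding S_def by linarith
  have nb': "norm (b' - mat 1) < \<rho> / 4" using upper_contract[OF b21 s0] nb by (simp add: b'_def)
  define f where "f t = \<delta> \<star> (mat 1, q ** rot t ** adj q) \<star> asnd s" for t
  have "f \<phi> = v \<star> pinv (fst u, b')"
  proof -
    have "b ** dg (exp s) = dg (exp s) ** b'" by (simp add: b'_def adj_cancel flip: matrix_mul_assoc)
    then have "v = f \<phi> \<star> (fst u, b')"
      unfolding *(7)[symmetric] f_def by (simp add: prod_eq_iff asnd_def su R flip: matrix_mul_assoc)
    moreover have "(fst u, b') \<in> SS" using du db by (simp add: SS_def b'_def det_mul)
    ultimately show ?thesis by (simp add: pmul_assoc)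
  qed
  moreover have "norm (pinv (fst u, b') - pone) < \<rho>"
  proof -
    have "norm ((fst u, b') - pone) \<le> norm (fst u - mat 1) + norm (b' - mat 1)" using norm_Pair_le_add[of "(fst u, b') - pone"] by simp
    also have "\<dots> < \<rho>" using nu nb' O(3) unfolding \<eta>_def by simp
    finally show ?thesis by (simp add: norm_pinv_minus_one)
  qed
  ultimately have fV: "f \<phi> \<in> V" using O(4)[OF *(4)] by simp
  have "continuous_on UNIV f"
  proof -
    have "continuous_on UNIV rot" unfolding continuous_on_def mat2_tendsto_iff by (auto intro!: tendsto_intros)
    then show ?thesis unfolding f_def by (intro continuous_intros)
  qed
  then have "open (f -` V)" using V(1) by (simp add: open_vimage)
  then obtain \<epsilon> where \<epsilon>: "\<epsilon> > 0" "\<And>t. \<bar>t - \<phi>\<bar> < \<epsilon> \<Longrightarrow> f t \<in> V"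
    using fV unfolding open_dist dist_real_def by blast
  obtain M where M: "T < d ^ M" using real_arch_pow[OF \<gamma>(2)] by blast
  \<comment> \<open>The irrational rotation brings the angle \<open>- (m * \<theta>)\<close> near
    \<open>\<phi>\<close>. The shift by \<open>M\<close> is built into the target, so that adding
    \<open>M\<close> to \<open>j\<close> makes \<open>d ^ m\<close> exceed \<open>T\<close>.\<close>
  obtain h j where hj: "j > 0" "\<bar>of_int j * \<alpha> - of_int h - (- (\<phi> + M * \<theta>) / (2 * pi))\<bar> < \<epsilon> / (2 * pi)"
    using sequence_of_fractional_parts_is_dense[OF irr, of "\<epsilon> / (2 * pi)"] \<epsilon>(1) by (metis divide_pos_pos pi_gt_zero zero_less_numeral mult_pos_pos)
  define m where "m = nat j + M"
  have mj: "real m = of_int j + real M" using hj(1) by (simp add: m_def)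
  define X where "X = of_int j * \<alpha> - of_int h - (- (\<phi> + M * \<theta>) / (2 * pi))"
  have "\<bar>X\<bar> * (2 * pi) < \<epsilon>" using hj(2) unfolding X_def by (simp add: pos_less_divide_eq)
  then have "\<bar>X * (2 * pi)\<bar> < \<epsilon>" by (simp add: abs_mult)
  moreover have "X * (2 * pi) = \<phi> - (- (m * \<theta>) + 2 * pi * of_int h)"
    by (simp add: X_def \<alpha>_def mj field_simps)
  ultimately have "\<bar>\<phi> - (- (m * \<theta>) + 2 * pi * of_int h)\<bar> < \<epsilon>" by (simp only:)
  then have "\<bar>- (m * \<theta>) + 2 * pi * of_int h - \<phi>\<bar> < \<epsilon>" by (simp only: abs_minus_commute)
  then have "f (- (m * \<theta>) + 2 * pi * of_int h) \<in> V" by (rule \<epsilon>(2))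
  then have fm: "f (- (m * \<theta>)) \<in> V" unfolding f_def rot_periodic .
  let ?\<gamma> = "(dg (d ^ m), q ** rot (m * \<theta>) ** adj q)"
  have p: "q ** rot (- (m * \<theta>)) ** adj q = adj (q ** rot (m * \<theta>) ** adj q)"
    by (simp only: adj_mult adj_rot adj_adj matrix_mul_assoc)
  \<comment> \<open>The power of the given element is used backwards: a rotation in the second
    factor is traded for the expansion \<open>dg (d ^ m)\<close> in the first.\<close>
  have "adj (dg (d ^ m)) ** dg (d ^ m) = mat 1" using \<gamma>(2) by (intro adj_left) simp
  then have eq: "(mat 1, q ** rot (- (m * \<theta>)) ** adj q) = pinv ?\<gamma> \<star> (dg (d ^ m), mat 1)"
    unfolding p pinv_def pmul_def by simp
  have "(dg (d ^ m), mat 1) \<star> asnd s = (dg (d ^ m), dg (exp s))" by (simp add: asnd_def pmul_def)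
  then have "f (- (m * \<theta>)) = (\<delta> \<star> pinv ?\<gamma>) \<star> pone \<star> (dg (d ^ m), dg (exp s))"
    unfolding f_def eq by (simp only: pmul_assoc pone_left)
  moreover have "\<delta> \<star> pinv ?\<gamma> \<in> L" using * pw mul_in inv_in by blast
  moreover have "d ^ m \<ge> T"
  proof -
    have "d ^ M \<le> d ^ m" using \<gamma>(2) by (intro power_increasing) (auto simp: m_def)
    then show ?thesis using M by simp
  qed
  moreover have "exp s \<ge> T"
  proof -
    have "ln (max T 1) \<le> s" using *(1) unfolding S_def by linarith
    then have "exp (ln (max T 1)) \<le> exp s" by (simp only: exp_le_cancel_iff)
    moreover have "exp (ln (max T 1)) = max T 1" by (rule exp_ln) simp
    ultimately show ?thesis by linarith
  qed
  ultimately show "\<exists>\<gamma>\<in>L. \<exists>x\<ge>T. \<exists>l\<ge>T. \<gamma> \<star> pone \<star> (dg x, dg l) \<in> V" using fm by metis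
qed

text \<open>A piece of the expanding horocycle around \<open>nm c0\<close> replaces the circle:
  transitivity provides a point \<open>nm c1\<close> of it that the flow carries into
  \<open>V\<close>. Torus elements commute with the diagonal group and move \<open>nm c0\<close> to
  \<open>nm (c0 / (y * y))\<close>, so \<open>y\<close> near the square root of
  \<open>c0 / c1\<close> reaches that point.\<close>

lemma dense_from_torus:
  assumes tor: "\<And>Y \<epsilon> T. Y > 0 \<Longrightarrow> \<epsilon> > 0 \<Longrightarrow> \<exists>x y. (dg x, dg y) \<in> L \<and> 0 < x \<and> x * T \<le> 1 \<and> 0 < y \<and> \<bar>y - Y\<bar> < \<epsilon>"
    and c0: "c0 \<noteq> 0"
  shows "dense_from L (mat 1, nm c0)"
  unfolding dense_from_def
proof (intro allI impI)
  fix V :: "mat22 set" and T :: real assume V: "open V" "V \<inter> SS \<noteq> {}"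
  obtain v0 where v0: "v0 \<in> V" "v0 \<in> SS" using V by blast
  then have "pone \<star> v0 \<in> V" by simp
  then obtain O1 \<rho> where O: "open O1" "v0 \<in> O1" "\<rho> > 0" 
    "\<And>w n. w \<in> O1 \<Longrightarrow> norm (n - pone) < \<rho> \<Longrightarrow> pone \<star> w \<star> n \<in> V"
    by (rule open_pmul_nhd[OF V(1)]) (rule that)
  \<comment> \<open>The upper triangular factor of \<open>u\<close> after splitting off a lower
    unipotent one.\<close>
  define F where "F u = adj (nm (u$2$1 / u$1$1)) ** u" for u :: mat2
  have t1: "((\<lambda>u::mat2. u$2$1 / u$1$1) \<longlongrightarrow> nm c0$2$1 / nm c0$1$1) (at (nm c0))"
    by (intro tendsto_intros) auto
  then have t2: "((\<lambda>u::mat2. u$2$1 / u$1$1) \<longlongrightarrow> c0) (at (nm c0))" by simp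
  have F1: "F (nm c0) = mat 1" by (simp add: F_def mat2_eq_iff)
  have t3: "(F \<longlongrightarrow> adj (nm c0) ** nm c0) (at (nm c0))"
  proof -
    have "((\<lambda>u::mat2. nm (u$2$1 / u$1$1)) \<longlongrightarrow> nm c0) (at (nm c0))" using t2 unfolding mat2_tendsto_iff by simp
    then show ?thesis unfolding F_def by (intro tendsto_intros)
  qed
  have "adj (nm c0) ** nm c0 = mat 1" by (simp add: adj_left)
  then have t3: "(F \<longlongrightarrow> mat 1) (at (nm c0))" using t3 by simp
  obtain \<eta>1 where \<eta>1: "\<eta>1 > 0" "\<And>u. u \<noteq> nm c0 \<Longrightarrow> norm (u - nm c0) < \<eta>1 \<Longrightarrow> norm (F u - mat 1) < \<rho> / 4"
    using t3 O(3) unfolding LIM_def dist_norm by (metis divide_pos_pos zero_less_numeral)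
  obtain \<eta>2 where \<eta>2: "\<eta>2 > 0" "\<And>u. u \<noteq> nm c0 \<Longrightarrow> norm (u - nm c0) < \<eta>2 \<Longrightarrow> \<bar>u$2$1 / u$1$1 - c0\<bar> < \<bar>c0\<bar> / 2"
    using t2 c0 unfolding LIM_def dist_norm real_norm_def by (metis divide_pos_pos zero_less_abs_iff zero_less_numeral)
  \<comment> \<open>1/2 keeps the upper left entry of \<open>snd u\<close> away from 0;
    \<open>\<eta>2\<close> keeps \<open>c1\<close> within half of \<open>c0\<close>, so that
    \<open>c0 / c1\<close> is positive and below 2; the rest bounds the errors.\<close>
  define \<eta> where "\<eta> = min (1/2) (min (min \<eta>1 \<eta>2) (\<rho> / 4))"
  \<comment> \<open>The torus element costs the factor \<open>y\<close>, which is below 3 because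
    \<open>Y < 2\<close> and \<open>y\<close> is within 1 of \<open>Y\<close>.\<close>
  define S where "S = max 0 (ln (3 * max T 1))"
  let ?p = "(mat 1, nm c0)"
  have "open (ball ?p \<eta>)" "?p \<in> ball ?p \<eta> \<inter> SS" using \<eta>1(1) \<eta>2(1) O(3) by (auto simp: \<eta>_def SS_def)
  then obtain s :: real and u v \<delta> where *: "s \<ge> S" "u \<in> ball ?p \<eta>" "u \<in> SS" "v \<in> O1" "v \<in> SS" "\<delta> \<in> L" "\<delta> \<star> u \<star> asnd s = v"
    using transitive[of "ball ?p \<eta>" O1 S] O(1,2) v0(2) by blast
  have nu: "norm (fst u - mat 1) < \<eta>" "norm (snd u - nm c0) < \<eta>"
    using *(2) norm_fst_diff[of u ?p] norm_snd_diff[of u ?p] by (auto simp: dist_norm norm_minus_commute)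
  define c1 where "c1 = snd u$2$1 / snd u$1$1"
  define b where "b = F (snd u)"
  have du: "det (fst u) = 1" "det (snd u) = 1" using *(3) by (simp_all add: SS_def)
  have "\<bar>(snd u - nm c0)$1$1\<bar> < \<eta>" using norm_ge_entry[of "snd u - nm c0" 1 1] nu(2) by linarith
  then have u11: "snd u$1$1 \<noteq> 0" by (auto simp: \<eta>_def)
  have c1d: "\<bar>c1 - c0\<bar> < \<bar>c0\<bar> / 2"
    using \<eta>2(2)[of "snd u"] nu(2) c0 unfolding c1_def by (cases "snd u = nm c0") (auto simp: \<eta>_def)
  have su: "snd u = nm c1 ** b" by (simp add: b_def F_def c1_def adj_cancel)
  have b21: "b$2$1 = 0" using u11 by (simp add: b_def F_def)
  have nb: "norm (b - mat 1) < \<rho> / 4"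
    using \<eta>1(2)[of "snd u"] nu(2) F1 O(3) unfolding b_def by (cases "snd u = nm c0") (auto simp: \<eta>_def)
  have db: "det b = 1" unfolding b_def F_def using du by (simp add: det_mul)
  define b' where "b' = adj (dg (exp s)) ** b ** dg (exp s)"
  have s0: "s \<ge> 0" using *(1) unfolding S_def by linarith
  have nb': "norm (b' - mat 1) < \<rho> / 4" using upper_contract[OF b21 s0] nb by (simp add: b'_def)
  define Y where "Y = sqrt (c0 / c1)"
  have c01: "c0 / c1 > 0" "c0 / c1 < 2" "c1 \<noteq> 0"
    using c1d by (auto simp: abs_if zero_less_divide_iff divide_less_eq split: if_splits)
  have Y: "Y > 0" "Y * Y = c0 / c1" using c01(1) unfolding Y_def by (simp, simp only: real_sqrt_mult_self abs_of_pos)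
  have "Y < 2"
  proof (rule ccontr)
    assume "\<not> Y < 2" then have "2 * 2 \<le> Y * Y" by (intro mult_mono) auto
    then show False using Y c01 by simp
  qed
  define f where "f y = \<delta> \<star> (mat 1, nm (c0 / (y * y))) \<star> asnd s" for y
  have "c0 / (Y * Y) = c1" using Y c01 c0 by simp
  then have "f Y = v \<star> pinv (fst u, b')"
  proof -
    have "b ** dg (exp s) = dg (exp s) ** b'" by (simp add: b'_def adj_cancel flip: matrix_mul_assoc)
    then have "v = f Y \<star> (fst u, b')"
      unfolding *(7)[symmetric] f_def \<open>c0 / (Y * Y) = c1\<close> by (simp add: prod_eq_iff asnd_def su flip: matrix_mul_assoc)
    moreover have "(fst u, b') \<in> SS" using du db by (simp add: SS_def b'_def det_mul)
    ultimately show ?thesis by (simp add: pmul_assoc)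
  qed
  moreover have "norm (pinv (fst u, b') - pone) < \<rho>"
  proof -
    have "norm ((fst u, b') - pone) \<le> norm (fst u - mat 1) + norm (b' - mat 1)" using norm_Pair_le_add[of "(fst u, b') - pone"] by simp
    also have "\<dots> < \<rho>" using nu nb' O(3) unfolding \<eta>_def by simp
    finally show ?thesis by (simp add: norm_pinv_minus_one)
  qed
  ultimately have fV: "f Y \<in> V" using O(4)[OF *(4)] by simp
  have "(f \<longlongrightarrow> f Y) (at Y)"
  proof -
    have "((\<lambda>y. nm (c0 / (y * y))) \<longlongrightarrow> nm (c0 / (Y * Y))) (at Y)"
    proof -
      have "((\<lambda>y. c0 / (y * y)) \<longlongrightarrow> c0 / (Y * Y)) (at Y)" using Y(1) by (intro tendsto_intros) simp
      then show ?thesis unfolding mat2_tendsto_iff by simp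
    qed
    then show ?thesis unfolding f_def by (intro tendsto_intros)
  qed
  then have "\<forall>\<^sub>F y in at Y. f y \<in> V" using V(1) fV by (rule topological_tendstoD)
  then obtain \<epsilon> where \<epsilon>: "\<epsilon> > 0" "\<And>y. y \<noteq> Y \<Longrightarrow> \<bar>y - Y\<bar> < \<epsilon> \<Longrightarrow> f y \<in> V"
    unfolding eventually_at dist_real_def by blast
  have "min \<epsilon> 1 > 0" using \<epsilon>(1) by simp
  then obtain x y where xy: "(dg x, dg y) \<in> L" "0 < x" "x * max T 1 \<le> 1" "0 < y" "\<bar>y - Y\<bar> < min \<epsilon> 1"
    using tor[OF Y(1)] by blast
  have fy: "f y \<in> V" using \<epsilon>(2)[of y] xy(5) fV by (cases "y = Y") auto
  have "(mat 1, nm (c0 / (y * y))) \<star> asnd s = (dg x, dg y) \<star> (mat 1, nm c0) \<star> (dg (inverse x), dg (exp s / y))"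
    using xy by (simp add: prod_eq_iff asnd_def mat2_eq_iff field_simps)
  then have "f y = (\<delta> \<star> (dg x, dg y)) \<star> (mat 1, nm c0) \<star> (dg (inverse x), dg (exp s / y))"
    by (simp add: f_def pmul_assoc)
  moreover have "\<delta> \<star> (dg x, dg y) \<in> L" using * xy mul_in by blast
  moreover have "inverse x \<ge> T"
  proof -
    have "max T 1 \<le> inverse x" unfolding inverse_eq_divide pos_le_divide_eq[OF xy(2)] using xy(3) by (simp only: mult.commute)
    then show ?thesis by simp
  qed
  moreover have "exp s / y \<ge> T"
  proof -
    have "ln (3 * max T 1) \<le> s" using *(1) unfolding S_def by linarith
    then have "exp (ln (3 * max T 1)) \<le> exp s" by (simp only: exp_le_cancel_iff)
    moreover have "exp (ln (3 * max T 1)) = 3 * max T 1" by (rule exp_ln) simp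
    ultimately have "3 * max T 1 \<le> exp s" by linarith
    moreover have "max T 1 * y \<le> max T 1 * 3" using xy(5) \<open>Y < 2\<close> by (intro mult_left_mono) auto
    ultimately have "max T 1 * y \<le> exp s" by linarith
    then have "max T 1 \<le> exp s / y" by (simp only: pos_le_divide_eq[OF xy(4)])
    then show ?thesis by simp
  qed
  ultimately show "\<exists>\<gamma>\<in>L. \<exists>x\<ge>T. \<exists>l\<ge>T. \<gamma> \<star> (mat 1, nm c0) \<star> (dg x, dg l) \<in> V" using fy by metis
qed

end

section \<open>Normal forms of the given element and the two cases\<close>

lemma upper_diag:
  assumes "det A = 1" "A$2$1 = 0" "A$1$1 * A$1$1 \<noteq> 1"
  shows "\<exists>\<beta>. adj (nn \<beta>) ** A ** nn \<beta> = dg (A$1$1)"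
proof -
  define a where "a = A$1$1"
  have 1: "a * A$2$2 = 1" using assms(1,2) by (simp add: det_2 a_def)
  have a0: "a \<noteq> 0" "a * a - 1 \<noteq> 0" using 1 assms(3) by (auto simp: a_def)
  have A22: "A$2$2 = inverse a" using 1 by (metis inverse_unique)
  define \<beta> where "\<beta> = - A$1$2 * a / (a * a - 1)"
  have "\<beta> * (a * a - 1) = - A$1$2 * a" using a0 by (simp add: \<beta>_def)
  then have "(a * \<beta> + A$1$2 - \<beta> * inverse a) * a = 0" using a0(1) by (simp add: field_simps)
  then have "a * \<beta> + A$1$2 - \<beta> * inverse a = 0" using a0(1) by simp
  then have "adj (nn \<beta>) ** A ** nn \<beta> = dg (A$1$1)"
    using assms(2) A22 by (simp add: mat2_eq_iff algebra_simps flip: a_def)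
  then show ?thesis by blast
qed

lemma hyperbolic_eigenvalue:
  assumes "det B = 1" "det (tl2 B) < 0"
  shows "\<exists>l::real. l * (trace B - l) = 1 \<and> l * l \<noteq> 1"
proof -
  let ?t = "trace B"
  have t: "?t\<^sup>2 - 4 > 0" using det_tl2[of B] assms by simp
  define s where "s = sqrt (?t\<^sup>2 - 4)"
  have s: "s * s = ?t\<^sup>2 - 4" using t by (simp add: s_def)
  define l where "l = (?t + s) / 2"
  have 1: "l * (?t - l) = 1" using s by (simp add: l_def field_simps power2_eq_square)
  moreover have "l * l \<noteq> 1"
  proof
    assume "l * l = 1"
    then have "l = ?t - l" using 1 by (metis mult_cancel_left mult_zero_left zero_neq_one)
    then have "s = 0" by (simp add: l_def field_simps)
    then show False using s t by simp
  qed
  ultimately show ?thesis by blast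
qed

text \<open>The columns of \<open>q\<close> are eigenvectors of \<open>B\<close>. The conditions on
  \<open>adj q\<close> are what is needed to write it as
  \<open>nm c0 ** (dg \<alpha> ** nn e)\<close> with positive \<open>\<alpha>\<close> and nonzero
  \<open>c0\<close>.\<close>

lemma hyperbolic_diag:
  assumes "det B = 1" "det (tl2 B) < 0" "B$2$1 \<noteq> 0"
  shows "\<exists>q l. det q = 1 \<and> adj q ** B ** q = dg l \<and> l * l \<noteq> 1 \<and> l \<noteq> 0 \<and> l + inverse l = trace B \<and> adj q$1$1 > 0 \<and> adj q$2$1 \<noteq> 0"
proof -
  obtain l where l: "l * (trace B - l) = 1" "l * l \<noteq> 1" using hyperbolic_eigenvalue assms by blast
  define m where "m = trace B - l"
  have lm: "l * m = 1" "l + m = B$1$1 + B$2$2" using l by (simp_all add: m_def trace_def sum_2)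
  have l0: "l \<noteq> 0" using lm by auto
  have mi: "inverse l = m" using lm(1) by (rule inverse_unique)
  define c e where "c = B$2$1" "e = B$2$2"
  have c: "c \<noteq> 0" using assms by (simp add: c_e_def)
  have B11: "B$1$1 = l + m - e" using lm by (simp add: c_e_def)
  have B12: "B$1$2 * c = (l + m - e) * e - 1" using assms(1) B11 by (simp add: det_2 c_e_def)
  have lmn: "l \<noteq> m" using l(2) lm by auto
  define D where "D = c * (l - m)"
  have D: "D \<noteq> 0" using c lmn by (simp add: D_def)
  define s where "s = sgn c"
  \<comment> \<open>\<open>D\<close> is the determinant of the matrix with columns
    \<open>(l - e, c)\<close> and \<open>(m - e, c)\<close>, so dividing the first column by it
    gives determinant 1; the sign \<open>s\<close> makes the lower right entry positive.\<close>
  define q where "q = s *\<^sub>R mk2 ((l - e) / D) (m - e) (c / D) c"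
  have sg: "s * s = 1" using c by (simp add: s_def sgn_if)
  have "det q = (s * s) * (((l - e) / D) * c - (m - e) * (c / D))" by (simp add: q_def det_2 divide_inverse algebra_simps)
  also have "\<dots> = c * (l - m) / D" unfolding sg by (simp add: algebra_simps divide_inverse)
  finally have dq: "det q = 1" using D by (simp add: D_def)
  have "B ** q = q ** dg l"
  proof -
    have "B$1$1 * (l - e) + B$1$2 * c = (l - e) * l" "B$1$1 * (m - e) + B$1$2 * c = (m - e) * m"
      unfolding B12 B11 using lm(1) by algebra+
    note Be = this
    have "B$1$1 * ((l - e) / D) + B$1$2 * (c / D) = (B$1$1 * (l - e) + B$1$2 * c) / D" by (simp add: add_divide_distrib)
    also have "\<dots> = ((l - e) / D) * l" unfolding Be(1) by simp
    finally have "B ** mk2 ((l - e) / D) (m - e) (c / D) c = mk2 ((l - e) / D) (m - e) (c / D) c ** dg l"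
      using Be(2) lm(2) D by (simp add: mat2_eq_iff mi flip: c_e_def) (simp add: field_simps)
    then show ?thesis by (simp add: q_def mult2.scaleR_left mult2.scaleR_right)
  qed
  then have "adj q ** B ** q = dg l" using dq by (simp add: adj_cancel flip: matrix_mul_assoc)
  moreover have "adj q$1$1 > 0" "adj q$2$1 \<noteq> 0" using c D by (auto simp: q_def s_def sgn_if)
  moreover have "l + inverse l = trace B" by (simp add: mi m_def)
  ultimately show ?thesis using dq l l0 by blast
qed

lemma det_tl2_conj: "det h = 1 \<Longrightarrow> det (tl2 (adj h ** A ** h)) = det (tl2 A)"
  by (simp only: tl2_conj det_mul det_adj mult_1_right mult_1_left)

lemma conj_set_mem: "x \<in> L \<Longrightarrow> cj h x \<in> conj_set h L"
  by (simp add: conj_set_def cj_def)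

lemma uminus_dg: "- dg a = dg (- a)" by (simp add: mat2_eq_iff)

text \<open>A shear in the first component diagonalizes the given element there. The shear commutes
  with nothing relevant but is contracted by the semigroup, so it may be moved into the base point
  and removed by \<open>dense_transfer\<close>.\<close>

lemma semiorbit_dense_mixed:
  assumes "irr22 L" "(C1, C2) \<in> L" "g \<in> SS" and fix1: "(adj (fst g) ** C1 ** fst g)$2$1 = 0"
    and hyp: "det (tl2 C1) < 0" and ell: "det (tl2 C2) > 0" and V: "open V" "V \<inter> SS \<noteq> {}"
  shows "\<exists>\<gamma>\<in>L. \<exists>l1\<ge>1. \<exists>l2\<ge>1. \<gamma> \<star> g \<star> (dg l1, dg l2) \<in> V"
proof -
  interpret irr22 L by fact
  have dC: "det C1 = 1" "det C2 = 1" using in_SS[OF assms(2)] by (simp_all add: SS_def)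
  have dg1: "det (fst g) = 1" "det (snd g) = 1" using assms(3) by (simp_all add: SS_def)
  define u where "u = adj (fst g) ** C1 ** fst g"
  define a where "a = u$1$1"
  have du: "det u = 1" using dC dg1 by (simp add: u_def det_mul)
  have tu: "det (tl2 u) < 0" using hyp det_tl2_conj[OF dg1(1)] by (simp add: u_def)
  have au: "a * u$2$2 = 1" using du fix1 by (simp add: det_2 a_def flip: u_def)
  have aa: "a * a \<noteq> 1"
  proof
    assume "a * a = 1"
    then have "u$2$2 = a" using au by (metis mult_cancel_left mult_zero_left zero_neq_one)
    then show False using tu fix1 by (simp add: det_2 a_def flip: u_def)
  qed
  obtain \<beta> where \<beta>: "adj (nn \<beta>) ** u ** nn \<beta> = dg a" using upper_diag[OF du] fix1 aa unfolding u_def a_def by blast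
  define z where "z = g \<star> (nn \<beta>, mat 1)"
  have zS: "z \<in> SS" using assms(3) by (simp add: z_def SS_def det_mul)
  interpret c: irr22 "conj_set z L" by (rule irr22_conj[OF assms(1) zS])
  define k where "k = adj (snd g) ** C2 ** snd g"
  have dk: "det k = 1" "det (tl2 k) > 0" using dC dg1 ell det_tl2_conj[OF dg1(2)] by (simp_all add: k_def det_mul)
  have "cj z (C1, C2) = (dg a, k)"
    using \<beta> unfolding u_def by (simp add: prod_eq_iff fst_cj snd_cj z_def adj_mult matrix_mul_assoc k_def)
  then have m: "(dg a, k) \<in> conj_set z L" using conj_set_mem[OF assms(2), of z] by simp
  have a0: "a \<noteq> 0" using au by auto
  have m2: "(dg (inverse a), adj k) \<in> conj_set z L"
  proof -
    have "pinv (dg a, k) = (dg (inverse a), adj k)" by (simp add: prod_eq_iff mat2_eq_iff)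
    then show ?thesis using c.inv_in[OF m] by simp
  qed
  \<comment> \<open>The sign of \<open>a\<close> is changed by an element of \<open>L\<close>, and
    passing to the inverse if necessary makes the diagonal entry larger than 1; an inverse of an
    elliptic matrix is elliptic.\<close>
  have mp: "(dg \<bar>a\<bar>, k) \<in> conj_set z L" "(dg (inverse \<bar>a\<bar>), adj k) \<in> conj_set z L"
    using c.neg_in(1)[OF m] c.neg_in(1)[OF m2] m m2 by (auto simp: uminus_dg abs_if)
  have ak: "det (adj k) = 1" "det (tl2 (adj k)) > 0" using dk unfolding tl2_adj det_uminus_2 by simp_all
  have "\<bar>a\<bar> \<noteq> 1" using aa by (metis abs_mult_self_eq mult_1)
  then consider "\<bar>a\<bar> > 1" | "inverse \<bar>a\<bar> > 1" using a0 by (metis linorder_neqE_linordered_idom one_less_inverse_iff zero_less_abs_iff)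
  then have "\<exists>d>1. \<exists>k'. (dg d, k') \<in> conj_set z L \<and> det k' = 1 \<and> det (tl2 k') > 0"
  proof cases
    case 1 then show ?thesis using mp(1) dk by blast
  next
    case 2 then show ?thesis using mp(2) ak by blast
  qed
  then obtain d k' where d: "d > 1" "(dg d, k') \<in> conj_set z L" "det k' = 1" "det (tl2 k') > 0" by blast
  obtain q t where q: "det q = 1" "q$2$1 = 0" "k' = q ** rot t ** adj q" using elliptic_normal_form[OF d(3,4)] by blast
  have "dense_from (conj_set z L) pone" by (rule c.dense_from_elliptic[OF d(2,1) q(3,1,2)])
  moreover have "g = z \<star> pone \<star> (nn (- \<beta>), dg 1 ** nn 0)"
    by (simp add: z_def prod_eq_iff dg_1 flip: matrix_mul_assoc) (simp add: mat2_eq_iff)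
  ultimately show ?thesis using dense_transfer[OF zS _ _ _ V] by (metis zero_less_one)
qed

text \<open>Both components are diagonalized, the second by a matrix \<open>q\<close> that does not
  fix infinity. Seen from \<open>z\<close>, the point is \<open>nm c0\<close> with nonzero
  \<open>c0\<close>, up to contracted directions and a diagonal factor.\<close>

lemma semiorbit_dense_regular:
  assumes "irr22 L" "(C1, C2) \<in> L" "g \<in> SS" and fix1: "(adj (fst g) ** C1 ** fst g)$2$1 = 0" 
    and fix2: "(adj (snd g) ** C2 ** snd g)$2$1 \<noteq> 0"
    and hyp: "det (tl2 C1) < 0" "det (tl2 C2) < 0" and reg: "(trace C1)\<^sup>2 \<noteq> (trace C2)\<^sup>2" and V: "open V" "V \<inter> SS \<noteq> {}"
  shows "\<exists>\<gamma>\<in>L. \<exists>l1\<ge>1. \<exists>l2\<ge>1. \<gamma> \<star> g \<star> (dg l1, dg l2) \<in> V"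
proof -
  interpret irr22 L by fact
  have dC: "det C1 = 1" "det C2 = 1" using in_SS[OF assms(2)] by (simp_all add: SS_def)
  have dg1: "det (fst g) = 1" "det (snd g) = 1" using assms(3) by (simp_all add: SS_def)
  define u where "u = adj (fst g) ** C1 ** fst g"
  define a where "a = u$1$1"
  have du: "det u = 1" using dC dg1 by (simp add: u_def det_mul)
  have tu: "det (tl2 u) < 0" using hyp det_tl2_conj[OF dg1(1)] by (simp add: u_def)
  have au: "a * u$2$2 = 1" using du fix1 by (simp add: det_2 a_def flip: u_def)
  have a0: "a \<noteq> 0" using au by auto
  have aa: "a * a \<noteq> 1"
  proof
    assume "a * a = 1"
    then have "u$2$2 = a" using au by (metis mult_cancel_left mult_zero_left zero_neq_one)
    then show False using tu fix1 by (simp add: det_2 a_def flip: u_def)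
  qed
  have tr1: "trace C1 = a + inverse a"
  proof -
    have "trace C1 = trace u" using trace_conj[OF dg1(1)] by (simp add: u_def)
    moreover have "u$2$2 = inverse a" using au by (metis inverse_unique)
    ultimately show ?thesis by (simp add: trace_def sum_2 a_def)
  qed
  obtain \<beta> where \<beta>: "adj (nn \<beta>) ** u ** nn \<beta> = dg a" using upper_diag[OF du] fix1 aa unfolding u_def a_def by blast
  define B where "B = adj (snd g) ** C2 ** snd g"
  have dB: "det B = 1" "det (tl2 B) < 0" using dC dg1 hyp det_tl2_conj[OF dg1(2)] by (simp_all add: B_def det_mul)
  obtain q l where q: "det q = 1" "adj q ** B ** q = dg l" "l * l \<noteq> 1" "l \<noteq> 0" "l + inverse l = trace B" "adj q$1$1 > 0" "adj q$2$1 \<noteq> 0"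
    using hyperbolic_diag[OF dB] fix2 unfolding B_def by blast
  have tr2: "trace C2 = l + inverse l" using trace_conj[OF dg1(2)] q(5) by (simp add: B_def)
  define z where "z = g \<star> (nn \<beta>, q)"
  have zS: "z \<in> SS" using assms(3) q(1) by (simp add: z_def SS_def det_mul)
  interpret c: irr22 "conj_set z L" by (rule irr22_conj[OF assms(1) zS])
  have "cj z (C1, C2) = (dg a, dg l)"
    using \<beta> q(2) unfolding u_def B_def by (simp add: prod_eq_iff fst_cj snd_cj z_def adj_mult matrix_mul_assoc)
  then have m: "(dg a, dg l) \<in> conj_set z L" using conj_set_mem[OF assms(2), of z] by simp
  then have m1: "(dg \<bar>a\<bar>, dg l) \<in> conj_set z L" using c.neg_in(1)[OF m] by (auto simp: uminus_dg abs_if)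
  then have m2: "(dg \<bar>a\<bar>, dg \<bar>l\<bar>) \<in> conj_set z L" using c.neg_in(2)[OF m1] by (auto simp: uminus_dg abs_if)
  have n1: "\<bar>a\<bar> \<noteq> 1" "\<bar>l\<bar> \<noteq> 1" using aa q(3) by (metis abs_mult_self_eq mult_1)+
  \<comment> \<open>The squared traces are unchanged when \<open>a\<close> or \<open>l\<close> is
    inverted or negated; one inequality between them therefore excludes both
    \<open>\<bar>a\<bar> = \<bar>l\<bar>\<close> and
    \<open>\<bar>a\<bar> * \<bar>l\<bar> = 1\<close>.\<close>
  have sq: "(trace C1)\<^sup>2 = a * a + 2 + inverse (a * a)" "(trace C2)\<^sup>2 = l * l + 2 + inverse (l * l)"
    using a0 q(4) by (simp_all add: tr1 tr2 power2_eq_square field_simps)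
  have n2: "\<bar>a\<bar> \<noteq> \<bar>l\<bar>"
  proof
    assume "\<bar>a\<bar> = \<bar>l\<bar>" then have "a * a = l * l" by (metis abs_mult_self_eq)
    then show False using reg sq by simp
  qed
  have n3: "\<bar>a\<bar> * \<bar>l\<bar> \<noteq> 1"
  proof
    assume "\<bar>a\<bar> * \<bar>l\<bar> = 1"
    then have "(\<bar>a\<bar> * \<bar>l\<bar>) * (\<bar>a\<bar> * \<bar>l\<bar>) = 1" by simp
    then have "(a * a) * (l * l) = 1" by (simp add: mult_ac flip: abs_mult)
    then have "l * l = inverse (a * a)" by (metis inverse_unique)
    then show False using reg sq by simp
  qed
  define \<alpha> where "\<alpha> = adj q$1$1"
  define c0 where "c0 = adj q$2$1 / \<alpha>"
  define e where "e = adj q$1$2 / \<alpha>"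
  have \<alpha>: "\<alpha> > 0" and c0: "c0 \<noteq> 0" using q by (simp_all add: \<alpha>_def c0_def del: adj_nth)
  have "\<exists>x y. (dg x, dg y) \<in> conj_set z L \<and> 0 < x \<and> x * T \<le> 1 \<and> 0 < y \<and> \<bar>y - Y\<bar> < \<epsilon>" if "Y > 0" "\<epsilon> > 0" for Y \<epsilon> T
    by (rule c.torus_dense[OF m2 _ _ n1 n2 n3 that]) (use a0 q in auto)
  then have D: "dense_from (conj_set z L) (mat 1, nm c0)" using c.dense_from_torus[OF _ c0] by blast
  have "adj q = nm c0 ** (dg \<alpha> ** nn e)"
  proof -
    have "det (adj q) = 1" using q(1) by simp
    then have "adj q$2$2 = (1 + adj q$1$2 * adj q$2$1) / \<alpha>" using \<alpha> by (simp add: det_2 \<alpha>_def field_simps)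
    then show ?thesis using \<alpha> unfolding mat2_eq_iff mult2_nth nm_nth dg_nth nn_nth
      by (simp add: c0_def e_def field_simps del: adj_nth) (simp add: \<alpha>_def)
  qed
  moreover have "nn \<beta> ** nn (- \<beta>) = mat 1" by (simp add: mat2_eq_iff)
  ultimately have "g = z \<star> (mat 1, nm c0) \<star> (nn (- \<beta>), dg \<alpha> ** nn e)"
    using q(1) adj_right[of q] by (simp add: z_def prod_eq_iff flip: matrix_mul_assoc) 
  then show ?thesis using dense_transfer[OF zS D _ \<alpha> V] by blast
qed

section \<open>Projections of lattices\<close>

text \<open>Conjugation by powers of \<open>dg d\<close> enlarges the upper right entry of elements
  near 1 to moderate size while their other entries tend to those of 1; a limit is
  \<open>nn t0\<close> with nonzero \<open>t0\<close>. The inverse conjugation shrinks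
  \<open>t0\<close>, and integer multiples of arbitrarily short steps are dense.\<close>

lemma closed_subgroup_unipotent:
  fixes H :: "mat2 set"
  assumes H: "closed H" "\<And>x y. x \<in> H \<Longrightarrow> y \<in> H \<Longrightarrow> x ** y \<in> H" "\<And>x. x \<in> H \<Longrightarrow> adj x \<in> H" and d: "dg d \<in> H" "d > 1"
    and small: "\<And>e. e > 0 \<Longrightarrow> \<exists>h\<in>H. norm (h - mat 1) < e \<and> h$1$2 \<noteq> 0"
  shows "nn t \<in> H"
proof -
  define D where "D = d * d"
  have D: "D > 1" using d by (simp add: D_def less_1_mult)
  have one: "mat 1 \<in> H"
  proof -
    have "dg d ** adj (dg d) \<in> H" using H d by blast
    then show ?thesis using d by (simp add: adj_right)
  qed
  have cjd: "dg d ** x ** adj (dg d) = mk2 (x$1$1) (D * x$1$2) (x$2$1 / D) (x$2$2)" 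
    "adj (dg d) ** x ** dg d = mk2 (x$1$1) (x$1$2 / D) (D * x$2$1) (x$2$2)" for x
    using d by (simp_all add: mat2_eq_iff D_def field_simps)
  have pw: "mk2 (x$1$1) (D ^ n * x$1$2) (x$2$1 / D ^ n) (x$2$2) \<in> H" if "x \<in> H" for x n
  proof (induction n)
    case 0 
    have "mk2 (x$1$1) (x$1$2) (x$2$1) (x$2$2) = x" by (simp add: mat2_eq_iff)
    then show ?case using that by simp
  next
    case (Suc n)
    have "dg d ** mk2 (x$1$1) (D ^ n * x$1$2) (x$2$1 / D ^ n) (x$2$2) ** adj (dg d) \<in> H" using H d Suc by blast
    then show ?case unfolding cjd by (simp add: mult_ac)
  qed
  have "\<exists>h\<in>H. norm (h - mat 1) < 1 / real (Suc m) \<and> h$1$2 \<noteq> 0" for m using small by simp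
  then obtain h where h: "\<And>m. h m \<in> H" "\<And>m. norm (h m - mat 1) < 1 / real (Suc m)" "\<And>m. h m$1$2 \<noteq> 0" by metis
  have h1: "h \<longlonglongrightarrow> mat 1"
  proof (rule LIM_zero_cancel, rule Lim_null_comparison)
    show "\<forall>\<^sub>F m in sequentially. norm (h m - mat 1) \<le> 1 / real (Suc m)" by (intro always_eventually allI less_imp_le h(2))
    show "(\<lambda>m. 1 / real (Suc m)) \<longlonglongrightarrow> 0" by (rule LIMSEQ_Suc[OF lim_1_over_n])
  qed
  \<comment> \<open>The first power of \<open>D\<close> that lifts the entry to 1 overshoots at most
    by the factor \<open>D\<close>, so the lifted entries stay in a compact set away from 0.\<close>
  have "\<exists>n. 1 \<le> D ^ n * \<bar>x\<bar> \<and> D ^ n * \<bar>x\<bar> \<le> D" if x: "x \<noteq> 0" "\<bar>x\<bar> < 1" for x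
  proof -
    obtain n0 where "1 / \<bar>x\<bar> < D ^ n0" using real_arch_pow[OF D] by blast
    then have "1 \<le> D ^ n0 * \<bar>x\<bar>" using x by (simp add: field_simps)
    then obtain n where n: "1 \<le> D ^ n * \<bar>x\<bar>" "\<And>i. i < n \<Longrightarrow> \<not> 1 \<le> D ^ i * \<bar>x\<bar>" 
      using exists_least_iff[of "\<lambda>n. 1 \<le> D ^ n * \<bar>x\<bar>"] by blast
    show ?thesis
    proof (cases n)
      case 0 then show ?thesis using n(1) x by auto
    next
      case (Suc k)
      then have "D ^ k * \<bar>x\<bar> < 1" using n(2)[of k] by simp
      then have "D * (D ^ k * \<bar>x\<bar>) \<le> D * 1" using D by (intro mult_left_mono) auto
      then show ?thesis using n(1) Suc by (intro exI[of _ "Suc k"]) (simp add: mult.assoc)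
    qed
  qed
  moreover have "\<bar>h m$1$2\<bar> < 1" for m
  proof -
    have "\<bar>(h m - mat 1)$1$2\<bar> \<le> norm (h m - mat 1)" by (rule norm_ge_entry)
    also have "\<dots> < 1 / real (Suc m)" by (rule h)
    also have "\<dots> \<le> 1" by simp
    finally show ?thesis by simp
  qed
  ultimately have "\<forall>m. \<exists>n. 1 \<le> D ^ n * \<bar>h m$1$2\<bar> \<and> D ^ n * \<bar>h m$1$2\<bar> \<le> D" using h(3) by blast
  then obtain N where N: "\<And>m. 1 \<le> D ^ N m * \<bar>h m$1$2\<bar>" "\<And>m. D ^ N m * \<bar>h m$1$2\<bar> \<le> D" by metis
  define b where "b m = D ^ N m * h m$1$2" for m
  have b: "\<bar>b m\<bar> \<ge> 1" "\<bar>b m\<bar> \<le> D" for m using N[of m] D by (simp_all add: b_def abs_mult)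
  have "bounded (range b)" unfolding bounded_iff using b by auto
  then obtain \<sigma> t0 where \<sigma>: "strict_mono \<sigma>" "(b \<circ> \<sigma>) \<longlonglongrightarrow> t0" using bounded_imp_convergent_subsequence by blast
  have t0: "\<bar>t0\<bar> \<ge> 1"
  proof (rule tendsto_lowerbound[OF tendsto_rabs[OF \<sigma>(2)]])
    show "\<forall>\<^sub>F n in sequentially. 1 \<le> \<bar>(b \<circ> \<sigma>) n\<bar>" using b by simp
  qed simp
  have hs: "(\<lambda>m. h (\<sigma> m)$i$j) \<longlonglongrightarrow> (mat 1 :: mat2)$i$j" for i j
    using LIMSEQ_subseq_LIMSEQ[OF h1 \<sigma>(1)] by (intro tendsto_vec_nth) (simp add: o_def)
  have "(\<lambda>m. mk2 (h (\<sigma> m)$1$1) (D ^ N (\<sigma> m) * h (\<sigma> m)$1$2) (h (\<sigma> m)$2$1 / D ^ N (\<sigma> m)) (h (\<sigma> m)$2$2)) \<longlonglongrightarrow> nn t0"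
    unfolding mat2_tendsto_iff mk2_nth nn_nth
  proof (intro conjI)
    show "(\<lambda>m. h (\<sigma> m)$1$1) \<longlonglongrightarrow> 1" "(\<lambda>m. h (\<sigma> m)$2$2) \<longlonglongrightarrow> 1" using hs[of 1 1] hs[of 2 2] by simp_all
    show "(\<lambda>m. D ^ N (\<sigma> m) * h (\<sigma> m)$1$2) \<longlonglongrightarrow> t0" using \<sigma>(2) by (simp add: b_def o_def)
    show "(\<lambda>m. h (\<sigma> m)$2$1 / D ^ N (\<sigma> m)) \<longlonglongrightarrow> 0"
    proof (rule Lim_null_comparison)
      show "\<forall>\<^sub>F m in sequentially. norm (h (\<sigma> m)$2$1 / D ^ N (\<sigma> m)) \<le> \<bar>h (\<sigma> m)$2$1\<bar>"
        using D by (intro always_eventually allI) (simp add: abs_divide divide_le_eq mult_le_cancel_left1 one_le_power)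
      show "(\<lambda>m. \<bar>h (\<sigma> m)$2$1\<bar>) \<longlonglongrightarrow> 0" using tendsto_rabs[OF hs[of 2 1]] by simp
    qed
  qed
  then have nt0: "nn t0 \<in> H" by (rule closed_sequentially[OF H(1) pw[OF h(1)]])
  have mul: "nn (real n * s) \<in> H" if "nn s \<in> H" for n s
  proof (induction n)
    case 0 have "nn 0 = mat 1" by (simp add: mat2_eq_iff)
    then show ?case using one by simp
  next
    case (Suc n) have "nn s ** nn (real n * s) = nn (real (Suc n) * s)" by (simp add: mat2_eq_iff algebra_simps)
    then show ?case using H(2)[OF that Suc] by simp
  qed
  have neg: "nn (- s) \<in> H" if "nn s \<in> H" for s
  proof -
    have "adj (nn s) = nn (- s)" by (simp add: mat2_eq_iff)
    then show ?thesis using H(3)[OF that] by simp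
  qed
  have mulz: "nn (of_int k * s) \<in> H" if "nn s \<in> H" for k s
    using mul[OF that, of "nat k"] neg[OF mul[OF that, of "nat (- k)"]] by (cases "k \<ge> 0") auto
  have divD: "nn (s / D ^ j) \<in> H" if "nn s \<in> H" for s j
  proof (induction j)
    case 0 then show ?case using that by simp
  next
    case (Suc j)
    have "adj (dg d) ** nn (s / D ^ j) ** dg d \<in> H" using H d Suc by blast
    moreover have "adj (dg d) ** nn (s / D ^ j) ** dg d = nn (s / D ^ Suc j)" unfolding cjd by (simp add: mat2_eq_iff)
    ultimately show ?case by simp
  qed
  define x where "x j = of_int \<lfloor>t / (t0 / D ^ j)\<rfloor> * (t0 / D ^ j)" for j
  have "x \<longlonglongrightarrow> t"
  proof (rule LIM_zero_cancel, rule Lim_null_comparison)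
    have "norm (x j - t) \<le> \<bar>t0\<bar> * (1 / D) ^ j" for j
    proof -
      define c where "c = t0 / D ^ j"
      have c: "c \<noteq> 0" using t0 D by (auto simp: c_def)
      have "\<bar>of_int \<lfloor>t / c\<rfloor> - t / c\<bar> \<le> 1" by linarith
      then have "\<bar>of_int \<lfloor>t / c\<rfloor> - t / c\<bar> * \<bar>c\<bar> \<le> 1 * \<bar>c\<bar>" by (intro mult_right_mono) auto
      then have "\<bar>of_int \<lfloor>t / c\<rfloor> * c - t\<bar> \<le> \<bar>c\<bar>" using c unfolding abs_mult[symmetric] by (simp add: left_diff_distrib)
      then show ?thesis using D by (simp add: x_def c_def abs_divide power_one_over)
    qed
    then show "\<forall>\<^sub>F j in sequentially. norm (x j - t) \<le> \<bar>t0\<bar> * (1 / D) ^ j" by simp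
    have "(\<lambda>j. \<bar>t0\<bar> * (1 / D) ^ j) \<longlonglongrightarrow> \<bar>t0\<bar> * 0" using D by (intro tendsto_intros LIMSEQ_power_zero) auto
    then show "(\<lambda>j. \<bar>t0\<bar> * (1 / D) ^ j) \<longlonglongrightarrow> 0" by simp
  qed
  then have "(\<lambda>j. nn (x j)) \<longlonglongrightarrow> nn t" unfolding mat2_tendsto_iff by simp
  moreover have "nn (x j) \<in> H" for j unfolding x_def by (intro mulz divD nt0)
  ultimately show ?thesis using closed_sequentially[OF H(1), of "\<lambda>j. nn (x j)"] by simp
qed

text \<open>If elements near 1 have a nonzero upper right or lower left entry, one unipotent group
  lies in \<open>H\<close>, and \<open>c\<close> carries it to the opposite one. Otherwise all
  elements near 1 are diagonal; but the conjugate by \<open>c\<close> of a nontrivial diagonal one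
  is not, as \<open>c\<close> has no zero entry.\<close>

lemma closed_subgroup_all:
  fixes H :: "mat2 set"
  assumes H: "closed H" "\<And>x y. x \<in> H \<Longrightarrow> y \<in> H \<Longrightarrow> x ** y \<in> H" "\<And>x. x \<in> H \<Longrightarrow> adj x \<in> H" "\<And>x. x \<in> H \<Longrightarrow> det x = 1"
    and d: "dg d \<in> H" "d > 1" and c: "c \<in> H" "\<And>i j. c$i$j \<noteq> 0"
    and small: "\<And>e. e > 0 \<Longrightarrow> \<exists>h\<in>H. norm (h - mat 1) < e \<and> h \<noteq> mat 1" and A: "det A = 1"
  shows "A \<in> H"
proof -
  define w where "w = mk2 0 (-1) 1 0"
  define H' where "H' = (\<lambda>x. w ** x ** adj w) -` H"
  have ww: "adj w ** w = mat 1" "w ** adj w = mat 1" by (simp_all add: w_def mat2_eq_iff)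
  have wx: "w ** x ** adj w = mk2 (x$2$2) (- x$2$1) (- x$1$2) (x$1$1)" for x by (simp add: w_def mat2_eq_iff)
  have cH': "closed H'" unfolding H'_def using H(1) by (intro closed_vimage continuous_intros)
  have mH': "x ** y \<in> H'" if "x \<in> H'" "y \<in> H'" for x y
  proof -
    have "w ** (x ** y) ** adj w = (w ** x ** adj w) ** (w ** y ** adj w)"
      using ww by (simp add: w_def mat2_eq_iff)
    then show ?thesis using that H(2) by (simp add: H'_def)
  qed
  have iH': "adj x \<in> H'" if "x \<in> H'" for x
  proof -
    have "w ** adj x ** adj w = adj (w ** x ** adj w)" by (simp add: adj_mult matrix_mul_assoc)
    then show ?thesis using that H(3) by (simp add: H'_def)
  qed
  have dH': "dg d \<in> H'"
  proof -
    have "w ** dg d ** adj w = adj (dg d)" by (simp add: w_def mat2_eq_iff)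
    then show ?thesis using d H(3) by (simp add: H'_def)
  qed
  have both: "A \<in> H" if nnH: "\<And>t. nn t \<in> H" and nmH: "\<And>t. nm t \<in> H"
  proof -
    obtain x y z t where "A = nn x ** nm y ** nn z ** nm t" using SL2_generated[OF A] by blast
    then show ?thesis using nnH nmH H(2) by simp
  qed
  have dc: "c$1$1 * c$2$2 - c$1$2 * c$2$1 = 1" using H(4)[OF c(1)] by (simp add: det_2)
  have dc': "c$1$2 * c$2$1 = c$1$1 * c$2$2 - 1" using dc by simp
  have up: "A \<in> H" if nnH: "\<And>t. nn t \<in> H"
  proof (rule both[OF nnH])
    fix t
    let ?k = "c$2$1"
    \<comment> \<open>Two shears make \<open>c\<close> antidiagonal, and an antidiagonal matrix
      exchanges upper and lower unipotents.\<close>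
    define v where "v = nn (- c$1$1 / ?k) ** c ** nn (- c$2$2 / ?k)"
    have c12: "c$1$2 = (c$1$1 * c$2$2 - 1) / ?k" using dc' c(2)[of 2 1] by (simp add: nonzero_eq_divide_eq)
    have v: "v = mk2 0 (- 1 / ?k) ?k 0" using c(2)[of 2 1] by (simp add: v_def mat2_eq_iff c12) (simp add: field_simps)
    have "v \<in> H" unfolding v_def using H(2) nnH c by blast
    then have "v ** nn (- t / (?k * ?k)) ** adj v \<in> H" using H(2,3) nnH by blast
    moreover have "v ** nn (- t / (?k * ?k)) ** adj v = nm t" unfolding v using c(2)[of 2 1] by (simp add: mat2_eq_iff)
    ultimately show "nm t \<in> H" by simp
  qed
  have lo: "A \<in> H" if nmH: "\<And>t. nm t \<in> H"
  proof (rule both[OF _ nmH])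
    fix t
    let ?k = "c$1$2"
    define v where "v = nm (- c$2$2 / ?k) ** c ** nm (- c$1$1 / ?k)"
    have c21: "c$2$1 = (c$1$1 * c$2$2 - 1) / ?k" using dc' c(2)[of 1 2] by (simp add: nonzero_eq_divide_eq mult.commute)
    have v: "v = mk2 0 ?k (- 1 / ?k) 0" using c(2)[of 1 2] by (simp add: v_def mat2_eq_iff c21) (simp add: field_simps)
    have "v \<in> H" unfolding v_def using H(2) nmH c by blast
    then have "v ** nm (- t / (?k * ?k)) ** adj v \<in> H" using H(2,3) nmH by blast
    moreover have "v ** nm (- t / (?k * ?k)) ** adj v = nn t" unfolding v using c(2)[of 1 2] by (simp add: mat2_eq_iff)
    ultimately show "nn t \<in> H" by simp
  qed
  show ?thesis
  proof (cases "\<forall>e>0. \<exists>h\<in>H. norm (h - mat 1) < e \<and> h$1$2 \<noteq> 0")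
    case True
    then show ?thesis using up closed_subgroup_unipotent[OF H(1-3) d] by blast
  next
    case n1: False
    show ?thesis
    proof (cases "\<forall>e>0. \<exists>h\<in>H. norm (h - mat 1) < e \<and> h$2$1 \<noteq> 0")
      case True
      have "\<exists>h\<in>H'. norm (h - mat 1) < e \<and> h$1$2 \<noteq> 0" if e: "e > 0" for e
      proof -
        obtain h where h: "h \<in> H" "norm (h - mat 1) < e" "h$2$1 \<noteq> 0" using True e by blast
        let ?h = "adj w ** h ** w"
        have "w ** ?h ** adj w = h" using ww by (simp add: matrix_mul_assoc) (simp add: ww flip: matrix_mul_assoc)
        then have "?h \<in> H'" using h by (simp add: H'_def)
        moreover have "(norm (?h - mat 1))\<^sup>2 = (norm (h - mat 1))\<^sup>2" unfolding norm_mat2_sq by (simp add: w_def)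
        then have "norm (?h - mat 1) < e" using h(2) by simp
        moreover have "?h$1$2 \<noteq> 0" using h(3) by (simp add: w_def)
        ultimately show ?thesis by blast
      qed
      then have "nn t \<in> H'" for t using closed_subgroup_unipotent[OF cH' mH' iH' dH' d(2)] by blast
      then have "w ** nn (- t) ** adj w \<in> H" for t by (simp add: H'_def)
      moreover have "w ** nn (- t) ** adj w = nm t" for t by (simp add: w_def mat2_eq_iff)
      ultimately show ?thesis using lo by simp
    next
      case False
      then obtain e1 e2 where e: "e1 > 0" "e2 > 0" "\<And>h. h \<in> H \<Longrightarrow> norm (h - mat 1) < e1 \<Longrightarrow> h$1$2 = 0"
        "\<And>h. h \<in> H \<Longrightarrow> norm (h - mat 1) < e2 \<Longrightarrow> h$2$1 = 0" using n1 by blast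
      have cpos: "norm c > 0" using c(2)[of 1 1] by auto
      \<comment> \<open>Small enough for \<open>h\<close> and for its conjugate by \<open>c\<close>
        to lie where the off-diagonal entries are known to vanish; the bound 1 excludes
        \<open>h = - mat 1\<close>.\<close>
      define r where "r = min (min 1 e2) (min e1 (e1 / (norm c * norm c)))"
      have "r > 0" using e cpos by (simp add: r_def)
      then obtain h where h: "h \<in> H" "norm (h - mat 1) < r" "h \<noteq> mat 1" using small by blast
      have r: "r \<le> 1" "r \<le> e1" "r \<le> e2" "r \<le> e1 / (norm c * norm c)" by (auto simp: r_def)
      have z: "h$1$2 = 0" "h$2$1 = 0" using e(3,4)[OF h(1)] h(2) r by auto
      have "c ** h ** adj c \<in> H" by (rule H(2)[OF H(2)[OF c(1) h(1)] H(3)[OF c(1)]])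
      moreover have "c ** h ** adj c - mat 1 = c ** (h - mat 1) ** adj c"
        using adj_right[OF H(4)[OF c(1)]] by (simp add: mult2.diff_left mult2.diff_right)
      then have "norm (c ** h ** adj c - mat 1) \<le> norm c * norm (h - mat 1) * norm c"
        using order_trans[OF norm_mult2 mult_right_mono[OF norm_mult2 norm_ge_zero], of c "h - mat 1" "adj c"] by simp
      moreover have "norm c * norm (h - mat 1) * norm c < e1"
      proof -
        have "norm (h - mat 1) < e1 / (norm c * norm c)" using h(2) r by linarith
        then show ?thesis using cpos by (simp add: field_simps)
      qed
      ultimately have "(c ** h ** adj c)$1$2 = 0" using e(3) by (meson le_less_trans)
      then have "c$1$1 * c$1$2 * (h$2$2 - h$1$1) = 0" using z by (simp add: algebra_simps)
      then have eq: "h$2$2 = h$1$1" using c(2) by simp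
      then have "h$1$1 * h$1$1 = 1" using H(4)[OF h(1)] z by (simp add: det_2)
      moreover have "\<bar>(h - mat 1)$1$1\<bar> < 1" using norm_ge_entry[of "h - mat 1" 1 1] h(2) r by linarith
      ultimately have "h$1$1 = 1" by (auto simp: square_eq_1_iff)
      then have "h = mat 1" using z eq by (simp add: mat2_eq_iff)
      then show ?thesis using h by simp
    qed
  qed
qed

section \<open>Recurrence and the closure of a projection\<close>

context lat22 begin

text \<open>Recurrence of the flow given by \<open>q diag(2\<^sup>n, 2\<^sup>-\<^sup>n) q\<^sup>-\<^sup>1\<close> yields elements of the projection that are
  asymptotic to it.\<close>

lemma projection_hyperbolic:
  assumes q: "det q = 1"
  shows "\<exists>x n. (\<forall>m. x m \<in> L) \<and> (\<forall>m. n m \<ge> m) \<and> (\<lambda>m. (1 / 2 ^ n m) *\<^sub>R fst (x m)) \<longlonglongrightarrow> q ** mk2 1 0 0 0 ** adj q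
    \<and> (\<lambda>m. snd (x m)) \<longlonglongrightarrow> mat 1"
proof -
  \<comment> \<open>The flow is run backwards: \<open>x \<star> u \<star> g n = u'\<close> makes
    \<open>fst x\<close> asymptotic to the inverse of \<open>fst (g n)\<close>, which expands by
    \<open>2 ^ n\<close>.\<close>
  define g where "g n = (q ** dg ((1/2) ^ n) ** adj q, mat 1 :: mat2)" for n :: nat
  have gS: "g n \<in> SS" for n using q by (simp add: g_def SS_def det_mul)
  have gm: "g (i + j) = g i \<star> g j" for i j
    using q by (simp add: g_def prod_eq_iff power_add dg_mult adj_cancel flip: matrix_mul_assoc)
  have "\<exists>n\<ge>m. \<exists>x\<in>L. \<exists>u\<in>ball pone (1 / Suc m) \<inter> SS. \<exists>u'\<in>ball pone (1 / Suc m) \<inter> SS. x \<star> u \<star> g n = u'" for m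
  proof -
    have "pone \<in> ball pone (1 / Suc m) \<inter> SS" by simp
    then have "ball pone (1 / Suc m) \<inter> SS \<noteq> {}" by blast
    then show ?thesis by (rule nonwandering[OF open_ball _ gS gm])
  qed
  moreover define Q where "Q = (\<lambda>m n x u u'. n \<ge> m \<and> x \<in> L \<and> u \<in> ball pone (1 / Suc m) \<inter> SS \<and> u' \<in> ball pone (1 / Suc m) \<inter> SS \<and> x \<star> u \<star> g n = u')"
  ultimately have "\<forall>m. \<exists>n x u u'. Q m n x u u'" by blast
  then obtain n x u u' where "\<And>m. Q m (n m) (x m) (u m) (u' m)" by metis
  then have *: "\<And>m. n m \<ge> m" "\<And>m. x m \<in> L" "\<And>m. u m \<in> ball pone (1 / Suc m) \<inter> SS" 
    "\<And>m. u' m \<in> ball pone (1 / Suc m) \<inter> SS" "\<And>m. x m \<star> u m \<star> g (n m) = u' m"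
    unfolding Q_def by blast+
  have lim: "w \<longlonglongrightarrow> pone" if "\<And>m. w m \<in> ball pone (1 / Suc m) \<inter> SS" for w
  proof (rule LIM_zero_cancel, rule Lim_null_comparison)
    have "norm (w m - pone) \<le> 1 / real (Suc m)" for m using that[of m] by (auto simp: dist_norm norm_minus_commute)
    then show "\<forall>\<^sub>F m in sequentially. norm (w m - pone) \<le> 1 / real (Suc m)" by simp
    show "(\<lambda>m. 1 / real (Suc m)) \<longlonglongrightarrow> 0" by (rule LIMSEQ_Suc[OF lim_1_over_n])
  qed
  have lu: "(\<lambda>m. fst (u' m)) \<longlonglongrightarrow> mat 1" "(\<lambda>m. adj (fst (u m))) \<longlonglongrightarrow> adj (mat 1)"
    using tendsto_fst[OF lim[OF *(4)]] bounded_linear.tendsto[OF bounded_linear_adj tendsto_fst[OF lim[OF *(3)]]] by simp_all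
  have xm: "fst (x m) = fst (u' m) ** q ** dg (2 ^ n m) ** adj q ** adj (fst (u m))" for m
  proof -
    have d: "det (fst (u m)) = 1" using *(3)[of m] by (simp add: SS_def)
    have i: "adj (dg ((1/2) ^ n m)) = dg (2 ^ n m)" by (simp add: mat2_eq_iff power_one_over inverse_eq_divide)
    have "fst (u' m) ** q ** dg (2 ^ n m) = fst (x m) ** fst (u m) ** (q ** (dg ((1/2) ^ n m) ** (adj q ** q) ** adj (dg ((1/2) ^ n m))))"
      unfolding *(5)[of m, symmetric] i by (simp add: g_def matrix_mul_assoc)
    also have "\<dots> = fst (x m) ** fst (u m) ** q" using q by (simp add: adj_left adj_right)
    finally have "fst (u' m) ** q ** dg (2 ^ n m) ** adj q ** adj (fst (u m)) = fst (x m) ** (fst (u m) ** (q ** (adj q ** adj (fst (u m)))))"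
      by (simp add: matrix_mul_assoc)
    then show ?thesis using d q by (simp add: adj_cancel adj_right)
  qed
  have four: "(\<lambda>m. (1 / 4 :: real) ^ n m) \<longlonglongrightarrow> 0"
  proof (rule Lim_null_comparison)
    show "\<forall>\<^sub>F m in sequentially. norm ((1 / 4 :: real) ^ n m) \<le> (1/4) ^ m" using *(1) by (simp add: power_decreasing)
    show "(\<lambda>m. (1/4 :: real) ^ m) \<longlonglongrightarrow> 0" by (rule LIMSEQ_power_zero) simp
  qed
  have "(\<lambda>m. mk2 1 0 0 ((1 / 4) ^ n m)) \<longlonglongrightarrow> mk2 1 0 0 0"
    unfolding mat2_tendsto_iff using four by simp
  then have "(\<lambda>m. fst (u' m) ** q ** mk2 1 0 0 ((1 / 4) ^ n m) ** adj q ** adj (fst (u m))) \<longlonglongrightarrow> mat 1 ** q ** mk2 1 0 0 0 ** adj q ** adj (mat 1)"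
    by (intro tendsto_intros lu)
  moreover have "(1 / 2 ^ n m) *\<^sub>R fst (x m) = fst (u' m) ** q ** mk2 1 0 0 ((1 / 4) ^ n m) ** adj q ** adj (fst (u m))" for m
  proof -
    have "(1/4::real) ^ k = 1 / (2 ^ k * 2 ^ k)" for k by (simp add: power_one_over flip: power_mult_distrib)
    then have "mk2 1 0 0 ((1 / 4) ^ n m) = (1 / 2 ^ n m) *\<^sub>R dg (2 ^ n m)" by (simp add: mat2_eq_iff field_simps)
    then show ?thesis by (simp add: xm mult2.scaleR_left mult2.scaleR_right)
  qed
  ultimately have "(\<lambda>m. (1 / 2 ^ n m) *\<^sub>R fst (x m)) \<longlonglongrightarrow> q ** mk2 1 0 0 0 ** adj q" by simp
  moreover have "snd (x m) = snd (u' m) ** adj (snd (u m))" for m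
  proof -
    have "det (snd (u m)) = 1" using *(3)[of m] by (simp add: SS_def)
    then show ?thesis unfolding *(5)[of m, symmetric] by (simp add: g_def adj_right flip: matrix_mul_assoc)
  qed
  moreover have "(\<lambda>m. snd (u' m) ** adj (snd (u m))) \<longlonglongrightarrow> snd pone ** adj (snd pone)"
    by (intro tendsto_intros tendsto_snd lim *(3,4))
  ultimately show ?thesis using * by (intro exI[of _ x] exI[of _ n]) simp
qed

text \<open>Recurrence supplies a hyperbolic element, diagonalized by \<open>k\<close>, and one
  whose conjugate by \<open>k\<close> has no zero entry, since both properties are open and hold for
  the limits. The closure of the conjugated projection then satisfies all assumptions of
  \<open>closed_subgroup_all\<close>.\<close>

lemma projection_dense_or_discrete:
  assumes nd: "\<not> (\<exists>e>0. \<forall>x\<in>L. norm (fst x - mat 1) < e \<longrightarrow> fst x = mat 1)" and A: "det A = 1" and e: "e > 0"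
  shows "\<exists>x\<in>L. norm (fst x - A) < e"
proof -
  have det1: "det (mat 1 :: mat2) = 1" by simp
  obtain xa n where xan: "\<And>m. xa m \<in> L" "\<And>m. n m \<ge> m" "(\<lambda>m. (1 / 2 ^ n m) *\<^sub>R fst (xa m)) \<longlonglongrightarrow> mat 1 ** mk2 1 0 0 0 ** adj (mat 1)"
    using projection_hyperbolic[OF det1] by blast
  define a where "a m = fst (xa m)" for m
  have an: "\<And>m. a m \<in> fst ` L" "\<And>m. n m \<ge> m" "(\<lambda>m. (1 / 2 ^ n m) *\<^sub>R a m) \<longlonglongrightarrow> mat 1 ** mk2 1 0 0 0 ** adj (mat 1)"
    using xan by (simp_all add: a_def)
  have "(\<lambda>m. ((1 / 2 ^ n m) *\<^sub>R a m)$1$1 + ((1 / 2 ^ n m) *\<^sub>R a m)$2$2) \<longlonglongrightarrow> 1 + 0"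
    using an(3) unfolding mat2_tendsto_iff by (intro tendsto_add) auto
  then have "\<forall>\<^sub>F m in sequentially. 1/2 < ((1 / 2 ^ n m) *\<^sub>R a m)$1$1 + ((1 / 2 ^ n m) *\<^sub>R a m)$2$2" by (rule order_tendstoD) simp
  then obtain M where M: "\<And>m. m \<ge> M \<Longrightarrow> 1/2 < ((1 / 2 ^ n m) *\<^sub>R a m)$1$1 + ((1 / 2 ^ n m) *\<^sub>R a m)$2$2"
    unfolding eventually_sequentially by blast
  define m where "m = max M 3"
  have "(1/2) * 2 ^ n m < trace (a m)" using M[of m] by (simp add: m_def trace_def sum_2 field_simps)
  moreover have "(2::real) ^ 3 \<le> 2 ^ n m" using an(2)[of m] by (intro power_increasing) (auto simp: m_def)
  ultimately have tr: "trace (a m) > 2" by simp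
  have dP: "det p = 1" if "p \<in> fst ` L" for p using that in_SS SS_D by blast
  have dt: "det (tl2 (a m)) < 0"
  proof -
    have "2 * 2 < trace (a m) * trace (a m)" using tr by (intro mult_strict_mono) auto
    then show ?thesis using det_tl2[of "a m"] dP[OF an(1)] by (simp add: power2_eq_square)
  qed
  define w where "w = mk2 0 (-1) 1 0"
  have "\<exists>k l. det k = 1 \<and> adj k ** a m ** k = dg l \<and> l * l \<noteq> 1 \<and> l \<noteq> 0"
  proof (cases "a m$2$1 = 0")
    case False then show ?thesis using hyperbolic_diag[OF dP[OF an(1)] dt] by blast
  next
    case True
    have 1: "a m$1$1 * a m$2$2 = 1" using dP[OF an(1), of m] True by (simp add: det_2)
    have "a m$1$1 * a m$1$1 \<noteq> 1"
    proof
      assume "a m$1$1 * a m$1$1 = 1"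
      then have "a m$2$2 = a m$1$1" using 1 by (metis mult_cancel_left mult_zero_left zero_neq_one)
      then show False using dt True by (simp add: det_2)
    qed
    then obtain \<beta> where "adj (nn \<beta>) ** a m ** nn \<beta> = dg (a m$1$1)" using upper_diag[OF dP[OF an(1)] True] by blast
    moreover have "a m$1$1 \<noteq> 0" using 1 by auto
    ultimately show ?thesis using \<open>a m$1$1 * a m$1$1 \<noteq> 1\<close> det_nn by blast
  qed
  then obtain k0 l where kl: "det k0 = 1" "adj k0 ** a m ** k0 = dg l" "l * l \<noteq> 1" "l \<noteq> 0" by blast
  have "trace (a m) = l + inverse l" using trace_conj[OF kl(1), of "a m"] kl(2) by (simp add: trace_def sum_2)
  then have "l > 0" using tr by (smt (verit) inverse_nonnegative_iff_nonnegative inverse_minus_eq)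
  \<comment> \<open>If the eigenvalue found is below 1, the quarter turn \<open>w\<close> exchanges
    the two eigenvectors.\<close>
  have "\<exists>k d. det k = 1 \<and> d > 1 \<and> adj k ** a m ** k = dg d"
  proof (cases "l > 1")
    case True then show ?thesis using kl by blast
  next
    case False
    then have "l < 1" using kl(3) by (cases "l = 1") auto
    then have "inverse l > 1" using \<open>l > 0\<close> by (simp add: one_less_inverse_iff)
    moreover have "adj (k0 ** w) ** a m ** (k0 ** w) = adj w ** (adj k0 ** a m ** k0) ** w" by (simp add: adj_mult matrix_mul_assoc)
    then have "adj (k0 ** w) ** a m ** (k0 ** w) = dg (inverse l)" unfolding kl(2) by (simp add: w_def mat2_eq_iff)
    moreover have "det (k0 ** w) = 1" using kl(1) by (simp add: det_mul w_def det_2)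
    ultimately show ?thesis by blast
  qed
  then obtain k d where k: "det k = 1" "d > 1" "adj k ** a m ** k = dg d" by blast
  \<comment> \<open>Any \<open>q0\<close> of determinant 1 without zero entries would do: the
    limiting rank-one matrix has no zero entry then, here it is
    \<open>mk2 2 (-1) 2 (-1)\<close>.\<close>
  define q0 where "q0 = mk2 1 1 1 2"
  have dq: "det (k ** q0) = 1" unfolding det_mul k(1) by (simp add: q0_def det_2)
  obtain xc n' where xcn: "\<And>m. xc m \<in> L" "(\<lambda>m. (1 / 2 ^ n' m) *\<^sub>R fst (xc m)) \<longlonglongrightarrow> (k ** q0) ** mk2 1 0 0 0 ** adj (k ** q0)"
    using projection_hyperbolic[OF dq] by blast
  define c where "c m = fst (xc m)" for m
  have cn: "\<And>m. c m \<in> fst ` L" "(\<lambda>m. (1 / 2 ^ n' m) *\<^sub>R c m) \<longlonglongrightarrow> (k ** q0) ** mk2 1 0 0 0 ** adj (k ** q0)"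
    using xcn by (simp_all add: c_def)
  have "(\<lambda>m. adj k ** ((1 / 2 ^ n' m) *\<^sub>R c m) ** k) \<longlonglongrightarrow> adj k ** ((k ** q0) ** mk2 1 0 0 0 ** adj (k ** q0)) ** k"
    by (intro tendsto_intros cn)
  moreover have "adj k ** ((k ** q0) ** mk2 1 0 0 0 ** adj (k ** q0)) ** k = q0 ** mk2 1 0 0 0 ** adj q0"
    using k(1) by (simp add: adj_mult adj_cancel adj_left flip: matrix_mul_assoc)
  moreover have "q0 ** mk2 1 0 0 0 ** adj q0 = mk2 2 (-1) 2 (-1)" by (simp add: q0_def mat2_eq_iff)
  ultimately have lim: "(\<lambda>m. adj k ** ((1 / 2 ^ n' m) *\<^sub>R c m) ** k) \<longlonglongrightarrow> mk2 2 (-1) 2 (-1)" by simp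
  have ent: "\<forall>\<^sub>F m in sequentially. (adj k ** ((1 / 2 ^ n' m) *\<^sub>R c m) ** k)$i$j \<noteq> 0" if "mk2 2 (-1) 2 (-1)$i$j \<noteq> 0" for i j
    by (rule tendsto_imp_eventually_ne[OF tendsto_vec_nth[OF tendsto_vec_nth[OF lim]] that])
  have "\<forall>\<^sub>F m in sequentially. (adj k ** ((1 / 2 ^ n' m) *\<^sub>R c m) ** k)$1$1 \<noteq> 0 \<and> (adj k ** ((1 / 2 ^ n' m) *\<^sub>R c m) ** k)$1$2 \<noteq> 0 \<and>
     (adj k ** ((1 / 2 ^ n' m) *\<^sub>R c m) ** k)$2$1 \<noteq> 0 \<and> (adj k ** ((1 / 2 ^ n' m) *\<^sub>R c m) ** k)$2$2 \<noteq> 0"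
    by (intro eventually_conj ent) simp_all
  then obtain m' where m': "(adj k ** ((1 / 2 ^ n' m') *\<^sub>R c m') ** k)$1$1 \<noteq> 0 \<and> (adj k ** ((1 / 2 ^ n' m') *\<^sub>R c m') ** k)$1$2 \<noteq> 0 \<and>
     (adj k ** ((1 / 2 ^ n' m') *\<^sub>R c m') ** k)$2$1 \<noteq> 0 \<and> (adj k ** ((1 / 2 ^ n' m') *\<^sub>R c m') ** k)$2$2 \<noteq> 0"
    using eventually_happens'[OF sequentially_bot] by blast
  define c' where "c' = adj k ** c m' ** k"
  have "adj k ** ((1 / 2 ^ n' m') *\<^sub>R c m') ** k = (1 / 2 ^ n' m') *\<^sub>R c'" by (simp add: c'_def mult2.scaleR_left mult2.scaleR_right)
  then have "c'$1$1 \<noteq> 0 \<and> c'$1$2 \<noteq> 0 \<and> c'$2$1 \<noteq> 0 \<and> c'$2$2 \<noteq> 0" using m' by (simp del: mult2_nth)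
  then have c'n: "c'$i$j \<noteq> 0" for i j using exhaust_2[of i] exhaust_2[of j] by auto
  define P where "P = (\<lambda>p. adj k ** p ** k) ` (fst ` L)"
  have Pm: "x ** y \<in> P" if xy: "x \<in> P" "y \<in> P" for x y
  proof -
    obtain s t where st: "s \<in> L" "t \<in> L" "x = adj k ** fst s ** k" "y = adj k ** fst t ** k" using xy unfolding P_def by blast
    have "x ** y = adj k ** fst (s \<star> t) ** k" using k(1) adj_right[of k] st(3,4) by (simp add: adj_cancel flip: matrix_mul_assoc)
    then show ?thesis using mul_in[OF st(1,2)] unfolding P_def by blast
  qed
  have Pi: "adj x \<in> P" if x: "x \<in> P" for x
  proof -
    obtain s where s: "s \<in> L" "x = adj k ** fst s ** k" using x unfolding P_def by blast
    have "adj x = adj k ** fst (pinv s) ** k" using s by (simp add: adj_mult matrix_mul_assoc)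
    then show ?thesis using inv_in[OF s(1)] unfolding P_def by blast
  qed
  define H where "H = closure P"
  have sub: "P \<subseteq> H" unfolding H_def by (rule closure_subset)
  have Pd: "P \<subseteq> {x. det x = 1}"
  proof
    fix x assume "x \<in> P"
    then obtain s where "s \<in> fst ` L" "x = adj k ** s ** k" unfolding P_def by blast
    then show "x \<in> {x. det x = 1}" using dP[of s] k(1) by (simp add: det_mul)
  qed
  have "closed {x::mat2. det x = 1}" unfolding det_2 by (intro closed_Collect_eq continuous_intros)
  then have Hd: "det x = 1" if "x \<in> H" for x using closure_minimal[OF Pd] that unfolding H_def by blast
  have Hi: "adj x \<in> H" if "x \<in> H" for x
  proof -
    have "adj ` closure P \<subseteq> H" by (rule image_closure_subset) (use Pi sub in \<open>auto simp: H_def intro!: continuous_intros\<close>)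
    then show ?thesis using that H_def by blast
  qed
  have Hm1: "x ** y \<in> H" if "x \<in> P" "y \<in> H" for x y
  proof -
    have "(\<lambda>y. x ** y) ` closure P \<subseteq> H" by (rule image_closure_subset) (use Pm[OF that(1)] sub in \<open>auto simp: H_def intro!: continuous_intros\<close>)
    then show ?thesis using that H_def by blast
  qed
  have Hm: "x ** y \<in> H" if "x \<in> H" "y \<in> H" for x y
  proof -
    have "(\<lambda>x. x ** y) ` closure P \<subseteq> H" by (rule image_closure_subset) (use Hm1[OF _ that(2)] in \<open>auto simp: H_def intro!: continuous_intros\<close>)
    then show ?thesis using that H_def by blast
  qed
  have nk: "norm k > 0" using k(1) by (auto simp: det_2)
  have small: "\<exists>h\<in>H. norm (h - mat 1) < r \<and> h \<noteq> mat 1" if r: "r > 0" for r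
  proof -
    have "r / (norm k * norm k) > 0" using r nk by simp
    then obtain x where x: "x \<in> L" "norm (fst x - mat 1) < r / (norm k * norm k)" "fst x \<noteq> mat 1" using nd by blast
    let ?h = "adj k ** fst x ** k"
    have "?h \<in> H" using x sub unfolding P_def by blast
    moreover have "?h - mat 1 = adj k ** (fst x - mat 1) ** k" using k(1) by (simp add: mult2.diff_left mult2.diff_right adj_left)
    then have "norm (?h - mat 1) \<le> norm k * norm (fst x - mat 1) * norm k"
      using order_trans[OF norm_mult2 mult_right_mono[OF norm_mult2 norm_ge_zero], of "adj k" "fst x - mat 1" k] by simp
    moreover have "norm k * norm (fst x - mat 1) * norm k < r" using x(2) nk by (simp add: field_simps)
    moreover have "?h \<noteq> mat 1"
    proof
      assume "?h = mat 1"
      then have "k ** ?h ** adj k = k ** adj k" by simp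
      then have "fst x = mat 1" using k(1) by (simp add: adj_cancel adj_right flip: matrix_mul_assoc)
      then show False using x by simp
    qed
    ultimately show ?thesis by (meson le_less_trans)
  qed
  have "dg d \<in> H" "c' \<in> H" using sub an(1) cn(1) k(3) unfolding P_def c'_def by (metis imageI subsetD)+
  moreover have "det (adj k ** A ** k) = 1" using A k(1) by (simp add: det_mul)
  ultimately have "adj k ** A ** k \<in> H"
    using closed_subgroup_all[of H d c' "adj k ** A ** k"] Hm Hi Hd k(2) c'n small unfolding H_def by (simp add: closed_closure)
  moreover have "e / (norm k * norm k) > 0" using e nk by simp
  ultimately obtain p where p: "p \<in> P" "dist p (adj k ** A ** k) < e / (norm k * norm k)"
    unfolding H_def closure_approachable by blast
  obtain x where x: "x \<in> L" "p = adj k ** fst x ** k" using p(1) unfolding P_def by blast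
  have "fst x - A = k ** (p - adj k ** A ** k) ** adj k"
    using k(1) by (simp add: x mult2.diff_left mult2.diff_right adj_cancel adj_right flip: matrix_mul_assoc)
  then have "norm (fst x - A) \<le> norm k * norm (p - adj k ** A ** k) * norm k"
    using order_trans[OF norm_mult2 mult_right_mono[OF norm_mult2 norm_ge_zero], of k "p - adj k ** A ** k" "adj k"] by simp
  also have "\<dots> < e" using p(2) nk by (simp add: dist_norm field_simps)
  finally show ?thesis using x by blast
qed

end

section \<open>Lattices in \<open>G\<close> and their preimages\<close>

definition SL2 :: "mat2 set" where "SL2 = {A. det A = 1}"

lemma carrier_SL2R: "carrier SL2R = SL2" by (simp add: SL2R_def SL2_def)

lemma SS_Times: "SS = SL2 \<times> SL2" by (auto simp: SS_def SL2_def)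

lemma psl_eq_iff: "psl A = psl B \<longleftrightarrow> A = B \<or> A = - B"
  by (auto simp: psl_eq doubleton_eq_iff)

lemma psl_mult: "A \<in> SL2 \<Longrightarrow> B \<in> SL2 \<Longrightarrow> psl A \<otimes>\<^bsub>PSL2R\<^esub> psl B = psl (A ** B)"
  using normal.rcos_sum[OF normal_pm1_SL2R, of A B] unfolding carrier_SL2R
  by (simp add: PSL2R_def FactGroup_def psl_def) (simp add: SL2R_def)

lemma psl_one: "psl (mat 1) = \<one>\<^bsub>PSL2R\<^esub>"
  by (simp add: PSL2R_def FactGroup_def psl_eq)

lemma psl_carrier: "A \<in> SL2 \<Longrightarrow> psl A \<in> carrier PSL2R"
  by (auto simp: carrier_PSL2R SL2_def)

lemma psl_inv: "A \<in> SL2 \<Longrightarrow> inv\<^bsub>PSL2R\<^esub> psl A = psl (adj A)"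
  by (rule group.inv_equality[OF group_PSL2R]) (simp_all add: psl_mult psl_carrier psl_one[symmetric] SL2_def adj_left)

text \<open>The full preimage of the image of \<open>U\<close> is the union of \<open>U\<close> and
  its negative, which is open.\<close>

lemma openin_PSL2R_image:
  assumes "openin (top_of_set SL2) U" shows "openin PSL2R_top (psl ` U)"
proof -
  have U: "U \<subseteq> SL2" using assms openin_imp_subset by blast
  obtain V where V: "open V" "U = SL2 \<inter> V" using assms by (auto simp: openin_open)
  have m: "- A \<in> SL2 \<longleftrightarrow> A \<in> SL2" for A by (simp add: SL2_def det_uminus_2)
  have "{A \<in> SL2. psl A \<in> psl ` U} = SL2 \<inter> (V \<union> uminus ` V)"
  proof (rule Set.set_eqI)
    fix A
    have "psl A \<in> psl ` U \<longleftrightarrow> A \<in> U \<or> - A \<in> U"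
      unfolding image_iff psl_eq_iff by (metis minus_minus)
    moreover have "A \<in> uminus ` V \<longleftrightarrow> - A \<in> V" by (metis image_iff minus_minus)
    ultimately show "A \<in> {A \<in> SL2. psl A \<in> psl ` U} \<longleftrightarrow> A \<in> SL2 \<inter> (V \<union> uminus ` V)" using V(2) m by blast
  qed
  moreover have "open (V \<union> uminus ` V)" using V(1) by (simp add: open_Un open_negations)
  ultimately have "openin (top_of_set SL2) {A \<in> SL2. psl A \<in> psl ` U}" by (simp add: openin_open_Int)
  moreover have "psl ` U \<subseteq> rcosets\<^bsub>SL2R\<^esub> {mat 1, - mat 1}"
    using U by (auto simp: RCOSETS_def psl_def carrier_SL2R)
  ultimately show ?thesis
    by (simp add: PSL2R_top_def openin_coset_topology carrier_SL2R psl_def[symmetric])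
qed

lemma continuous_map_psl: "continuous_map (top_of_set SL2) PSL2R_top psl"
  using quotient_imp_continuous_map[OF quotient_map_coset_topology[of "top_of_set (carrier SL2R)" SL2R "{mat 1, - mat 1}"]]
  by (simp add: PSL2R_top_def carrier_SL2R psl_def[abs_def])

text \<open>The covering of \<open>G2\<close> by \<open>SS\<close>; its fibres are the four choices
  of signs.\<close>

definition PP :: "mat22 \<Rightarrow> (real^2^2) set \<times> (real^2^2) set" where "PP x = (psl (fst x), psl (snd x))"

lemma PP_eq_iff: "PP x = PP y \<longleftrightarrow> (fst x = fst y \<or> fst x = - fst y) \<and> (snd x = snd y \<or> snd x = - snd y)"
  by (simp add: PP_def psl_eq_iff)

lemma carrier_G2: "carrier G2 = PP ` SS"
proof -
  have "carrier G2 = psl ` SL2 \<times> psl ` SL2" by (simp add: G2_def carrier_PSL2R SL2_def)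
  also have "\<dots> = PP ` SS" by (auto simp: SS_Times PP_def image_iff)
  finally show ?thesis .
qed

lemma PP_carrier [simp]: "x \<in> SS \<Longrightarrow> PP x \<in> carrier G2" by (simp add: carrier_G2)

lemma PP_mult: "x \<in> SS \<Longrightarrow> y \<in> SS \<Longrightarrow> PP x \<otimes>\<^bsub>G2\<^esub> PP y = PP (x \<star> y)"
  by (simp add: G2_def PP_def psl_mult SS_def SL2_def)

lemma PP_one: "PP pone = \<one>\<^bsub>G2\<^esub>" by (simp add: G2_def PP_def psl_one)

lemma PP_inv: "x \<in> SS \<Longrightarrow> inv\<^bsub>G2\<^esub> PP x = PP (pinv x)"
  by (rule group.inv_equality[OF group_G2]) (simp_all add: PP_mult PP_one)

lemma continuous_map_PP: "continuous_map (top_of_set SS) G2_top PP"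
proof -
  have "continuous_map (top_of_set SS) PSL2R_top (\<lambda>x. psl (fst x))"
    by (rule continuous_map_compose[OF _ continuous_map_psl, unfolded o_def]) (auto simp: SS_Times intro!: continuous_intros)
  moreover have "continuous_map (top_of_set SS) PSL2R_top (\<lambda>x. psl (snd x))"
    by (rule continuous_map_compose[OF _ continuous_map_psl, unfolded o_def]) (auto simp: SS_Times intro!: continuous_intros)
  ultimately show ?thesis by (simp add: G2_top_def PP_def[abs_def] continuous_map_pairedI)
qed

lemma openin_G2_image:
  assumes "open V" shows "openin G2_top (PP ` (V \<inter> SS))"
  unfolding G2_top_def openin_prod_topology_alt
proof (intro allI impI)
  fix p q assume "(p, q) \<in> PP ` (V \<inter> SS)"
  then obtain x where x: "x \<in> V" "x \<in> SS" "p = psl (fst x)" "q = psl (snd x)" by (auto simp: PP_def)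
  obtain A B where AB: "open A" "open B" "x \<in> A \<times> B" "A \<times> B \<subseteq> V" using open_prod_elim[OF assms x(1)] by blast
  let ?A = "SL2 \<inter> A" and ?B = "SL2 \<inter> B"
  have "openin PSL2R_top (psl ` ?A)" "openin PSL2R_top (psl ` ?B)"
    using AB by (intro openin_PSL2R_image openin_open_Int; simp)+
  moreover have "p \<in> psl ` ?A" "q \<in> psl ` ?B" using x AB(3) by (auto simp: SS_Times)
  moreover have "psl ` ?A \<times> psl ` ?B \<subseteq> PP ` (V \<inter> SS)"
  proof
    fix y assume "y \<in> psl ` ?A \<times> psl ` ?B"
    then obtain a b where ab: "a \<in> ?A" "b \<in> ?B" "y = (psl a, psl b)" by blast
    then have "(a, b) \<in> V \<inter> SS" using AB(4) by (auto simp: SS_Times)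
    then show "y \<in> PP ` (V \<inter> SS)" using ab(3) by (auto simp: PP_def image_iff intro: bexI[of _ "(a, b)"])
  qed
  ultimately show "\<exists>U W. openin PSL2R_top U \<and> openin PSL2R_top W \<and> p \<in> U \<and> q \<in> W \<and> U \<times> W \<subseteq> PP ` (V \<inter> SS)" by blast
qed

lemma openin_G2_preimage: "openin G2_top W \<Longrightarrow> openin (top_of_set SS) {x \<in> SS. PP x \<in> W}"
  using openin_continuous_map_preimage[OF continuous_map_PP] by simp

section \<open>The quotient and its invariant measure\<close>

lemma pigeonhole_measure:
  fixes B :: "nat \<Rightarrow> 'a set"
  assumes fin: "emeasure M (space M) \<noteq> \<infinity>" and B: "\<And>i. B i \<in> sets M" "\<And>i. emeasure M (B i) \<ge> c" "c > 0"
  shows "\<exists>i j. i < j \<and> B i \<inter> B j \<noteq> {}"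
proof (rule ccontr)
  assume n: "\<not> (\<exists>i j. i < j \<and> B i \<inter> B j \<noteq> {})"
  interpret finite_measure M by (rule finite_measureI) (use fin in auto)
  have dis: "disjoint_family B" unfolding disjoint_family_on_def using n by (metis inf_commute nat_neq_iff)
  define d where "d = measure M (B 0)"
  have cfin: "c \<noteq> \<infinity>" using B(2)[of 0] emeasure_finite[of "B 0"] by (metis infinity_ennreal_def neq_top_trans)
  define r where "r = enn2real c"
  have r: "r > 0" using B(3) cfin unfolding r_def by (simp add: enn2real_positive_iff less_top)
  have m: "measure M (B i) \<ge> r" for i
    using B(2)[of i] unfolding r_def measure_def
    by (rule enn2real_mono) (use emeasure_finite[of "B i"] in \<open>simp add: less_top[symmetric]\<close>)
  obtain k where k: "measure M (space M) < real k * r" using reals_Archimedean3[OF r] by blast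
  have "real k * r \<le> (\<Sum>i<k. measure M (B i))" using sum_mono[of "{..<k}" "\<lambda>_. r" "\<lambda>i. measure M (B i)"] m by simp
  also have "\<dots> = measure M (\<Union>i<k. B i)"
    by (rule finite_measure_finite_Union[symmetric]) (use B(1) dis in \<open>auto simp: disjoint_family_on_def\<close>)
  also have "\<dots> \<le> measure M (space M)" by (rule bounded_measure)
  finally show False using k by simp
qed

text \<open>The measure whose existence \<open>finite_covolume\<close> asserts becomes a parameter,
  so that it can be lifted, compared and pushed forward.\<close>

locale lattice_G2 =
  fixes \<Gamma> :: "((real^2^2) set \<times> (real^2^2) set) set" and M :: "((real^2^2) set \<times> (real^2^2) set) set measure"
  assumes dsub: "discrete_subgroup G2 G2_top \<Gamma>"
    and sets_M: "sets M = sets (sigma (rcosets\<^bsub>G2\<^esub> \<Gamma>) {U. openin (coset_topology G2 G2_top \<Gamma>) U})"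
    and M_pos: "emeasure M (space M) \<noteq> 0" and M_fin: "emeasure M (space M) \<noteq> \<infinity>"
    and M_inv: "g \<in> carrier G2 \<Longrightarrow> B \<in> sets M \<Longrightarrow> emeasure M ((\<lambda>x. x #>\<^bsub>G2\<^esub> g) ` B) = emeasure M B"
begin

definition L :: "mat22 set" where "L = {x \<in> SS. PP x \<in> \<Gamma>}"

definition PI :: "mat22 \<Rightarrow> ((real^2^2) set \<times> (real^2^2) set) set" where "PI x = \<Gamma> #>\<^bsub>G2\<^esub> PP x"

lemma subgroup: "subgroup \<Gamma> G2" using dsub by (simp add: discrete_subgroup_def)

lemma Gamma_eq: "\<Gamma> = PP ` L"
proof
  show "\<Gamma> \<subseteq> PP ` L"
  proof
    fix g assume g: "g \<in> \<Gamma>"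
    then have "g \<in> carrier G2" using subgroup.mem_carrier[OF subgroup] by blast
    then obtain x where "x \<in> SS" "g = PP x" by (auto simp: carrier_G2)
    then show "g \<in> PP ` L" using g by (auto simp: L_def)
  qed
qed (auto simp: L_def)

lemma L_sign: "x \<in> L \<Longrightarrow> PP y = PP x \<Longrightarrow> y \<in> L"
proof -
  assume x: "x \<in> L" and e: "PP y = PP x"
  then have "y \<in> SS" using PP_eq_iff[of y x] by (auto simp: L_def SS_def det_uminus_2)
  then show "y \<in> L" using x e by (simp add: L_def)
qed

lemma discrete_SS_L: "discrete_SS L"
proof
  show "L \<subseteq> SS" by (auto simp: L_def)
  show "pone \<in> L" using subgroup.one_closed[OF subgroup] by (simp add: L_def PP_one)
  show "x \<star> y \<in> L" if "x \<in> L" "y \<in> L" for x y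
    using that subgroup.m_closed[OF subgroup, of "PP x" "PP y"] by (simp add: L_def PP_mult)
  show "pinv x \<in> L" if "x \<in> L" for x
    using that subgroup.m_inv_closed[OF subgroup, of "PP x"] by (simp add: L_def PP_inv)
  have one: "PP pone \<in> \<Gamma>" using subgroup.one_closed[OF subgroup] by (simp add: PP_one)
  have "openin (discrete_topology \<Gamma>) {PP pone}" using one by simp
  then have "openin (subtopology G2_top \<Gamma>) {PP pone}" using dsub by (simp add: discrete_subgroup_def)
  then obtain W where W: "openin G2_top W" "{PP pone} = W \<inter> \<Gamma>" by (auto simp: openin_subtopology)
  obtain V where V: "open V" "{x \<in> SS. PP x \<in> W} = SS \<inter> V" using openin_G2_preimage[OF W(1)] by (auto simp: openin_open)
  have "pone \<in> SS \<inter> V" using W(2) V(2) by auto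
  then obtain e where e: "e > 0" "ball pone e \<subseteq> V" using V(1) open_contains_ball by (metis IntE)
  show "\<exists>e>0. \<forall>x\<in>L. norm (x - pone) < e \<longrightarrow> x = pone"
  proof (intro exI[of _ "min e 1"] conjI ballI impI)
    show "min e 1 > 0" using e by simp
    \<comment> \<open>Discreteness of \<open>\<Gamma>\<close> determines \<open>x\<close> only up to
      signs; distance below 1 from \<open>pone\<close> settles these.\<close>
    fix x assume x: "x \<in> L" "norm (x - pone) < min e 1"
    then have "x \<in> SS \<inter> V" using e(2) by (auto simp: L_def dist_norm norm_minus_commute)
    then have "PP x \<in> W \<inter> \<Gamma>" using x(1) V(2) by (auto simp: L_def)
    then have "PP x = PP pone" using W(2) by blast
    then have c: "fst x = mat 1 \<or> fst x = - mat 1" "snd x = mat 1 \<or> snd x = - mat 1" by (simp_all add: PP_eq_iff)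
    have "norm (fst x - mat 1) < 1" "norm (snd x - mat 1) < 1"
      using x(2) norm_fst_diff[of x pone] norm_snd_diff[of x pone] by auto
    then have "fst x = mat 1" "snd x = mat 1" using c norm_neg1 by auto
    then show "x = pone" by (simp add: prod_eq_iff)
  qed
qed

sublocale discrete_SS L by (rule discrete_SS_L)

lemma PI_eq_iff:
  assumes "x \<in> SS" "y \<in> SS" shows "PI x = PI y \<longleftrightarrow> (\<exists>\<gamma>\<in>L. \<gamma> \<star> x = y)"
proof
  interpret G: group G2 by (rule group_G2)
  assume "PI x = PI y"
  then have "PP y \<in> \<Gamma> #>\<^bsub>G2\<^esub> PP x" using G.rcos_self[OF PP_carrier[OF assms(2)] subgroup] by (simp add: PI_def)
  then obtain g where g: "g \<in> \<Gamma>" "PP y = g \<otimes>\<^bsub>G2\<^esub> PP x" by (auto simp: r_coset_def)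
  obtain \<gamma> where \<gamma>: "\<gamma> \<in> L" "g = PP \<gamma>" using g(1) equalityD1[OF Gamma_eq] by blast
  have "PP y = PP (\<gamma> \<star> x)" using g(2) \<gamma> assms by (simp add: PP_mult)
  then have "PP (y \<star> pinv x) = PP \<gamma>"
    using assms \<gamma> PP_mult[of y "pinv x"] PP_mult[of "\<gamma> \<star> x" "pinv x"] by (simp add: pmul_assoc)
  then have "y \<star> pinv x \<in> L" using L_sign \<gamma>(1) by blast
  moreover have "y \<star> pinv x \<star> x = y" using assms by (simp add: pmul_assoc)
  ultimately show "\<exists>\<gamma>\<in>L. \<gamma> \<star> x = y" by blast
next
  interpret G: group G2 by (rule group_G2)
  assume "\<exists>\<gamma>\<in>L. \<gamma> \<star> x = y"
  then obtain \<gamma> where \<gamma>: "\<gamma> \<in> L" "\<gamma> \<star> x = y" by blast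
  have S: "\<gamma> \<in> SS" "PP \<gamma> \<in> \<Gamma>" using \<gamma>(1) unfolding L_def by blast+
  have "PP \<gamma> \<otimes>\<^bsub>G2\<^esub> PP x = PP y" using PP_mult[OF S(1) assms(1)] \<gamma>(2) by simp
  then have "PI y = \<Gamma> #>\<^bsub>G2\<^esub> (PP \<gamma> \<otimes>\<^bsub>G2\<^esub> PP x)" by (simp add: PI_def)
  also have "\<dots> = (\<Gamma> #>\<^bsub>G2\<^esub> PP \<gamma>) #>\<^bsub>G2\<^esub> PP x"
    by (rule G.coset_mult_assoc[symmetric]) (use S(1) assms(1) subgroup.subset[OF subgroup] in simp_all)
  also have "\<Gamma> #>\<^bsub>G2\<^esub> PP \<gamma> = \<Gamma>" by (rule G.coset_join2[OF PP_carrier[OF S(1)] subgroup S(2)])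
  finally show "PI x = PI y" by (simp add: PI_def)
qed

lemma PI_translate: "x \<in> SS \<Longrightarrow> y \<in> SS \<Longrightarrow> PI x #>\<^bsub>G2\<^esub> PP y = PI (x \<star> y)"
  unfolding PI_def using group.coset_mult_assoc[OF group_G2 subgroup.subset[OF subgroup], of "PP x" "PP y"] by (simp add: PP_mult)

lemma rcosets_eq: "rcosets\<^bsub>G2\<^esub> \<Gamma> = PI ` SS"
  by (auto simp: RCOSETS_def PI_def carrier_G2)

lemma space_M: "space M = PI ` SS"
proof -
  have "space M = space (sigma (rcosets\<^bsub>G2\<^esub> \<Gamma>) {U. openin (coset_topology G2 G2_top \<Gamma>) U})" using sets_M by (rule sets_eq_imp_space_eq)
  also have "\<dots> = PI ` SS"
  proof -
    have "{U. openin (coset_topology G2 G2_top \<Gamma>) U} \<subseteq> Pow (rcosets\<^bsub>G2\<^esub> \<Gamma>)" by (auto simp: openin_coset_topology)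
    then show ?thesis by (simp add: space_measure_of rcosets_eq)
  qed
  finally show ?thesis .
qed

text \<open>The preimage in \<open>SS\<close> is the saturation of \<open>V\<close> under
  \<open>L\<close>, a union of left translates.\<close>

lemma openin_PI_image:
  assumes "open V" shows "openin (coset_topology G2 G2_top \<Gamma>) (PI ` (V \<inter> SS))"
  unfolding openin_coset_topology
proof
  show "PI ` (V \<inter> SS) \<subseteq> rcosets\<^bsub>G2\<^esub> \<Gamma>" by (auto simp: rcosets_eq)
  define W where "W = (\<Union>\<gamma>\<in>L. (\<lambda>w. pinv \<gamma> \<star> w) -` V)"
  have "open W" unfolding W_def using assms by (intro open_UN ballI open_vimage continuous_intros)
  then have "openin G2_top (PP ` (W \<inter> SS))" by (rule openin_G2_image)
  moreover have "{g \<in> topspace G2_top. \<Gamma> #>\<^bsub>G2\<^esub> g \<in> PI ` (V \<inter> SS)} = PP ` (W \<inter> SS)"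
  proof (rule Set.set_eqI)
    fix g
    have "g \<in> {g \<in> topspace G2_top. \<Gamma> #>\<^bsub>G2\<^esub> g \<in> PI ` (V \<inter> SS)} \<longleftrightarrow> (\<exists>x\<in>SS. g = PP x \<and> PI x \<in> PI ` (V \<inter> SS))"
      by (auto simp: topspace_G2_top carrier_G2 PI_def)
    also have "\<dots> \<longleftrightarrow> (\<exists>x\<in>SS. g = PP x \<and> x \<in> W)"
    proof (intro bex_cong refl conj_cong)
      fix x assume x: "x \<in> SS"
      have "PI x \<in> PI ` (V \<inter> SS) \<longleftrightarrow> (\<exists>v\<in>V \<inter> SS. PI v = PI x)" by (auto simp: image_iff)
      also have "\<dots> \<longleftrightarrow> (\<exists>v\<in>V \<inter> SS. \<exists>\<gamma>\<in>L. \<gamma> \<star> v = x)" using PI_eq_iff x by blast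
      also have "\<dots> \<longleftrightarrow> x \<in> W"
      proof
        assume "\<exists>v\<in>V \<inter> SS. \<exists>\<gamma>\<in>L. \<gamma> \<star> v = x"
        then obtain v \<gamma> where v: "v \<in> V" "\<gamma> \<in> L" "\<gamma> \<star> v = x" by blast
        then have "pinv \<gamma> \<star> x = v" by auto
        then show "x \<in> W" using v by (auto simp: W_def)
      next
        assume "x \<in> W"
        then obtain \<gamma> where \<gamma>: "\<gamma> \<in> L" "pinv \<gamma> \<star> x \<in> V" unfolding W_def by blast
        then have "\<gamma> \<star> (pinv \<gamma> \<star> x) = x" "pinv \<gamma> \<star> x \<in> V \<inter> SS" using x by simp_all
        then show "\<exists>v\<in>V \<inter> SS. \<exists>\<gamma>\<in>L. \<gamma> \<star> v = x" using \<gamma>(1) by blast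
      qed
      finally show "PI x \<in> PI ` (V \<inter> SS) \<longleftrightarrow> x \<in> W" .
    qed
    also have "\<dots> \<longleftrightarrow> g \<in> PP ` (W \<inter> SS)" by blast
    finally show "g \<in> {g \<in> topspace G2_top. \<Gamma> #>\<^bsub>G2\<^esub> g \<in> PI ` (V \<inter> SS)} \<longleftrightarrow> g \<in> PP ` (W \<inter> SS)" .
  qed
  ultimately show "openin G2_top {g \<in> topspace G2_top. \<Gamma> #>\<^bsub>G2\<^esub> g \<in> PI ` (V \<inter> SS)}" by simp
qed

lemma PI_image_sets [simp]: "open V \<Longrightarrow> PI ` (V \<inter> SS) \<in> sets M"
  unfolding sets_M using openin_PI_image[of V]
  by (subst sets_measure_of) (auto simp: openin_coset_topology intro: sigma_sets.Basic)

lemma openin_PI_preimage: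
  assumes "openin (coset_topology G2 G2_top \<Gamma>) U"
  obtains V where "open V" "{x \<in> SS. PI x \<in> U} = SS \<inter> V"
proof -
  have "openin G2_top {g \<in> topspace G2_top. \<Gamma> #>\<^bsub>G2\<^esub> g \<in> U}" using assms by (simp add: openin_coset_topology)
  from openin_G2_preimage[OF this] have "openin (top_of_set SS) {x \<in> SS. PI x \<in> U}"
    by (simp add: topspace_G2_top PI_def cong: conj_cong)
  then show ?thesis using that by (auto simp: openin_open)
qed

lemma M_translate:
  assumes "open V" "y \<in> SS" shows "emeasure M (PI ` ((\<lambda>x. x \<star> y) ` (V \<inter> SS))) = emeasure M (PI ` (V \<inter> SS))"
proof -
  have "(\<lambda>x. x #>\<^bsub>G2\<^esub> PP y) ` (PI ` (V \<inter> SS)) = PI ` ((\<lambda>x. x \<star> y) ` (V \<inter> SS))"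
    unfolding image_image using PI_translate assms(2) by (intro image_cong) auto
  then show ?thesis using M_inv[of "PP y" "PI ` (V \<inter> SS)"] assms by simp
qed

lemma translate_open:
  assumes "y \<in> SS" shows "(\<lambda>x. x \<star> y) ` (V \<inter> SS) = ((\<lambda>x. x \<star> pinv y) -` V) \<inter> SS"
proof
  show "(\<lambda>x. x \<star> y) ` (V \<inter> SS) \<subseteq> ((\<lambda>x. x \<star> pinv y) -` V) \<inter> SS" using assms by (auto simp: pmul_assoc)
  show "((\<lambda>x. x \<star> pinv y) -` V) \<inter> SS \<subseteq> (\<lambda>x. x \<star> y) ` (V \<inter> SS)"
  proof
    fix x assume "x \<in> ((\<lambda>x. x \<star> pinv y) -` V) \<inter> SS"
    then have "x = (x \<star> pinv y) \<star> y" "x \<star> pinv y \<in> V \<inter> SS" using assms by (simp_all add: pmul_assoc)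
    then show "x \<in> (\<lambda>x. x \<star> y) ` (V \<inter> SS)" by blast
  qed
qed

lemma open_translate: "open V \<Longrightarrow> open ((\<lambda>x. x \<star> y) -` V)"
  by (intro open_vimage continuous_intros)

text \<open>Right translates of \<open>V\<close> cover \<open>SS\<close>, countably many suffice by
  the Lindelof property, and their images all have the same measure; if it were 0, the whole measure
  would vanish.\<close>

lemma M_open_pos:
  assumes "open V" "V \<inter> SS \<noteq> {}" shows "emeasure M (PI ` (V \<inter> SS)) > 0"
proof (rule ccontr)
  assume "\<not> ?thesis"
  then have z: "emeasure M (PI ` (V \<inter> SS)) = 0" by simp
  obtain u0 where u0: "u0 \<in> V" "u0 \<in> SS" using assms by blast
  define N where "N k = (\<lambda>w. w \<star> (pinv k \<star> u0)) -` V" for k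
  have oN: "open (N k)" for k unfolding N_def using assms(1) by (rule open_translate)
  have kN: "k \<in> N k" if "k \<in> SS" for k using that u0 by (simp add: N_def)
  obtain F' where F': "F' \<subseteq> N ` SS" "countable F'" "\<Union>F' = \<Union>(N ` SS)" using Lindelof[of "N ` SS"] oN by blast
  have null: "PI ` (W \<inter> SS) \<in> null_sets M" if W: "W \<in> F'" for W
  proof -
    obtain k where k: "k \<in> SS" "W = N k" using W F'(1) by blast
    have "W = (\<lambda>x. x \<star> pinv (pinv u0 \<star> k)) -` V" by (simp add: k N_def pinv_mul)
    then have "W \<inter> SS = (\<lambda>x. x \<star> (pinv u0 \<star> k)) ` (V \<inter> SS)" using translate_open[of "pinv u0 \<star> k" V] k u0 by simp
    then have "emeasure M (PI ` (W \<inter> SS)) = 0" using M_translate[OF assms(1), of "pinv u0 \<star> k"] k u0 z by simp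
    then show ?thesis using oN k by (intro null_setsI) auto
  qed
  have "(\<Union>W\<in>F'. PI ` (W \<inter> SS)) \<in> null_sets M" by (rule null_sets_UN'[OF F'(2) null])
  moreover have "(\<Union>W\<in>F'. PI ` (W \<inter> SS)) = PI ` SS"
  proof -
    have "SS \<subseteq> \<Union>F'" unfolding F'(3) using kN by blast
    then have "SS = (\<Union>W\<in>F'. W \<inter> SS)" by blast
    then have "PI ` SS = PI ` (\<Union>W\<in>F'. W \<inter> SS)" by simp
    then show ?thesis by (simp only: image_UN)
  qed
  ultimately show False using M_pos space_M by auto
qed

text \<open>Poincare recurrence: the images of the translates of \<open>U\<close> have equal
  positive measure in a finite measure space, so two of them meet.\<close>

lemma nonwandering_L:
  fixes g :: "nat \<Rightarrow> mat22"
  assumes U: "open U" "U \<inter> SS \<noteq> {}" and g: "\<And>n. g n \<in> SS" "\<And>i j. g (i + j) = g i \<star> g j"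
  shows "\<exists>n\<ge>N. \<exists>\<gamma>\<in>L. \<exists>u\<in>U \<inter> SS. \<exists>u'\<in>U \<inter> SS. \<gamma> \<star> u \<star> g n = u'"
proof -
  \<comment> \<open>Only multiples of \<open>N\<close> are used as times, so that two different ones
    differ by at least \<open>N\<close>. For \<open>N = 0\<close> the return time is 0, which the
    claim allows.\<close>
  define B where "B k = PI ` ((\<lambda>x. x \<star> g (N * k)) ` (U \<inter> SS))" for k
  have "\<exists>i j. i < j \<and> B i \<inter> B j \<noteq> {}"
  proof (rule pigeonhole_measure[OF M_fin])
    show "B k \<in> sets M" for k unfolding B_def translate_open[OF g(1)] by (intro PI_image_sets open_translate U)
    show "emeasure M (PI ` (U \<inter> SS)) \<le> emeasure M (B k)" for k using M_translate[OF U(1) g(1)] by (simp add: B_def)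
    show "0 < emeasure M (PI ` (U \<inter> SS))" by (rule M_open_pos[OF U])
  qed
  then obtain i j where ij: "i < j" "B i \<inter> B j \<noteq> {}" by blast
  then obtain u u' where u: "u \<in> U \<inter> SS" "u' \<in> U \<inter> SS" "PI (u \<star> g (N * j)) = PI (u' \<star> g (N * i))"
    unfolding B_def by blast
  have "u \<star> g (N * j) \<in> SS" "u' \<star> g (N * i) \<in> SS" using u g by simp_all
  then obtain \<gamma> where \<gamma>: "\<gamma> \<in> L" "\<gamma> \<star> (u \<star> g (N * j)) = u' \<star> g (N * i)" using PI_eq_iff u(3) by blast
  define n where "n = N * (j - i)"
  have "N * j = n + N * i" using ij(1) by (simp add: n_def diff_mult_distrib2)
  then have "\<gamma> \<star> u \<star> g n \<star> g (N * i) = u' \<star> g (N * i)" using \<gamma>(2) g(2)[of n "N * i"] by (simp add: pmul_assoc)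
  then have "\<gamma> \<star> u \<star> g n \<star> g (N * i) \<star> pinv (g (N * i)) = u' \<star> g (N * i) \<star> pinv (g (N * i))" by simp
  then have "\<gamma> \<star> u \<star> g n = u'" using g(1) by (simp add: pmul_assoc)
  moreover have "1 \<le> j - i" using ij(1) by simp
  then have "N * 1 \<le> N * (j - i)" by (rule mult_le_mono2)
  then have "n \<ge> N" by (simp add: n_def)
  ultimately show ?thesis using u \<gamma> by blast
qed

end

section \<open>Haar measure and packing\<close>

text \<open>By Fubini, each slice at a fixed second coordinate is merely translated. On matrices as
  pairs of rows this shear is left multiplication by \<open>nn t\<close>, the next one that by
  \<open>nm t\<close>.\<close>

lemma lborel_shear1:
  "distr lborel borel (\<lambda>p. (fst p + t *\<^sub>R snd p, snd p)) = (lborel :: ('a::euclidean_space \<times> 'a) measure)" (is "distr _ _ ?g = _")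
proof (rule measure_eqI)
  have g: "?g \<in> borel_measurable borel" by (intro borel_measurable_continuous_onI continuous_intros)
  fix S assume "S \<in> sets (distr lborel borel ?g)"
  then have S: "S \<in> sets borel" by simp
  have gS: "?g -` S \<in> sets borel" using measurable_sets[OF g S] by simp
  have S': "S \<in> sets (lborel \<Otimes>\<^sub>M (lborel :: 'a measure))" "?g -` S \<in> sets (lborel \<Otimes>\<^sub>M (lborel :: 'a measure))"
    using S gS by (simp_all only: lborel_prod sets_lborel)
  have slice: "(\<lambda>x. (x, y)) -` S \<in> sets borel" for y :: 'a
    using measurable_sets[OF borel_measurable_continuous_onI S, of "\<lambda>x. (x, y)"] by (simp add: continuous_intros)
  have "emeasure (distr lborel borel ?g) S = emeasure lborel (?g -` S)" using g S by (subst emeasure_distr) auto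
  also have "\<dots> = (\<integral>\<^sup>+y. emeasure lborel ((\<lambda>x. (x, y)) -` (?g -` S)) \<partial>(lborel :: 'a measure))"
    using lborel_pair.emeasure_pair_measure_alt2[OF S'(2)] by (simp add: lborel_prod)
  also have "\<dots> = (\<integral>\<^sup>+y. emeasure lborel ((\<lambda>x. (x, y)) -` S) \<partial>(lborel :: 'a measure))"
  proof (rule nn_integral_cong)
    fix y :: 'a
    have "emeasure lborel ((\<lambda>x. (x, y)) -` S) = emeasure (distr lborel borel ((+) (t *\<^sub>R y))) ((\<lambda>x. (x, y)) -` S)"
      by (simp add: lborel_distr_plus)
    also have "\<dots> = emeasure lborel ((+) (t *\<^sub>R y) -` ((\<lambda>x. (x, y)) -` S))" using slice by (subst emeasure_distr) auto
    also have "(+) (t *\<^sub>R y) -` ((\<lambda>x. (x, y)) -` S) = (\<lambda>x. (x, y)) -` (?g -` S)" by (auto simp: add.commute)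
    finally show "emeasure lborel ((\<lambda>x. (x, y)) -` (?g -` S)) = emeasure lborel ((\<lambda>x. (x, y)) -` S)" by simp
  qed
  also have "\<dots> = emeasure lborel S"
    using lborel_pair.emeasure_pair_measure_alt2[OF S'(1)] by (simp add: lborel_prod)
  finally show "emeasure (distr lborel borel ?g) S = emeasure lborel S" .
qed simp

lemma lborel_shear2:
  "distr lborel borel (\<lambda>p. (fst p, snd p + t *\<^sub>R fst p)) = (lborel :: ('a::euclidean_space \<times> 'a) measure)" (is "distr _ _ ?g = _")
proof (rule measure_eqI)
  have g: "?g \<in> borel_measurable borel" by (intro borel_measurable_continuous_onI continuous_intros)
  fix S assume "S \<in> sets (distr lborel borel ?g)"
  then have S: "S \<in> sets borel" by simp
  have gS: "?g -` S \<in> sets borel" using measurable_sets[OF g S] by simp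
  have S': "S \<in> sets ((lborel :: 'a measure) \<Otimes>\<^sub>M lborel)" "?g -` S \<in> sets ((lborel :: 'a measure) \<Otimes>\<^sub>M lborel)"
    using S gS by (simp_all only: lborel_prod sets_lborel)
  have slice: "Pair x -` S \<in> sets borel" for x :: 'a
    using measurable_sets[OF borel_measurable_continuous_onI S, of "Pair x"] by (simp add: continuous_intros)
  have "emeasure (distr lborel borel ?g) S = emeasure lborel (?g -` S)" using g S by (subst emeasure_distr) auto
  also have "\<dots> = (\<integral>\<^sup>+x. emeasure lborel (Pair x -` (?g -` S)) \<partial>(lborel :: 'a measure))"
    using lborel.emeasure_pair_measure_alt[OF S'(2)] by (simp add: lborel_prod)
  also have "\<dots> = (\<integral>\<^sup>+x. emeasure lborel (Pair x -` S) \<partial>(lborel :: 'a measure))"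
  proof (rule nn_integral_cong)
    fix x :: 'a
    have "emeasure lborel (Pair x -` S) = emeasure (distr lborel borel ((+) (t *\<^sub>R x))) (Pair x -` S)"
      by (simp add: lborel_distr_plus)
    also have "\<dots> = emeasure lborel ((+) (t *\<^sub>R x) -` (Pair x -` S))" using slice by (subst emeasure_distr) auto
    also have "(+) (t *\<^sub>R x) -` (Pair x -` S) = Pair x -` (?g -` S)" by (auto simp: add.commute)
    finally show "emeasure lborel (Pair x -` (?g -` S)) = emeasure lborel (Pair x -` S)" by simp
  qed
  also have "\<dots> = emeasure lborel S"
    using lborel.emeasure_pair_measure_alt[OF S'(1)] by (simp add: lborel_prod)
  finally show "emeasure (distr lborel borel ?g) S = emeasure lborel S" .
qed simp

text \<open>Right multiplication of a matrix acts by one and the same map on both rows.\<close>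

lemma lborel_prod_map:
  fixes s :: "'a::euclidean_space \<Rightarrow> 'a"
  assumes "continuous_on UNIV s" "distr lborel borel s = lborel"
  shows "distr lborel borel (\<lambda>p. (s (fst p), s (snd p))) = lborel"
proof -
  have m: "s \<in> measurable lborel borel" using borel_measurable_continuous_onI[OF assms(1)] by simp
  have "lborel \<Otimes>\<^sub>M lborel = distr lborel borel s \<Otimes>\<^sub>M distr lborel borel s" by (simp add: assms(2))
  also have "\<dots> = distr (lborel \<Otimes>\<^sub>M lborel) (borel \<Otimes>\<^sub>M borel) (\<lambda>(x, y). (s x, s y))"
    by (rule pair_measure_distr[OF m m]) (simp add: assms(2) sigma_finite_lborel)
  finally show ?thesis by (simp add: lborel_prod borel_prod case_prod_unfold)
qed

section \<open>Haar measure of \<open>SL(2,R)\<close>\<close>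

type_synonym row2 = "(real \<times> real) \<times> (real \<times> real)"

text \<open>Matrices are parametrized by their pairs of rows, since Lebesgue measure is then a
  product to which Fubini and the shears apply.\<close>

definition mmat :: "row2 \<Rightarrow> mat2" where "mmat p = mk2 (fst (fst p)) (snd (fst p)) (fst (snd p)) (snd (snd p))"
definition dt :: "row2 \<Rightarrow> real" where "dt p = fst (fst p) * snd (snd p) - snd (fst p) * fst (snd p)"
definition nrm :: "row2 \<Rightarrow> mat2" where "nrm p = (1 / sqrt (dt p)) *\<^sub>R mmat p"
definition tcone :: "row2 set" where "tcone = {p. 0 < dt p \<and> dt p \<le> 1}"

text \<open>The Haar measure of \<open>SL(2,\<real>)\<close>: a set is measured by the Lebesgue measure of the truncated cone over it.\<close>

definition haar1 :: "mat2 measure" where "haar1 = distr (restrict_space lborel tcone) borel nrm"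

lemma continuous_dt: "continuous_on UNIV dt" unfolding dt_def by (intro continuous_intros)

lemma continuous_mmat: "continuous_on S mmat"
  unfolding continuous_on_def mat2_tendsto_iff by (auto simp: mmat_def intro!: tendsto_intros)

lemma continuous_nrm: "continuous_on {p. 0 < dt p} nrm"
  unfolding nrm_def by (intro continuous_intros continuous_mmat continuous_on_subset[OF continuous_dt]) auto

lemma cone_borel [measurable]: "tcone \<in> sets borel"
proof -
  have "tcone = {p. 0 < dt p} \<inter> {p. dt p \<le> 1}" by (auto simp: tcone_def)
  moreover have "open {p. 0 < dt p}" "closed {p. dt p \<le> 1}"
    using continuous_dt by (auto intro: open_Collect_less closed_Collect_le)
  ultimately show ?thesis using sets.Int[OF borel_open borel_closed] by metis
qed

lemma nrm_measurable: "nrm \<in> measurable (restrict_space lborel tcone) borel"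
proof -
  have "nrm \<in> borel_measurable (restrict_space borel tcone)"
    by (rule borel_measurable_continuous_on_restrict, rule continuous_on_subset[OF continuous_nrm]) (auto simp: tcone_def)
  then show ?thesis by (simp add: measurable_def space_restrict_space sets_restrict_space)
qed

lemma cone_nrm_borel: "S \<in> sets borel \<Longrightarrow> tcone \<inter> nrm -` S \<in> sets borel"
  using measurable_sets[OF nrm_measurable, of S] by (simp add: space_restrict_space sets_restrict_space_iff Int_commute)

lemma emeasure_haar1: "S \<in> sets borel \<Longrightarrow> emeasure haar1 S = emeasure lborel (tcone \<inter> nrm -` S)"
  unfolding haar1_def
  by (subst emeasure_distr[OF nrm_measurable]) (auto simp: space_restrict_space emeasure_restrict_space Int_commute)

lemma sets_haar1 [simp]: "sets haar1 = sets borel" and space_haar1 [simp]: "space haar1 = UNIV"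
  by (simp_all add: haar1_def)

text \<open>A homogeneous map that preserves Lebesgue measure and \<open>dt\<close> preserves the
  truncated cone and commutes with the normalization \<open>nrm\<close>.\<close>

lemma haar1_invariant:
  assumes f: "continuous_on UNIV f" "distr lborel borel f = lborel" "\<And>p. dt (f p) = dt p"
    and F: "continuous_on UNIV F" "\<And>p. mmat (f p) = F (mmat p)" "\<And>c X. F (c *\<^sub>R X) = c *\<^sub>R F X"
  shows "distr haar1 borel F = haar1"
proof (rule measure_eqI)
  have Fm: "F \<in> measurable haar1 borel" using borel_measurable_continuous_onI[OF F(1)] by (simp add: measurable_def)
  have fm: "f \<in> measurable lborel borel" using borel_measurable_continuous_onI[OF f(1)] by simp
  fix S assume "S \<in> sets (distr haar1 borel F)"
  then have S: "S \<in> sets borel" by simp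
  have FS: "F -` S \<in> sets borel" using measurable_sets[OF Fm S] by simp
  have "emeasure (distr haar1 borel F) S = emeasure haar1 (F -` S)" using S by (subst emeasure_distr[OF Fm]) auto
  also have "\<dots> = emeasure lborel (tcone \<inter> nrm -` (F -` S))" by (rule emeasure_haar1[OF FS])
  also have "tcone \<inter> nrm -` (F -` S) = f -` (tcone \<inter> nrm -` S)" by (rule Set.set_eqI) (simp add: tcone_def nrm_def f(3) F(2,3))
  also have "emeasure lborel (f -` (tcone \<inter> nrm -` S)) = emeasure (distr lborel borel f) (tcone \<inter> nrm -` S)"
    using cone_nrm_borel[OF S] by (subst emeasure_distr[OF fm]) auto
  also have "\<dots> = emeasure haar1 S" unfolding f(2) by (rule emeasure_haar1[OF S, symmetric])
  finally show "emeasure (distr haar1 borel F) S = emeasure haar1 S" .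
qed simp

lemma haar1_compose:
  assumes "distr haar1 borel F = haar1" "distr haar1 borel G = haar1" "continuous_on UNIV F" "continuous_on UNIV G"
  shows "distr haar1 borel (\<lambda>x. F (G x)) = haar1"
proof -
  have m: "F \<in> measurable borel borel" "G \<in> measurable haar1 borel"
    using borel_measurable_continuous_onI assms(3,4) by (auto simp: measurable_def)
  have "distr haar1 borel (\<lambda>x. F (G x)) = distr (distr haar1 borel G) borel F"
    by (simp add: distr_distr[OF m] comp_def)
  then show ?thesis using assms by simp
qed

lemma haar1_left: assumes "det A = 1" shows "distr haar1 borel (\<lambda>X. A ** X) = haar1"
proof -
  have n: "distr haar1 borel (\<lambda>X. nn t ** X) = haar1" for t
    by (rule haar1_invariant[OF _ lborel_shear1[of t]])
      (auto simp: dt_def mmat_def mat2_eq_iff algebra_simps intro!: continuous_intros)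
  have m: "distr haar1 borel (\<lambda>X. nm t ** X) = haar1" for t
    by (rule haar1_invariant[OF _ lborel_shear2[of t]])
      (auto simp: dt_def mmat_def mat2_eq_iff algebra_simps intro!: continuous_intros)
  obtain x y z t where A: "A = nn x ** nm y ** nn z ** nm t" using SL2_generated[OF assms] by blast
  have "distr haar1 borel (\<lambda>X. nn x ** (nm y ** (nn z ** (nm t ** X)))) = haar1"
    by (rule haar1_compose[OF n haar1_compose[OF m haar1_compose[OF n m]]]) (intro continuous_intros)+
  then show ?thesis by (simp add: A matrix_mul_assoc)
qed

lemma haar1_right: assumes "det A = 1" shows "distr haar1 borel (\<lambda>X. X ** A) = haar1"
proof -
  have n: "distr haar1 borel (\<lambda>X. X ** nn t) = haar1" for t
    by (rule haar1_invariant[OF _ lborel_prod_map[OF _ lborel_shear2[of t]]])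
      (auto simp: dt_def mmat_def mat2_eq_iff algebra_simps intro!: continuous_intros)
  have m: "distr haar1 borel (\<lambda>X. X ** nm t) = haar1" for t
    by (rule haar1_invariant[OF _ lborel_prod_map[OF _ lborel_shear1[of t]]])
      (auto simp: dt_def mmat_def mat2_eq_iff algebra_simps intro!: continuous_intros)
  obtain x y z t where A: "A = nn x ** nm y ** nn z ** nm t" using SL2_generated[OF assms] by blast
  have "distr haar1 borel (\<lambda>X. ((X ** nn x) ** nm y) ** nn z ** nm t) = haar1"
    by (rule haar1_compose[OF m haar1_compose[OF n haar1_compose[OF m n]]]) (intro continuous_intros)+
  then show ?thesis by (simp add: A matrix_mul_assoc)
qed

lemma norm_row2_le: "norm (p::row2) \<le> 4 * norm (mmat p)"
proof -
  have "norm p \<le> norm (fst p) + norm (snd p)" using norm_Pair_le[of "fst p" "snd p"] by simp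
  also have "\<dots> \<le> (\<bar>fst (fst p)\<bar> + \<bar>snd (fst p)\<bar>) + (\<bar>fst (snd p)\<bar> + \<bar>snd (snd p)\<bar>)"
    using norm_Pair_le[of "fst (fst p)" "snd (fst p)"] norm_Pair_le[of "fst (snd p)" "snd (snd p)"] by simp
  also have "\<dots> \<le> 4 * norm (mmat p)"
    using norm_ge_entry[of "mmat p" 1 1] norm_ge_entry[of "mmat p" 1 2] norm_ge_entry[of "mmat p" 2 1] norm_ge_entry[of "mmat p" 2 2]
    by (simp add: mmat_def)
  finally show ?thesis .
qed

lemma haar1_ball_finite: "emeasure haar1 (ball 0 r) \<noteq> \<infinity>"
proof -
  have "tcone \<inter> nrm -` ball 0 r \<subseteq> cball 0 (4 * \<bar>r\<bar>)"
  proof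
    fix p assume p: "p \<in> tcone \<inter> nrm -` ball 0 r"
    then have d: "0 < dt p" "dt p \<le> 1" "norm (nrm p) < r" by (auto simp: tcone_def)
    have "mmat p = sqrt (dt p) *\<^sub>R nrm p" using d by (simp add: nrm_def)
    then have "norm (mmat p) = sqrt (dt p) * norm (nrm p)" using d by simp
    also have "\<dots> \<le> 1 * \<bar>r\<bar>" using d by (intro mult_mono) auto
    finally show "p \<in> cball 0 (4 * \<bar>r\<bar>)" using norm_row2_le[of p] by simp
  qed
  then have "bounded (tcone \<inter> nrm -` ball 0 r)" using bounded_cball bounded_subset by blast
  then have "emeasure lborel (tcone \<inter> nrm -` ball 0 r) < \<infinity>" by (rule emeasure_bounded_finite)
  then show ?thesis by (simp add: emeasure_haar1)
qed

lemma sigma_finite_haar1: "sigma_finite_measure haar1"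
proof
  show "\<exists>A. countable A \<and> A \<subseteq> sets haar1 \<and> \<Union> A = space haar1 \<and> (\<forall>a\<in>A. emeasure haar1 a \<noteq> \<infinity>)"
  proof (intro exI[of _ "range (\<lambda>n::nat. ball 0 (real n))"] conjI ballI)
    show "\<Union> (range (\<lambda>n::nat. ball 0 (real n))) = space haar1"
      using reals_Archimedean2 by auto
    fix a assume "a \<in> range (\<lambda>n::nat. ball (0::mat2) (real n))"
    then show "emeasure haar1 a \<noteq> \<infinity>" using haar1_ball_finite by auto
  qed auto
qed

lemma haar1_open_pos: assumes V: "open V" "mat 1 \<in> V" shows "emeasure haar1 V > 0"
proof (rule ccontr)
  assume "\<not> ?thesis"
  then have z: "emeasure lborel (tcone \<inter> nrm -` V) = 0" using V by (simp add: emeasure_haar1)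
  define W where "W = {p. 0 < dt p \<and> dt p < 1} \<inter> ({p. 0 < dt p} \<inter> nrm -` V)"
  have "open {p. 0 < dt p}" using continuous_dt by (auto intro: open_Collect_less)
  then have "open ({p. 0 < dt p} \<inter> nrm -` V)" using continuous_nrm V(1) by (intro continuous_open_preimage) auto
  moreover have "open {p. 0 < dt p \<and> dt p < 1}" using continuous_dt by (intro open_Collect_conj open_Collect_less) auto
  ultimately have "open W" unfolding W_def by (rule open_Int[rotated])
  have "W \<subseteq> tcone \<inter> nrm -` V" by (auto simp: W_def tcone_def)
  then have "emeasure lborel W \<le> emeasure lborel (tcone \<inter> nrm -` V)"
    using cone_nrm_borel[of V] V(1) by (intro emeasure_mono) auto
  then have "emeasure lborel W = 0" using z by simp
  then have "W \<in> null_sets lborel" using \<open>open W\<close> by (intro null_setsI) auto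
  then have "negligible W" by (simp add: negligible_iff_null_sets null_sets_completionI)
  then have "W = {}" using open_not_negligible[OF \<open>open W\<close>] by blast
  \<comment> \<open>A scalar matrix over the identity strictly inside the truncated cone:
    \<open>W\<close> is cut off below \<open>dt = 1\<close> to be open.\<close>
  moreover have d: "dt ((1/2, 0), (0, 1/2)) = (1/2)\<^sup>2" by (simp add: dt_def power2_eq_square)
  have "sqrt (dt ((1/2, 0), (0, 1/2))) = 1/2" unfolding d by (rule real_sqrt_unique) auto
  then have "nrm ((1/2, 0), (0, 1/2)) = mat 1" by (simp add: nrm_def mmat_def mat2_eq_iff)
  then have "((1/2, 0), (0, 1/2)) \<in> W" using V(2) by (simp add: W_def d power2_eq_square)
  ultimately show False by blast
qed

section \<open>Haar measure of the product\<close>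

definition haar :: "mat22 measure" where "haar = haar1 \<Otimes>\<^sub>M haar1"

lemma sets_haar [simp]: "sets haar = sets borel"
proof -
  have "sets haar = sets (borel \<Otimes>\<^sub>M (borel :: mat2 measure))" unfolding haar_def by (rule sets_pair_measure_cong) simp_all
  then show ?thesis by (simp only: borel_prod)
qed

lemma space_haar [simp]: "space haar = UNIV" by (simp add: haar_def space_pair_measure)

interpretation haar1: sigma_finite_measure haar1 by (rule sigma_finite_haar1)
interpretation haar1_pair: pair_sigma_finite haar1 haar1 ..

lemma sigma_finite_haar: "sigma_finite_measure haar"
  unfolding haar_def by (rule haar1_pair.P.sigma_finite_measure_axioms)

lemma haar_map_invariant:
  assumes "distr haar1 borel F = haar1" "distr haar1 borel G = haar1" "continuous_on UNIV F" "continuous_on UNIV G"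
    and S: "S \<in> sets borel"
  shows "emeasure haar ((\<lambda>x. (F (fst x), G (snd x))) -` S) = emeasure haar S"
proof -
  have m: "F \<in> measurable haar1 borel" "G \<in> measurable haar1 borel"
    using borel_measurable_continuous_onI assms(3,4) by (auto simp: measurable_def)
  have "haar = distr haar1 borel F \<Otimes>\<^sub>M distr haar1 borel G" by (simp add: haar_def assms)
  also have "\<dots> = distr (haar1 \<Otimes>\<^sub>M haar1) (borel \<Otimes>\<^sub>M borel) (\<lambda>(x, y). (F x, G y))"
    by (rule pair_measure_distr[OF m]) (simp add: assms(2) sigma_finite_haar1)
  finally have e: "haar = distr haar borel (\<lambda>x. (F (fst x), G (snd x)))" by (simp add: haar_def borel_prod case_prod_unfold)
  have "continuous_on UNIV (\<lambda>x::mat22. F (fst x))" "continuous_on UNIV (\<lambda>x::mat22. G (snd x))"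
    using assms(3,4) by (auto intro!: continuous_on_compose2[of UNIV F _ fst] continuous_on_compose2[of UNIV G _ snd] continuous_intros)
  then have "continuous_on UNIV (\<lambda>x::mat22. (F (fst x), G (snd x)))" by (intro continuous_on_Pair)
  then have mm: "(\<lambda>x. (F (fst x), G (snd x))) \<in> measurable haar borel"
    using borel_measurable_continuous_onI by (auto simp: measurable_def)
  have "emeasure haar S = emeasure (distr haar borel (\<lambda>x. (F (fst x), G (snd x)))) S" using e by simp
  also have "\<dots> = emeasure haar ((\<lambda>x. (F (fst x), G (snd x))) -` S)" using S by (subst emeasure_distr[OF mm]) auto
  finally show ?thesis by simp
qed

lemma haar_left: "g \<in> SS \<Longrightarrow> S \<in> sets borel \<Longrightarrow> emeasure haar ((\<lambda>x. g \<star> x) -` S) = emeasure haar S"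
  using haar_map_invariant[OF haar1_left[of "fst g"] haar1_left[of "snd g"], of S]
  by (simp add: SS_def pmul_def continuous_intros)

lemma haar_right: "g \<in> SS \<Longrightarrow> S \<in> sets borel \<Longrightarrow> emeasure haar ((\<lambda>x. x \<star> g) -` S) = emeasure haar S"
  using haar_map_invariant[OF haar1_right[of "fst g"] haar1_right[of "snd g"], of S]
  by (simp add: SS_def pmul_def continuous_intros)

text \<open>\<open>haar\<close> is a measure on all pairs of matrices, but it is carried by
  \<open>SS\<close> because the values of \<open>nrm\<close> on the cone have determinant 1.\<close>

lemma haar_null_compl: "S \<in> sets borel \<Longrightarrow> emeasure haar (S \<inter> SS) = emeasure haar S"
proof -
  assume S: "S \<in> sets borel"
  have nd: "det (nrm p) = 1" if "p \<in> tcone" for p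
  proof -
    have "dt p > 0" using that by (simp add: tcone_def)
    then have "sqrt (dt p) * sqrt (dt p) = dt p" "sqrt (dt p) \<noteq> 0" by simp_all
    moreover have "det (nrm p) = dt p / (sqrt (dt p) * sqrt (dt p))" by (simp add: nrm_def det_2 dt_def mmat_def diff_divide_distrib)
    ultimately show ?thesis using \<open>dt p > 0\<close> by simp
  qed
  have cl: "closed SL2" unfolding SL2_def det_2 by (intro closed_Collect_eq continuous_intros)
  have "emeasure haar1 (- SL2) = emeasure lborel (tcone \<inter> nrm -` (- SL2))" using cl by (intro emeasure_haar1) auto
  also have "tcone \<inter> nrm -` (- SL2) = {}" using nd by (auto simp: SL2_def)
  finally have z: "- SL2 \<in> null_sets haar1" using cl by (intro null_setsI) auto
  have "(- SL2) \<times> UNIV \<in> null_sets (haar1 \<Otimes>\<^sub>M haar1)" "UNIV \<times> (- SL2) \<in> null_sets (haar1 \<Otimes>\<^sub>M haar1)"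
    using cl null_setsD1[OF z] by (auto intro!: null_setsI simp: haar1.emeasure_pair_measure_Times)
  then have "((- SL2) \<times> UNIV) \<union> (UNIV \<times> (- SL2)) \<in> null_sets haar" unfolding haar_def by (rule null_sets.Un)
  moreover have "((- SL2) \<times> UNIV) \<union> (UNIV \<times> (- SL2)) = - SS" by (auto simp: SS_Times)
  ultimately have "- SS \<in> null_sets haar" by simp
  then have "emeasure haar (S - (- SS)) = emeasure haar S" using S by (intro emeasure_Diff_null_set) simp_all
  moreover have "S - (- SS) = S \<inter> SS" by blast
  ultimately show ?thesis by simp
qed

lemma haar_open_pos: assumes "open V" "pone \<in> V" shows "emeasure haar (V \<inter> SS) > 0"
proof -
  obtain A B where AB: "open A" "open B" "pone \<in> A \<times> B" "A \<times> B \<subseteq> V" using open_prod_elim[OF assms] by blast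
  have "0 < emeasure haar1 A * emeasure haar1 B"
    using haar1_open_pos[of A] haar1_open_pos[of B] AB by (simp add: pone_def ennreal_zero_less_mult_iff)
  also have "\<dots> = emeasure haar (A \<times> B)" unfolding haar_def using AB by (simp add: haar1.emeasure_pair_measure_Times)
  also have "\<dots> \<le> emeasure haar V" using AB(4) assms(1) by (intro emeasure_mono) auto
  finally show ?thesis using haar_null_compl[of V] assms(1) by simp
qed

lemma haar_bounded_finite: assumes "S \<subseteq> ball 0 r" "S \<in> sets borel" shows "emeasure haar S \<noteq> \<infinity>"
proof -
  have "S \<subseteq> ball 0 r \<times> ball 0 r"
  proof
    fix x assume "x \<in> S"
    then have "norm x < r" using assms(1) by auto
    then show "x \<in> ball 0 r \<times> ball 0 r" using norm_fst_diff[of x 0] norm_snd_diff[of x 0] by (cases x) auto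
  qed
  then have "emeasure haar S \<le> emeasure haar (ball 0 r \<times> ball 0 r)" by (intro emeasure_mono) (simp_all add: borel_open open_Times)
  also have "\<dots> = emeasure haar1 (ball 0 r) * emeasure haar1 (ball 0 r)"
    unfolding haar_def by (simp add: haar1.emeasure_pair_measure_Times)
  also have "\<dots> < \<infinity>" using haar1_ball_finite[of r] by (simp add: ennreal_mult_less_top less_top)
  finally show ?thesis by simp
qed

section \<open>Comparison of the quotient measure with Haar measure\<close>

context lattice_G2 begin

text \<open>The measure \<open>M\<close> lifted to \<open>V\<close> along the local inverse of
  \<open>PI\<close>; meaningful when \<open>PI\<close> is injective on
  \<open>V \<inter> SS\<close>.\<close>

definition nu :: "mat22 set \<Rightarrow> mat22 measure" where
  "nu V = distr (restrict_space M (PI ` (V \<inter> SS))) borel (inv_into (V \<inter> SS) PI)"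

lemma nu_props:
  assumes V: "open V" and inj: "inj_on PI (V \<inter> SS)"
  shows "S \<in> sets borel \<Longrightarrow> emeasure (nu V) S = emeasure M (PI ` (V \<inter> SS \<inter> S))"
    and "sets (nu V) = sets borel" "space (nu V) = UNIV" "finite_measure (nu V)"
proof -
  let ?E = "V \<inter> SS" and ?R = "restrict_space M (PI ` (V \<inter> SS))" and ?s = "inv_into (V \<inter> SS) PI"
  have sE: "PI ` ?E \<in> sets M" using V by simp
  have sp: "space ?R = PI ` ?E" using sets.sets_into_space[OF sE] by (auto simp: space_restrict_space)
  have pre: "?s -` S \<inter> PI ` ?E = PI ` (?E \<inter> S)" for S
    using inj by (auto simp: image_iff)
  have sm: "?s \<in> measurable ?R borel"
  proof (rule borel_measurableI)
    fix S :: "mat22 set" assume "open S"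
    then have "PI ` ((V \<inter> S) \<inter> SS) \<in> sets M" using V by (intro PI_image_sets) auto
    moreover have "V \<inter> S \<inter> SS = ?E \<inter> S" by blast
    ultimately show "?s -` S \<inter> space ?R \<in> sets ?R"
      unfolding sp pre using sE by (subst sets_restrict_space_iff) (auto simp: sets.Int_space_eq2)
  qed
  show e: "emeasure (nu V) S = emeasure M (PI ` (V \<inter> SS \<inter> S))" if S: "S \<in> sets borel" for S
  proof -
    have "emeasure (nu V) S = emeasure ?R (?s -` S \<inter> space ?R)" unfolding nu_def by (rule emeasure_distr[OF sm S])
    also have "\<dots> = emeasure ?R (PI ` (?E \<inter> S))" by (simp only: sp pre)
    also have "\<dots> = emeasure M (PI ` (?E \<inter> S))" using sE by (intro emeasure_restrict_space) (auto simp: sets.Int_space_eq2)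
    finally show ?thesis .
  qed
  show "sets (nu V) = sets borel" "space (nu V) = UNIV" by (simp_all add: nu_def)
  show "finite_measure (nu V)"
  proof (rule finite_measureI)
    have "emeasure (nu V) (space (nu V)) = emeasure M (PI ` (V \<inter> SS \<inter> UNIV))" using e[of UNIV] by (simp add: nu_def)
    also have "\<dots> \<le> emeasure M (space M)" by (rule emeasure_space)
    finally show "emeasure (nu V) (space (nu V)) \<noteq> \<infinity>" using M_fin by (auto simp: top_unique)
  qed
qed

text \<open>As for the uniqueness of Haar measure: apply Fubini to the set of pairs \<open>(e, y)\<close> with \<open>e \<in> V\<^sub>1\<close> and
  \<open>e y \<in> V\<^sub>2\<close>, with the transported measure on the first and Haar measure on the second factor.\<close>

lemma measure_proportional:
  assumes V: "open V1" "open V2" and inj: "inj_on PI (V1 \<inter> SS)" "inj_on PI (V2 \<inter> SS)"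
  shows "emeasure M (PI ` (V1 \<inter> SS)) * emeasure haar (V2 \<inter> SS) =
    emeasure M (PI ` (V2 \<inter> SS)) * emeasure haar (pinv -` (V1 \<inter> SS))"
proof -
  let ?n1 = "nu V1" and ?n2 = "nu V2" and ?E1 = "V1 \<inter> SS" and ?E2 = "V2 \<inter> SS"
  note n1 = nu_props[OF V(1) inj(1)] and n2 = nu_props[OF V(2) inj(2)]
  interpret h: sigma_finite_measure haar by (rule sigma_finite_haar)
  interpret f1: finite_measure ?n1 by (rule n1(4))
  interpret f2: finite_measure ?n2 by (rule n2(4))
  interpret p1: pair_sigma_finite ?n1 haar ..
  interpret p2: pair_sigma_finite ?n2 haar ..
  have bE: "?E1 \<in> sets borel" "?E2 \<in> sets borel" using V closed_SS by auto
  have sp: "sets (?n1 \<Otimes>\<^sub>M haar) = sets borel" "sets (?n2 \<Otimes>\<^sub>M haar) = sets borel"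
    using sets_pair_measure_cong[of ?n1 borel haar borel] sets_pair_measure_cong[of ?n2 borel haar borel] n1(2) n2(2)
    unfolding borel_prod by (simp_all only: sets_haar)
  \<comment> \<open>\<open>Q1\<close> and \<open>Q2\<close> parametrize the same pairs: with
    \<open>e' = e \<star> y\<close>, the conditions \<open>e \<star> y\<close> in \<open>E2\<close>
    and \<open>e' \<star> pinv y\<close> in \<open>E1\<close> are exchanged, and the lifted measures
    supply the respective other one.\<close>
  define Q1 where "Q1 = (\<lambda>p. fst p \<star> snd p) -` ?E2"
  define Q2 where "Q2 = (\<lambda>p. fst p \<star> pinv (snd p)) -` ?E1"
  have Q: "Q1 \<in> sets borel" "Q2 \<in> sets borel"
    using measurable_sets[OF borel_measurable_continuous_onI bE(2), of "\<lambda>p. fst p \<star> snd p"]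
      measurable_sets[OF borel_measurable_continuous_onI bE(1), of "\<lambda>p. fst p \<star> pinv (snd p)"]
    by (simp_all add: Q1_def Q2_def continuous_intros)
  have pi1: "pinv -` ?E1 \<in> sets borel"
    using measurable_sets[OF borel_measurable_continuous_onI bE(1), of pinv] by (simp add: continuous_intros)
  have supp: "AE e in ?n1. e \<in> SS" "AE e in ?n2. e \<in> SS"
  proof -
    have z: "emeasure ?n1 (- SS) = 0" "emeasure ?n2 (- SS) = 0"
    proof -
      have "emeasure ?n1 (- SS) = emeasure M (PI ` (V1 \<inter> SS \<inter> - SS))" by (rule n1(1)) (use closed_SS in auto)
      moreover have "V1 \<inter> SS \<inter> - SS = {}" by blast
      ultimately show "emeasure ?n1 (- SS) = 0" by simp
      have "emeasure ?n2 (- SS) = emeasure M (PI ` (V2 \<inter> SS \<inter> - SS))" by (rule n2(1)) (use closed_SS in auto)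
      moreover have "V2 \<inter> SS \<inter> - SS = {}" by blast
      ultimately show "emeasure ?n2 (- SS) = 0" by simp
    qed
    then have "- SS \<in> null_sets ?n1" "- SS \<in> null_sets ?n2" using n1(2) n2(2) closed_SS by (auto intro!: null_setsI)
    then show "AE e in ?n1. e \<in> SS" "AE e in ?n2. e \<in> SS" by (auto intro: AE_I')
  qed
  have "emeasure (?n1 \<Otimes>\<^sub>M haar) Q1 = (\<integral>\<^sup>+e. emeasure haar (Pair e -` Q1) \<partial>?n1)"
    by (rule h.emeasure_pair_measure_alt) (unfold sp, rule Q)
  also have "\<dots> = (\<integral>\<^sup>+e. emeasure haar ?E2 \<partial>?n1)"
  proof (rule nn_integral_cong_AE, use supp(1) in eventually_elim)
    fix e assume e: "e \<in> SS"
    have "Pair e -` Q1 = (\<lambda>x. e \<star> x) -` ?E2" by (auto simp: Q1_def)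
    then show "emeasure haar (Pair e -` Q1) = emeasure haar ?E2" by (simp only: haar_left[OF e bE(2)])
  qed
  also have "\<dots> = emeasure haar ?E2 * emeasure M (PI ` ?E1)" using n1(1)[of UNIV] n1(3) by simp
  finally have L: "emeasure (?n1 \<Otimes>\<^sub>M haar) Q1 = emeasure haar ?E2 * emeasure M (PI ` ?E1)" .
  have "emeasure (?n2 \<Otimes>\<^sub>M haar) Q2 = (\<integral>\<^sup>+e. emeasure haar (Pair e -` Q2) \<partial>?n2)"
    by (rule h.emeasure_pair_measure_alt) (unfold sp, rule Q)
  also have "\<dots> = (\<integral>\<^sup>+e. emeasure haar (pinv -` ?E1) \<partial>?n2)"
  proof (rule nn_integral_cong_AE, use supp(2) in eventually_elim)
    fix e assume e: "e \<in> SS"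
    have "Pair e -` Q2 = (\<lambda>x. x \<star> pinv e) -` (pinv -` ?E1)" by (rule Set.set_eqI) (simp add: Q2_def pinv_mul)
    then show "emeasure haar (Pair e -` Q2) = emeasure haar (pinv -` ?E1)" by (simp only: haar_right[OF SS_pinv[OF e] pi1])
  qed
  also have "\<dots> = emeasure haar (pinv -` ?E1) * emeasure M (PI ` ?E2)" using n2(1)[of UNIV] n2(3) by simp
  finally have R: "emeasure (?n2 \<Otimes>\<^sub>M haar) Q2 = emeasure haar (pinv -` ?E1) * emeasure M (PI ` ?E2)" .
  \<comment> \<open>For fixed \<open>y\<close> the two slices correspond under right translation by
    \<open>y\<close>, which preserves \<open>M\<close>; for \<open>y\<close> outside
    \<open>SS\<close> both are empty up to null sets.\<close>
  have "emeasure (?n1 \<Otimes>\<^sub>M haar) Q1 = (\<integral>\<^sup>+y. emeasure ?n1 ((\<lambda>e. (e, y)) -` Q1) \<partial>haar)"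
    by (rule p1.emeasure_pair_measure_alt2) (unfold sp, rule Q)
  also have "\<dots> = (\<integral>\<^sup>+y. emeasure ?n2 ((\<lambda>e. (e, y)) -` Q2) \<partial>haar)"
  proof (rule nn_integral_cong)
    fix y
    have q1: "(\<lambda>e. (e, y)) -` Q1 = (\<lambda>e. e \<star> y) -` ?E2" and q2: "(\<lambda>e. (e, y)) -` Q2 = (\<lambda>e. e \<star> pinv y) -` ?E1"
      by (auto simp: Q1_def Q2_def)
    have b1: "(\<lambda>e. e \<star> y) -` ?E2 \<in> sets borel" "(\<lambda>e. e \<star> pinv y) -` ?E1 \<in> sets borel"
      using measurable_sets[OF borel_measurable_continuous_onI bE(2), of "\<lambda>e. e \<star> y"]
        measurable_sets[OF borel_measurable_continuous_onI bE(1), of "\<lambda>e. e \<star> pinv y"] by (simp_all add: continuous_intros)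
    show "emeasure ?n1 ((\<lambda>e. (e, y)) -` Q1) = emeasure ?n2 ((\<lambda>e. (e, y)) -` Q2)"
      unfolding q1 q2 n1(1)[OF b1(1)] n2(1)[OF b1(2)]
    proof (cases "y \<in> SS")
      case True
      define V where "V = V1 \<inter> (\<lambda>e. e \<star> y) -` V2"
      have oV: "open V" unfolding V_def using V by (intro open_Int open_translate)
      have "e \<star> y \<in> SS" if "e \<in> SS" for e using that True by simp
      then have e1: "V1 \<inter> SS \<inter> (\<lambda>e. e \<star> y) -` (V2 \<inter> SS) = V \<inter> SS" unfolding V_def by blast
      have "(\<lambda>x. x \<star> y) ` (V \<inter> SS) = V2 \<inter> SS \<inter> (\<lambda>e. e \<star> pinv y) -` (V1 \<inter> SS)"
        unfolding translate_open[OF True]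
      proof (rule Set.set_eqI)
        fix x
        have "x \<star> pinv y \<star> y = x" using True by (simp add: pmul_assoc)
        moreover have "x \<star> pinv y \<in> SS" if "x \<in> SS" using that True by simp
        ultimately show "x \<in> (\<lambda>x. x \<star> pinv y) -` V \<inter> SS \<longleftrightarrow> x \<in> V2 \<inter> SS \<inter> (\<lambda>e. e \<star> pinv y) -` (V1 \<inter> SS)"
          by (auto simp: V_def simp del: pmul_assoc split_paired_All split_paired_Ex)
      qed
      then show "emeasure M (PI ` (V1 \<inter> SS \<inter> (\<lambda>e. e \<star> y) -` (V2 \<inter> SS))) = emeasure M (PI ` (V2 \<inter> SS \<inter> (\<lambda>e. e \<star> pinv y) -` (V1 \<inter> SS)))"
        using M_translate[OF oV True] unfolding e1 by simp
    next
      case False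
      have "V1 \<inter> SS \<inter> (\<lambda>e. e \<star> y) -` (V2 \<inter> SS) = {}" "V2 \<inter> SS \<inter> (\<lambda>e. e \<star> pinv y) -` (V1 \<inter> SS) = {}"
        using False by (auto simp: SS_def det_mul)
      then show "emeasure M (PI ` (V1 \<inter> SS \<inter> (\<lambda>e. e \<star> y) -` (V2 \<inter> SS))) = emeasure M (PI ` (V2 \<inter> SS \<inter> (\<lambda>e. e \<star> pinv y) -` (V1 \<inter> SS)))"
        by simp
    qed
  qed
  also have "\<dots> = emeasure (?n2 \<Otimes>\<^sub>M haar) Q2"
    by (rule p2.emeasure_pair_measure_alt2[symmetric]) (unfold sp, rule Q)
  finally show ?thesis using L R by (simp add: mult.commute)
qed

text \<open>\<open>M\<close> is invariant under right translation, while the balls at different base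
  points are left translates of one another. Comparison with \<open>haar\<close>, which is invariant
  on both sides, shows that their images have the same measure wherever \<open>PI\<close> is
  injective.\<close>

lemma measure_lower_bound:
  assumes \<rho>: "\<rho> > 0" and small: "\<And>\<gamma> w w'. \<gamma> \<in> L \<Longrightarrow> w \<in> ball pone \<rho> \<inter> SS \<Longrightarrow> w' \<in> ball pone \<rho> \<inter> SS \<Longrightarrow> \<gamma> \<star> w = w' \<Longrightarrow> \<gamma> = pone"
  shows "\<exists>c>0. \<forall>h\<in>SS. inj_on PI (((\<lambda>w. pinv h \<star> w) -` ball pone \<rho>) \<inter> SS) \<longrightarrow>
    c \<le> emeasure M (PI ` (((\<lambda>w. pinv h \<star> w) -` ball pone \<rho>) \<inter> SS))"
proof -
  let ?O = "ball pone \<rho>"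
  have inj0: "inj_on PI (?O \<inter> SS)"
  proof (rule inj_onI)
    fix x y assume xy: "x \<in> ?O \<inter> SS" "y \<in> ?O \<inter> SS" "PI x = PI y"
    then obtain \<gamma> where "\<gamma> \<in> L" "\<gamma> \<star> x = y" using PI_eq_iff[of x y] by blast
    then show "x = y" using small xy by (metis pone_left)
  qed
  have bO: "?O \<inter> SS \<in> sets borel" using closed_SS by auto
  define a where "a = emeasure haar (?O \<inter> SS)"
  define b where "b = emeasure haar (pinv -` (?O \<inter> SS))"
  define m where "m = emeasure M (PI ` (?O \<inter> SS))"
  have apos: "a > 0" unfolding a_def using haar_open_pos[of ?O] \<rho> by simp
  have "?O \<inter> SS \<subseteq> ball 0 (2 + \<rho>)"
  proof
    fix x assume "x \<in> ?O \<inter> SS"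
    then have "norm (x - pone) < \<rho>" by (simp add: dist_norm norm_minus_commute)
    then show "x \<in> ball 0 (2 + \<rho>)" using norm_triangle_sub[of x pone] by simp
  qed
  then have afin: "a \<noteq> \<infinity>" unfolding a_def using haar_bounded_finite bO by blast
  have "pinv -` (?O \<inter> SS) = (pinv -` ?O) \<inter> SS"
    by (auto simp: SS_def)
  moreover have "open (pinv -` ?O)" by (intro open_vimage continuous_intros) auto
  ultimately have bpos: "b > 0" unfolding b_def using haar_open_pos[of "pinv -` ?O"] \<rho> by simp
  have "pone \<in> ?O \<inter> SS" using \<rho> by simp
  then have mpos: "m > 0" unfolding m_def by (intro M_open_pos open_ball) blast
  \<comment> \<open>The common value of the measures: applying \<open>pinv\<close> turns left
    translates into right ones, so \<open>b\<close> is the same for all \<open>h\<close>.\<close>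
  define c where "c = m * b / a"
  have "c > 0" unfolding c_def using apos afin bpos mpos by (simp add: ennreal_zero_less_divide ennreal_zero_less_mult_iff less_top)
  moreover have "c \<le> emeasure M (PI ` (((\<lambda>w. pinv h \<star> w) -` ?O) \<inter> SS))"
    if h: "h \<in> SS" and inj: "inj_on PI (((\<lambda>w. pinv h \<star> w) -` ?O) \<inter> SS)" for h
  proof -
    let ?V = "(\<lambda>w. pinv h \<star> w) -` ?O"
    have oV: "open ?V" by (intro open_vimage continuous_intros) auto
    have "emeasure M (PI ` (?V \<inter> SS)) * a = m * emeasure haar (pinv -` (?V \<inter> SS))"
      unfolding a_def m_def by (rule measure_proportional[OF oV open_ball inj inj0])
    also have "pinv -` (?V \<inter> SS) = (\<lambda>x. x \<star> h) -` (pinv -` (?O \<inter> SS))"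
      by (rule Set.set_eqI) (use h in \<open>simp add: pinv_mul SS_def det_mul\<close>)
    also have "emeasure haar \<dots> = b" unfolding b_def 
      using measurable_sets[OF borel_measurable_continuous_onI bO, of pinv] by (intro haar_right[OF h]) (simp add: continuous_intros)
    finally have e: "emeasure M (PI ` (?V \<inter> SS)) * a = m * b" .
    have "c = emeasure M (PI ` (?V \<inter> SS)) * a / a" unfolding c_def e ..
    also have "\<dots> = emeasure M (PI ` (?V \<inter> SS))" using apos afin
      by (metis ennreal_mult_divide_eq infinity_ennreal_def less_numeral_extra(3))
    finally show ?thesis by simp
  qed
  ultimately show ?thesis by blast
qed

text \<open>The constant 6 is 2 times 3: \<open>w'\<close> and \<open>w\<close> differ by less than
  \<open>2 * \<rho>\<close>, and \<open>w\<close> has norm at most 3.\<close>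

lemma near_quotient:
  assumes w: "w \<in> ball pone \<rho> \<inter> SS" "w' \<in> ball pone \<rho> \<inter> SS" and \<rho>: "\<rho> \<le> 1" "6 * \<rho> \<le> r"
  shows "norm (w' \<star> pinv w - pone) < r"
proof -
  have n: "norm (w - pone) < \<rho>" "norm (w' - pone) < \<rho>" using w by (simp_all add: dist_norm norm_minus_commute)
  have "w' \<star> pinv w - pone = (w' - w) \<star> pinv w" using w by (simp add: pmul.diff_left)
  then have "norm (w' \<star> pinv w - pone) \<le> norm (w' - w) * norm w" using norm_pmul[of "w' - w" "pinv w"] by simp
  also have "\<dots> \<le> norm (w' - w) * 3" using n norm_triangle_sub[of w pone] \<rho> by (intro mult_left_mono) auto
  also have "\<dots> < (2 * \<rho>) * 3" using norm_triangle_ineq4[of "w' - pone" "w - pone"] n by (intro mult_strict_right_mono) auto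
  finally show ?thesis using \<rho> by simp
qed

text \<open>The assumption on \<open>h n\<close> makes \<open>PI\<close> injective on a ball at
  \<open>h n\<close>, whose image therefore has measure at least \<open>c\<close>. Infinitely many
  such images cannot be disjoint, and a common point yields \<open>\<gamma>\<close>.\<close>

lemma packing_L:
  fixes h :: "nat \<Rightarrow> mat22"
  assumes r: "r > 0" and h: "\<And>n. h n \<in> SS" 
    and s: "\<And>n \<gamma>. \<gamma> \<in> L \<Longrightarrow> norm (pinv (h n) \<star> \<gamma> \<star> h n - pone) < r \<Longrightarrow> \<gamma> = pone" and r': "r' > 0"
  shows "\<exists>i j. i < j \<and> (\<exists>\<gamma>\<in>L. norm (pinv (h j) \<star> \<gamma> \<star> h i - pone) < r')"
proof -
  obtain e where e: "e > 0" "\<And>x. x \<in> L \<Longrightarrow> norm (x - pone) < e \<Longrightarrow> x = pone" using discrete by blast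
  define \<rho> where "\<rho> = min 1 (min (min r r') e / 6)"
  have \<rho>: "\<rho> > 0" "\<rho> \<le> 1" "6 * \<rho> \<le> r" "6 * \<rho> \<le> r'" "6 * \<rho> \<le> e" using r r' e(1) by (auto simp: \<rho>_def min_def)
  have "\<gamma> = pone" if g: "\<gamma> \<in> L" "w \<in> ball pone \<rho> \<inter> SS" "w' \<in> ball pone \<rho> \<inter> SS" "\<gamma> \<star> w = w'" for \<gamma> w w'
  proof -
    have "\<gamma> = w' \<star> pinv w" using g by (auto simp: pmul_assoc)
    then show ?thesis using e(2)[OF g(1)] near_quotient[OF g(2,3) \<rho>(2,5)] by simp
  qed
  then obtain c where c: "c > 0" "\<And>h. h \<in> SS \<Longrightarrow> inj_on PI (((\<lambda>w. pinv h \<star> w) -` ball pone \<rho>) \<inter> SS) \<Longrightarrow>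
    c \<le> emeasure M (PI ` (((\<lambda>w. pinv h \<star> w) -` ball pone \<rho>) \<inter> SS))"
    using measure_lower_bound[OF \<rho>(1)] by blast
  define E where "E n = (\<lambda>w. pinv (h n) \<star> w) -` ball pone \<rho>" for n
  have oE: "open (E n)" for n unfolding E_def by (intro open_vimage continuous_intros) auto
  have q: "norm (pinv (h j) \<star> \<gamma> \<star> h i - pone) < t" 
    if "w \<in> E i \<inter> SS" "w' \<in> E j \<inter> SS" "\<gamma> \<star> w = w'" "6 * \<rho> \<le> t" for i j w w' \<gamma> t
  proof -
    have m: "pinv (h i) \<star> w \<in> ball pone \<rho> \<inter> SS" "pinv (h j) \<star> w' \<in> ball pone \<rho> \<inter> SS" using that h by (simp_all add: E_def)
    have "pinv (h j) \<star> w' \<star> pinv (pinv (h i) \<star> w) = pinv (h j) \<star> \<gamma> \<star> h i"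
      using that by (auto simp: pinv_mul pmul_assoc)
    then show ?thesis using near_quotient[OF m \<rho>(2) that(4)] by simp
  qed
  have inj: "inj_on PI (E n \<inter> SS)" for n
  proof (rule inj_onI)
    fix x y assume xy: "x \<in> E n \<inter> SS" "y \<in> E n \<inter> SS" "PI x = PI y"
    then obtain \<gamma> where \<gamma>: "\<gamma> \<in> L" "\<gamma> \<star> x = y" using PI_eq_iff[of x y] by blast
    then have "\<gamma> = pone" using s q[OF xy(1,2) _ \<rho>(3)] by blast
    then show "x = y" using \<gamma> by simp
  qed
  have "\<exists>i j. i < j \<and> PI ` (E i \<inter> SS) \<inter> PI ` (E j \<inter> SS) \<noteq> {}"
  proof (rule pigeonhole_measure[OF M_fin])
    show "PI ` (E i \<inter> SS) \<in> sets M" for i using oE by simp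
    show "c \<le> emeasure M (PI ` (E i \<inter> SS))" for i using c(2)[OF h] inj unfolding E_def by blast
  qed (rule c(1))
  then obtain i j w w' where ij: "i < j" "w \<in> E i \<inter> SS" "w' \<in> E j \<inter> SS" "PI w = PI w'" by blast
  then obtain \<gamma> where "\<gamma> \<in> L" "\<gamma> \<star> w = w'" using PI_eq_iff[of w w'] by blast
  then show ?thesis using q[OF ij(2,3) _ \<rho>(4)] ij(1) by blast
qed

lemma lat22_L: "lat22 L"
proof
  have "PP (- mat 1, mat 1) = PP pone" "PP (mat 1, - mat 1) = PP pone" by (simp_all add: PP_eq_iff)
  then show "(- mat 1, mat 1) \<in> L" "(mat 1, - mat 1) \<in> L" using L_sign one_in by blast+
qed (rule nonwandering_L packing_L; assumption)+

end

section \<open>Lattices with a discrete projection\<close>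

lemma carrier_PSL2R_SL2: "carrier PSL2R = psl ` SL2" by (simp add: carrier_PSL2R SL2_def)

lemma SL2_mult [simp]: "A \<in> SL2 \<Longrightarrow> B \<in> SL2 \<Longrightarrow> A ** B \<in> SL2" and SL2_adj [simp]: "A \<in> SL2 \<Longrightarrow> adj A \<in> SL2"
  and SL2_one [simp]: "mat 1 \<in> SL2" and SL2_neg [simp]: "- A \<in> SL2 \<longleftrightarrow> A \<in> SL2"
  by (simp_all add: SL2_def det_mul det_uminus_2)

lemma openin_PSL2R_preimage: "openin PSL2R_top P \<Longrightarrow> openin (top_of_set SL2) {b \<in> SL2. psl b \<in> P}"
  using openin_continuous_map_preimage[OF continuous_map_psl] by simp

lemma openin_PSL2R_I:
  assumes "P \<subseteq> carrier PSL2R" "openin (top_of_set SL2) {b \<in> SL2. psl b \<in> P}" shows "openin PSL2R_top P"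
proof -
  have "psl ` {b \<in> SL2. psl b \<in> P} = P" using assms(1) by (auto simp: carrier_PSL2R_SL2)
  then show ?thesis using openin_PSL2R_image[OF assms(2)] by simp
qed

lemma openin_coset_PSL2R_iff:
  "openin (coset_topology PSL2R PSL2R_top H) U \<longleftrightarrow>
    U \<subseteq> rcosets\<^bsub>PSL2R\<^esub> H \<and> (\<exists>V. open V \<and> {b \<in> SL2. H #>\<^bsub>PSL2R\<^esub> psl b \<in> U} = SL2 \<inter> V)" (is "?l \<longleftrightarrow> ?r")
proof -
  have e: "{b \<in> SL2. psl b \<in> {g \<in> topspace PSL2R_top. H #>\<^bsub>PSL2R\<^esub> g \<in> U}} = {b \<in> SL2. H #>\<^bsub>PSL2R\<^esub> psl b \<in> U}"
    by (auto simp: topspace_PSL2R_top psl_carrier)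
  have "openin PSL2R_top {g \<in> topspace PSL2R_top. H #>\<^bsub>PSL2R\<^esub> g \<in> U} \<longleftrightarrow> 
      openin (top_of_set SL2) {b \<in> SL2. H #>\<^bsub>PSL2R\<^esub> psl b \<in> U}"
    using openin_PSL2R_preimage[of "{g \<in> topspace PSL2R_top. H #>\<^bsub>PSL2R\<^esub> g \<in> U}"]
      openin_PSL2R_I[of "{g \<in> topspace PSL2R_top. H #>\<^bsub>PSL2R\<^esub> g \<in> U}"] unfolding e by (auto simp: topspace_PSL2R_top)
  then show ?thesis unfolding openin_coset_topology openin_open by blast
qed

text \<open>\<open>f\<close> is the projection with discrete image, \<open>p\<close> the other one,
  and \<open>j\<close> embeds the other factor as the kernel of \<open>f\<close>. This treats both
  factors at once.\<close>

locale discrete_factor = lattice_G2 +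
  fixes f p :: "mat22 \<Rightarrow> mat2" and j :: "mat2 \<Rightarrow> mat22"
  assumes fpj: "f = fst \<and> p = snd \<and> j = Pair (mat 1) \<or> f = snd \<and> p = fst \<and> j = (\<lambda>b. (b, mat 1))"
    and disc: "\<exists>e>0. \<forall>x\<in>L. norm (f x - mat 1) < e \<longrightarrow> f x = mat 1"
begin

lemma f_mult [simp]: "f (x \<star> y) = f x ** f y" and p_mult [simp]: "p (x \<star> y) = p x ** p y"
  and f_inv [simp]: "f (pinv x) = adj (f x)" and p_inv [simp]: "p (pinv x) = adj (p x)"
  and fj [simp]: "f (j b) = mat 1" and pj [simp]: "p (j b) = b"
  and f_one: "f pone = mat 1" and p_one: "p pone = mat 1"
  using fpj by auto

lemma fp_ext: "f x = f y \<Longrightarrow> p x = p y \<Longrightarrow> x = y"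
  using fpj by (elim disjE) (simp_all add: prod_eq_iff)

lemma SS_fp: "x \<in> SS \<longleftrightarrow> f x \<in> SL2 \<and> p x \<in> SL2"
  using fpj by (elim disjE) (simp_all add: SS_def SL2_def conj_commute)

lemma PP_fp: "PP x = PP y \<longleftrightarrow> psl (f x) = psl (f y) \<and> psl (p x) = psl (p y)"
  using fpj by (elim disjE) (simp_all add: PP_def conj_commute)

lemma j_mult: "j (a ** b) = j a \<star> j b" and j_adj: "j (adj b) = pinv (j b)" and j_one: "j (mat 1) = pone"
  by (rule fp_ext; simp add: f_one p_one)+

lemma cont_f: "continuous_on UNIV f" and cont_p: "continuous_on UNIV p"
  using fpj by (elim disjE; simp add: continuous_on_fst continuous_on_snd continuous_on_id)+

lemma norm_j: "norm (j b - pone) = norm (b - mat 1)"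
  using fpj by (elim disjE) (simp_all add: norm_prod_def)

text \<open>The kernel of \<open>f\<close> on \<open>L\<close>, seen in the other factor; its image
  \<open>H\<close> is the candidate for the lattice there.\<close>

definition "K = {b \<in> SL2. j b \<in> L}"

abbreviation "H \<equiv> psl ` K"

lemma psl_H: "b \<in> SL2 \<Longrightarrow> psl b \<in> H \<longleftrightarrow> b \<in> K"
proof
  assume b: "b \<in> SL2" and "psl b \<in> H"
  then obtain a where a: "a \<in> K" "psl b = psl a" by blast
  then have "PP (j b) = PP (j a)" by (simp add: PP_fp)
  moreover have "j a \<in> L" using a(1) unfolding K_def by blast
  ultimately have "j b \<in> L" using L_sign by blast
  then show "b \<in> K" unfolding K_def using b by blast
qed blast

lemma K_closed: "mat 1 \<in> K" "a \<in> K \<Longrightarrow> b \<in> K \<Longrightarrow> a ** b \<in> K" "a \<in> K \<Longrightarrow> adj a \<in> K" "a \<in> K \<Longrightarrow> a \<in> SL2"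
proof -
  show "mat 1 \<in> K" unfolding K_def using one_in j_one SL2_one by simp
  show "a ** b \<in> K" if "a \<in> K" "b \<in> K" 
    using that mul_in[of "j a" "j b"] unfolding K_def by (simp add: j_mult)
  show "adj a \<in> K" if "a \<in> K"
    using that inv_in[of "j a"] unfolding K_def by (simp add: j_adj)
  show "a \<in> SL2" if "a \<in> K" using that unfolding K_def by blast
qed

lemma subgroup_H: "subgroup H PSL2R"
proof (rule group.subgroupI[OF group_PSL2R])
  show "H \<subseteq> carrier PSL2R" using K_closed(4) by (auto simp: carrier_PSL2R_SL2)
  show "H \<noteq> {}" using K_closed(1) by blast
  show "inv\<^bsub>PSL2R\<^esub> a \<in> H" if "a \<in> H" for a using that K_closed(3,4) by (auto simp: psl_inv)
  show "a \<otimes>\<^bsub>PSL2R\<^esub> b \<in> H" if "a \<in> H" "b \<in> H" for a b using that K_closed(2,4) by (auto simp: psl_mult)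
qed

lemma discrete_H: "discrete_subgroup PSL2R PSL2R_top H"
  unfolding discrete_subgroup_def
proof
  show "subgroup H PSL2R" by (rule subgroup_H)
  obtain e where e: "e > 0" "\<And>x. x \<in> L \<Longrightarrow> norm (x - pone) < e \<Longrightarrow> x = pone" using discrete by blast
  have sub: "H \<subseteq> topspace PSL2R_top" using K_closed(4) by (auto simp: topspace_PSL2R_top carrier_PSL2R_SL2)
  have "openin (subtopology PSL2R_top H) {psl b}" if b: "b \<in> K" for b
  proof -
    define W where "W = (\<lambda>c. c ** adj b) -` ball (mat 1) e"
    have oW: "open W" unfolding W_def by (intro open_vimage continuous_intros) auto
    have b1: "det b = 1" using K_closed(4)[OF b] by (simp add: SL2_def)
    have "psl ` (SL2 \<inter> W) \<inter> H = {psl b}"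
    proof
      show "psl ` (SL2 \<inter> W) \<inter> H \<subseteq> {psl b}"
      proof
        fix q assume "q \<in> psl ` (SL2 \<inter> W) \<inter> H"
        then obtain c where c: "c \<in> SL2" "c \<in> W" "q = psl c" "psl c \<in> H" by blast
        then have "c \<in> K" using psl_H by blast
        then have k: "c ** adj b \<in> K" using K_closed(2,3) b by blast
        have "norm (j (c ** adj b) - pone) < e" using c(2) unfolding W_def norm_j by (simp add: dist_norm norm_minus_commute)
        then have "j (c ** adj b) = pone" using e(2) k unfolding K_def by blast
        then have "p (j (c ** adj b)) = mat 1" by (simp add: p_one)
        then have "c ** adj b ** b = b" by simp
        then have "c = b" by (simp add: matrix_mul_assoc[symmetric] adj_left[OF b1])
        then show "q \<in> {psl b}" using c(3) by simp
      qed
      have "b \<in> W" using e(1) by (simp add: W_def adj_right[OF b1])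
      then show "{psl b} \<subseteq> psl ` (SL2 \<inter> W) \<inter> H" using b K_closed(4) by blast
    qed
    then have "psl ` (SL2 \<inter> W) \<inter> H = {psl b}" .
    then show ?thesis unfolding openin_subtopology
      by (intro exI[of _ "psl ` (SL2 \<inter> W)"]) (simp add: openin_PSL2R_image openin_open_Int oW)
  qed
  then have "discrete_topology H = subtopology PSL2R_top H"
    unfolding discrete_topology_unique using sub by auto
  then show "subtopology PSL2R_top H = discrete_topology H" by simp
qed

lemma H_coset: 
  assumes "a \<in> K" "b \<in> SL2" shows "H #>\<^bsub>PSL2R\<^esub> psl (a ** b) = H #>\<^bsub>PSL2R\<^esub> psl b"
proof -
  have a: "a \<in> SL2" using K_closed(4) assms(1) by blast
  have "H #>\<^bsub>PSL2R\<^esub> psl (a ** b) = (H #>\<^bsub>PSL2R\<^esub> psl a) #>\<^bsub>PSL2R\<^esub> psl b"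
    using group.coset_mult_assoc[OF group_PSL2R subgroup.subset[OF subgroup_H], of "psl a" "psl b"] a assms(2) 
    by (simp add: psl_mult psl_carrier)
  also have "H #>\<^bsub>PSL2R\<^esub> psl a = H"
    using group.coset_join2[OF group_PSL2R _ subgroup_H, of "psl a"] a assms(1) psl_carrier by blast
  finally show ?thesis .
qed

lemma H_translate: "a \<in> SL2 \<Longrightarrow> b \<in> SL2 \<Longrightarrow> (H #>\<^bsub>PSL2R\<^esub> psl a) #>\<^bsub>PSL2R\<^esub> psl b = H #>\<^bsub>PSL2R\<^esub> psl (a ** b)"
  using group.coset_mult_assoc[OF group_PSL2R subgroup.subset[OF subgroup_H], of "psl a" "psl b"]
  by (simp add: psl_mult psl_carrier)

lemma rcosets_H: "rcosets\<^bsub>PSL2R\<^esub> H = (\<lambda>b. H #>\<^bsub>PSL2R\<^esub> psl b) ` SL2"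
  by (auto simp: RCOSETS_def carrier_PSL2R_SL2)

text \<open>Near the kernel of the discrete projection, \<open>\<Gamma>\G\<close> fibres over \<open>H\PSL(2,\<real>)\<close>; the invariant
  measure is the push-forward.\<close>

lemma finite_covolume_H: "finite_covolume PSL2R PSL2R_top H"
proof -
  obtain e where e: "e > 0" "\<And>x. x \<in> L \<Longrightarrow> norm (f x - mat 1) < e \<Longrightarrow> f x = mat 1" using disc by blast
  define \<rho> where "\<rho> = min 1 (e / 6)"
  have \<rho>: "\<rho> > 0" "\<rho> \<le> 1" "6 * \<rho> \<le> e" using e(1) by (auto simp: \<rho>_def min_def)
  \<comment> \<open>A tube around the kernel of \<open>f\<close>, so thin that an element of
    \<open>L\<close> joining two of its points has \<open>f\<close>-part 1 and comes from
    \<open>K\<close>. Hence \<open>\<psi>\<close> does not depend on the representative.\<close>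
  define V where "V = f -` ball (mat 1) \<rho>"
  have oV: "open V" unfolding V_def using open_vimage[OF open_ball] cont_f by blast
  define Y where "Y = PI ` (V \<inter> SS)"
  have Ys: "Y \<in> sets M" unfolding Y_def using oV by simp
  define \<psi> where "\<psi> x = H #>\<^bsub>PSL2R\<^esub> psl (p (inv_into (V \<inter> SS) PI x))" for x
  have \<psi>: "\<psi> (PI w) = H #>\<^bsub>PSL2R\<^esub> psl (p w)" if w: "w \<in> V \<inter> SS" for w
  proof -
    define w' where "w' = inv_into (V \<inter> SS) PI (PI w)"
    have w': "w' \<in> V \<inter> SS" "PI w' = PI w" unfolding w'_def
      using inv_into_into[of "PI w" PI "V \<inter> SS"] f_inv_into_f[of "PI w" PI "V \<inter> SS"] w by blast+
    then obtain \<gamma> where g: "\<gamma> \<in> L" "\<gamma> \<star> w = w'" using PI_eq_iff[of w w'] w by auto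
    \<comment> \<open>Padding with 1 lets \<open>near_quotient\<close>, stated for pairs, estimate
      the quotient of the \<open>f\<close>-parts.\<close>
    define v v' where "v = (f w, mat 1 :: mat2)" and "v' = (f w', mat 1 :: mat2)"
    have vv: "v \<in> SS" "v' \<in> SS" using SS_fp[of w] SS_fp[of w'] w w'(1) by (simp_all add: v_def v'_def SS_def SL2_def)
    have n: "norm (f w - mat 1) < \<rho>" "norm (f w' - mat 1) < \<rho>"
      using w w'(1) by (simp_all add: V_def dist_norm norm_minus_commute)
    have "v \<in> ball pone \<rho> \<inter> SS" "v' \<in> ball pone \<rho> \<inter> SS"
      using vv n by (simp_all add: v_def v'_def dist_norm norm_prod_def norm_minus_commute pone_def)
    from near_quotient[OF this \<rho>(2,3)] have nq: "norm (v' \<star> pinv v - pone) < e" .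
    have "f w ** adj (f w) = mat 1" using w SS_fp by (simp add: SL2_def adj_right)
    then have "f \<gamma> = f w' ** adj (f w)" using g(2) by (simp flip: g(2) add: matrix_mul_assoc[symmetric])
    then have "norm (f \<gamma> - mat 1) < e" using nq norm_fst_diff[of "v' \<star> pinv v" pone] by (simp add: v_def v'_def)
    then have f1: "f \<gamma> = mat 1" using e(2) g(1) by blast
    then have "\<gamma> = j (p \<gamma>)" by (intro fp_ext) simp_all
    moreover have "p \<gamma> \<in> SL2" using SS_fp in_SS[OF g(1)] by blast
    ultimately have "p \<gamma> \<in> K" unfolding K_def using g(1) by simp
    then have "H #>\<^bsub>PSL2R\<^esub> psl (p \<gamma> ** p w) = H #>\<^bsub>PSL2R\<^esub> psl (p w)" using H_coset w SS_fp by blast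
    moreover have "p \<gamma> ** p w = p w'" by (simp flip: g(2))
    ultimately show ?thesis unfolding \<psi>_def w'_def[symmetric] by simp
  qed
  let ?T = "coset_topology PSL2R PSL2R_top H"
  let ?X = "rcosets\<^bsub>PSL2R\<^esub> H"
  let ?S = "sigma ?X {U. openin ?T U}"
  let ?R = "restrict_space M Y"
  have Pow: "{U. openin ?T U} \<subseteq> Pow ?X" by (auto simp: openin_coset_topology)
  have spS: "space ?S = ?X" using Pow by (simp add: space_measure_of)
  have spR: "space ?R = Y" using sets.sets_into_space[OF Ys] by (auto simp: space_restrict_space)
  have pV: "p w \<in> SL2" if "w \<in> V \<inter> SS" for w using that SS_fp by blast
  have \<psi>X: "\<psi> x \<in> ?X" if x: "x \<in> Y" for x
  proof -
    obtain w where w: "w \<in> V \<inter> SS" "x = PI w" using x unfolding Y_def by blast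
    show ?thesis unfolding w(2) \<psi>[OF w(1)] rcosets_H using pV[OF w(1)] by blast
  qed
  have \<psi>m: "\<psi> \<in> measurable ?R ?S"
  proof (rule measurable_measure_of[OF Pow])
    show "\<psi> \<in> space ?R \<rightarrow> ?X" unfolding spR using \<psi>X by blast
    fix U assume "U \<in> {U. openin ?T U}"
    then obtain O' where O': "open O'" "{b \<in> SL2. H #>\<^bsub>PSL2R\<^esub> psl b \<in> U} = SL2 \<inter> O'"
      using openin_coset_PSL2R_iff by blast
    have "\<psi> -` U \<inter> Y = PI ` ((V \<inter> p -` O') \<inter> SS)"
    proof (intro equalityI subsetI)
      fix x assume x: "x \<in> \<psi> -` U \<inter> Y"
      then obtain w where w: "w \<in> V \<inter> SS" "x = PI w" unfolding Y_def by blast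
      then have "p w \<in> {b \<in> SL2. H #>\<^bsub>PSL2R\<^esub> psl b \<in> U}" using x \<psi>[OF w(1)] pV[OF w(1)] by auto
      then show "x \<in> PI ` ((V \<inter> p -` O') \<inter> SS)" unfolding O'(2) using w by blast
    next
      fix x assume "x \<in> PI ` ((V \<inter> p -` O') \<inter> SS)"
      then obtain w where w: "w \<in> V \<inter> SS" "p w \<in> O'" "x = PI w" by blast
      then have "p w \<in> {b \<in> SL2. H #>\<^bsub>PSL2R\<^esub> psl b \<in> U}" unfolding O'(2) using pV by blast
      then show "x \<in> \<psi> -` U \<inter> Y" unfolding Y_def using w \<psi>[OF w(1)] by auto
    qed
    also have "\<dots> \<in> sets M" using oV open_vimage[OF O'(1) cont_p] by (intro PI_image_sets open_Int)
    finally have "\<psi> -` U \<inter> Y \<in> sets M" .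
    then show "\<psi> -` U \<inter> space ?R \<in> sets ?R" unfolding spR using Ys 
      by (subst sets_restrict_space_iff) (auto simp: sets.Int_space_eq2)
  qed
  define N where "N = distr ?R ?S \<psi>"
  have setsN: "sets N = sets ?S" by (simp add: N_def)
  have pre_sets: "\<psi> -` B \<inter> Y \<in> sets M" and emN: "emeasure N B = emeasure M (\<psi> -` B \<inter> Y)" if B: "B \<in> sets ?S" for B
  proof -
    have "\<psi> -` B \<inter> space ?R \<in> sets ?R" by (rule measurable_sets[OF \<psi>m B])
    then show s: "\<psi> -` B \<inter> Y \<in> sets M" unfolding spR using Ys 
      by (subst (asm) sets_restrict_space_iff) (auto simp: sets.Int_space_eq2)
    have "emeasure N B = emeasure ?R (\<psi> -` B \<inter> space ?R)" unfolding N_def by (rule emeasure_distr[OF \<psi>m B])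
    also have "\<dots> = emeasure ?R (\<psi> -` B \<inter> Y)" by (simp only: spR)
    also have "\<dots> = emeasure M (\<psi> -` B \<inter> Y)" using Ys by (intro emeasure_restrict_space) (auto simp: sets.Int_space_eq2)
    finally show "emeasure N B = emeasure M (\<psi> -` B \<inter> Y)" .
  qed
  have tr: "(\<lambda>x. x #>\<^bsub>PSL2R\<^esub> psl c) ` B \<in> sets ?S" if B: "B \<in> sets ?S" and c: "c \<in> SL2" for B c
  proof -
    let ?t = "\<lambda>x. x #>\<^bsub>PSL2R\<^esub> psl (adj c)"
    have dc: "det c = 1" using c by (simp add: SL2_def)
    have BX: "B \<subseteq> ?X" using sets.sets_into_space[OF B] spS by simp
    have "?t \<in> measurable ?S ?S"
    proof (rule measurable_measure_of[OF Pow])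
      show "?t \<in> space ?S \<rightarrow> ?X"
      proof
        fix x assume "x \<in> space ?S"
        then have "x \<in> ?X" by (simp only: spS)
        then obtain b where b: "b \<in> SL2" "x = H #>\<^bsub>PSL2R\<^esub> psl b" using rcosets_H by blast
        have "b ** adj c \<in> SL2" using b c by simp
        then show "?t x \<in> ?X" unfolding b(2) H_translate[OF b(1) SL2_adj[OF c]] rcosets_H by (rule imageI)
      qed
      fix U assume "U \<in> {U. openin ?T U}"
      then obtain O' where O': "open O'" "{b \<in> SL2. H #>\<^bsub>PSL2R\<^esub> psl b \<in> U} = SL2 \<inter> O'"
        using openin_coset_PSL2R_iff by blast
      have "{b \<in> SL2. H #>\<^bsub>PSL2R\<^esub> psl b \<in> ?t -` U \<inter> ?X} = {b \<in> SL2. b ** adj c \<in> {b \<in> SL2. H #>\<^bsub>PSL2R\<^esub> psl b \<in> U}}"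
        using c by (auto simp: H_translate rcosets_H)
      also have "\<dots> = SL2 \<inter> ((\<lambda>b. b ** adj c) -` O')" unfolding O'(2) using c by auto
      finally have "{b \<in> SL2. H #>\<^bsub>PSL2R\<^esub> psl b \<in> ?t -` U \<inter> ?X} = SL2 \<inter> ((\<lambda>b. b ** adj c) -` O')" .
      moreover have "open ((\<lambda>b. b ** adj c) -` O')" using O'(1) by (intro open_vimage continuous_intros)
      ultimately have "openin ?T (?t -` U \<inter> ?X)" unfolding openin_coset_PSL2R_iff by blast
      then show "?t -` U \<inter> space ?S \<in> sets ?S" unfolding spS using Pow
        by (subst sets_measure_of) (auto intro: sigma_sets.Basic)
    qed
    from measurable_sets[OF this B] have "?t -` B \<inter> ?X \<in> sets ?S" unfolding spS .
    moreover have "(\<lambda>x. x #>\<^bsub>PSL2R\<^esub> psl c) ` B = ?t -` B \<inter> ?X"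
    proof (intro equalityI subsetI)
      fix y assume "y \<in> (\<lambda>x. x #>\<^bsub>PSL2R\<^esub> psl c) ` B"
      then obtain x where x: "x \<in> B" "y = x #>\<^bsub>PSL2R\<^esub> psl c" by blast
      obtain b where b: "b \<in> SL2" "x = H #>\<^bsub>PSL2R\<^esub> psl b" using x(1) BX rcosets_H by blast
      have "b ** c ** adj c = b" by (simp add: matrix_mul_assoc[symmetric] adj_right[OF dc])
      then show "y \<in> ?t -` B \<inter> ?X" using x b c by (simp add: H_translate rcosets_H)
    next
      fix y assume y: "y \<in> ?t -` B \<inter> ?X"
      then obtain b where b: "b \<in> SL2" "y = H #>\<^bsub>PSL2R\<^esub> psl b" using rcosets_H by blast
      have "b ** adj c ** c = b" by (simp add: matrix_mul_assoc[symmetric] adj_left[OF dc])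
      then have "y = ?t y #>\<^bsub>PSL2R\<^esub> psl c" using b c by (simp add: H_translate)
      then show "y \<in> (\<lambda>x. x #>\<^bsub>PSL2R\<^esub> psl c) ` B" using y by blast
    qed
    ultimately show ?thesis by simp
  qed
  have inv: "emeasure N ((\<lambda>x. x #>\<^bsub>PSL2R\<^esub> g) ` B) = emeasure N B" if g: "g \<in> carrier PSL2R" and B: "B \<in> sets ?S" for g B
  proof -
    obtain c where c: "c \<in> SL2" "g = psl c" using g carrier_PSL2R_SL2 by blast
    have dc: "det c = 1" using c by (simp add: SL2_def)
    have jc: "j c \<in> SS" using c by (simp add: SS_fp)
    have BX: "B \<subseteq> ?X" using sets.sets_into_space[OF B] spS by simp
    have wc: "w \<star> j c \<in> V \<inter> SS" if "w \<in> V \<inter> SS" for w using that jc by (simp add: V_def)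
    have wp: "p (w \<star> j c) = p w ** c" for w by simp
    have cc: "b ** c ** adj c = b" for b by (simp add: matrix_mul_assoc[symmetric] adj_right[OF dc])
    have jj: "pinv (j c) = j (adj c)" by (simp add: j_adj)
    \<comment> \<open>Right translation by \<open>j c\<close> leaves the \<open>f\<close>-part
      alone, so it preserves the tube, and \<open>\<psi>\<close> turns it into translation by
      \<open>psl c\<close>.\<close>
    have eq: "\<psi> -` ((\<lambda>x. x #>\<^bsub>PSL2R\<^esub> g) ` B) \<inter> Y = (\<lambda>x. x #>\<^bsub>G2\<^esub> PP (j c)) ` (\<psi> -` B \<inter> Y)"
    proof (intro equalityI subsetI)
      fix y assume y: "y \<in> \<psi> -` ((\<lambda>x. x #>\<^bsub>PSL2R\<^esub> g) ` B) \<inter> Y"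
      then obtain w where w: "w \<in> V \<inter> SS" "y = PI w" unfolding Y_def by blast
      obtain x where x: "x \<in> B" "\<psi> y = x #>\<^bsub>PSL2R\<^esub> g" using y by blast
      obtain b where b: "b \<in> SL2" "x = H #>\<^bsub>PSL2R\<^esub> psl b" using x(1) BX rcosets_H by blast
      define u where "u = w \<star> pinv (j c)"
      have u: "u \<in> V \<inter> SS" "w = u \<star> j c" using w(1) jc unfolding u_def by (simp_all add: V_def pmul_assoc)
      have pu: "p u = p w ** adj c" by (simp add: u_def)
      have "\<psi> (PI u) = (H #>\<^bsub>PSL2R\<^esub> psl (p w)) #>\<^bsub>PSL2R\<^esub> psl (adj c)" 
        unfolding \<psi>[OF u(1)] pu using c(1) pV[OF w(1)] by (simp add: H_translate)
      also have "H #>\<^bsub>PSL2R\<^esub> psl (p w) = x #>\<^bsub>PSL2R\<^esub> g" using x(2) unfolding w(2) \<psi>[OF w(1)] .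
      also have "\<dots> = H #>\<^bsub>PSL2R\<^esub> psl (b ** c)" unfolding b(2) c(2) using b(1) c(1) by (rule H_translate)
      also have "\<dots> #>\<^bsub>PSL2R\<^esub> psl (adj c) = x" using b c(1) by (simp add: H_translate cc)
      finally have "PI u \<in> \<psi> -` B \<inter> Y" using x(1) u(1) unfolding Y_def by blast
      moreover have "y = PI u #>\<^bsub>G2\<^esub> PP (j c)" unfolding w(2) u(2) using u(1) jc by (simp add: PI_translate)
      ultimately show "y \<in> (\<lambda>x. x #>\<^bsub>G2\<^esub> PP (j c)) ` (\<psi> -` B \<inter> Y)" by blast
    next
      fix y assume "y \<in> (\<lambda>x. x #>\<^bsub>G2\<^esub> PP (j c)) ` (\<psi> -` B \<inter> Y)"
      then obtain x where x: "x \<in> Y" "\<psi> x \<in> B" "y = x #>\<^bsub>G2\<^esub> PP (j c)" by blast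
      obtain w where w: "w \<in> V \<inter> SS" "x = PI w" using x(1) unfolding Y_def by blast
      have y: "y = PI (w \<star> j c)" unfolding x(3) w(2) using w(1) jc by (simp add: PI_translate)
      have "\<psi> y = \<psi> x #>\<^bsub>PSL2R\<^esub> g" unfolding y w(2) \<psi>[OF w(1)] \<psi>[OF wc[OF w(1)]] c(2) using c(1) pV[OF w(1)] by (simp add: H_translate)
      moreover have "y \<in> Y" unfolding y Y_def using wc[OF w(1)] by blast
      ultimately show "y \<in> \<psi> -` ((\<lambda>x. x #>\<^bsub>PSL2R\<^esub> g) ` B) \<inter> Y" using x(2) by blast
    qed
    have "emeasure N ((\<lambda>x. x #>\<^bsub>PSL2R\<^esub> g) ` B) = emeasure M ((\<lambda>x. x #>\<^bsub>G2\<^esub> PP (j c)) ` (\<psi> -` B \<inter> Y))"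
      unfolding eq[symmetric] by (rule emN) (use tr[OF B c(1)] c(2) in simp)
    also have "\<dots> = emeasure M (\<psi> -` B \<inter> Y)" by (rule M_inv[OF PP_carrier[OF jc] pre_sets[OF B]])
    finally show ?thesis using emN[OF B] by simp
  qed
  have "\<psi> -` space N \<inter> Y = Y" using \<psi>X spS by (auto simp: N_def)
  then have tot: "emeasure N (space N) = emeasure M Y"
    using emN[of "space N"] sets.top[of N] setsN by simp
  have "pone \<in> V \<inter> SS" using \<rho>(1) by (simp add: V_def f_one)
  then have "emeasure M Y > 0" unfolding Y_def by (intro M_open_pos oV) blast
  moreover have "emeasure M Y \<noteq> \<infinity>" using emeasure_space[of M Y] M_fin by (auto simp: top_unique)
  ultimately show ?thesis unfolding finite_covolume_def using setsN tot inv by (intro exI[of _ N]) auto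
qed

lemma lattice_H: "lattice_subgroup PSL2R PSL2R_top H"
  unfolding lattice_subgroup_def using discrete_H finite_covolume_H by blast

end

section \<open>Discrete projections and finite index\<close>

context lat22 begin

text \<open>The kernel of the discrete projection contains two non-commuting elements; an element whose
  first component is close to \<open>1\<close> has small commutators with them, hence commutes with both.\<close>

lemma discrete_fst_if_discrete_snd:
  assumes d: "\<exists>e>0. \<forall>x\<in>L. norm (snd x - mat 1) < e \<longrightarrow> snd x = mat 1"
  shows "\<exists>e>0. \<forall>x\<in>L. norm (fst x - mat 1) < e \<longrightarrow> fst x = mat 1"
proof -
  obtain e where e: "e > 0" "\<And>x. x \<in> L \<Longrightarrow> norm (snd x - mat 1) < e \<Longrightarrow> snd x = mat 1" using d by blast
  obtain e' where e': "e' > 0" "\<And>x. x \<in> L \<Longrightarrow> norm (x - pone) < e' \<Longrightarrow> x = pone" using discrete by blast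
  define q0 where "q0 = mk2 1 1 1 2"
  define P where "P = mat 1 ** mk2 1 0 0 0 ** adj (mat 1)"
  define Q where "Q = q0 ** mk2 1 0 0 0 ** adj q0"
  have dets: "det (mat 1 :: mat2) = 1" "det q0 = 1" by (simp_all add: det_2 q0_def)
  obtain x n where x: "\<And>m. x m \<in> L" "(\<lambda>m. (1 / 2 ^ n m) *\<^sub>R fst (x m)) \<longlonglongrightarrow> P" "(\<lambda>m. snd (x m)) \<longlonglongrightarrow> mat 1"
    using projection_hyperbolic[OF dets(1)] unfolding P_def by blast
  obtain y n' where y: "\<And>m. y m \<in> L" "(\<lambda>m. (1 / 2 ^ n' m) *\<^sub>R fst (y m)) \<longlonglongrightarrow> Q" "(\<lambda>m. snd (y m)) \<longlonglongrightarrow> mat 1"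
    using projection_hyperbolic[OF dets(2)] unfolding Q_def by blast
  define A B where "A m = (1 / 2 ^ n m) *\<^sub>R fst (x m)" and "B m = (1 / 2 ^ n' m) *\<^sub>R fst (y m)" for m
  have AB: "A \<longlonglongrightarrow> P" "B \<longlonglongrightarrow> Q" using x(2) y(2) unfolding A_def B_def by simp_all
  \<comment> \<open>The limits \<open>P\<close> and \<open>Q\<close> do not commute, hence neither
    do \<open>A m\<close> and \<open>B m\<close> for late \<open>m\<close>, nor the unscaled
    matrices; the second components are near 1 by then and equal 1 by discreteness.\<close>
  have "(\<lambda>m. A m ** B m - B m ** A m) \<longlonglongrightarrow> P ** Q - Q ** P" using AB by (intro tendsto_intros)
  moreover have "P ** Q - Q ** P \<noteq> 0" by (simp add: P_def Q_def q0_def mat2_eq_iff)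
  ultimately have "eventually (\<lambda>m. A m ** B m - B m ** A m \<noteq> 0) sequentially" by (rule tendsto_imp_eventually_ne)
  moreover have "eventually (\<lambda>m. norm (snd (x m) - mat 1) < e) sequentially" "eventually (\<lambda>m. norm (snd (y m) - mat 1) < e) sequentially"
    using tendstoD[OF x(3) e(1)] tendstoD[OF y(3) e(1)] by (simp_all add: dist_norm)
  ultimately have "eventually (\<lambda>m. A m ** B m - B m ** A m \<noteq> 0 \<and> norm (snd (x m) - mat 1) < e \<and> norm (snd (y m) - mat 1) < e) sequentially"
    by eventually_elim simp
  then obtain m where m: "A m ** B m - B m ** A m \<noteq> 0" "norm (snd (x m) - mat 1) < e" "norm (snd (y m) - mat 1) < e"
    by (auto dest: eventually_happens)
  define X Y where "X = fst (x m)" and "Y = fst (y m)"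
  have nc: "X ** Y \<noteq> Y ** X"
  proof
    assume "X ** Y = Y ** X"
    then have "A m ** B m = B m ** A m" unfolding A_def B_def X_def Y_def by (simp add: mult2.scaleR_left mult2.scaleR_right)
    then show False using m(1) by simp
  qed
  have XL: "(X, mat 1) \<in> L" "(Y, mat 1) \<in> L" 
    using e(2)[OF x(1) m(2)] e(2)[OF y(1) m(3)] x(1)[of m] y(1)[of m] unfolding X_def Y_def by (metis prod.collapse)+
  have comm: "\<exists>d>0. \<forall>h\<in>L. norm (fst h - mat 1) < d \<longrightarrow> fst h ** Z = Z ** fst h" if Z: "(Z, mat 1) \<in> L" for Z
  proof -
    have dZ: "det Z = 1" using SS_D[OF in_SS[OF Z]] by simp
    have "continuous_on UNIV (\<lambda>C. C ** Z ** adj C ** adj Z)" by (intro continuous_intros)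
    then obtain d where d: "d > 0" "\<And>C. dist C (mat 1) < d \<Longrightarrow> dist (C ** Z ** adj C ** adj Z) (mat 1 ** Z ** adj (mat 1) ** adj Z) < e'"
      using e'(1) unfolding continuous_on_iff by (metis UNIV_I)
    have "fst h ** Z = Z ** fst h" if h: "h \<in> L" "norm (fst h - mat 1) < d" for h
    proof -
      let ?c = "h \<star> (Z, mat 1) \<star> pinv h \<star> pinv (Z, mat 1)"
      have dh: "det (fst h) = 1" "det (snd h) = 1" using SS_D[OF in_SS[OF h(1)]] by simp_all
      have cL: "?c \<in> L" using h(1) Z by (intro mul_in inv_in)
      have c: "fst ?c = fst h ** Z ** adj (fst h) ** adj Z" "snd ?c = mat 1" by (simp_all add: adj_right[OF dh(2)])
      have "norm (fst ?c - mat 1) < e'" using d(2)[of "fst h"] h(2) unfolding c by (simp add: dist_norm adj_right[OF dZ])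
      then have "norm (?c - pone) < e'" using c(2) by (simp add: norm_prod_def)
      then have "?c = pone" using e'(2) cL by blast
      then have "fst ?c ** Z ** fst h = Z ** fst h" by simp
      then show ?thesis unfolding c by (simp add: matrix_mul_assoc[symmetric] adj_left[OF dh(1)] adj_left[OF dZ] adj_cancel(1,2) dh dZ)
    qed
    then show ?thesis using d(1) by blast
  qed
  obtain d1 where d1: "d1 > 0" "\<And>h. h \<in> L \<Longrightarrow> norm (fst h - mat 1) < d1 \<Longrightarrow> fst h ** X = X ** fst h" using comm[OF XL(1)] by blast
  obtain d2 where d2: "d2 > 0" "\<And>h. h \<in> L \<Longrightarrow> norm (fst h - mat 1) < d2 \<Longrightarrow> fst h ** Y = Y ** fst h" using comm[OF XL(2)] by blast
  show ?thesis
  proof (intro exI[of _ "min 1 (min d1 d2)"] conjI ballI impI)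
    show "0 < min 1 (min d1 d2)" using d1 d2 by simp
    fix h assume h: "h \<in> L" "norm (fst h - mat 1) < min 1 (min d1 d2)"
    have c: "fst h ** X = X ** fst h" "fst h ** Y = Y ** fst h" using d1 d2 h by auto
    have "tl2 (fst h) = 0"
    proof (rule ccontr)
      assume n: "tl2 (fst h) \<noteq> 0"
      obtain a where a: "tl2 X = a *\<^sub>R tl2 (fst h)" using commute_proportional[OF c(1) n] by blast
      obtain b where b: "tl2 Y = b *\<^sub>R tl2 (fst h)" using commute_proportional[OF c(2) n] by blast
      show False
      proof (cases "b = 0")
        case True
        then have "tl2 Y = 0 *\<^sub>R tl2 X" using b by simp
        then show False using proportional_commute nc by blast
      next
        case False
        then have "tl2 X = (a / b) *\<^sub>R tl2 Y" using a b by simp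
        then show False using proportional_commute nc by metis
      qed
    qed
    then have "fst h = mat 1 \<or> fst h = - mat 1" using tl2_eq0_iff SS_D[OF in_SS[OF h(1)]] by blast
    then show "fst h = mat 1" using h(2) norm_neg1 by auto
  qed
qed

end

context lattice_G2 begin

text \<open>Representatives of infinitely many cosets give base points
  \<open>(1, snd (g n))\<close>, to which packing applies because both projections are discrete. The
  element obtained has the form \<open>(1, b)\<close> and joins two second components exactly; the
  quotient of the first components is then also in a kernel, so the two cosets coincide.\<close>

lemma finite_index_if_discrete:
  assumes d1: "\<exists>e>0. \<forall>x\<in>L. norm (fst x - mat 1) < e \<longrightarrow> fst x = mat 1"
    and d2: "\<exists>e>0. \<forall>x\<in>L. norm (snd x - mat 1) < e \<longrightarrow> snd x = mat 1"
    and H: "subgroup (H1 \<times> H2) G2" "\<And>a. (a, mat 1) \<in> L \<Longrightarrow> psl a \<in> H1" "\<And>b. (mat 1, b) \<in> L \<Longrightarrow> psl b \<in> H2"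
  shows "finite (rcosets\<^bsub>G2\<lparr>carrier := \<Gamma>\<rparr>\<^esub> (H1 \<times> H2))"
proof (rule ccontr)
  assume inf: "\<not> ?thesis"
  obtain e1 where e1: "e1 > 0" "\<And>x. x \<in> L \<Longrightarrow> norm (fst x - mat 1) < e1 \<Longrightarrow> fst x = mat 1" using d1 by blast
  obtain e2 where e2: "e2 > 0" "\<And>x. x \<in> L \<Longrightarrow> norm (snd x - mat 1) < e2 \<Longrightarrow> snd x = mat 1" using d2 by blast
  define C where "C x = (H1 \<times> H2) #>\<^bsub>G2\<^esub> PP x" for x
  have "rcosets\<^bsub>G2\<lparr>carrier := \<Gamma>\<rparr>\<^esub> (H1 \<times> H2) \<subseteq> C ` L"
  proof
    fix c assume "c \<in> rcosets\<^bsub>G2\<lparr>carrier := \<Gamma>\<rparr>\<^esub> (H1 \<times> H2)"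
    then obtain g where g: "g \<in> \<Gamma>" "c = (H1 \<times> H2) #>\<^bsub>G2\<^esub> g" by (auto simp: RCOSETS_def r_coset_def)
    then obtain x where "x \<in> L" "g = PP x" using equalityD1[OF Gamma_eq] by blast
    then show "c \<in> C ` L" using g(2) unfolding C_def by blast
  qed
  then have "infinite (C ` L)" using inf finite_subset by blast
  then obtain s :: "nat \<Rightarrow> _" where s: "inj s" "range s \<subseteq> C ` L" using infinite_countable_subset by blast
  then have "\<forall>n. \<exists>x. x \<in> L \<and> s n = C x" by blast
  then obtain g where g: "\<And>n. g n \<in> L" "\<And>n. s n = C (g n)" by metis
  define h where "h n = (mat 1 :: mat2, snd (g n))" for n
  have dg: "det (fst (g n)) = 1" "det (snd (g n)) = 1" for n using SS_D[OF in_SS[OF g(1)]] by blast+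
  have hS: "h n \<in> SS" for n by (simp add: h_def SS_def dg)
  define r where "r = min e1 e2"
  have r: "r > 0" using e1(1) e2(1) by (simp add: r_def)
  \<comment> \<open>The points \<open>h n\<close> do not lie in \<open>L\<close>, but the second
    component in question is also that of \<open>pinv (g k) \<star> \<gamma> \<star> g i\<close>, an
    element of \<open>L\<close>.\<close>
  have near: "fst \<gamma> = mat 1 \<and> snd (pinv (g k) \<star> \<gamma> \<star> g i) = mat 1"
    if "\<gamma> \<in> L" "norm (pinv (h k) \<star> \<gamma> \<star> h i - pone) < r" for \<gamma> i k
  proof -
    have "norm (fst (pinv (h k) \<star> \<gamma> \<star> h i) - mat 1) < e1" 
      using that(2) norm_fst_diff[of "pinv (h k) \<star> \<gamma> \<star> h i" pone] by (simp add: r_def)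
    then have "norm (fst \<gamma> - mat 1) < e1" by (simp add: h_def)
    moreover have "norm (snd (pinv (h k) \<star> \<gamma> \<star> h i) - mat 1) < e2" 
      using that(2) norm_snd_diff[of "pinv (h k) \<star> \<gamma> \<star> h i" pone] by (simp add: r_def)
    then have "norm (snd (pinv (g k) \<star> \<gamma> \<star> g i) - mat 1) < e2" by (simp add: h_def)
    moreover have "pinv (g k) \<star> \<gamma> \<star> g i \<in> L" using that(1) g(1) by (intro mul_in inv_in)
    ultimately show ?thesis using e1(2) e2(2) that(1) by blast
  qed
  have "\<exists>i k. i < k \<and> (\<exists>\<gamma>\<in>L. norm (pinv (h k) \<star> \<gamma> \<star> h i - pone) < r)"
  proof (rule packing_L[OF r hS _ r])
    fix n \<gamma> assume a: "\<gamma> \<in> L" "norm (pinv (h n) \<star> \<gamma> \<star> h n - pone) < r"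
    have f: "fst \<gamma> = mat 1" "adj (snd (g n)) ** snd \<gamma> ** snd (g n) = mat 1" using near[OF a] by simp_all
    have "snd (g n) ** (adj (snd (g n)) ** snd \<gamma> ** snd (g n)) ** adj (snd (g n)) = snd \<gamma>"
      using dg(2)[of n] by (simp add: matrix_mul_assoc[symmetric] adj_right adj_cancel)
    then have "snd \<gamma> = mat 1" unfolding f(2) using dg(2)[of n] by (simp add: adj_right)
    then show "\<gamma> = pone" using f(1) by (simp add: prod_eq_iff)
  qed
  then obtain i k \<gamma> where ik: "i < k" "\<gamma> \<in> L" "norm (pinv (h k) \<star> \<gamma> \<star> h i - pone) < r" by blast
  define b where "b = snd \<gamma>"
  have f: "fst \<gamma> = mat 1" "adj (snd (g k)) ** b ** snd (g i) = mat 1" using near[OF ik(2,3)] by (simp_all add: b_def)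
  have \<gamma>: "\<gamma> = (mat 1, b)" using f(1) by (simp add: b_def prod_eq_iff)
  have "snd (g k) ** (adj (snd (g k)) ** b ** snd (g i)) = b ** snd (g i)"
    using dg(2)[of k] by (simp add: matrix_mul_assoc[symmetric] adj_cancel)
  then have sk: "snd (g k) = b ** snd (g i)" unfolding f(2) by simp
  define a where "a = fst (g k) ** adj (fst (g i))"
  have "g k \<star> pinv (\<gamma> \<star> g i) \<in> L" using g(1) ik(2) by (intro mul_in inv_in)
  moreover have "g k \<star> pinv (\<gamma> \<star> g i) = (a, mat 1)"
  proof -
    have "det (b ** snd (g i)) = 1" using dg(2)[of k] sk by simp
    then show ?thesis unfolding \<gamma> by (simp add: prod_eq_iff a_def sk adj_right)
  qed
  ultimately have aL: "(a, mat 1) \<in> L" by simp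
  have abS: "(a, b) \<in> SS" using SS_D[OF in_SS[OF aL]] SS_D[OF in_SS[OF ik(2)]] by (simp add: SS_def b_def)
  have mem: "PP (a, b) \<in> H1 \<times> H2" using H(2)[OF aL] H(3)[of b] ik(2) unfolding \<gamma> by (simp add: PP_def)
  have "fst (g k) = a ** fst (g i)" using dg(1)[of i] by (simp add: a_def matrix_mul_assoc[symmetric] adj_left)
  then have gk: "g k = (a, b) \<star> g i" using sk by (simp add: prod_eq_iff)
  have "C (g k) = (H1 \<times> H2 #>\<^bsub>G2\<^esub> PP (a, b)) #>\<^bsub>G2\<^esub> PP (g i)" unfolding C_def gk
    using group.coset_mult_assoc[OF group_G2 subgroup.subset[OF H(1)], of "PP (a, b)" "PP (g i)"] abS in_SS[OF g(1)]
    by (simp add: PP_mult)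
  also have "H1 \<times> H2 #>\<^bsub>G2\<^esub> PP (a, b) = H1 \<times> H2"
    by (rule group.coset_join2[OF group_G2 PP_carrier[OF abS] H(1) mem])
  finally have "s k = s i" unfolding g(2) C_def .
  then show False using s(1) ik(1) by (auto dest: injD)
qed

lemma irr22_L:
  assumes "\<not> reducible_lattice \<Gamma>" shows "irr22 L"
proof -
  interpret lat22 L by (rule lat22_L)
  interpret sw: lat22 "prod.swap ` L" by (rule lat22_swap[OF lat22_L])
  let ?d1 = "\<exists>e>0. \<forall>x\<in>L. norm (fst x - mat 1) < e \<longrightarrow> fst x = mat 1"
  let ?d2 = "\<exists>e>0. \<forall>x\<in>L. norm (snd x - mat 1) < e \<longrightarrow> snd x = mat 1"
  have 12: "?d2 \<Longrightarrow> ?d1" by (rule discrete_fst_if_discrete_snd)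
  have 21: "?d1 \<Longrightarrow> ?d2" using sw.discrete_fst_if_discrete_snd by simp
  have "\<not> (?d1 \<and> ?d2)"
  proof
    assume d: "?d1 \<and> ?d2"
    \<comment> \<open>In \<open>a\<close> the first component is the discrete one, so
      \<open>a.H\<close> is the lattice in the second factor and \<open>b.H\<close> the one in the
      first.\<close>
    interpret a: discrete_factor \<Gamma> M fst snd "Pair (mat 1)" by unfold_locales (use d in auto)
    interpret b: discrete_factor \<Gamma> M snd fst "\<lambda>b. (b, mat 1)" by unfold_locales (use d in auto)
    have sub: "subgroup (b.H \<times> a.H) G2" unfolding G2_def
      by (rule DirProd_subgroups[OF group_PSL2R b.subgroup_H group_PSL2R a.subgroup_H])
    have "b.H \<times> a.H \<subseteq> \<Gamma>"
    proof
      fix x assume "x \<in> b.H \<times> a.H"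
      then obtain a b where ab: "a \<in> b.K" "b \<in> a.K" "x = (psl a, psl b)" by blast
      then have "(a, mat 1) \<star> (mat 1, b) \<in> L" unfolding a.K_def b.K_def by (intro mul_in) blast+
      then have "PP ((a, mat 1) \<star> (mat 1, b)) \<in> \<Gamma>" using equalityD2[OF Gamma_eq] by blast
      then show "x \<in> \<Gamma>" using ab(3) by (simp add: PP_def)
    qed
    moreover have "psl a \<in> b.H" if "(a, mat 1) \<in> L" for a
      using that SS_D(1)[OF in_SS[OF that]] unfolding b.K_def by (auto simp: SL2_def)
    moreover have "psl b \<in> a.H" if "(mat 1, b) \<in> L" for b
      using that SS_D(2)[OF in_SS[OF that]] unfolding a.K_def by (auto simp: SL2_def)
    ultimately have "finite (rcosets\<^bsub>G2\<lparr>carrier := \<Gamma>\<rparr>\<^esub> (b.H \<times> a.H))" 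
      using finite_index_if_discrete[OF _ _ sub] d by blast
    moreover have "lattice_subgroup G2 G2_top \<Gamma>" unfolding lattice_subgroup_def finite_covolume_def
      using dsub sets_M M_pos M_fin M_inv by blast
    ultimately have "reducible_lattice \<Gamma>" unfolding reducible_lattice_def
      using a.lattice_H b.lattice_H \<open>b.H \<times> a.H \<subseteq> \<Gamma>\<close> by blast
    then show False using assms by blast
  qed
  then have nd: "\<not> ?d1" "\<not> ?d2" using 12 21 by blast+
  have nd2: "\<not> (\<exists>e>0. \<forall>x\<in>prod.swap ` L. norm (fst x - mat 1) < e \<longrightarrow> fst x = mat 1)" using nd(2) by simp
  show ?thesis
  proof
    fix A :: mat2 and e :: real assume "det A = 1" "e > 0"
    then show "\<exists>x\<in>L. norm (fst x - A) < e" "\<exists>x\<in>L. norm (snd x - A) < e"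
      using projection_dense_or_discrete[OF nd(1)] sw.projection_dense_or_discrete[OF nd2] by auto
  qed
qed

end

section \<open>Density of semi-orbits in \<open>\<Gamma>\G\<close>\<close>

lemma diag_SL2_dg: "diag_SL2 l = dg l" by (simp add: diag_SL2_def dg_def mk2_def)

text \<open>Moving \<open>h(\<infinity>)\<close> back to \<open>\<infinity>\<close> conjugates
  \<open>C\<close> by \<open>h\<close>, and a matrix fixes \<open>\<infinity>\<close> exactly when
  it is upper triangular.\<close>

lemma psl_act_fixed_iff:
  assumes "det C = 1" "det h = 1"
  shows "psl_act (psl C) (psl_act (psl h) Infinity) = psl_act (psl h) Infinity \<longleftrightarrow> (adj h ** C ** h)$2$1 = 0"
proof (cases "h$2$1 = 0")
  case True
  then have "h$1$1 \<noteq> 0" using assms(2) by (auto simp: det_2)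
  then show ?thesis using True by (simp add: psl_act_psl)
next
  case False
  define x where "x = h$1$1 / h$2$1"
  have h11: "h$1$1 = x * h$2$1" using False by (simp add: x_def)
  \<comment> \<open>Up to a nonzero square the entry is the fixed point equation of \<open>C\<close>
    at \<open>x\<close>, with the denominator cleared.\<close>
  have e: "(adj h ** C ** h)$2$1 = h$2$1 * h$2$1 * (x * (C$2$1 * x + C$2$2) - (C$1$1 * x + C$1$2))"
    by (simp add: h11 algebra_simps)
  show ?thesis
  proof (cases "C$2$1 * x + C$2$2 = 0")
    case True
    have "C$1$1 * x + C$1$2 \<noteq> 0"
    proof
      assume z: "C$1$1 * x + C$1$2 = 0"
      have "C$1$2 = - C$1$1 * x" "C$2$2 = - C$2$1 * x" using z True by simp_all
      then show False using assms(1) by (simp add: det_2)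
    qed
    then show ?thesis unfolding e using False True by (simp add: psl_act_psl x_def[symmetric])
  next
    case nz: False
    have "(C$1$1 * x + C$1$2) / (C$2$1 * x + C$2$2) = x \<longleftrightarrow> x * (C$2$1 * x + C$2$2) - (C$1$1 * x + C$1$2) = 0"
      using nz by (auto simp: divide_eq_eq)
    then show ?thesis unfolding e using False nz by (simp add: psl_act_psl x_def[symmetric])
  qed
qed

lemma psl_trivial_iff: "A \<in> SL2 \<Longrightarrow> psl A = \<one>\<^bsub>PSL2R\<^esub> \<longleftrightarrow> tl2 A = 0"
  unfolding psl_one[symmetric] psl_eq_iff using tl2_eq0_iff[of A] by (simp add: SL2_def)

lemma abs_less_2: "\<bar>t\<bar> < 2 \<longleftrightarrow> t\<^sup>2 < 4" "\<bar>t\<bar> = 2 \<longleftrightarrow> t\<^sup>2 = 4" "2 < \<bar>t\<bar> \<longleftrightarrow> 4 < t\<^sup>2" for t :: real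
  using abs_square_less_1[of "t/2"] abs_square_eq_1[of "t/2"] abs_square_le_1[of "t/2"] by (auto simp: power_divide)

lemma kind_iff:
  assumes "A \<in> SL2"
  shows "hyperbolic (psl A) \<longleftrightarrow> det (tl2 A) < 0" "elliptic (psl A) \<longleftrightarrow> det (tl2 A) > 0"
    "parabolic (psl A) \<longleftrightarrow> tl2 A \<noteq> 0 \<and> det (tl2 A) = 0"
proof -
  have d: "det (tl2 A) = 4 - (trace A)\<^sup>2" using assms det_tl2[of A] by (simp add: SL2_def)
  have z: "tl2 A = 0 \<Longrightarrow> det (tl2 A) = 0" by (simp add: det_2)
  show "hyperbolic (psl A) \<longleftrightarrow> det (tl2 A) < 0"
    unfolding hyperbolic_def abs_trace_psl psl_trivial_iff[OF assms] abs_less_2 using psl_carrier[OF assms] d z by auto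
  show "elliptic (psl A) \<longleftrightarrow> det (tl2 A) > 0"
    unfolding elliptic_def abs_trace_psl psl_trivial_iff[OF assms] abs_less_2 using psl_carrier[OF assms] d z by auto
  show "parabolic (psl A) \<longleftrightarrow> tl2 A \<noteq> 0 \<and> det (tl2 A) = 0"
    unfolding parabolic_def abs_trace_psl psl_trivial_iff[OF assms] abs_less_2 using psl_carrier[OF assms] d by auto
qed

lemma dominant_eigenvalue_abs:
  assumes "det A = 1" "2 < \<bar>trace A\<bar>"
  shows "dominant_eigenvalue (psl A) = (\<bar>trace A\<bar> + sqrt ((trace A)\<^sup>2 - 4)) / 2"
proof (cases "trace A > 0")
  case True
  then show ?thesis using dominant_eigenvalue_psl[of A] assms by simp
next
  case False
  have "psl A = psl (- A)" by (simp add: psl_eq_iff)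
  then show ?thesis using dominant_eigenvalue_psl[of "- A"] assms False by (simp add: det_uminus_2 trace_uminus)
qed

text \<open>Density of the semi-orbit before passing to the quotient: the left factor
  \<open>\<gamma>\<close> accounts for the cosets.\<close>

definition dense_semiorbit :: "mat22 set \<Rightarrow> mat22 \<Rightarrow> bool" where
  "dense_semiorbit L g \<longleftrightarrow> (\<forall>V. open V \<longrightarrow> V \<inter> SS \<noteq> {} \<longrightarrow> (\<exists>\<gamma>\<in>L. \<exists>l1\<ge>1. \<exists>l2\<ge>1. \<gamma> \<star> g \<star> (dg l1, dg l2) \<in> V))"

lemma dense_semiorbit_swap:
  assumes "dense_semiorbit (prod.swap ` L) (prod.swap g)" shows "dense_semiorbit L g"
  unfolding dense_semiorbit_def
proof (intro allI impI)
  fix V :: "mat22 set" assume V: "open V" "V \<inter> SS \<noteq> {}"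
  have "open (prod.swap -` V)" using V(1) by (intro open_vimage continuous_on_swap)
  moreover have "prod.swap -` V \<inter> SS \<noteq> {}"
  proof -
    obtain x where "x \<in> V" "x \<in> SS" using V(2) by blast
    then have "prod.swap x \<in> prod.swap -` V \<inter> SS" by (simp add: SS_def)
    then show ?thesis by blast
  qed
  ultimately obtain \<gamma>' l1 l2 where g: "\<gamma>' \<in> prod.swap ` L" "l1 \<ge> 1" "l2 \<ge> 1" "\<gamma>' \<star> prod.swap g \<star> (dg l1, dg l2) \<in> prod.swap -` V"
    using assms unfolding dense_semiorbit_def by blast
  obtain \<gamma> where \<gamma>: "\<gamma> \<in> L" "\<gamma>' = prod.swap \<gamma>" using g(1) by blast
  have "prod.swap (\<gamma>' \<star> prod.swap g \<star> (dg l1, dg l2)) = \<gamma> \<star> g \<star> (dg l2, dg l1)" unfolding \<gamma>(2) by (simp add: pmul_def)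
  then have "\<gamma> \<star> g \<star> (dg l2, dg l1) \<in> V" using g(4) by simp
  then show "\<exists>\<gamma>\<in>L. \<exists>l1\<ge>1. \<exists>l2\<ge>1. \<gamma> \<star> g \<star> (dg l1, dg l2) \<in> V" using \<gamma>(1) g(2,3) by blast
qed

text \<open>A fixed boundary point rules out an elliptic first component;
  \<open>no_parabolic_mixed\<close>, in both orders of the factors, rules out a single parabolic
  one. What remains is hyperbolic in the first factor and elliptic in the second.\<close>

lemma dense_semiorbit_if_mixed:
  assumes "irr22 L" "(C1, C2) \<in> L" "g \<in> SS" and fix1: "(adj (fst g) ** C1 ** fst g)$2$1 = 0"
    and n: "\<not> (tl2 C1 = 0 \<and> tl2 C2 = 0)" "\<not> (det (tl2 C1) < 0 \<and> det (tl2 C2) < 0)"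
      "\<not> ((tl2 C1 \<noteq> 0 \<and> det (tl2 C1) = 0) \<and> (tl2 C2 \<noteq> 0 \<and> det (tl2 C2) = 0))"
  shows "dense_semiorbit L g"
proof -
  interpret irr22 L by fact
  interpret s: irr22 "prod.swap ` L" by (rule irr22_swap) fact
  have nt: "tl2 C1 \<noteq> 0" "tl2 C2 \<noteq> 0" using trivial_fst[OF assms(2)] trivial_snd[OF assms(2)] n(1) by blast+
  let ?D = "adj (fst g) ** C1 ** fst g"
  have "det (tl2 C1) = det (tl2 ?D)" using det_tl2_conj[of "fst g" C1] SS_D(1)[OF assms(3)] by simp
  \<comment> \<open>For a triangular matrix the determinant of the traceless part is minus the
    square of the difference of the eigenvalues.\<close>
  also have "\<dots> = - (?D$1$1 - ?D$2$2)\<^sup>2" unfolding det_2 tl2_nth fix1 by (simp add: power2_eq_square algebra_simps)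
  finally have "det (tl2 C1) \<le> 0" by simp
  moreover have "det (tl2 C1) \<noteq> 0"
  proof
    assume z: "det (tl2 C1) = 0"
    then have "det (tl2 C2) \<noteq> 0" using n(3) nt by blast
    moreover have "(C2, C1) \<in> prod.swap ` L" using assms(2) by force
    ultimately show False using s.no_parabolic_mixed nt(1) z by blast
  qed
  ultimately have 1: "det (tl2 C1) < 0" by simp
  then have "det (tl2 C2) \<noteq> 0" using no_parabolic_mixed[OF assms(2)] nt(2) by auto
  then have 2: "det (tl2 C2) > 0" using n(2) 1 by simp
  show ?thesis unfolding dense_semiorbit_def using semiorbit_dense_mixed[OF assms(1-4) 1 2] by blast
qed

lemma (in lattice_G2) closure_semi_orbit:
  assumes "g \<in> SS" "dense_semiorbit L g"
  shows "coset_topology G2 G2_top \<Gamma> closure_of semi_orbit (PI g) = rcosets\<^bsub>G2\<^esub> \<Gamma>"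
proof -
  let ?X = "coset_topology G2 G2_top \<Gamma>"
  have top: "topspace ?X = rcosets\<^bsub>G2\<^esub> \<Gamma>" by (rule topspace_coset_topology[OF topspace_G2_top])
  have "semi_orbit (PI g) \<inter> T \<noteq> {}" if T: "openin ?X T" "T \<noteq> {}" for T
  proof -
    obtain V where V: "open V" "{x \<in> SS. PI x \<in> T} = SS \<inter> V" using openin_PI_preimage[OF T(1)] .
    have "T \<subseteq> PI ` SS" using openin_subset[OF T(1)] unfolding top rcosets_eq .
    then have "V \<inter> SS \<noteq> {}" using V(2) T(2) by blast
    then obtain \<gamma> l1 l2 where g: "\<gamma> \<in> L" "l1 \<ge> 1" "l2 \<ge> 1" "\<gamma> \<star> g \<star> (dg l1, dg l2) \<in> V"
      using assms(2) V(1) unfolding dense_semiorbit_def by blast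
    let ?a = "(dg l1, dg l2)"
    have a: "?a \<in> SS" using g(2,3) by (simp add: SS_def)
    have s: "\<gamma> \<star> g \<star> ?a \<in> SS" "g \<star> ?a \<in> SS" using a assms(1) in_SS[OF g(1)] by simp_all
    have "PI (\<gamma> \<star> g \<star> ?a) \<in> T" using V(2) g(4) s by blast
    moreover have "PI (g \<star> ?a) = PI (\<gamma> \<star> g \<star> ?a)" unfolding PI_eq_iff[OF s(2,1)] using g(1) by (intro bexI[of _ \<gamma>]) (simp_all add: pmul_assoc)
    moreover have "PI (g \<star> ?a) = PI g #>\<^bsub>G2\<^esub> PP ?a" using PI_translate[OF assms(1) a] by simp
    moreover have "PP ?a \<in> A_plus" unfolding A_plus_def PP_def diag_SL2_dg using g(2,3) by auto
    ultimately have "PI g #>\<^bsub>G2\<^esub> PP ?a \<in> semi_orbit (PI g)" "PI g #>\<^bsub>G2\<^esub> PP ?a \<in> T" unfolding semi_orbit_def by (blast, simp)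
    then show ?thesis by blast
  qed
  then have "\<forall>T. openin ?X T \<and> T \<noteq> {} \<longrightarrow> semi_orbit (PI g) \<inter> T \<noteq> {}" by simp
  from dense_intersects_open[THEN iffD2, OF this] show ?thesis unfolding top .
qed

theorem theorem1p2:
  fixes \<Gamma> :: "((real^2^2) set \<times> (real^2^2) set) set"
    and g1 g2 :: "(real^2^2) set"
    and x :: "((real^2^2) set \<times> (real^2^2) set) set"
  assumes "irreducible_lattice \<Gamma>"
    and "(g1, g2) \<in> carrier G2"
    and "x = \<Gamma> #>\<^bsub>G2\<^esub> (g1, g2)"
    and "(\<exists>\<gamma>1 \<gamma>2. (\<gamma>1, \<gamma>2) \<in> \<Gamma> \<and> mixed (\<gamma>1, \<gamma>2) \<and>
            (psl_act \<gamma>1 (psl_act g1 Infinity) = psl_act g1 Infinity \<or>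
             psl_act \<gamma>2 (psl_act g2 Infinity) = psl_act g2 Infinity))
       \<or> (\<exists>\<gamma>1 \<gamma>2. (\<gamma>1, \<gamma>2) \<in> \<Gamma> \<and> hyperbolic_G2 (\<gamma>1, \<gamma>2) \<and> hyper_regular (\<gamma>1, \<gamma>2) \<and>
            (psl_act \<gamma>1 (psl_act g1 Infinity) = psl_act g1 Infinity) \<noteq>
            (psl_act \<gamma>2 (psl_act g2 Infinity) = psl_act g2 Infinity))"
  shows "coset_topology G2 G2_top \<Gamma> closure_of semi_orbit x = rcosets\<^bsub>G2\<^esub> \<Gamma>"
proof -
  have lat: "discrete_subgroup G2 G2_top \<Gamma>" "finite_covolume G2 G2_top \<Gamma>" "\<not> reducible_lattice \<Gamma>"
    using assms(1) by (simp_all add: irreducible_lattice_def lattice_subgroup_def)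
  obtain M where "lattice_G2 \<Gamma> M" using lat(1,2) unfolding lattice_G2_def finite_covolume_def by blast
  then interpret lattice_G2 \<Gamma> M .
  have irr: "irr22 L" by (rule irr22_L[OF lat(3)])
  then have irr': "irr22 (prod.swap ` L)" by (rule irr22_swap)
  obtain g where g: "g \<in> SS" "(g1, g2) = PP g" using assms(2) unfolding carrier_G2 by blast
  have g12: "g1 = psl (fst g)" "g2 = psl (snd g)" using g(2) by (simp_all add: PP_def)
  have dg: "det (fst g) = 1" "det (snd g) = 1" "prod.swap g \<in> SS" using g(1) by (simp_all add: SS_def)
  have x: "x = PI g" unfolding assms(3) g(2) PI_def ..
  have "dense_semiorbit L g" using assms(4)
  proof (elim disjE exE conjE)
    fix \<gamma>1 \<gamma>2 assume G: "(\<gamma>1, \<gamma>2) \<in> \<Gamma>" and mix: "mixed (\<gamma>1, \<gamma>2)"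
    obtain c where c: "c \<in> L" "(\<gamma>1, \<gamma>2) = PP c" using G equalityD1[OF Gamma_eq] by blast
    obtain C1 C2 where CC: "c = (C1, C2)" by (cases c)
    have CL: "(C1, C2) \<in> L" "(C2, C1) \<in> prod.swap ` L" using c(1) CC by force+
    have gam: "\<gamma>1 = psl C1" "\<gamma>2 = psl C2" using c(2) CC by (simp_all add: PP_def)
    have dC: "det C1 = 1" "det C2 = 1" using SS_D[OF in_SS[OF CL(1)]] by simp_all
    then have S: "C1 \<in> SL2" "C2 \<in> SL2" by (simp_all add: SL2_def)
    have "\<not> (psl C1 = \<one>\<^bsub>PSL2R\<^esub> \<and> psl C2 = \<one>\<^bsub>PSL2R\<^esub>)" using mix unfolding mixed_def gam by (auto simp: G2_def)
    then have n: "\<not> (tl2 C1 = 0 \<and> tl2 C2 = 0)" "\<not> (det (tl2 C1) < 0 \<and> det (tl2 C2) < 0)"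
      "\<not> ((tl2 C1 \<noteq> 0 \<and> det (tl2 C1) = 0) \<and> (tl2 C2 \<noteq> 0 \<and> det (tl2 C2) = 0))"
      using mix unfolding mixed_def gam psl_trivial_iff[OF S(1)] psl_trivial_iff[OF S(2)]
        hyperbolic_G2_def parabolic_G2_def kind_iff[OF S(1)] kind_iff[OF S(2)] fst_conv snd_conv by blast+
    {
      assume "psl_act \<gamma>1 (psl_act g1 Infinity) = psl_act g1 Infinity"
      then have "(adj (fst g) ** C1 ** fst g)$2$1 = 0" unfolding gam g12 psl_act_fixed_iff[OF dC(1) dg(1)] .
      then show ?thesis using dense_semiorbit_if_mixed[OF irr CL(1) g(1)] n by blast
    next
      \<comment> \<open>The second factor is the first one of the swapped lattice.\<close>
      assume "psl_act \<gamma>2 (psl_act g2 Infinity) = psl_act g2 Infinity"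
      then have "(adj (snd g) ** C2 ** snd g)$2$1 = 0" unfolding gam g12 psl_act_fixed_iff[OF dC(2) dg(2)] .
      then have "(adj (fst (prod.swap g)) ** C2 ** fst (prod.swap g))$2$1 = 0" by simp
      then show ?thesis using dense_semiorbit_if_mixed[OF irr' CL(2) dg(3)] n dense_semiorbit_swap by blast
    }
  next
    fix \<gamma>1 \<gamma>2 assume G: "(\<gamma>1, \<gamma>2) \<in> \<Gamma>" and hyp: "hyperbolic_G2 (\<gamma>1, \<gamma>2)" and reg: "hyper_regular (\<gamma>1, \<gamma>2)"
      and one: "(psl_act \<gamma>1 (psl_act g1 Infinity) = psl_act g1 Infinity) \<noteq> (psl_act \<gamma>2 (psl_act g2 Infinity) = psl_act g2 Infinity)"
    obtain c where c: "c \<in> L" "(\<gamma>1, \<gamma>2) = PP c" using G equalityD1[OF Gamma_eq] by blast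
    obtain C1 C2 where CC: "c = (C1, C2)" by (cases c)
    have CL: "(C1, C2) \<in> L" "(C2, C1) \<in> prod.swap ` L" using c(1) CC by force+
    have gam: "\<gamma>1 = psl C1" "\<gamma>2 = psl C2" using c(2) CC by (simp_all add: PP_def)
    have dC: "det C1 = 1" "det C2 = 1" using SS_D[OF in_SS[OF CL(1)]] by simp_all
    then have S: "C1 \<in> SL2" "C2 \<in> SL2" by (simp_all add: SL2_def)
    have h: "det (tl2 C1) < 0" "det (tl2 C2) < 0"
      using hyp unfolding hyperbolic_G2_def gam kind_iff[OF S(1)] kind_iff[OF S(2)] fst_conv snd_conv by blast+
    then have big: "2 < \<bar>trace C1\<bar>" "2 < \<bar>trace C2\<bar>" unfolding abs_less_2 by (simp_all add: det_tl2 dC)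
    \<comment> \<open>Dominant eigenvalues are functions of the absolute trace, so equal squares
      would contradict hyper-regularity.\<close>
    have tr: "(trace C1)\<^sup>2 \<noteq> (trace C2)\<^sup>2"
    proof
      assume e: "(trace C1)\<^sup>2 = (trace C2)\<^sup>2"
      then have "\<bar>trace C1\<bar> = \<bar>trace C2\<bar>" by (simp add: power2_eq_iff abs_eq_iff)
      then show False using reg e unfolding hyper_regular_def gam
        by (simp add: dominant_eigenvalue_abs[OF dC(1) big(1)] dominant_eigenvalue_abs[OF dC(2) big(2)])
    qed
    have one': "((adj (fst g) ** C1 ** fst g)$2$1 = 0) \<noteq> ((adj (snd g) ** C2 ** snd g)$2$1 = 0)"
      using one unfolding gam g12 psl_act_fixed_iff[OF dC(1) dg(1)] psl_act_fixed_iff[OF dC(2) dg(2)] .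
    show ?thesis
    proof (cases "(adj (fst g) ** C1 ** fst g)$2$1 = 0")
      case True
      then show ?thesis unfolding dense_semiorbit_def
        using semiorbit_dense_regular[OF irr CL(1) g(1) True _ h tr] one' by blast
    next
      case False
      then have "(adj (fst (prod.swap g)) ** C2 ** fst (prod.swap g))$2$1 = 0" 
        "(adj (snd (prod.swap g)) ** C1 ** snd (prod.swap g))$2$1 \<noteq> 0" using one' by simp_all
      then have "dense_semiorbit (prod.swap ` L) (prod.swap g)" unfolding dense_semiorbit_def
        using semiorbit_dense_regular[OF irr' CL(2) dg(3) _ _ h(2,1) tr[symmetric]] by blast
      then show ?thesis by (rule dense_semiorbit_swap)
    qed
  qed
  then show ?thesis unfolding x by (rule closure_semi_orbit[OF g(1)])
qed

end
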